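(* Let $Z$ be a countable set, $W_{0}$ a finite dimensional complex Hilbert space, and $\Gamma$ a free abelian group of finite rank $d$ (written multiplicatively) acting freely on $Z$ with finite quotient $Z_{0}=Z/\Gamma$; identify $Z_{0}$ with a fixed fundamental set $F_{0}\subset Z$ (a complete set of representatives of the $\Gamma$-orbits). Let $U$ be a unitary operator on $\ell^{2}(Z,W_{0})$ such that (i) $U$ commutes with the action of $\Gamma$ on $\ell^{2}(Z,W_{0})$; (ii) there exists a finite set $S\subset\Gamma$ such that $U(\delta_{\alpha x_{0}}\otimes\phi)(\beta y_{0})=0$ for any $x_{0},y_{0}\in Z_{0}$, $\alpha\in\Gamma$, $\beta\in\Gamma\setminus\alpha S$ and $\phi\in W_{0}$. For each $\chi\in\widehat{\Gamma}$ let $U_{\chi}$ be the restriction of $U$ to $C_{\chi}(Z,W_{0})$. Then: (1) A number $\omega$ is an eigenvalue of $U$ if and only if $\omega$ is an eigenvalue of $U_{\chi}$ for all $\chi\in\widehat{\Gamma}$. Hence the number of eigenvalues of $U$ is finite. (2) The continuous spectrum of $U$ is absolutely continuous with respect to the Lebesgue measure on the unit circle $S^{1}$ in $\mathbb{C}$. Hence also: (3) $U$ has no eigenvalues if and only if $\limsup_{n\to\infty}p_{n}(u;x)=0$ for any $u\in\ell^{2}(Z,W_{0})$ and $x\in Z$ (so that in this case the transition probability is never localized at any point for any initial state). (4) If $U$ has only one eigenvalue $\omega$ and $\pi$ is the orthogonal projection onto the corresponding eigenspace, then for any $u\in\ell^{2}(Z,W_{0})$ and $x\in Z$ the limit $\lim_{n\to\infty}p_{n}(u;x)$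 exists and equals $\|(\pi u)(x)\|_{W_{0}}^{2}$.
   Context: $\ell^{2}(Z,W_{0})$ is the Hilbert space of square summable $W_{0}$-valued functions on $Z$ with inner product $\langle f,g\rangle=\sum_{x\in Z}\langle f(x),g(x)\rangle_{W_{0}}$. $\Gamma$ acts on functions by translation. $\delta_{x}\otimes\phi$ is the function with value $\phi$ at $x$ and $0$ elsewhere. $\widehat{\Gamma}$ is the group of $U(1)$-valued characters of $\Gamma$, and $C_{\chi}(Z,W_{0})=\{f:Z\to W_{0}: f(\alpha x)=\chi(\alpha)f(x)\ (x\in Z,\alpha\in\Gamma)\}$, a finite dimensional space isomorphic (by restriction to $F_{0}\cong Z_{0}$) to $\ell^{2}(Z_{0},W_{0})$, from which it inherits its inner product. By (i) and (ii), $U$ is continuous for the topology of pointwise convergence, so it extends to a linear map on the space of all functions $Z\to W_{0}$, explicitly $(Uf)(y)=\sum_{x\in Z}U(\delta_{x}\otimes f(x))(y)$ (a finite sum for each $y$). This extension preserves $C_{\chi}(Z,W_{0})$ and restricts there to a unitary operator $U_{\chi}$. The transition probability is $p_{n}(u;x)=\|(U^{n}u)(x)\|_{W_{0}}^{2}$ for integers $n\ge 0$; with initial state $u$ it is localized at $x$ if $\limsup_{n\to\infty}p_{n}(u;x)>0$. Let $E$ be the projection-valued spectral measure of $U$ on $S^{1}$ and $\pi_{c}=I-\pi_{p}$, where $\pi_{p}$ is the orthogonal projection onto the closed linear span of all eigenvectors of $U$. "The continuous spectrum of $U$ is absolutely continuous" means that for every $u$ the measure $\Lambda\mapsto\|E(\Lambda)\pi_{c}u\|^{2}$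 on $S^{1}$ is absolutely continuous with respect to Lebesgue measure. *)

theory Defs
  imports
    "HOL-Analysis.Analysis"
    "HOL-Algebra.Group_Action"
    "HOL-Algebra.Free_Abelian_Groups"
begin

section \<open>Finite dimensional complex Hilbert spaces\<close>

text \<open>
  The underlying real inner product structure (and with it norm and topology) is the library's
  \<^class>\<open>real_inner\<close>; the complex inner product is linear in its first argument.
\<close>

class complex_inner_space = real_inner +
  fixes scaleC :: "complex \<Rightarrow> 'a \<Rightarrow> 'a"  (infixr \<open>*\<^sub>C\<close> 75)
    and cinner :: "'a \<Rightarrow> 'a \<Rightarrow> complex"
  assumes scaleC_add_right: "a *\<^sub>C (x + y) = a *\<^sub>C x + a *\<^sub>C y"
    and scaleC_add_left: "(a + b) *\<^sub>C x = a *\<^sub>C x + b *\<^sub>C x"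
    and scaleC_scaleC: "a *\<^sub>C (b *\<^sub>C x) = (a * b) *\<^sub>C x"
    and scaleC_of_real: "of_real r *\<^sub>C x = r *\<^sub>R x"
    and cinner_commute: "cinner x y = cnj (cinner y x)"
    and cinner_add_left: "cinner (x + y) z = cinner x z + cinner y z"
    and cinner_scaleC_left: "cinner (a *\<^sub>C x) y = a * cinner x y"
    and Re_cinner: "Re (cinner x y) = inner x y"

class fin_dim_complex_inner_space = complex_inner_space +
  assumes finite_spanning_set: "\<exists>B. finite B \<and> (\<forall>v. \<exists>c. v = (\<Sum>b\<in>B. c b *\<^sub>C b))"

instantiation complex :: fin_dim_complex_inner_space
begin

definition "scaleC a (x::complex) = a * x"
definition "cinner (x::complex) y = x * cnj y"

instance
proof
  show "\<exists>B::complex set. finite B \<and> (\<forall>v. \<exists>c. v = (\<Sum>b\<in>B. c b *\<^sub>C b))"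
  proof (intro exI conjI allI)
    fix v :: complex
    show "v = (\<Sum>b\<in>{1}. (\<lambda>_. v) b *\<^sub>C b)"
      by (simp add: scaleC_complex_def)
  qed simp
qed (auto simp: scaleC_complex_def cinner_complex_def inner_complex_def algebra_simps
       scaleR_conv_of_real)

end


section \<open>The Hilbert space of square summable functions\<close>

text \<open>
  A function on the set \<open>Z\<close> is represented by a total function that vanishes outside \<open>Z\<close>.
  Operators are total functions on \<^typ>\<open>'z \<Rightarrow> 'w\<close> of which only the values on the space
  in question matter.
\<close>

definition functions_on :: "'z set \<Rightarrow> ('z \<Rightarrow> 'w::zero) set" where
  "functions_on Z = {f. \<forall>x. x \<notin> Z \<longrightarrow> f x = 0}"

definition l2 :: "'z set \<Rightarrow> ('z \<Rightarrow> 'w::complex_inner_space) set" where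
  "l2 Z = {f \<in> functions_on Z. (\<lambda>x. (norm (f x))\<^sup>2) summable_on Z}"

definition l2_inner :: "'z set \<Rightarrow> ('z \<Rightarrow> 'w::complex_inner_space) \<Rightarrow> ('z \<Rightarrow> 'w) \<Rightarrow> complex" where
  "l2_inner Z f g = (\<Sum>\<^sub>\<infinity>x\<in>Z. cinner (f x) (g x))"

definition l2_norm :: "'z set \<Rightarrow> ('z \<Rightarrow> 'w::complex_inner_space) \<Rightarrow> real" where
  "l2_norm Z f = sqrt (Re (l2_inner Z f f))"

definition delta :: "'z \<Rightarrow> 'w \<Rightarrow> 'z \<Rightarrow> 'w::zero" where
  "delta x v = (\<lambda>y. if y = x then v else 0)"

definition linear_on_l2 ::
    "'z set \<Rightarrow> (('z \<Rightarrow> 'w::complex_inner_space) \<Rightarrow> ('z \<Rightarrow> 'w)) \<Rightarrow> bool" where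
  "linear_on_l2 Z T \<longleftrightarrow>
     (\<forall>f\<in>l2 Z. \<forall>g\<in>l2 Z. T (\<lambda>x. f x + g x) = (\<lambda>x. T f x + T g x)) \<and>
     (\<forall>f\<in>l2 Z. \<forall>c. T (\<lambda>x. c *\<^sub>C f x) = (\<lambda>x. c *\<^sub>C T f x))"

definition unitary_on_l2 ::
    "'z set \<Rightarrow> (('z \<Rightarrow> 'w::complex_inner_space) \<Rightarrow> ('z \<Rightarrow> 'w)) \<Rightarrow> bool" where
  "unitary_on_l2 Z T \<longleftrightarrow>
     linear_on_l2 Z T \<and> T ` l2 Z = l2 Z \<and>
     (\<forall>f\<in>l2 Z. \<forall>g\<in>l2 Z. l2_inner Z (T f) (T g) = l2_inner Z f g)"

definition orthogonal_projection_on_l2 ::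
    "'z set \<Rightarrow> (('z \<Rightarrow> 'w::complex_inner_space) \<Rightarrow> ('z \<Rightarrow> 'w)) \<Rightarrow> bool" where
  "orthogonal_projection_on_l2 Z P \<longleftrightarrow>
     linear_on_l2 Z P \<and> P ` l2 Z \<subseteq> l2 Z \<and>
     (\<forall>f\<in>l2 Z. P (P f) = P f) \<and>
     (\<forall>f\<in>l2 Z. \<forall>g\<in>l2 Z. l2_inner Z (P f) g = l2_inner Z f (P g))"

text \<open>The orthogonal projection onto a closed linear subspace \<open>V\<close> of \<open>l2 Z\<close>.\<close>

definition proj_onto ::
    "'z set \<Rightarrow> ('z \<Rightarrow> 'w::complex_inner_space) set \<Rightarrow> ('z \<Rightarrow> 'w) \<Rightarrow> ('z \<Rightarrow> 'w)" where
  "proj_onto Z V u = (THE v. v \<in> V \<and> (\<forall>w\<in>V. l2_inner Z (\<lambda>x. u x - v x) w = 0))"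

definition lin_span :: "('z \<Rightarrow> 'w::complex_inner_space) set \<Rightarrow> ('z \<Rightarrow> 'w) set" where
  "lin_span A = {(\<lambda>x. \<Sum>f\<in>F. c f *\<^sub>C f x) | F c. finite F \<and> F \<subseteq> A}"

definition closed_lin_span ::
    "'z set \<Rightarrow> ('z \<Rightarrow> 'w::complex_inner_space) set \<Rightarrow> ('z \<Rightarrow> 'w) set" where
  "closed_lin_span Z A =
     {u \<in> l2 Z. \<forall>e>0. \<exists>v\<in>lin_span A. l2_norm Z (\<lambda>x. u x - v x) < e}"


section \<open>Eigenvalues\<close>

definition eigenspace_on ::
    "('z \<Rightarrow> 'w::complex_inner_space) set \<Rightarrow> (('z \<Rightarrow> 'w) \<Rightarrow> ('z \<Rightarrow> 'w)) \<Rightarrow> complex \<Rightarrow> ('z \<Rightarrow> 'w) set" where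
  "eigenspace_on V T \<omega> = {f \<in> V. T f = (\<lambda>x. \<omega> *\<^sub>C f x)}"

definition eigenvalue_on ::
    "('z \<Rightarrow> 'w::complex_inner_space) set \<Rightarrow> (('z \<Rightarrow> 'w) \<Rightarrow> ('z \<Rightarrow> 'w)) \<Rightarrow> complex \<Rightarrow> bool" where
  "eigenvalue_on V T \<omega> \<longleftrightarrow> (\<exists>f\<in>eigenspace_on V T \<omega>. f \<noteq> (\<lambda>_. 0))"

definition eigenvectors_on ::
    "('z \<Rightarrow> 'w::complex_inner_space) set \<Rightarrow> (('z \<Rightarrow> 'w) \<Rightarrow> ('z \<Rightarrow> 'w)) \<Rightarrow> ('z \<Rightarrow> 'w) set" where
  "eigenvectors_on V T = {f. f \<noteq> (\<lambda>_. 0) \<and> (\<exists>\<omega>. f \<in> eigenspace_on V T \<omega>)}"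

definition pure_point_proj ::
    "'z set \<Rightarrow> (('z \<Rightarrow> 'w::complex_inner_space) \<Rightarrow> ('z \<Rightarrow> 'w)) \<Rightarrow> ('z \<Rightarrow> 'w) \<Rightarrow> ('z \<Rightarrow> 'w)" where
  "pure_point_proj Z U = proj_onto Z (closed_lin_span Z (eigenvectors_on (l2 Z) U))"

definition continuous_proj ::
    "'z set \<Rightarrow> (('z \<Rightarrow> 'w::complex_inner_space) \<Rightarrow> ('z \<Rightarrow> 'w)) \<Rightarrow> ('z \<Rightarrow> 'w) \<Rightarrow> ('z \<Rightarrow> 'w)" where
  "continuous_proj Z U u = (\<lambda>x. u x - pure_point_proj Z U u x)"


section \<open>Spectral measure\<close>

definition circle_borel :: "complex measure" where
  "circle_borel = restrict_space borel (sphere 0 1)"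

definition circle_lebesgue :: "complex measure" where
  "circle_lebesgue = distr (restrict_space lborel {0..<2 * pi}) circle_borel cis"

definition scalar_spectral_measure ::
    "'z set \<Rightarrow> (complex set \<Rightarrow> ('z \<Rightarrow> 'w::complex_inner_space) \<Rightarrow> ('z \<Rightarrow> 'w)) \<Rightarrow> ('z \<Rightarrow> 'w) \<Rightarrow> complex measure" where
  "scalar_spectral_measure Z E u =
     measure_of (sphere 0 1) (sets circle_borel) (\<lambda>\<Lambda>. ennreal ((l2_norm Z (E \<Lambda> u))\<^sup>2))"

definition projection_valued_measure ::
    "'z set \<Rightarrow> (complex set \<Rightarrow> ('z \<Rightarrow> 'w::complex_inner_space) \<Rightarrow> ('z \<Rightarrow> 'w)) \<Rightarrow> bool" where
  "projection_valued_measure Z E \<longleftrightarrow>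
     (\<forall>\<Lambda>\<in>sets circle_borel. orthogonal_projection_on_l2 Z (E \<Lambda>)) \<and>
     (\<forall>u\<in>l2 Z. E {} u = (\<lambda>_. 0) \<and> E (sphere 0 1) u = u) \<and>
     (\<forall>A\<in>sets circle_borel. \<forall>B\<in>sets circle_borel. \<forall>u\<in>l2 Z. E (A \<inter> B) u = E A (E B u)) \<and>
     (\<forall>A :: nat \<Rightarrow> complex set. range A \<subseteq> sets circle_borel \<longrightarrow> disjoint_family A \<longrightarrow>
        (\<forall>u\<in>l2 Z. (\<lambda>N. l2_norm Z (\<lambda>x. E (\<Union>i. A i) u x - (\<Sum>i<N. E (A i) u x))) \<longlonglongrightarrow> 0))"

text \<open>
  The identity \<open>U = \<integral> z dE(z)\<close> is stated through its quadratic form, with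
  \<open>\<langle>E(\<Lambda>)u, u\<rangle> = \<parallel>E(\<Lambda>)u\<parallel>\<^sup>2\<close>; by polarization this determines \<open>U\<close>.
\<close>

definition is_spectral_measure ::
    "'z set \<Rightarrow> (('z \<Rightarrow> 'w::complex_inner_space) \<Rightarrow> ('z \<Rightarrow> 'w)) \<Rightarrow>
     (complex set \<Rightarrow> ('z \<Rightarrow> 'w) \<Rightarrow> ('z \<Rightarrow> 'w)) \<Rightarrow> bool" where
  "is_spectral_measure Z U E \<longleftrightarrow>
     projection_valued_measure Z E \<and>
     (\<forall>u\<in>l2 Z. l2_inner Z (U u) u = (\<integral>z. z \<partial>scalar_spectral_measure Z E u))"

text \<open>
  By the spectral theorem a unitary operator has exactly one spectral measure (up to values on
  non-Borel sets and on functions outside \<open>l2 Z\<close>), so the quantifier over \<open>E\<close> ranges over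
  just that one.
\<close>

definition continuous_spectrum_abs_cont ::
    "'z set \<Rightarrow> (('z \<Rightarrow> 'w::complex_inner_space) \<Rightarrow> ('z \<Rightarrow> 'w)) \<Rightarrow> bool" where
  "continuous_spectrum_abs_cont Z U \<longleftrightarrow>
     (\<forall>E. is_spectral_measure Z U E \<longrightarrow>
        (\<forall>u\<in>l2 Z. absolutely_continuous circle_lebesgue
                     (scalar_spectral_measure Z E (continuous_proj Z U u))))"


section \<open>Group actions and characters\<close>

definition free_abelian_group_of_rank :: "('g, 'm) monoid_scheme \<Rightarrow> nat \<Rightarrow> bool" where
  "free_abelian_group_of_rank G d \<longleftrightarrow> comm_group G \<and> G \<cong> free_Abelian_group {..<d}"

definition free_action :: "('g, 'm) monoid_scheme \<Rightarrow> 'z set \<Rightarrow> ('g \<Rightarrow> 'z \<Rightarrow> 'z) \<Rightarrow> bool" where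
  "free_action G Z act \<longleftrightarrow>
     group_action G Z act \<and> (\<forall>\<alpha>\<in>carrier G. \<forall>x\<in>Z. act \<alpha> x = x \<longrightarrow> \<alpha> = \<one>\<^bsub>G\<^esub>)"

definition fundamental_set ::
    "('g, 'm) monoid_scheme \<Rightarrow> 'z set \<Rightarrow> ('g \<Rightarrow> 'z \<Rightarrow> 'z) \<Rightarrow> 'z set \<Rightarrow> bool" where
  "fundamental_set G Z act F \<longleftrightarrow> F \<subseteq> Z \<and> (\<forall>A\<in>orbits G Z act. \<exists>!x. x \<in> F \<inter> A)"

definition translate ::
    "('g, 'm) monoid_scheme \<Rightarrow> 'z set \<Rightarrow> ('g \<Rightarrow> 'z \<Rightarrow> 'z) \<Rightarrow> 'g \<Rightarrow> ('z \<Rightarrow> 'w) \<Rightarrow> ('z \<Rightarrow> 'w::zero)" where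
  "translate G Z act \<alpha> f = (\<lambda>x. if x \<in> Z then f (act (inv\<^bsub>G\<^esub> \<alpha>) x) else 0)"

definition circle_group :: "complex monoid" where
  "circle_group = \<lparr>carrier = sphere 0 1, monoid.mult = (*), one = 1\<rparr>"

definition characters :: "('g, 'm) monoid_scheme \<Rightarrow> ('g \<Rightarrow> complex) set" where
  "characters G = hom G circle_group"

definition C_chi ::
    "('g, 'm) monoid_scheme \<Rightarrow> 'z set \<Rightarrow> ('g \<Rightarrow> 'z \<Rightarrow> 'z) \<Rightarrow> ('g \<Rightarrow> complex) \<Rightarrow>
     ('z \<Rightarrow> 'w::complex_inner_space) set" where
  "C_chi G Z act \<kappa> =
     {f \<in> functions_on Z. \<forall>x\<in>Z. \<forall>\<alpha>\<in>carrier G. f (act \<alpha> x) = \<kappa> \<alpha> *\<^sub>C f x}"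

text \<open>
  For an operator satisfying the finite propagation condition below, only finitely many
  \<open>x\<close> contribute to the value at a given \<open>y\<close>.
\<close>

definition extend_op ::
    "'z set \<Rightarrow> (('z \<Rightarrow> 'w::complex_inner_space) \<Rightarrow> ('z \<Rightarrow> 'w)) \<Rightarrow> ('z \<Rightarrow> 'w) \<Rightarrow> ('z \<Rightarrow> 'w)" where
  "extend_op Z U f = (\<lambda>y. \<Sum>x | x \<in> Z \<and> U (delta x (f x)) y \<noteq> 0. U (delta x (f x)) y)"

definition U_chi ::
    "('g, 'm) monoid_scheme \<Rightarrow> 'z set \<Rightarrow> ('g \<Rightarrow> 'z \<Rightarrow> 'z) \<Rightarrow>
     (('z \<Rightarrow> 'w::complex_inner_space) \<Rightarrow> ('z \<Rightarrow> 'w)) \<Rightarrow> ('g \<Rightarrow> complex) \<Rightarrow> ('z \<Rightarrow> 'w) \<Rightarrow> ('z \<Rightarrow> 'w)" where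
  "U_chi G Z act U \<kappa> = restrict (extend_op Z U) (C_chi G Z act \<kappa>)"

definition commutes_with_action ::
    "('g, 'm) monoid_scheme \<Rightarrow> 'z set \<Rightarrow> ('g \<Rightarrow> 'z \<Rightarrow> 'z) \<Rightarrow>
     (('z \<Rightarrow> 'w::complex_inner_space) \<Rightarrow> ('z \<Rightarrow> 'w)) \<Rightarrow> bool" where
  "commutes_with_action G Z act U \<longleftrightarrow>
     (\<forall>\<alpha>\<in>carrier G. \<forall>f\<in>l2 Z. U (translate G Z act \<alpha> f) = translate G Z act \<alpha> (U f))"

definition finite_propagation ::
    "('g, 'm) monoid_scheme \<Rightarrow> ('g \<Rightarrow> 'z \<Rightarrow> 'z) \<Rightarrow> 'z set \<Rightarrow>
     (('z \<Rightarrow> 'w::complex_inner_space) \<Rightarrow> ('z \<Rightarrow> 'w)) \<Rightarrow> bool" where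
  "finite_propagation G act F U \<longleftrightarrow>
     (\<exists>S. finite S \<and> S \<subseteq> carrier G \<and>
        (\<forall>x\<in>F. \<forall>y\<in>F. \<forall>\<alpha>\<in>carrier G. \<forall>\<beta>\<in>carrier G - (\<alpha> <#\<^bsub>G\<^esub> S). \<forall>v.
           U (delta (act \<alpha> x) v) (act \<beta> y) = 0))"


section \<open>Transition probabilities\<close>

definition transition_prob ::
    "(('z \<Rightarrow> 'w::complex_inner_space) \<Rightarrow> ('z \<Rightarrow> 'w)) \<Rightarrow> nat \<Rightarrow> ('z \<Rightarrow> 'w) \<Rightarrow> 'z \<Rightarrow> real" where
  "transition_prob U n u x = (norm ((U ^^ n) u x))\<^sup>2"

definition localized_at ::
    "(('z \<Rightarrow> 'w::complex_inner_space) \<Rightarrow> ('z \<Rightarrow> 'w)) \<Rightarrow> ('z \<Rightarrow> 'w) \<Rightarrow> 'z \<Rightarrow> bool" where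
  "localized_at U u x \<longleftrightarrow> limsup (\<lambda>n. ereal (transition_prob U n u x)) > 0"

end

theory Submission
  imports Defs "HOL-Computational_Algebra.Fundamental_Theorem_Algebra"
begin

text \<open>
  After choosing coordinates on \<open>\<Gamma>\<close>, the correlations \<open>\<langle>U\<^sup>n a, T\<^sub>c b\<rangle>\<close> of finitely supported
  \<open>a\<close>, \<open>b\<close> with all translates \<open>T\<^sub>c\<close> are annihilated, up to finitely many terms, by a Laurent
  polynomial in the time shift and the lattice shifts (a dimension count on boxes).
  Lipshitz's counting argument then gives a recurrence with polynomial coefficients for
  \<open>\<langle>U\<^sup>n a, b\<rangle>\<close> alone.  As these numbers are bounded, some nonzero polynomial \<open>p\<close> satisfies
  \<open>\<langle>U\<^sup>n p(U) a, b\<rangle> = O(1/n)\<close>: the corresponding spectral measure has square summable moments and is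
  absolutely continuous, and what \<open>p(U)\<close> annihilates is a sum of eigenvectors.  The same decay
  gives the limits of the transition probabilities.

  An eigenvalue has a finitely supported eigenfunction, because otherwise the trace of the spectral
  projection, which grows like the volume of a box, would be bounded by the size of its collar.
  Periodizing it against a character gives an eigenfunction of \<open>U\<^sub>\<chi>\<close>; conversely,
  eigenfunctions for enough torsion characters combine to one that vanishes on a collar.
\<close>

section \<open>Linear systems and boxes in a lattice\<close>

text \<open>A Fourier transform would turn the walk into a family of finite unitary matrices, but
  then eigenvalue branches have to be controlled as functions of several angles. Correlations
  replace that analysis by linear algebra on finite boxes, where a collar of fixed width has
  vanishing relative volume. The price is the polynomial \<open>p\<close>. A component along an
  eigenvector makes correlations oscillate forever, so decay of
  \<open>\<langle>U^n a, b\<rangle>\<close> itself cannot be expected. Conclusions pass from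
  \<open>p(U) b\<close> to \<open>b\<close> through closed reducing subspaces: one that contains
  \<open>p(U) b\<close> and all eigenvectors contains \<open>b\<close>. A single factor
  \<open>1/n\<close> suffices because it is square summable. The spectral measure is given only
  through its first moment, as a quadratic form. All higher moments have to be rebuilt from step
  functions before any statement on moments can be applied to it.\<close>

lemma homogeneous_system_nontrivial_solution:
  fixes A :: "'e \<Rightarrow> 'i \<Rightarrow> 'a::field"
  assumes "finite B" "finite I" "card B < card I"
  shows "\<exists>c. (\<exists>i\<in>I. c i \<noteq> 0) \<and> (\<forall>b\<in>B. (\<Sum>i\<in>I. c i * A b i) = 0)"
  using assms
proof (induction B arbitrary: A I rule: finite_induct)
  case empty
  then have "I \<noteq> {}" by auto
  then show ?case by (intro exI[of _ "\<lambda>_. 1"]) auto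
next
  case (insert b B)
  show ?case
  proof (cases "\<forall>i\<in>I. A b i = 0")
    case True
    from insert.prems insert.hyps have "card B < card I" by simp
    from insert.IH[OF insert.prems(1) this, of A] obtain c
      where "\<exists>i\<in>I. c i \<noteq> 0" "\<forall>b\<in>B. (\<Sum>i\<in>I. c i * A b i) = 0" by blast
    with True show ?thesis by (intro exI[of _ c]) auto
  next
    case False
    then obtain i0 where i0: "i0 \<in> I" "A b i0 \<noteq> 0" by blast
    define J where "J = I - {i0}"
    have fJ: "finite J" and cJ: "card B < card J"
      using insert.prems insert.hyps i0 by (auto simp: J_def card_Diff_singleton)
    have IJ: "I = insert i0 J" "i0 \<notin> J" using i0 by (auto simp: J_def)
    from insert.IH[OF fJ cJ, of "\<lambda>e i. A e i - A e i0 * A b i / A b i0"]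
    obtain c where c: "\<exists>i\<in>J. c i \<noteq> 0"
      "\<And>e. e \<in> B \<Longrightarrow> (\<Sum>i\<in>J. c i * (A e i - A e i0 * A b i / A b i0)) = 0" by blast
    define c' where "c' = c(i0 := - (\<Sum>i\<in>J. c i * A b i) / A b i0)"
    have sumJ: "(\<Sum>i\<in>J. c' i * A e i) = (\<Sum>i\<in>J. c i * A e i)" for e
      using IJ by (intro sum.cong) (auto simp: c'_def)
    have "(\<Sum>i\<in>I. c' i * A e i) = 0" if e: "e \<in> insert b B" for e
    proof -
      have s: "(\<Sum>i\<in>I. c' i * A e i) = c' i0 * A e i0 + (\<Sum>i\<in>J. c i * A e i)"
        using IJ fJ sumJ by simp
      show ?thesis
      proof (cases "e = b")
        case True
        then show ?thesis using s i0 by (simp add: c'_def)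
      next
        case False
        then have "(\<Sum>i\<in>J. c i * (A e i - A e i0 * A b i / A b i0)) = 0" using c e by blast
        then have "(\<Sum>i\<in>J. c i * A e i) = (\<Sum>i\<in>J. c i * A b i) * (A e i0 / A b i0)"
          by (simp add: right_diff_distrib sum_subtractf sum_distrib_left sum_divide_distrib mult_ac)
        then show ?thesis using s by (simp add: c'_def)
      qed
    qed
    moreover have "\<exists>i\<in>I. c' i \<noteq> 0"
    proof -
      from c(1) obtain i where "i \<in> J" "c i \<noteq> 0" by blast
      then show ?thesis using IJ by (auto simp: c'_def intro!: bexI[of _ i])
    qed
    ultimately show ?thesis by blast
  qed
qed

text \<open>The functionals are evaluations of the coordinate polynomial at an integer that avoids
  the finitely many roots of the differences.\<close>

lemma additive_functional_inj_on:
  fixes S :: "(nat \<Rightarrow>\<^sub>0 int) set"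
  assumes "finite S"
  shows "\<exists>l :: (nat \<Rightarrow>\<^sub>0 int) \<Rightarrow> int. (\<forall>x y. l (x + y) = l x + l y) \<and> inj_on l S"
proof -
  have "finite (\<Union>x\<in>S. Poly_Mapping.keys x)" using assms by auto
  then obtain N where N: "(\<Union>x\<in>S. Poly_Mapping.keys x) \<subseteq> {..<N}"
    by (meson finite_nat_iff_bounded)
  define p :: "(nat \<Rightarrow>\<^sub>0 int) \<Rightarrow> int poly"
    where "p x = (\<Sum>i<N. monom (Poly_Mapping.lookup x i) i)" for x
  have cp: "poly.coeff (p x) i = (if i < N then Poly_Mapping.lookup x i else 0)" for x i
    by (simp add: p_def coeff_sum sum.delta)
  have pinj: "x = y" if "x \<in> S" "y \<in> S" "p x = p y" for x y
  proof (rule poly_mapping_eqI)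
    fix i
    show "Poly_Mapping.lookup x i = Poly_Mapping.lookup y i"
    proof (cases "i < N")
      case True
      then show ?thesis using arg_cong[OF that(3), of "\<lambda>q. poly.coeff q i"] by (simp add: cp)
    next
      case False
      then have "i \<notin> Poly_Mapping.keys x" "i \<notin> Poly_Mapping.keys y" using N that by auto
      then show ?thesis by (simp add: in_keys_iff)
    qed
  qed
  define R where "R = (\<Union>z\<in>{z \<in> S \<times> S. fst z \<noteq> snd z}. {a. poly (p (fst z) - p (snd z)) a = 0})"
  have "finite R" unfolding R_def
    using assms pinj by (intro finite_UN_I poly_roots_finite) auto
  then obtain a :: int where a: "a \<notin> R" using ex_new_if_finite infinite_UNIV_int by blast
  define l where "l x = poly (p x) a" for x
  have "p (x + y) = p x + p y" for x y
    by (simp add: p_def lookup_add flip: add_monom sum.distrib)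
  then have "\<forall>x y. l (x + y) = l x + l y" by (simp add: l_def)
  moreover have "inj_on l S"
  proof (rule inj_onI, rule ccontr)
    fix x y assume "x \<in> S" "y \<in> S" "l x = l y" "x \<noteq> y"
    then have "a \<in> R" by (auto simp: R_def l_def intro!: bexI[of _ "(x, y)"])
    then show False using a by simp
  qed
  ultimately show ?thesis by blast
qed

text \<open>An injective additive functional orders both sets linearly, and the sum of the two
  minimizers can arise in only one way. This is the unique-product property of the lattice; it keeps
  the lowest term of a convolution from cancelling in \<open>conv_eq_0D\<close>.\<close>

lemma unique_sum_pair:
  fixes A B :: "(nat \<Rightarrow>\<^sub>0 int) set"
  assumes "finite A" "finite B" "A \<noteq> {}" "B \<noteq> {}"
  obtains a b where "a \<in> A" "b \<in> B"
    "\<And>a' b'. \<lbrakk>a' \<in> A; b' \<in> B; a' + b' = a + b\<rbrakk> \<Longrightarrow> a' = a \<and> b' = b"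
proof -
  obtain l :: "(nat \<Rightarrow>\<^sub>0 int) \<Rightarrow> int" where l: "\<And>x y. l (x + y) = l x + l y" "inj_on l (A \<union> B)"
    using additive_functional_inj_on[of "A \<union> B"] assms by auto
  have "\<exists>a\<in>A. \<forall>x\<in>A. l a \<le> l x"
    using ex_min_if_finite[of "l ` A"] assms by (fastforce simp: not_less)
  then obtain a where a: "a \<in> A" "\<forall>x\<in>A. l a \<le> l x" by blast
  have "\<exists>b\<in>B. \<forall>x\<in>B. l b \<le> l x"
    using ex_min_if_finite[of "l ` B"] assms by (fastforce simp: not_less)
  then obtain b where b: "b \<in> B" "\<forall>x\<in>B. l b \<le> l x" by blast
  show thesis
  proof (rule that[OF a(1) b(1)])
    fix a' b' assume *: "a' \<in> A" "b' \<in> B" "a' + b' = a + b"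
    then have "l a' + l b' = l a + l b" using l(1) by metis
    moreover have "l a \<le> l a'" "l b \<le> l b'" using a b * by auto
    ultimately have "l a' = l a" "l b' = l b" by auto
    then show "a' = a \<and> b' = b" using l(2) a(1) b(1) * by (metis UnI1 UnI2 inj_onD)
  qed
qed

text \<open>Lattices of all ranks share one type, so a rank is a bound on \<open>keys\<close>. The
  lattice of rank \<open>Suc d\<close> thereby contains the one of rank \<open>d\<close>, and
  coordinate \<open>d\<close> is free to serve as time. The upper bound is exclusive:
  \<open>cube d (-r) (r + 1)\<close> is the symmetric box of radius \<open>r\<close>.\<close>

definition cube :: "nat \<Rightarrow> int \<Rightarrow> int \<Rightarrow> (nat \<Rightarrow>\<^sub>0 int) set" where
  "cube d lo hi = {x. Poly_Mapping.keys x \<subseteq> {..<d} \<and>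
     (\<forall>i<d. lo \<le> Poly_Mapping.lookup x i \<and> Poly_Mapping.lookup x i < hi)}"

lemma keys_Abs_lessThan: "Poly_Mapping.keys (Abs_poly_mapping (\<lambda>i. if i < d then f i else 0)) \<subseteq> {..<(d::nat)}"
  by (auto simp: in_keys_iff split: if_splits)

lemma lookup_eq_0_lessThan: "Poly_Mapping.keys x \<subseteq> {..<d} \<Longrightarrow> \<not> i < d \<Longrightarrow> Poly_Mapping.lookup x i = 0"
  by (auto simp: in_keys_iff)

lemma bij_betw_cube:
  "bij_betw (\<lambda>x. \<lambda>i\<in>{..<d}. Poly_Mapping.lookup x i) (cube d lo hi) ({..<d} \<rightarrow>\<^sub>E {lo..<hi})"
proof (rule bij_betwI[where g = "\<lambda>f. Abs_poly_mapping (\<lambda>i. if i < d then f i else 0)"])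
  show "(\<lambda>x. \<lambda>i\<in>{..<d}. Poly_Mapping.lookup x i) \<in> cube d lo hi \<rightarrow> ({..<d} \<rightarrow>\<^sub>E {lo..<hi})"
    by (auto simp: cube_def)
  show "(\<lambda>f. Abs_poly_mapping (\<lambda>i. if i < d then f i else 0)) \<in> ({..<d} \<rightarrow>\<^sub>E {lo..<hi}) \<rightarrow> cube d lo hi"
    using keys_Abs_lessThan[of d] by (fastforce simp: cube_def PiE_iff)
next
  fix x assume x: "x \<in> cube d lo hi"
  show "Abs_poly_mapping (\<lambda>i. if i < d then (\<lambda>i\<in>{..<d}. Poly_Mapping.lookup x i) i else 0) = x"
    using x by (intro poly_mapping_eqI) (auto simp: cube_def lookup_eq_0_lessThan)
next
  fix f assume f: "f \<in> {..<d} \<rightarrow>\<^sub>E {lo..<hi}"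
  show "(\<lambda>i\<in>{..<d}. Poly_Mapping.lookup (Abs_poly_mapping (\<lambda>i. if i < d then f i else 0)) i) = f"
    using f by (auto simp: PiE_iff extensional_def restrict_def)
qed

lemma finite_cube [simp, intro]: "finite (cube d lo hi)"
  using bij_betw_finite[OF bij_betw_cube[of d lo hi]] by (simp add: finite_PiE)

lemma card_cube: "card (cube d lo hi) = nat (hi - lo) ^ d"
  using bij_betw_same_card[OF bij_betw_cube[of d lo hi]] by (simp add: card_PiE)

lemma zero_in_cube [simp]: "lo \<le> 0 \<Longrightarrow> 0 < hi \<Longrightarrow> 0 \<in> cube d lo hi"
  by (auto simp: cube_def)

lemma cube_mono: "lo' \<le> lo \<Longrightarrow> hi \<le> hi' \<Longrightarrow> cube d lo hi \<subseteq> cube d lo' hi'"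
  by (force simp: cube_def)

lemma cube_add:
  assumes "x \<in> cube d (-a) (a + 1)" "y \<in> cube d (-b) (b + 1)"
  shows "x + y \<in> cube d (-(a + b)) (a + b + 1)"
  using assms keys_add[of x y] by (fastforce simp: cube_def lookup_add)

lemma cube_uminus: "x \<in> cube d (-a) (a + 1) \<Longrightarrow> - x \<in> cube d (-a) (a + 1)"
  by (force simp: cube_def)

lemma finite_subset_cube:
  assumes "finite S" "\<And>x. x \<in> S \<Longrightarrow> Poly_Mapping.keys x \<subseteq> {..<d}"
  obtains r where "0 \<le> r" "S \<subseteq> cube d (-r) (r + 1)"
proof -
  define r where "r = (\<Sum>x\<in>S. \<Sum>i<d. \<bar>Poly_Mapping.lookup x i\<bar>)"
  have "\<bar>Poly_Mapping.lookup x i\<bar> \<le> r" if "x \<in> S" "i < d" for x i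
  proof -
    have "\<bar>Poly_Mapping.lookup x i\<bar> \<le> (\<Sum>i<d. \<bar>Poly_Mapping.lookup x i\<bar>)"
      using that by (intro member_le_sum) auto
    also have "\<dots> \<le> r" unfolding r_def
      using that assms by (intro member_le_sum[where f = "\<lambda>x. \<Sum>i<d. \<bar>Poly_Mapping.lookup x i\<bar>"]) (auto intro: sum_nonneg)
    finally show ?thesis .
  qed
  then have "S \<subseteq> cube d (-r) (r + 1)" using assms(2) by (fastforce simp: cube_def abs_le_iff)
  moreover have "0 \<le> r" by (auto simp: r_def intro!: sum_nonneg)
  ultimately show thesis using that by blast
qed

text \<open>The ratio of the two volumes is \<open>(1 - c / n) ^ d\<close>, which tends to 1. Every
  comparison of a box with its collar rests on this.\<close>

lemma eventually_power_collar_small: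
  assumes "0 < e"
  shows "\<forall>\<^sub>F n in sequentially. real n ^ d - real (n - c) ^ d \<le> e * real n ^ d"
proof -
  have "(\<lambda>n. (1 - real c / real n) ^ d) \<longlonglongrightarrow> (1 - 0) ^ d"
    by (intro tendsto_intros lim_const_over_n)
  then have "\<forall>\<^sub>F n in sequentially. 1 - e < (1 - real c / real n) ^ d"
    using assms by (intro order_tendstoD) auto
  then show ?thesis using eventually_gt_at_top[of "c"]
  proof eventually_elim
    case (elim n)
    then have n: "real n > 0" "real (n - c) = (1 - real c / real n) * real n"
      by (auto simp: field_simps of_nat_diff)
    have "real n ^ d - real (n - c) ^ d = (1 - (1 - real c / real n) ^ d) * real n ^ d"
      unfolding n(2) power_mult_distrib by (simp add: algebra_simps)
    also have "\<dots> \<le> e * real n ^ d" using elim by (intro mult_right_mono) auto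
    finally show ?case .
  qed
qed

section \<open>Holonomic recurrences\<close>

text \<open>Multiplication of the formal series with coefficients \<open>f\<close> by the Laurent
  polynomial with coefficients \<open>q\<close> on \<open>S\<close>. The explicit set
  \<open>S\<close> keeps the sum finite for arbitrary \<open>f\<close>.\<close>

definition conv :: "(nat \<Rightarrow>\<^sub>0 int) set \<Rightarrow> ((nat \<Rightarrow>\<^sub>0 int) \<Rightarrow> complex) \<Rightarrow>
    ((nat \<Rightarrow>\<^sub>0 int) \<Rightarrow> complex) \<Rightarrow> (nat \<Rightarrow>\<^sub>0 int) \<Rightarrow> complex" where
  "conv S q f = (\<lambda>x. \<Sum>s\<in>S. q s * f (x - s))"

lemma conv_nonzeroE:
  assumes "conv S q f x \<noteq> 0"
  obtains s where "s \<in> S" "f (x - s) \<noteq> 0"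
proof (rule ccontr)
  assume "\<not> thesis"
  with that have "q s * f (x - s) = 0" if "s \<in> S" for s using \<open>s \<in> S\<close> by auto
  then have "conv S q f x = 0" unfolding conv_def by (intro sum.neutral) blast
  with assms show False ..
qed

lemma conv_add: "conv S q (\<lambda>x. f x + g x) = (\<lambda>x. conv S q f x + conv S q g x)"
  by (simp add: conv_def ring_distribs sum.distrib)

lemma conv_scale: "conv S q (\<lambda>x. c * f x) = (\<lambda>x. c * conv S q f x)"
  by (simp add: conv_def sum_distrib_left mult_ac)

lemma conv_sum: "conv S q (\<lambda>x. \<Sum>i\<in>I. c i * f i x) = (\<lambda>x. \<Sum>i\<in>I. c i * conv S q (f i) x)"
proof
  fix x
  have "conv S q (\<lambda>x. \<Sum>i\<in>I. c i * f i x) x = (\<Sum>s\<in>S. \<Sum>i\<in>I. q s * (c i * f i (x - s)))"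
    by (simp add: conv_def sum_distrib_left)
  also have "\<dots> = (\<Sum>i\<in>I. \<Sum>s\<in>S. q s * (c i * f i (x - s)))" by (rule sum.swap)
  finally show "conv S q (\<lambda>x. \<Sum>i\<in>I. c i * f i x) x = (\<Sum>i\<in>I. c i * conv S q (f i) x)"
    by (simp add: conv_def sum_distrib_left mult_ac)
qed

lemma conv_shift: "conv S q (\<lambda>x. f (x + t)) = (\<lambda>x. conv S q f (x + t))"
  by (simp add: conv_def algebra_simps)

lemma conv_commute: "conv S q (conv T p f) = conv T p (conv S q f)"
proof
  fix x
  have "conv S q (conv T p f) x = (\<Sum>s\<in>S. \<Sum>t\<in>T. q s * (p t * f (x - s - t)))"
    by (simp add: conv_def sum_distrib_left)
  also have "\<dots> = (\<Sum>t\<in>T. \<Sum>s\<in>S. q s * (p t * f (x - s - t)))" by (rule sum.swap)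
  also have "\<dots> = conv T p (conv S q f) x"
    unfolding conv_def sum_distrib_left by (intro sum.cong refl) (simp add: algebra_simps)
  finally show "conv S q (conv T p f) x = conv T p (conv S q f) x" .
qed

lemma funpow_conv_scale: "(conv S q ^^ m) (\<lambda>x. c * f x) = (\<lambda>x. c * (conv S q ^^ m) f x)"
  by (induction m) (simp_all add: conv_scale)

lemma funpow_conv_add: "(conv S q ^^ m) (\<lambda>x. f x + g x) = (\<lambda>x. (conv S q ^^ m) f x + (conv S q ^^ m) g x)"
  by (induction m) (simp_all add: conv_add)

lemma funpow_conv_sum: "(conv S q ^^ m) (\<lambda>x. \<Sum>i\<in>I. c i * f i x) = (\<lambda>x. \<Sum>i\<in>I. c i * (conv S q ^^ m) (f i) x)"
  by (induction m) (simp_all add: conv_sum)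

lemma funpow_conv_shift: "(conv S q ^^ m) (\<lambda>x. f (x + t)) = (\<lambda>x. (conv S q ^^ m) f (x + t))"
  by (induction m) (simp_all add: conv_shift)

text \<open>Multiplication by a coordinate is a derivation of formal Laurent series, so its
  commutator with \<open>conv S q\<close> is convolution with the derivative of
  \<open>q\<close>.\<close>

lemma conv_coord_mult:
  "conv S q (\<lambda>x. of_int (Poly_Mapping.lookup x i) * f x) =
    (\<lambda>x. of_int (Poly_Mapping.lookup x i) * conv S q f x - conv S (\<lambda>s. of_int (Poly_Mapping.lookup s i) * q s) f x)"
  by (simp add: conv_def sum_distrib_left sum_subtractf[symmetric] lookup_minus algebra_simps)

text \<open>This is the derivative of a power of a Laurent polynomial: by
  \<open>conv_commute\<close> the derivative of each factor can be moved past the other factors, and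
  the contributions add up.\<close>

lemma funpow_conv_coord_mult:
  "(conv S q ^^ Suc m) (\<lambda>x. of_int (Poly_Mapping.lookup x i) * f x) =
    (\<lambda>x. of_int (Poly_Mapping.lookup x i) * (conv S q ^^ Suc m) f x
       - of_nat (Suc m) * conv S (\<lambda>s. of_int (Poly_Mapping.lookup s i) * q s) ((conv S q ^^ m) f) x)"
proof (induction m)
  case 0
  then show ?case by (simp add: conv_coord_mult)
next
  case (Suc m)
  let ?Q' = "conv S (\<lambda>s. of_int (Poly_Mapping.lookup s i) * q s)"
  let ?X = "\<lambda>f x. of_int (Poly_Mapping.lookup x i) * f x"
  have "(conv S q ^^ Suc (Suc m)) (?X f) = conv S q ((conv S q ^^ Suc m) (?X f))"
    unfolding funpow.simps(2) comp_def ..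
  also have "\<dots> = conv S q (\<lambda>x. ?X ((conv S q ^^ Suc m) f) x + (- of_nat (Suc m)) * ?Q' ((conv S q ^^ m) f) x)"
    unfolding Suc.IH by (simp only: mult_minus_left diff_conv_add_uminus)
  also have "\<dots> = (\<lambda>x. ?X (conv S q ((conv S q ^^ Suc m) f)) x - ?Q' ((conv S q ^^ Suc m) f) x
      - of_nat (Suc m) * ?Q' (conv S q ((conv S q ^^ m) f)) x)"
    unfolding conv_add conv_coord_mult conv_scale conv_commute[of S q S "\<lambda>s. of_int (Poly_Mapping.lookup s i) * q s"]
    by (rule ext) (simp only: mult_minus_left diff_conv_add_uminus minus_add_distrib add_ac)
  also have "\<dots> = (\<lambda>x. ?X ((conv S q ^^ Suc (Suc m)) f) x - of_nat (Suc (Suc m)) * ?Q' ((conv S q ^^ Suc m) f) x)"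
    unfolding funpow.simps(2) comp_def of_nat_Suc by (rule ext) (simp only: algebra_simps mult_1_left)
  finally show ?case .
qed

definition box_supported :: "nat \<Rightarrow> int \<Rightarrow> ((nat \<Rightarrow>\<^sub>0 int) \<Rightarrow> complex) \<Rightarrow> bool" where
  "box_supported D r f \<longleftrightarrow> (\<forall>x. f x \<noteq> 0 \<longrightarrow> x \<in> cube D (-r) (r + 1))"

lemma box_supported_conv:
  assumes "box_supported D r f" "S \<subseteq> cube D (-\<rho>) (\<rho> + 1)"
  shows "box_supported D (r + \<rho>) (conv S q f)"
  unfolding box_supported_def
proof (intro allI impI)
  fix x assume "conv S q f x \<noteq> 0"
  then obtain s where s: "s \<in> S" "f (x - s) \<noteq> 0"
    by (rule conv_nonzeroE)
  then have "x - s \<in> cube D (-r) (r + 1)" "s \<in> cube D (-\<rho>) (\<rho> + 1)"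
    using assms by (auto simp: box_supported_def)
  from cube_add[OF this] show "x \<in> cube D (-(r + \<rho>)) (r + \<rho> + 1)" by simp
qed

locale annihilator =
  fixes D :: nat and S :: "(nat \<Rightarrow>\<^sub>0 int) set" and q :: "(nat \<Rightarrow>\<^sub>0 int) \<Rightarrow> complex" and \<rho> :: int
  assumes S_cube: "S \<subseteq> cube D (-\<rho>) (\<rho> + 1)" and \<rho>_nonneg: "0 \<le> \<rho>"
begin

text \<open>After \<open>m\<close> applications of the annihilator only a function on a box is left.
  Exponent and radius are both tracked, because the later count needs a radius that grows linearly
  with the number of operations.\<close>

definition annih :: "nat \<Rightarrow> int \<Rightarrow> ((nat \<Rightarrow>\<^sub>0 int) \<Rightarrow> complex) \<Rightarrow> bool" where
  "annih m r f \<longleftrightarrow> box_supported D r ((conv S q ^^ m) f)"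

lemma annih_Suc: "annih m r f \<Longrightarrow> annih (Suc m) (r + \<rho>) f"
  unfolding annih_def using box_supported_conv[OF _ S_cube] by simp

lemma annih_plus: "annih m r f \<Longrightarrow> annih (m + k) (r + int k * \<rho>) f"
proof (induction k)
  case (Suc k)
  from annih_Suc[OF Suc.IH[OF Suc.prems]] show ?case by (simp add: algebra_simps)
qed simp

lemma annih_shift:
  assumes "annih m r f" "t \<in> cube D (-\<tau>) (\<tau> + 1)"
  shows "annih m (r + \<tau>) (\<lambda>x. f (x + t))"
  unfolding annih_def box_supported_def funpow_conv_shift
proof (intro allI impI)
  fix x assume "(conv S q ^^ m) f (x + t) \<noteq> 0"
  then have "x + t \<in> cube D (-r) (r + 1)" using assms by (auto simp: annih_def box_supported_def)
  from cube_add[OF this cube_uminus[OF assms(2)]]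
  show "x \<in> cube D (-(r + \<tau>)) (r + \<tau> + 1)" by simp
qed

text \<open>One more power of the annihilating operator absorbs its commutator with a coordinate.\<close>

lemma annih_coord_mult:
  assumes "annih m r f"
  shows "annih (Suc m) (r + \<rho>) (\<lambda>x. (of_int (Poly_Mapping.lookup x i) + c) * f x)"
proof -
  let ?Q' = "conv S (\<lambda>s. of_int (Poly_Mapping.lookup s i) * q s)"
  have *: "(conv S q ^^ Suc m) (\<lambda>x. (of_int (Poly_Mapping.lookup x i) + c) * f x) =
    (\<lambda>x. of_int (Poly_Mapping.lookup x i) * (conv S q ^^ Suc m) f x
       - of_nat (Suc m) * ?Q' ((conv S q ^^ m) f) x + c * (conv S q ^^ Suc m) f x)"
    unfolding distrib_right funpow_conv_add funpow_conv_coord_mult funpow_conv_scale ..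
  have 1: "box_supported D (r + \<rho>) ((conv S q ^^ Suc m) f)"
    using annih_Suc[OF assms] by (simp add: annih_def)
  have 2: "box_supported D (r + \<rho>) (?Q' ((conv S q ^^ m) f))"
    using box_supported_conv[OF _ S_cube] assms by (simp add: annih_def)
  show ?thesis
    unfolding annih_def * box_supported_def
  proof (intro allI impI)
    fix x
    assume "of_int (Poly_Mapping.lookup x i) * (conv S q ^^ Suc m) f x
       - of_nat (Suc m) * ?Q' ((conv S q ^^ m) f) x + c * (conv S q ^^ Suc m) f x \<noteq> 0"
    then have "(conv S q ^^ Suc m) f x \<noteq> 0 \<or> ?Q' ((conv S q ^^ m) f) x \<noteq> 0" by auto
    then show "x \<in> cube D (- (r + \<rho>)) (r + \<rho> + 1)"
      using 1 2 by (auto simp only: box_supported_def)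
  qed
qed

text \<open>Each linear factor costs one application and enlarges the radius by
  \<open>\<rho>\<close>. Rising factorials serve for the spatial coordinates because order
  \<open>k\<close> vanishes at \<open>- j\<close> for every natural \<open>j < k\<close>, which
  later isolates one spatial order.\<close>

lemma annih_pochhammer:
  assumes "annih m r f"
  shows "annih (m + k) (r + int k * \<rho>) (\<lambda>x. pochhammer (of_int (Poly_Mapping.lookup x i)) k * f x)"
proof (induction k)
  case 0
  then show ?case using assms by simp
next
  case (Suc k)
  from annih_coord_mult[OF this, of i "of_nat k"]
  show ?case by (simp add: pochhammer_Suc algebra_simps)
qed

lemma annih_power:
  assumes "annih m r f"
  shows "annih (m + k) (r + int k * \<rho>) (\<lambda>x. of_int (Poly_Mapping.lookup x i) ^ k * f x)"
proof (induction k)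
  case 0
  then show ?case using assms by simp
next
  case (Suc k)
  from annih_coord_mult[OF this, of i 0]
  show ?case by (simp add: algebra_simps)
qed

lemma annih_prod_pochhammer:
  assumes "annih m r f"
  shows "annih (m + (\<Sum>i<n. k i)) (r + int (\<Sum>i<n. k i) * \<rho>)
    (\<lambda>x. (\<Prod>i<n. pochhammer (of_int (Poly_Mapping.lookup x i)) (k i)) * f x)"
proof (induction n)
  case 0
  then show ?case using assms by simp
next
  case (Suc n)
  from annih_pochhammer[OF this, of "k n" n]
  show ?case by (simp add: algebra_simps)
qed

end

text \<open>Such an \<open>f\<close> behaves like a power series in time whose coefficients are
  Laurent polynomials in space. Without a restriction of this kind convolution is not injective: a
  difference operator kills the constants.\<close>

definition finite_below :: "nat \<Rightarrow> ((nat \<Rightarrow>\<^sub>0 int) \<Rightarrow> complex) \<Rightarrow> bool" where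
  "finite_below t f \<longleftrightarrow> (\<forall>n. finite {x. f x \<noteq> 0 \<and> Poly_Mapping.lookup x t \<le> n})"

lemma finite_below_conv:
  assumes "finite_below t f" "finite S"
  shows "finite_below t (conv S q f)"
  unfolding finite_below_def
proof
  fix n
  have "{x. conv S q f x \<noteq> 0 \<and> Poly_Mapping.lookup x t \<le> n} \<subseteq>
    (\<Union>s\<in>S. (\<lambda>y. y + s) ` {y. f y \<noteq> 0 \<and> Poly_Mapping.lookup y t \<le> n - Poly_Mapping.lookup s t})"
  proof (clarify)
    fix x assume x: "conv S q f x \<noteq> 0" "Poly_Mapping.lookup x t \<le> n"
    from x(1) obtain s where s: "s \<in> S" "f (x - s) \<noteq> 0"
      by (rule conv_nonzeroE)
    then show "x \<in> (\<Union>s\<in>S. (\<lambda>y. y + s) ` {y. f y \<noteq> 0 \<and> Poly_Mapping.lookup y t \<le> n - Poly_Mapping.lookup s t})"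
      using x by (auto simp: lookup_minus intro!: bexI[of _ s] image_eqI[of _ _ "x - s"])
  qed
  then show "finite {x. conv S q f x \<noteq> 0 \<and> Poly_Mapping.lookup x t \<le> n}"
    by (rule finite_subset) (use assms in \<open>auto simp: finite_below_def\<close>)
qed

lemma finite_below_shift:
  assumes "finite_below t f"
  shows "finite_below t (\<lambda>x. f (x + s))"
  unfolding finite_below_def
proof
  fix n
  have "{x. f (x + s) \<noteq> 0 \<and> Poly_Mapping.lookup x t \<le> n} \<subseteq>
    (\<lambda>y. y - s) ` {y. f y \<noteq> 0 \<and> Poly_Mapping.lookup y t \<le> n + Poly_Mapping.lookup s t}"
    by (auto simp: lookup_add image_iff algebra_simps intro!: exI[of _ "_ + s"])
  then show "finite {x. f (x + s) \<noteq> 0 \<and> Poly_Mapping.lookup x t \<le> n}"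
    by (rule finite_subset) (use assms in \<open>auto simp: finite_below_def\<close>)
qed

lemma finite_below_mult: "finite_below t f \<Longrightarrow> finite_below t (\<lambda>x. p x * f x)"
  unfolding finite_below_def by (auto intro: finite_subset[rotated])

lemma finite_below_sum:
  assumes "finite I" "\<And>i. i \<in> I \<Longrightarrow> finite_below t (f i)"
  shows "finite_below t (\<lambda>x. \<Sum>i\<in>I. f i x)"
  unfolding finite_below_def
proof
  fix n
  have "{x. (\<Sum>i\<in>I. f i x) \<noteq> 0 \<and> Poly_Mapping.lookup x t \<le> n} \<subseteq>
    (\<Union>i\<in>I. {x. f i x \<noteq> 0 \<and> Poly_Mapping.lookup x t \<le> n})"
    by (auto dest: sum.not_neutral_contains_not_neutral)
  then show "finite {x. (\<Sum>i\<in>I. f i x) \<noteq> 0 \<and> Poly_Mapping.lookup x t \<le> n}"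
    by (rule finite_subset) (use assms in \<open>auto simp: finite_below_def\<close>)
qed

lemma ex_min_on:
  fixes l :: "'b \<Rightarrow> int"
  assumes "finite A" "A \<noteq> {}"
  shows "\<exists>a\<in>A. \<forall>x\<in>A. l a \<le> l x"
  using ex_min_if_finite[of "l ` A"] assms by (auto simp: not_less)

text \<open>The earliest time layers of \<open>f\<close> and of \<open>q\<close> are finite and
  nonempty, so \<open>unique_sum_pair\<close> provides a point at which exactly one product
  contributes, and that product is nonzero.\<close>

lemma conv_eq_0D:
  assumes "finite_below t f" "finite S" "S \<noteq> {}" "\<And>s. s \<in> S \<Longrightarrow> q s \<noteq> 0" "conv S q f = (\<lambda>_. 0)"
  shows "f = (\<lambda>_. 0)"
proof (rule ccontr)
  let ?l = "\<lambda>x. Poly_Mapping.lookup x t"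
  assume "f \<noteq> (\<lambda>_. 0)"
  then obtain x1 where x1: "f x1 \<noteq> 0" by auto
  have "finite {x. f x \<noteq> 0 \<and> ?l x \<le> ?l x1}" using assms(1) by (auto simp: finite_below_def)
  moreover have "{x. f x \<noteq> 0 \<and> ?l x \<le> ?l x1} \<noteq> {}" using x1 by blast
  ultimately obtain x0 where x0m: "x0 \<in> {x. f x \<noteq> 0 \<and> ?l x \<le> ?l x1}"
    and x0min: "\<And>x. x \<in> {x. f x \<noteq> 0 \<and> ?l x \<le> ?l x1} \<Longrightarrow> ?l x0 \<le> ?l x"
    using ex_min_on[where l = ?l] by meson
  have x0: "f x0 \<noteq> 0" "?l x0 \<le> ?l x1" using x0m by auto
  have x0': "?l x0 \<le> ?l x" if "f x \<noteq> 0" for x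
    using x0min[of x] that x0(2) by (cases "?l x \<le> ?l x1") auto
  obtain s0 where s0: "s0 \<in> S" "\<And>s. s \<in> S \<Longrightarrow> ?l s0 \<le> ?l s"
    using ex_min_on[OF assms(2,3), of ?l] by auto
  define A where "A = {x. f x \<noteq> 0 \<and> ?l x \<le> ?l x0}"
  define B where "B = {s \<in> S. ?l s \<le> ?l s0}"
  have "finite A" "finite B" "A \<noteq> {}" "B \<noteq> {}"
    using assms(1,2) x0(1) s0 by (auto simp: A_def B_def finite_below_def)
  then obtain a b where ab: "a \<in> A" "b \<in> B"
    "\<And>a' b'. \<lbrakk>a' \<in> A; b' \<in> B; a' + b' = a + b\<rbrakk> \<Longrightarrow> a' = a \<and> b' = b"
    by (rule unique_sum_pair) (rule that)
  have zero: "q s * f (a + b - s) = 0" if s: "s \<in> S - {b}" for s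
  proof (rule ccontr)
    assume "q s * f (a + b - s) \<noteq> 0"
    then have f: "f (a + b - s) \<noteq> 0" by auto
    \<comment> \<open>Both times are at least the respective minima while their sum equals the sum
      of the minima, so both points lie in the earliest layers.\<close>
    have "?l s0 \<le> ?l s" "?l x0 \<le> ?l (a + b - s)" "?l a \<le> ?l x0" "?l b \<le> ?l s0"
      using f s s0 x0' ab by (auto simp: A_def B_def)
    then have "?l s \<le> ?l s0" "?l (a + b - s) \<le> ?l x0" by (auto simp: lookup_add lookup_minus)
    then have "a + b - s \<in> A" "s \<in> B" using f s by (auto simp: A_def B_def)
    then have "s = b" using ab(3)[of "a + b - s" s] diff_add_cancel by blast
    then show False using s by blast
  qed
  have "conv S q f (a + b) = q b * f a + (\<Sum>s\<in>S - {b}. q s * f (a + b - s))"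
    unfolding conv_def using ab(2) assms(2) by (subst sum.remove[of _ b]) (auto simp: B_def)
  also have "(\<Sum>s\<in>S - {b}. q s * f (a + b - s)) = 0"
    using zero by (intro sum.neutral) blast
  finally have "q b * f a = 0" using assms(5) by simp
  then show False using ab assms(4) by (auto simp: A_def B_def)
qed

lemma funpow_conv_eq_0D:
  assumes "finite_below t f" "finite S" "S \<noteq> {}" "\<And>s. s \<in> S \<Longrightarrow> q s \<noteq> 0" "(conv S q ^^ m) f = (\<lambda>_. 0)"
  shows "f = (\<lambda>_. 0)"
  using assms(5)
proof (induction m)
  case (Suc m)
  have "finite_below t ((conv S q ^^ m) f)"
    by (induction m) (use assms finite_below_conv in auto)
  from conv_eq_0D[OF this assms(2,3,4)] Suc show ?case by simp
qed simp

text \<open>Lipshitz's counting argument.  Coordinate \<open>d\<close> is the time; the shifted polynomial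
  multiples of \<open>\<phi>\<close> of order at most \<open>N\<close> are about \<open>N ^ (d + 2)\<close> many, but a power of the annihilator
  embeds their span into functions on a box with about \<open>N ^ (d + 1)\<close> points.  The resulting linear
  relation is evaluated at minus its lowest order of spatial shift, where the rising factorials
  kill all other orders.\<close>

theorem holonomic_recurrence:
  fixes \<phi> :: "(nat \<Rightarrow>\<^sub>0 int) \<Rightarrow> complex"
  assumes fb: "finite_below d \<phi>"
    and S: "finite S" "S \<noteq> {}" "\<And>s. s \<in> S \<Longrightarrow> Poly_Mapping.keys s \<subseteq> {..<Suc d}" "\<And>s. s \<in> S \<Longrightarrow> q s \<noteq> 0"
    and supp: "finite {x. conv S q \<phi> x \<noteq> 0}"
      "\<And>x. conv S q \<phi> x \<noteq> 0 \<Longrightarrow> Poly_Mapping.keys x \<subseteq> {..<Suc d}"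
  shows "\<exists>N e. (\<exists>k\<le>N. \<exists>b\<le>N. e k b \<noteq> (0::complex)) \<and>
    (\<forall>n::int. (\<Sum>k\<le>N. (\<Sum>b\<le>N. e k b * of_int n ^ b) * \<phi> (Poly_Mapping.single d (n - int k))) = 0)"
proof -
  obtain \<rho> where \<rho>: "0 \<le> \<rho>" "S \<subseteq> cube (Suc d) (-\<rho>) (\<rho> + 1)"
    using finite_subset_cube[of S "Suc d"] S by blast
  obtain r0 where r0: "0 \<le> r0" "{x. conv S q \<phi> x \<noteq> 0} \<subseteq> cube (Suc d) (-r0) (r0 + 1)"
    using finite_subset_cube[OF supp(1), of "Suc d"] supp(2) by blast
  interpret annihilator "Suc d" S q \<rho> by unfold_locales (use \<rho> in auto)
  have base: "annih 1 r0 \<phi>" using r0 by (auto simp: annih_def box_supported_def)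
  \<comment> \<open>\<open>c\<close> makes the side \<open>2 * r + 1\<close> of the final box at
    most \<open>c * (N + 1)\<close>. With \<open>N = c ^ Suc d\<close> that box has at most
    \<open>N * (N + 1) ^ Suc d\<close> points, fewer than the \<open>(N + 1) ^ (d + 2)\<close>
    indices in \<open>I\<close>. The exponent \<open>m\<close> pays 1 for \<open>\<phi>\<close>,
    \<open>N\<close> for the powers of time and \<open>d * N\<close> for the rising
    factorials.\<close>
  define c where "c = 2 * (nat r0 + nat \<rho> * (d + 1) + 1) + 1"
  define N where "N = c ^ Suc d"
  define m where "m = 1 + (N + d * N)"
  define r where "r = r0 + int (N + d * N) * \<rho> + int N"
  define I where "I = {..N} \<times> {..N} \<times> cube d 0 (int N + 1)"
  \<comment> \<open>The index consists of a time shift \<open>k\<close>, a power \<open>b\<close> of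
    time and a spatial shift \<open>\<gamma>\<close>. The orders of the rising factorials are tied
    to \<open>\<gamma>\<close>, so evaluation at a suitable point can separate the spatial
    shifts.\<close>
  define g :: "nat \<times> nat \<times> (nat \<Rightarrow>\<^sub>0 int) \<Rightarrow> (nat \<Rightarrow>\<^sub>0 int) \<Rightarrow> complex" where
    "g = (\<lambda>(k, b, \<gamma>) x. of_int (Poly_Mapping.lookup x d) ^ b *
       ((\<Prod>i<d. pochhammer (of_int (Poly_Mapping.lookup x i)) (nat (Poly_Mapping.lookup \<gamma> i))) *
        \<phi> (x + (\<gamma> - Poly_Mapping.single d (int k)))))"
  have g_annih: "annih m r (g i)" if i: "i \<in> I" for i
  proof -
    obtain k b \<gamma> where i_eq: "i = (k, b, \<gamma>)" by (cases i) auto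
    then have k: "k \<le> N" "b \<le> N" and \<gamma>: "\<gamma> \<in> cube d 0 (int N + 1)" using i by (auto simp: I_def)
    let ?t = "\<gamma> - Poly_Mapping.single d (int k)"
    let ?s = "\<Sum>i<d. nat (Poly_Mapping.lookup \<gamma> i)"
    have t: "?t \<in> cube (Suc d) (- int N) (int N + 1)"
    proof -
      have "Poly_Mapping.keys ?t \<subseteq> {..<Suc d}"
        using \<gamma> keys_diff[of \<gamma> "Poly_Mapping.single d (int k)"] by (auto simp: cube_def split: if_splits)
      moreover have "- int N \<le> Poly_Mapping.lookup ?t i \<and> Poly_Mapping.lookup ?t i < int N + 1"
        if "i < Suc d" for i
      proof (cases "i = d")
        case True
        then have "Poly_Mapping.lookup \<gamma> i = 0" using \<gamma> by (auto simp: cube_def lookup_eq_0_lessThan)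
        then show ?thesis using True k by (simp add: lookup_minus lookup_single)
      next
        case False
        then have "i < d" using that by simp
        then have "0 \<le> Poly_Mapping.lookup \<gamma> i \<and> Poly_Mapping.lookup \<gamma> i < int N + 1"
          using \<gamma> by (auto simp: cube_def)
        then show ?thesis using False by (auto simp: lookup_minus lookup_single when_def)
      qed
      ultimately show ?thesis by (auto simp: cube_def)
    qed
    have s: "?s \<le> d * N"
      using sum_bounded_above[of "{..<d}" "\<lambda>i. nat (Poly_Mapping.lookup \<gamma> i)" N] \<gamma> by (force simp: cube_def)
    have "annih (1 + ?s + b) (r0 + int N + int ?s * \<rho> + int b * \<rho>) (g i)"
      unfolding g_def i_eq prod.case
      by (rule annih_power, rule annih_prod_pochhammer, rule annih_shift, rule base, rule t)
    from annih_plus[OF this, of "m - (1 + ?s + b)"]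
    have "annih m (r0 + int N + int ?s * \<rho> + int b * \<rho> + int (m - (1 + ?s + b)) * \<rho>) (g i)"
      using s k by (simp add: m_def)
    also have "r0 + int N + int ?s * \<rho> + int b * \<rho> + int (m - (1 + ?s + b)) * \<rho> = r"
    proof -
      have m: "int (N + d * N) = int ?s + int b + int (m - (1 + ?s + b))"
        using s k by (simp add: m_def)
      show ?thesis unfolding r_def m by (simp only: algebra_simps)
    qed
    finally show ?thesis .
  qed
  have finI: "finite I" by (auto simp: I_def)
  have cardI: "card I = (N + 1) ^ (d + 2)"
    by (simp add: I_def card_cartesian_product card_cube nat_add_distrib)
  have "card (cube (Suc d) (-r) (r + 1)) < card I"
  proof -
    have "int (2 * (nat r0 + nat \<rho> * (d + 1) * N + N) + 1) = 2 * r + 1"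
      using \<rho> r0 by (simp add: r_def algebra_simps)
    then have "nat (2 * r + 1) = 2 * (nat r0 + nat \<rho> * (d + 1) * N + N) + 1" by linarith
    also have "\<dots> \<le> c * (N + 1)" by (simp add: c_def algebra_simps)
    finally have "nat (r + 1 - (-r)) \<le> c * (N + 1)" by simp
    then have "card (cube (Suc d) (-r) (r + 1)) \<le> (c * (N + 1)) ^ Suc d"
      unfolding card_cube by (intro power_mono) auto
    also have "\<dots> = N * (N + 1) ^ Suc d" by (simp only: power_mult_distrib N_def)
    also have "\<dots> < (N + 1) * (N + 1) ^ Suc d" by simp
    also have "\<dots> = card I" unfolding cardI by simp
    finally show ?thesis .
  qed
  from homogeneous_system_nontrivial_solution[OF finite_cube finI this, of "\<lambda>x i. (conv S q ^^ m) (g i) x"]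
  obtain e where e: "\<exists>i\<in>I. e i \<noteq> 0"
    "\<And>x. x \<in> cube (Suc d) (-r) (r + 1) \<Longrightarrow> (\<Sum>i\<in>I. e i * (conv S q ^^ m) (g i) x) = 0"
    by blast
  have zero: "(\<Sum>i\<in>I. e i * (conv S q ^^ m) (g i) x) = 0" for x
  proof (cases "x \<in> cube (Suc d) (-r) (r + 1)")
    case False
    then have "(conv S q ^^ m) (g i) x = 0" if "i \<in> I" for i
      using g_annih[OF that] by (auto simp: annih_def box_supported_def)
    then show ?thesis by simp
  qed (use e in auto)
  have fbs: "finite_below d (\<lambda>x. \<Sum>i\<in>I. e i * g i x)"
    using fb by (intro finite_below_sum finI finite_below_mult)
      (auto simp: g_def intro!: finite_below_mult finite_below_shift)
  have z: "(conv S q ^^ m) (\<lambda>x. \<Sum>i\<in>I. e i * g i x) = (\<lambda>_. 0)"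
    unfolding funpow_conv_sum using zero by (intro ext)
  have "(\<lambda>x. \<Sum>i\<in>I. e i * g i x) = (\<lambda>_. 0)"
    by (rule funpow_conv_eq_0D[OF fbs S(1,2) _ z]) (rule S(4))
  then have rel: "(\<Sum>i\<in>I. e i * g i x) = 0" for x by meson
  define w where "w \<gamma> = (\<Sum>i<d. Poly_Mapping.lookup \<gamma> i)" for \<gamma> :: "nat \<Rightarrow>\<^sub>0 int"
  define \<Gamma> where "\<Gamma> = {\<gamma> \<in> cube d 0 (int N + 1). \<exists>k\<le>N. \<exists>b\<le>N. e (k, b, \<gamma>) \<noteq> 0}"
  have "finite \<Gamma>" unfolding \<Gamma>_def by simp
  moreover have "\<Gamma> \<noteq> {}" using e(1) by (fastforce simp: \<Gamma>_def I_def)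
  ultimately obtain \<gamma>0 where \<gamma>0: "\<gamma>0 \<in> \<Gamma>" "\<And>\<gamma>. \<gamma> \<in> \<Gamma> \<Longrightarrow> w \<gamma>0 \<le> w \<gamma>"
    using ex_min_on[of \<Gamma> w] by auto
  have \<gamma>0c: "\<gamma>0 \<in> cube d 0 (int N + 1)" using \<gamma>0 by (auto simp: \<Gamma>_def)
  define P where "P = (\<Prod>i<d. pochhammer (- of_int (Poly_Mapping.lookup \<gamma>0 i)) (nat (Poly_Mapping.lookup \<gamma>0 i)) :: complex)"
  have "P \<noteq> 0"
  proof -
    have "pochhammer (- of_int (Poly_Mapping.lookup \<gamma>0 i)) (nat (Poly_Mapping.lookup \<gamma>0 i)) \<noteq> (0::complex)"
      if "i < d" for i
    proof -
      have "of_int (Poly_Mapping.lookup \<gamma>0 i) = (of_nat (nat (Poly_Mapping.lookup \<gamma>0 i)) :: complex)"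
        using \<gamma>0c that by (auto simp: cube_def)
      then show ?thesis by (simp only: pochhammer_of_nat_eq_0_iff)
    qed
    then show ?thesis by (auto simp: P_def)
  qed
  have step: "(\<Sum>k\<le>N. (\<Sum>b\<le>N. e (k, b, \<gamma>0) * of_int n ^ b) * \<phi> (Poly_Mapping.single d (n - int k))) = 0" for n :: int
  proof -
    \<comment> \<open>The spatial part is \<open>- \<gamma>0\<close>, so the shift by
      \<open>\<gamma>0\<close> lands on the time axis, where the recurrence is wanted.\<close>
    define x where "x = Poly_Mapping.single d n - \<gamma>0"
    have xd: "Poly_Mapping.lookup x d = n" and xi: "\<And>i. i < d \<Longrightarrow> Poly_Mapping.lookup x i = - Poly_Mapping.lookup \<gamma>0 i"
      using \<gamma>0c by (auto simp: x_def lookup_minus lookup_single cube_def lookup_eq_0_lessThan)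
    \<comment> \<open>Either \<open>\<gamma>\<close> is at most \<open>\<gamma>0\<close> in every
      coordinate, hence of smaller total order and absent from \<open>\<Gamma>\<close>, or it
      exceeds \<open>\<gamma>0\<close> somewhere and the rising factorial of that coordinate
      vanishes.\<close>
    have van: "e (k, b, \<gamma>) * g (k, b, \<gamma>) x = 0"
      if \<gamma>: "\<gamma> \<in> cube d 0 (int N + 1)" "\<gamma> \<noteq> \<gamma>0" "k \<le> N" "b \<le> N" for k b \<gamma>
    proof (cases "\<forall>i<d. Poly_Mapping.lookup \<gamma> i \<le> Poly_Mapping.lookup \<gamma>0 i")
      case True
      have "\<exists>i<d. Poly_Mapping.lookup \<gamma> i \<noteq> Poly_Mapping.lookup \<gamma>0 i"
      proof (rule ccontr)
        assume "\<not> ?thesis"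
        then have "\<gamma> = \<gamma>0" using \<gamma> \<gamma>0c
          by (intro poly_mapping_eqI) (metis (mono_tags, lifting) cube_def lookup_eq_0_lessThan mem_Collect_eq)
        then show False using \<gamma> by simp
      qed
      then have "w \<gamma> < w \<gamma>0" unfolding w_def
        by (intro sum_strict_mono_ex1) (use True in \<open>auto simp: less_le\<close>)
      then have "\<gamma> \<notin> \<Gamma>" using \<gamma>0(2) by force
      then show ?thesis using \<gamma> by (auto simp: \<Gamma>_def)
    next
      case False
      then obtain i where i: "i < d" "Poly_Mapping.lookup \<gamma>0 i < Poly_Mapping.lookup \<gamma> i" by force
      have "0 \<le> Poly_Mapping.lookup \<gamma>0 i" using \<gamma>0c i by (auto simp: cube_def)
      then have eq: "of_int (Poly_Mapping.lookup x i) = (- of_nat (nat (Poly_Mapping.lookup \<gamma>0 i)) :: complex)"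
        using xi[OF i(1)] by simp
      have "pochhammer (of_int (Poly_Mapping.lookup x i)) (nat (Poly_Mapping.lookup \<gamma> i)) = (0::complex)"
        unfolding eq pochhammer_of_nat_eq_0_iff using i \<open>0 \<le> Poly_Mapping.lookup \<gamma>0 i\<close> by simp
      then have "(\<Prod>i<d. pochhammer (of_int (Poly_Mapping.lookup x i)) (nat (Poly_Mapping.lookup \<gamma> i))) = (0::complex)"
        using i(1) by (intro prod_zero) auto
      then show ?thesis by (simp add: g_def)
    qed
    have surv: "g (k, b, \<gamma>0) x = of_int n ^ b * (P * \<phi> (Poly_Mapping.single d (n - int k)))" for k b
    proof -
      have "x + (\<gamma>0 - Poly_Mapping.single d (int k)) = Poly_Mapping.single d (n - int k)"
        by (simp add: x_def single_diff)
      then show ?thesis using xd xi by (simp add: g_def P_def)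
    qed
    have "0 = (\<Sum>k\<le>N. \<Sum>b\<le>N. \<Sum>\<gamma>\<in>cube d 0 (int N + 1). e (k, b, \<gamma>) * g (k, b, \<gamma>) x)"
      using rel[of x] unfolding I_def by (simp add: sum.cartesian_product case_prod_unfold)
    also have "\<dots> = (\<Sum>k\<le>N. \<Sum>b\<le>N. e (k, b, \<gamma>0) * g (k, b, \<gamma>0) x)"
    proof (intro sum.cong refl)
      fix k b assume kb: "k \<in> {..N}" "b \<in> {..N}"
      have "(\<Sum>\<gamma>\<in>cube d 0 (int N + 1). e (k, b, \<gamma>) * g (k, b, \<gamma>) x) =
        (\<Sum>\<gamma>\<in>{\<gamma>0}. e (k, b, \<gamma>) * g (k, b, \<gamma>) x)"
        using \<gamma>0c van kb by (intro sum.mono_neutral_right) auto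
      then show "(\<Sum>\<gamma>\<in>cube d 0 (int N + 1). e (k, b, \<gamma>) * g (k, b, \<gamma>) x) = e (k, b, \<gamma>0) * g (k, b, \<gamma>0) x"
        by simp
    qed
    also have "\<dots> = P * (\<Sum>k\<le>N. (\<Sum>b\<le>N. e (k, b, \<gamma>0) * of_int n ^ b) * \<phi> (Poly_Mapping.single d (n - int k)))"
      by (simp add: surv sum_distrib_left sum_distrib_right mult_ac)
    finally show ?thesis using \<open>P \<noteq> 0\<close> by simp
  qed
  show ?thesis
    using \<gamma>0(1) step by (intro exI[of _ N] exI[of _ "\<lambda>k b. e (k, b, \<gamma>0)"]) (auto simp: \<Gamma>_def)
qed

text \<open>For bounded solutions only the leading coefficients in \<open>n\<close> matter.\<close>

lemma bounded_holonomic_asymptotic_recurrence: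
  fixes \<psi> :: "int \<Rightarrow> complex"
  assumes rec: "\<And>n. (\<Sum>k\<le>N. (\<Sum>b\<le>N. e k b * of_int n ^ b) * \<psi> (n - int k)) = 0"
    and nz: "\<exists>k\<le>N. \<exists>b\<le>N. e k b \<noteq> (0::complex)"
    and bd: "\<And>n. norm (\<psi> n) \<le> C"
  shows "\<exists>a. (\<exists>k\<le>N. a k \<noteq> 0) \<and>
    (\<exists>C'. \<forall>n\<ge>1. real n * norm (\<Sum>k\<le>N. a k * \<psi> (int n - int k)) \<le> C')"
proof -
  define b0 where "b0 = Max {b. b \<le> N \<and> (\<exists>k\<le>N. e k b \<noteq> 0)}"
  have "b0 \<in> {b. b \<le> N \<and> (\<exists>k\<le>N. e k b \<noteq> 0)}"
    unfolding b0_def by (rule Max_in) (use nz in auto)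
  then have b0: "b0 \<le> N" "\<exists>k\<le>N. e k b0 \<noteq> 0" by auto
  have above: "e k b = 0" if "k \<le> N" "b \<le> N" "b0 < b" for k b
  proof (rule ccontr)
    assume "e k b \<noteq> 0"
    then have "b \<le> b0" unfolding b0_def using that by (intro Max_ge) auto
    then show False using that by simp
  qed
  define T where "T b n = (\<Sum>k\<le>N. e k b * \<psi> (n - int k))" for b n
  define C1 where "C1 = (\<Sum>b\<le>N. \<Sum>k\<le>N. norm (e k b) * C)"
  have C0: "0 \<le> C" using bd[of 0] norm_ge_zero order_trans by blast
  have C1: "norm (T b n) \<le> C1" if "b \<le> N" for b n
  proof -
    have "norm (T b n) \<le> (\<Sum>k\<le>N. norm (e k b) * C)"
      unfolding T_def by (intro sum_norm_le) (auto simp: norm_mult intro!: mult_left_mono bd)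
    also have "\<dots> \<le> C1" unfolding C1_def
      using that C0 by (intro member_le_sum[where f = "\<lambda>b. \<Sum>k\<le>N. norm (e k b) * C"]) (auto intro!: sum_nonneg mult_nonneg_nonneg)
    finally show ?thesis .
  qed
  \<comment> \<open>Solving the relation for its top power of \<open>n\<close> leaves only lower
    powers with bounded coefficients on the other side; the division by \<open>n ^ b0\<close> then
    gains a factor \<open>1/n\<close>.\<close>
  have main: "of_int n ^ b0 * T b0 n = - (\<Sum>b<b0. of_int n ^ b * T b n)" for n
  proof -
    have "0 = (\<Sum>b\<le>N. of_int n ^ b * T b n)"
      using rec[of n] unfolding T_def sum_distrib_left sum_distrib_right
      by (subst sum.swap) (simp add: mult_ac)
    also have "\<dots> = (\<Sum>b\<le>b0. of_int n ^ b * T b n)"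
      using b0 above by (intro sum.mono_neutral_right) (auto simp: T_def)
    also have "\<dots> = (\<Sum>b<b0. of_int n ^ b * T b n) + of_int n ^ b0 * T b0 n"
      by (simp add: lessThan_Suc_atMost[symmetric])
    finally show ?thesis by (simp add: eq_neg_iff_add_eq_0 add.commute)
  qed
  have "real n * norm (T b0 (int n)) \<le> real b0 * C1" if n: "n \<ge> 1" for n
  proof -
    have "real n ^ b0 * norm (T b0 (int n)) = norm (\<Sum>b<b0. of_int (int n) ^ b * T b (int n))"
      using arg_cong[OF main[of "int n"], of norm] by (simp add: norm_mult norm_power)
    also have "\<dots> \<le> (\<Sum>b<b0. real n ^ (b0 - 1) * C1)"
    proof (rule sum_norm_le)
      fix b assume "b \<in> {..<b0}"
      then have "real n ^ b \<le> real n ^ (b0 - 1)" "norm (T b (int n)) \<le> C1"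
        using n b0 C1 by (auto intro!: power_increasing)
      then show "norm (of_int (int n) ^ b * T b (int n)) \<le> real n ^ (b0 - 1) * C1"
        by (auto simp: norm_mult norm_power intro!: mult_mono)
    qed
    finally have le: "real n ^ b0 * norm (T b0 (int n)) \<le> real n ^ (b0 - 1) * (real b0 * C1)"
      by (simp add: mult_ac)
    show ?thesis
    \<comment> \<open>For \<open>b0 = 0\<close> the truncated exponent \<open>b0 - 1\<close> does no
      harm, since the bound carries the factor \<open>real b0\<close>.\<close>
    proof (cases b0)
      case 0
      then show ?thesis using le by simp
    next
      case (Suc j)
      then have "real n ^ j * (real n * norm (T b0 (int n))) \<le> real n ^ j * (real b0 * C1)"
        using le by (simp add: mult_ac)
      then show ?thesis using n by (simp add: mult_le_cancel_left)
    qed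
  qed
  then show ?thesis using b0(2)
    by (intro exI[of _ "\<lambda>k. e k b0"] conjI exI[of _ "real b0 * C1"]) (auto simp: T_def)
qed

section \<open>Complex Hilbert spaces\<close>

lemma scaleC_zero_left [simp]: "0 *\<^sub>C x = 0"
  using scaleC_of_real[of 0 x] by simp

lemma scaleC_one [simp]: "1 *\<^sub>C x = x"
  using scaleC_of_real[of 1 x] by simp

lemma scaleC_zero_right [simp]: "a *\<^sub>C 0 = 0"
  using scaleC_add_right[of a 0 0] by simp

lemma scaleC_eq_0_iff [simp]: "a *\<^sub>C x = 0 \<longleftrightarrow> a = 0 \<or> x = 0"
  using scaleC_scaleC[of "inverse a" a x] by (cases "a = 0") auto

lemma cinner_add_right: "cinner x (y + z) = cinner x y + cinner x z"
  by (metis cinner_add_left cinner_commute complex_cnj_add)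

lemma cinner_scaleC_right: "cinner x (a *\<^sub>C y) = cnj a * cinner x y"
  by (metis cinner_commute cinner_scaleC_left complex_cnj_mult)

lemma cinner_self: "cinner x x = of_real ((norm x)\<^sup>2)"
proof (rule complex_eqI)
  show "Re (cinner x x) = Re (of_real ((norm x)\<^sup>2))"
    by (simp add: Re_cinner power2_norm_eq_inner)
  have "Im (cinner x x) = Im (cnj (cinner x x))"
    using cinner_commute[of x x] by (rule arg_cong)
  then show "Im (cinner x x) = Im (of_real ((norm x)\<^sup>2))" by simp
qed

lemma norm_scaleC [simp]: "norm (a *\<^sub>C x) = cmod a * norm x"
proof -
  have "complex_of_real ((norm (a *\<^sub>C x))\<^sup>2) = a * cnj a * of_real ((norm x)\<^sup>2)"
    by (metis cinner_self cinner_scaleC_left cinner_scaleC_right mult.assoc)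
  also have "\<dots> = of_real ((cmod a * norm x)\<^sup>2)"
    by (simp add: power_mult_distrib flip: complex_norm_square)
  finally have "complex_of_real ((norm (a *\<^sub>C x))\<^sup>2) = of_real ((cmod a * norm x)\<^sup>2)" .
  then have "(norm (a *\<^sub>C x))\<^sup>2 = (cmod a * norm x)\<^sup>2" by (simp only: of_real_eq_iff)
  then show ?thesis by simp
qed

lemma cinner_eq_inner: "cinner x y = Complex (inner x y) (inner x (\<i> *\<^sub>C y))"
  by (rule complex_eqI) (simp_all add: cinner_scaleC_right flip: Re_cinner)

lemma norm_cinner_le: "cmod (cinner x y) \<le> norm x * norm y"
proof (cases "cinner x y = 0")
  case False
  define c where "c = cnj (sgn (cinner x y))"
  have "cmod c = 1" using False by (simp add: c_def norm_sgn)
  have "complex_of_real (cmod (cinner x y)) = c * cinner x y"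
    by (simp add: c_def sgn_eq mult.commute flip: complex_norm_square) (simp add: power2_eq_square)
  then have "cmod (cinner x y) = inner (c *\<^sub>C x) y"
    by (metis Re_cinner Re_complex_of_real cinner_scaleC_left)
  also have "\<dots> \<le> norm (c *\<^sub>C x) * norm y" by (rule norm_cauchy_schwarz)
  finally show ?thesis using \<open>cmod c = 1\<close> by simp
qed simp

lemma bounded_bilinear_cinner: "bounded_bilinear (cinner :: 'a::complex_inner_space \<Rightarrow> 'a \<Rightarrow> complex)"
proof
  show "\<exists>K. \<forall>(a::'a) b. cmod (cinner a b) \<le> norm a * norm b * K"
    by (intro exI[of _ 1] allI) (simp add: norm_cinner_le)
qed (simp_all add: cinner_add_left cinner_add_right cinner_scaleC_left cinner_scaleC_right
    scaleR_conv_of_real flip: scaleC_of_real)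

lemma bounded_bilinear_scaleC: "bounded_bilinear (scaleC :: complex \<Rightarrow> 'a::complex_inner_space \<Rightarrow> 'a)"
proof
  show "\<exists>K. \<forall>a (b::'a). norm (a *\<^sub>C b) \<le> norm a * norm b * K"
    by (intro exI[of _ 1]) simp
qed (simp_all add: scaleC_add_left scaleC_add_right scaleC_scaleC scaleR_conv_of_real mult.commute flip: scaleC_of_real)

interpretation cinner: bounded_bilinear "cinner :: 'a::complex_inner_space \<Rightarrow> 'a \<Rightarrow> complex"
  by (rule bounded_bilinear_cinner)

interpretation scaleC: bounded_bilinear "scaleC :: complex \<Rightarrow> 'a::complex_inner_space \<Rightarrow> 'a"
  by (rule bounded_bilinear_scaleC)

definition csubspace :: "'a::complex_inner_space set \<Rightarrow> bool" where
  "csubspace S \<longleftrightarrow> 0 \<in> S \<and> (\<forall>x\<in>S. \<forall>y\<in>S. x + y \<in> S) \<and> (\<forall>c. \<forall>x\<in>S. c *\<^sub>C x \<in> S)"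

lemma csubspaceD:
  assumes "csubspace S"
  shows csubspace_0: "0 \<in> S"
    and csubspace_add: "\<lbrakk>x \<in> S; y \<in> S\<rbrakk> \<Longrightarrow> x + y \<in> S"
    and csubspace_scaleC: "x \<in> S \<Longrightarrow> c *\<^sub>C x \<in> S"
  using assms by (auto simp: csubspace_def)

lemma csubspace_diff:
  assumes "csubspace S" "x \<in> S" "y \<in> S"
  shows "x - y \<in> S"
proof -
  have "x + (-1) *\<^sub>C y \<in> S" using assms by (intro csubspace_add csubspace_scaleC)
  then show ?thesis by (simp add: scaleC.minus_left)
qed

lemma csubspace_sum:
  assumes "csubspace S" "\<And>i. i \<in> I \<Longrightarrow> f i \<in> S"
  shows "(\<Sum>i\<in>I. f i) \<in> S"
  using assms(2) by (induction I rule: infinite_finite_induct) (auto intro: csubspaceD[OF assms(1)])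

lemma csubspace_imp_subspace: "csubspace S \<Longrightarrow> subspace S"
  unfolding subspace_def csubspace_def by (metis scaleC_of_real)

text \<open>A minimizing sequence is Cauchy by the parallelogram law.\<close>

theorem closed_subspace_projection_exists:
  fixes S :: "'a::{real_inner, complete_space} set"
  assumes "subspace S" "closed S"
  shows "\<exists>v\<in>S. \<forall>w\<in>S. inner (u - v) w = 0"
proof -
  define D where "D = (\<lambda>v. (norm (u - v))\<^sup>2) ` S"
  define d where "d = Inf D"
  have ne: "D \<noteq> {}" using subspace_0[OF assms(1)] by (auto simp: D_def)
  have bdd: "bdd_below D" by (rule bdd_belowI[of _ 0]) (auto simp: D_def)
  have lower: "d \<le> (norm (u - v))\<^sup>2" if "v \<in> S" for v
    unfolding d_def by (rule cInf_lower[OF _ bdd]) (use that in \<open>auto simp: D_def\<close>)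
  have "\<exists>v\<in>S. (norm (u - v))\<^sup>2 < d + 1 / real (Suc n)" for n
  proof -
    have "Inf D < d + 1 / real (Suc n)" by (simp add: d_def)
    from cInf_lessD[OF ne this] show ?thesis by (auto simp: D_def)
  qed
  then obtain v where v: "\<And>n. v n \<in> S" "\<And>n. (norm (u - v n))\<^sup>2 < d + 1 / real (Suc n)" by metis
  have close: "(norm (v m - v n))\<^sup>2 \<le> 2 / real (Suc m) + 2 / real (Suc n)" for m n
  proof -
    have "(1/2) *\<^sub>R (v m + v n) \<in> S" using v assms(1) by (simp add: subspace_add subspace_scale)
    then have "4 * d \<le> 4 * (norm (u - (1/2) *\<^sub>R (v m + v n)))\<^sup>2" using lower by simp
    also have "\<dots> = 2 * (norm (u - v m))\<^sup>2 + 2 * (norm (u - v n))\<^sup>2 - (norm (v m - v n))\<^sup>2"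
      by (simp add: power2_norm_eq_inner inner_simps inner_commute algebra_simps)
    finally show ?thesis using v(2)[of m] v(2)[of n] by simp
  qed
  have "Cauchy v"
  proof (rule CauchyI)
    fix e :: real assume e: "e > 0"
    obtain M where M: "4 / e\<^sup>2 < real M" using reals_Archimedean2 by blast
    show "\<exists>M. \<forall>m\<ge>M. \<forall>n\<ge>M. norm (v m - v n) < e"
    proof (intro exI allI impI)
      fix m n assume mn: "M \<le> m" "M \<le> n"
      have "0 < real M" using M e by (smt (verit) divide_nonneg_nonneg zero_le_power2)
      then have "2 / real (Suc m) < 2 / real M" "2 / real (Suc n) < 2 / real M"
        using mn by (auto intro!: divide_strict_left_mono)
      then have "(norm (v m - v n))\<^sup>2 < 4 / real M" using close[of m n] by simp
      also have "\<dots> < e\<^sup>2" using M e \<open>0 < real M\<close> by (simp add: field_simps)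
      finally show "norm (v m - v n) < e" using e by (simp add: power2_less_imp_less)
    qed
  qed
  then obtain l where l: "v \<longlonglongrightarrow> l" using Cauchy_convergent convergent_def by blast
  have lS: "l \<in> S" using assms(2) v(1) l closed_sequentially by blast
  have "(\<lambda>n. (norm (u - v n))\<^sup>2) \<longlonglongrightarrow> (norm (u - l))\<^sup>2" by (intro tendsto_intros l)
  moreover have "(\<lambda>n. d + 1 / real (Suc n)) \<longlonglongrightarrow> d + 0"
    by (intro tendsto_intros LIMSEQ_Suc[OF lim_1_over_n])
  ultimately have le: "(norm (u - l))\<^sup>2 \<le> d"
    using v(2) by (intro LIMSEQ_le[where X = "\<lambda>n. (norm (u - v n))\<^sup>2" and Y = "\<lambda>n. d + 1 / real (Suc n)"]) (auto intro: less_imp_le)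
  have "inner (u - l) w = 0" if w: "w \<in> S" for w
  proof (cases "w = 0")
    case False
    \<comment> \<open>This \<open>t\<close> minimizes the distance from \<open>u\<close> to the line
      through \<open>l\<close> in direction \<open>w\<close>. As \<open>l\<close> is already
      optimal, the gain, which is a square over a square, cannot be positive.\<close>
    define t where "t = inner (u - l) w / (norm w)\<^sup>2"
    have "l + t *\<^sub>R w \<in> S" using lS w assms(1) by (simp add: subspace_add subspace_scale)
    then have "(norm (u - l))\<^sup>2 \<le> (norm (u - (l + t *\<^sub>R w)))\<^sup>2" by (rule order_trans[OF le lower])
    also have "\<dots> = (norm (u - l))\<^sup>2 - (2 * t * inner (u - l) w - t\<^sup>2 * (norm w)\<^sup>2)"
      unfolding power2_norm_eq_inner by (simp add: inner_simps inner_commute algebra_simps power2_eq_square)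
    also have "2 * t * inner (u - l) w - t\<^sup>2 * (norm w)\<^sup>2 = (inner (u - l) w)\<^sup>2 / (norm w)\<^sup>2"
      using False by (simp add: t_def field_simps power2_eq_square)
    finally show ?thesis using False by (simp add: divide_le_0_iff)
  qed simp
  then show ?thesis using lS by blast
qed

text \<open>In a complex subspace, real orthogonality to both \<open>w\<close> and
  \<open>\<i> *\<^sub>C w\<close> is complex orthogonality to \<open>w\<close>, so the real
  projection already works.\<close>

lemma closed_csubspace_projection_exists:
  fixes S :: "'a::{complex_inner_space, complete_space} set"
  assumes "csubspace S" "closed S"
  shows "\<exists>v\<in>S. \<forall>w\<in>S. cinner (u - v) w = 0"
proof -
  obtain v where "v \<in> S" "\<And>w. w \<in> S \<Longrightarrow> inner (u - v) w = 0"
    using closed_subspace_projection_exists[OF csubspace_imp_subspace[OF assms(1)] assms(2), of u] by blast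
  then show ?thesis using csubspace_scaleC[OF assms(1)] by (auto simp: cinner_eq_inner complex_eq_iff)
qed

text \<open>The basis is one over the reals: a complex spanning set together with its multiples by
  \<open>\<i>\<close> spans over the reals and is then orthogonalized. All later counts of
  coordinates use the cardinality of this real basis.\<close>

lemma finite_orthonormal_basis_exists:
  obtains E :: "'w::fin_dim_complex_inner_space set"
  where "finite E" "\<And>e. e \<in> E \<Longrightarrow> norm e = 1" "\<And>e f. e \<in> E \<Longrightarrow> f \<in> E \<Longrightarrow> e \<noteq> f \<Longrightarrow> inner e f = 0"
    "\<And>x. x = (\<Sum>e\<in>E. inner x e *\<^sub>R e)"
proof -
  obtain B :: "'w set" where B: "finite B" "\<And>v. \<exists>c. v = (\<Sum>b\<in>B. c b *\<^sub>C b)"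
    using finite_spanning_set by blast
  define B' where "B' = B \<union> (\<lambda>b. \<i> *\<^sub>C b) ` B"
  have "finite B'" using B by (simp add: B'_def)
  have span: "v \<in> span B'" for v
  proof -
    obtain c where c: "v = (\<Sum>b\<in>B. c b *\<^sub>C b)" using B by blast
    have "c b *\<^sub>C b \<in> span B'" if "b \<in> B" for b
    proof -
      have "c b *\<^sub>C b = Re (c b) *\<^sub>R b + Im (c b) *\<^sub>R (\<i> *\<^sub>C b)"
      proof -
        have "c b = of_real (Re (c b)) + of_real (Im (c b)) * \<i>"
          by (simp add: complex_eq_iff)
        then have "c b *\<^sub>C b = (of_real (Re (c b)) + of_real (Im (c b)) * \<i>) *\<^sub>C b" by (rule arg_cong)
        then show ?thesis by (simp only: scaleC_add_left scaleC_of_real flip: scaleC_scaleC)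
      qed
      moreover have "b \<in> span B'" "\<i> *\<^sub>C b \<in> span B'"
        using that by (auto simp: B'_def intro!: span_base)
      ultimately show ?thesis by (simp add: span_add span_scale)
    qed
    then show ?thesis unfolding c by (rule span_sum)
  qed
  obtain C where C: "finite C" "span C = span B'" "pairwise orthogonal C"
    using basis_orthogonal[OF \<open>finite B'\<close>] by blast
  define E where "E = (\<lambda>x. x /\<^sub>R norm x) ` (C - {0})"
  have fin: "finite E" using C by (simp add: E_def)
  have n1: "norm e = 1" if "e \<in> E" for e
  proof -
    from that obtain x where "x \<noteq> 0" "e = x /\<^sub>R norm x" by (auto simp: E_def)
    then show ?thesis by simp
  qed
  have orth: "inner e f = 0" if "e \<in> E" "f \<in> E" "e \<noteq> f" for e f
  proof -
    from that obtain x y where "x \<in> C" "y \<in> C" and xy: "e = x /\<^sub>R norm x" "f = y /\<^sub>R norm y"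
      by (auto simp: E_def)
    moreover have "x \<noteq> y" using that(3) xy by auto
    ultimately have "inner x y = 0" using C(3) by (auto simp: pairwise_def orthogonal_def)
    then show ?thesis by (simp add: xy)
  qed
  have "C \<subseteq> span E"
  proof
    fix x assume x: "x \<in> C"
    show "x \<in> span E"
    proof (cases "x = 0")
      case False
      then have "x /\<^sub>R norm x \<in> span E" using x by (auto simp: E_def intro!: span_base)
      then have "norm x *\<^sub>R (x /\<^sub>R norm x) \<in> span E" by (rule span_scale)
      then show ?thesis using False by simp
    qed (simp add: span_zero)
  qed
  then have "span B' \<subseteq> span E" using C(2) by (metis span_minimal subspace_span)
  then have E_span: "v \<in> span E" for v using span by blast
  have "x = (\<Sum>e\<in>E. inner x e *\<^sub>R e)" for x
  proof -
    define y where "y = x - (\<Sum>e\<in>E. inner x e *\<^sub>R e)"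
    have y_orth: "inner y f = 0" if "f \<in> E" for f
    proof -
      have "(\<Sum>e\<in>E. inner x e * inner e f) = (\<Sum>e\<in>E. if e = f then inner x f else 0)"
        using that orth n1 by (intro sum.cong refl) (auto simp: norm_eq_1)
      then show ?thesis using that fin by (simp add: y_def inner_diff_left inner_sum_left)
    qed
    have "inner y z = 0" if "z \<in> span E" for z
      using that by (induction rule: span_induct_alt) (auto simp: inner_add_right y_orth)
    then have "y = 0" using E_span inner_eq_zero_iff by blast
    then show ?thesis by (simp add: y_def)
  qed
  with that fin n1 orth show thesis by blast
qed

lemma fin_dim_tendstoI:
  fixes X :: "nat \<Rightarrow> 'w::fin_dim_complex_inner_space"
  assumes "\<And>e. (\<lambda>n. inner (X n) e) \<longlonglongrightarrow> inner L e"
  shows "X \<longlonglongrightarrow> L"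
proof -
  obtain E :: "'w set" where E: "\<And>x. x = (\<Sum>e\<in>E. inner x e *\<^sub>R e)"
    using finite_orthonormal_basis_exists by metis
  have "(\<lambda>n. \<Sum>e\<in>E. inner (X n) e *\<^sub>R e) \<longlonglongrightarrow> (\<Sum>e\<in>E. inner L e *\<^sub>R e)"
    by (intro tendsto_intros assms)
  then show ?thesis unfolding E[symmetric] .
qed

instance fin_dim_complex_inner_space \<subseteq> complete_space
proof
  fix X :: "nat \<Rightarrow> 'a" assume X: "Cauchy X"
  obtain E :: "'a set" where E: "\<And>x. x = (\<Sum>e\<in>E. inner x e *\<^sub>R e)"
    using finite_orthonormal_basis_exists by metis
  have "convergent (\<lambda>n. inner (X n) e)" for e
    using bounded_linear.Cauchy[OF bounded_linear_inner_left X] by (simp add: Cauchy_convergent)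
  then obtain l where l: "\<And>e. (\<lambda>n. inner (X n) e) \<longlonglongrightarrow> l e" unfolding convergent_def by metis
  have "(\<lambda>n. \<Sum>e\<in>E. inner (X n) e *\<^sub>R e) \<longlonglongrightarrow> (\<Sum>e\<in>E. l e *\<^sub>R e)"
    by (intro tendsto_intros l)
  then show "convergent X" unfolding E[symmetric] by (rule convergentI)
qed

section \<open>Complex linear operators and polynomials in them\<close>

definition clinear :: "('a::complex_inner_space \<Rightarrow> 'a) \<Rightarrow> bool" where
  "clinear T \<longleftrightarrow> (\<forall>x y. T (x + y) = T x + T y) \<and> (\<forall>c x. T (c *\<^sub>C x) = c *\<^sub>C T x)"

lemma clinearD:
  assumes "clinear T"
  shows clinear_add: "T (x + y) = T x + T y" and clinear_scaleC: "T (c *\<^sub>C x) = c *\<^sub>C T x"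
  using assms by (auto simp: clinear_def)

lemma clinear_0: "clinear T \<Longrightarrow> T 0 = 0"
  using clinear_scaleC[of T 0 0] by simp

lemma clinear_diff: "clinear T \<Longrightarrow> T (x - y) = T x - T y"
  using clinear_add[of T "x - y" y] by simp

lemma clinear_sum: "clinear T \<Longrightarrow> T (\<Sum>i\<in>I. f i) = (\<Sum>i\<in>I. T (f i))"
  by (induction I rule: infinite_finite_induct) (auto simp: clinear_0 clinear_add)

lemma clinear_funpow: "clinear T \<Longrightarrow> clinear (T ^^ n)"
  by (induction n) (auto simp: clinear_def)

definition poly_op :: "complex poly \<Rightarrow> ('a::complex_inner_space \<Rightarrow> 'a) \<Rightarrow> 'a \<Rightarrow> 'a" where
  "poly_op p T x = (\<Sum>k\<le>degree p. poly.coeff p k *\<^sub>C (T ^^ k) x)"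

lemma poly_op_bound:
  assumes "degree p \<le> N"
  shows "poly_op p T x = (\<Sum>k\<le>N. poly.coeff p k *\<^sub>C (T ^^ k) x)"
  unfolding poly_op_def using assms by (intro sum.mono_neutral_left) (auto simp: coeff_eq_0)

lemma poly_op_pCons: "poly_op (pCons a p) T x = a *\<^sub>C x + poly_op p T (T x)"
proof -
  have "poly_op (pCons a p) T x = (\<Sum>k\<le>Suc (degree p). poly.coeff (pCons a p) k *\<^sub>C (T ^^ k) x)"
    by (intro poly_op_bound) (simp add: degree_pCons_le)
  then show ?thesis by (simp add: sum.atMost_Suc_shift poly_op_def funpow_swap1 del: sum.atMost_Suc)
qed

lemma poly_op_add: "poly_op (p + q) T x = poly_op p T x + poly_op q T x"
proof -
  let ?N = "max (degree p) (degree q)"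
  show ?thesis
    by (simp add: poly_op_bound[of _ ?N] degree_add_le scaleC_add_left sum.distrib)
qed

lemma poly_op_smult: "poly_op (smult c p) T x = c *\<^sub>C poly_op p T x"
  by (simp add: poly_op_bound[of _ "degree p"] degree_smult_le scaleC.sum_right scaleC_scaleC)

lemma clinear_poly_op: "clinear T \<Longrightarrow> clinear (poly_op p T)"
  using clinear_funpow[of T]
  by (auto simp: clinear_def poly_op_def scaleC_add_right sum.distrib scaleC.sum_right scaleC_scaleC mult.commute)

lemma poly_op_in:
  assumes "csubspace M" "T ` M \<subseteq> M" "x \<in> M"
  shows "poly_op p T x \<in> M"
proof -
  have "(T ^^ k) x \<in> M" for k by (induction k) (use assms in auto)
  then show ?thesis unfolding poly_op_def using assms by (intro csubspace_sum csubspace_scaleC)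
qed

text \<open>Split off a root \<open>s\<close> of \<open>p\<close>. Either
  \<open>T x - s *\<^sub>C x\<close> vanishes and \<open>x\<close> is an eigenvector, or it is a
  nonzero vector killed by the remaining factor of smaller degree.\<close>

lemma eigenvector_of_poly_op_eq_0:
  assumes "clinear T" "csubspace M" "T ` M \<subseteq> M" "x \<in> M" "x \<noteq> 0" "p \<noteq> 0" "poly_op p T x = 0"
  shows "\<exists>s e. e \<in> M \<and> e \<noteq> 0 \<and> T e = s *\<^sub>C e"
  using assms(4-)
proof (induction "degree p" arbitrary: p x)
  case 0
  then obtain c where "p = [:c:]" by (metis degree_eq_zeroE)
  then show ?case using 0 by (simp add: poly_op_def)
next
  case (Suc n)
  then obtain s where "poly p s = 0"
    using fundamental_theorem_of_algebra by (metis constant_degree nat.distinct(1))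
  then obtain q where q: "p = [:-s, 1:] * q" by (meson dvdE poly_eq_0_iff_dvd)
  then have q0: "q \<noteq> 0" using Suc.prems by auto
  then have dq: "n = degree q" using Suc.hyps(2) unfolding q by (subst (asm) degree_mult_eq) auto
  define y where "y = T x - s *\<^sub>C x"
  have "poly_op p T x = poly_op q T (T x) - s *\<^sub>C poly_op q T x"
  proof -
    have "p = smult (-s) q + pCons 0 q" by (simp add: q)
    then show ?thesis
      by (simp only: poly_op_add poly_op_smult poly_op_pCons) (simp add: scaleC.minus_left)
  qed
  also have "\<dots> = poly_op q T y"
    using clinear_poly_op[OF assms(1), of q] by (simp add: y_def clinear_diff clinear_scaleC)
  finally have "poly_op q T y = 0" using Suc.prems by simp
  moreover have "y \<in> M" unfolding y_def
    using assms Suc.prems by (intro csubspace_diff csubspace_scaleC) auto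
  ultimately show ?case
    using Suc.hyps(1)[OF dq, of y] q0 Suc.prems(1,2) by (cases "y = 0") (auto simp: y_def)
qed

text \<open>The square summable functions on \<open>Z\<close> will be a closed subspace of a space
  of functions on the whole type. Hence the operator is linear everywhere but unitary only on
  \<open>H\<close>.\<close>

locale unitary_on_csubspace =
  fixes H :: "'a::{complex_inner_space, complete_space} set" and U :: "'a \<Rightarrow> 'a"
  assumes csubspace_H: "csubspace H" and closed_H: "closed H" and clinear_U: "clinear U"
    and U_image: "U ` H = H"
    and U_cinner: "\<lbrakk>x \<in> H; y \<in> H\<rbrakk> \<Longrightarrow> cinner (U x) (U y) = cinner x y"
begin

lemma U_in: "x \<in> H \<Longrightarrow> U x \<in> H"
  using U_image by blast

lemma funpow_U_in: "x \<in> H \<Longrightarrow> (U ^^ n) x \<in> H"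
  by (induction n) (auto simp: U_in)

lemma funpow_U_cinner: "\<lbrakk>x \<in> H; y \<in> H\<rbrakk> \<Longrightarrow> cinner ((U ^^ n) x) ((U ^^ n) y) = cinner x y"
  by (induction n) (auto simp: U_cinner funpow_U_in)

lemma norm_U: "x \<in> H \<Longrightarrow> norm (U x) = norm x"
  using U_cinner[of x x] by (simp add: cinner_self flip: of_real_power)

lemma norm_funpow_U: "x \<in> H \<Longrightarrow> norm ((U ^^ n) x) = norm x"
  by (induction n) (auto simp: norm_U funpow_U_in)

lemma eigenvalue_norm:
  assumes "e \<in> H" "e \<noteq> 0" "U e = s *\<^sub>C e"
  shows "cmod s = 1"
  using norm_U[OF assms(1)] assms by simp

text \<open>An eigenvector of a unitary operator is an eigenvector of its adjoint for the conjugate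
  eigenvalue. Moving \<open>U\<close> across the inner product gives this without introducing an
  adjoint.\<close>

lemma cinner_U_eigenvector:
  assumes "e \<in> H" "e \<noteq> 0" "U e = s *\<^sub>C e" "x \<in> H"
  shows "cinner (U x) e = s * cinner x e"
proof -
  have "cnj s * cinner (U x) e = cinner x e"
    using U_cinner[OF assms(4,1)] assms(3) by (simp add: cinner_scaleC_right)
  then have "s * cnj s * cinner (U x) e = s * cinner x e" by (simp add: mult.assoc)
  then show ?thesis using eigenvalue_norm[OF assms(1-3)] by (simp add: complex_norm_square[symmetric])
qed

lemma cinner_funpow_U_eigenvector:
  assumes "e \<in> H" "e \<noteq> 0" "U e = s *\<^sub>C e" "x \<in> H"
  shows "cinner ((U ^^ n) x) e = s ^ n * cinner x e"
  by (induction n) (use assms in \<open>auto simp: cinner_U_eigenvector funpow_U_in\<close>)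

text \<open>The orthogonal complement of a reducing subspace is reducing, so an element of it
  that is annihilated by a polynomial in \<open>U\<close> yields an eigenvector there.\<close>

lemma reducing_subspace_absorbs:
  assumes N: "csubspace N" "closed N" "N \<subseteq> H" "U ` N = N"
    and v: "v \<in> H" and p: "p \<noteq> 0" "poly_op p U v \<in> N"
    and no_eig: "\<And>e s. \<lbrakk>e \<in> H; e \<noteq> 0; U e = s *\<^sub>C e; \<And>w. w \<in> N \<Longrightarrow> cinner e w = 0\<rbrakk> \<Longrightarrow> False"
  shows "v \<in> N"
proof -
  define M where "M = {x \<in> H. \<forall>w\<in>N. cinner x w = 0}"
  have M: "csubspace M"
    using csubspaceD[OF csubspace_H] by (auto simp: M_def csubspace_def cinner_add_left cinner_scaleC_left cinner.zero_left)
  have UM: "U ` M \<subseteq> M"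
  proof clarify
    fix x assume x: "x \<in> M"
    have "cinner (U x) w = 0" if "w \<in> N" for w
    proof -
      have "w \<in> U ` N" using N(4) that by simp
      then obtain w' where "w' \<in> N" "w = U w'" by blast
      then show ?thesis using x N(3) by (auto simp: M_def U_cinner subset_iff)
    qed
    then show "U x \<in> M" using x by (auto simp: M_def U_in)
  qed
  obtain v1 where v1: "v1 \<in> N" "\<And>w. w \<in> N \<Longrightarrow> cinner (v - v1) w = 0"
    using closed_csubspace_projection_exists[OF N(1,2)] by blast
  define v2 where "v2 = v - v1"
  have v2: "v2 \<in> M"
    using v v1 N(3) by (auto simp: M_def v2_def intro!: csubspace_diff[OF csubspace_H])
  have "poly_op p U v2 = poly_op p U v - poly_op p U v1"
    using clinear_poly_op[OF clinear_U] by (simp add: v2_def clinear_diff)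
  then have "poly_op p U v2 \<in> N"
    using p poly_op_in[OF N(1)] v1 N(4) by (simp add: csubspace_diff[OF N(1)])
  moreover have "poly_op p U v2 \<in> M" using poly_op_in[OF M UM v2] .
  ultimately have "cinner (poly_op p U v2) (poly_op p U v2) = 0" by (auto simp: M_def)
  then have z: "poly_op p U v2 = 0" by (simp add: cinner_self)
  have "v2 = 0"
  proof (rule ccontr)
    assume "v2 \<noteq> 0"
    from eigenvector_of_poly_op_eq_0[OF clinear_U M UM v2 this p(1) z] no_eig
    show False by (auto simp: M_def)
  qed
  then show ?thesis using v1 by (simp add: v2_def)
qed

text \<open>The vectors whose correlation with \<open>u\<close> tends to 0 form a closed reducing
  subspace. It contains every eigenvector, since \<open>u\<close> is orthogonal to all of them, and
  it contains \<open>poly_op p U v\<close>; so it absorbs \<open>v\<close>.\<close>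

lemma cinner_funpow_tendsto_0:
  assumes u: "u \<in> H" "\<And>e s. \<lbrakk>e \<in> H; e \<noteq> 0; U e = s *\<^sub>C e\<rbrakk> \<Longrightarrow> cinner u e = 0"
    and v: "v \<in> H" and p: "p \<noteq> 0" "(\<lambda>n. cinner ((U ^^ n) u) (poly_op p U v)) \<longlonglongrightarrow> 0"
  shows "(\<lambda>n. cinner ((U ^^ n) u) v) \<longlonglongrightarrow> 0"
proof -
  define N where "N = {w \<in> H. (\<lambda>n. cinner ((U ^^ n) u) w) \<longlonglongrightarrow> 0}"
  have "csubspace N"
    unfolding csubspace_def N_def
    using csubspaceD[OF csubspace_H]
    by (auto simp: cinner_add_right cinner_scaleC_right cinner.zero_right intro: tendsto_add_zero tendsto_mult_right_zero)
  moreover have "closed N"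
    unfolding closed_sequential_limits
  proof (intro allI impI, elim conjE)
    fix x l assume x: "\<forall>n. x n \<in> N" "x \<longlonglongrightarrow> l"
    have lH: "l \<in> H" using closed_sequentially[OF closed_H] x by (auto simp: N_def)
    have "(\<lambda>n. cinner ((U ^^ n) u) l) \<longlonglongrightarrow> 0"
    proof (rule LIMSEQ_I)
      fix r :: real assume r: "0 < r"
      define e where "e = r / (2 * (norm u + 1))"
      have e: "0 < e" using r by (auto simp: e_def intro!: divide_pos_pos add_nonneg_pos)
      then obtain k where k: "norm (x k - l) < e" using LIMSEQ_D[OF x(2) e] by blast
      have "(\<lambda>n. cinner ((U ^^ n) u) (x k)) \<longlonglongrightarrow> 0" using x by (auto simp: N_def)
      from LIMSEQ_D[OF this, of "r / 2"] r
      obtain n0 where n0: "\<And>n. n \<ge> n0 \<Longrightarrow> norm (cinner ((U ^^ n) u) (x k)) < r / 2" by auto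
      have "norm (cinner ((U ^^ n) u) l) < r" if "n \<ge> n0" for n
      proof -
        have "cinner ((U ^^ n) u) l = cinner ((U ^^ n) u) (x k) - cinner ((U ^^ n) u) (x k - l)"
          by (simp add: cinner.diff_right)
        then have "norm (cinner ((U ^^ n) u) l) \<le> norm (cinner ((U ^^ n) u) (x k)) + norm (cinner ((U ^^ n) u) (x k - l))"
          by (metis norm_triangle_ineq4)
        moreover have "norm (cinner ((U ^^ n) u) (x k - l)) \<le> norm u * e"
          using norm_cinner_le[of "(U ^^ n) u" "x k - l"] k norm_funpow_U[OF u(1), of n]
          by (smt (verit) mult_left_mono norm_ge_zero)
        moreover have "norm u * e \<le> r / 2"
        proof -
          have "norm u + 1 \<noteq> 0" using norm_ge_zero[of u] by linarith
          then have "(norm u + 1) * e = r / 2" by (simp add: e_def field_simps)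
          then show ?thesis using e by (simp add: distrib_right)
        qed
        ultimately show ?thesis using n0[OF that] by simp
      qed
      then show "\<exists>no. \<forall>n\<ge>no. norm (cinner ((U ^^ n) u) l - 0) < r" by auto
    qed
    then show "l \<in> N" using lH by (simp add: N_def)
  qed
  moreover have "U ` N = N"
  proof (intro equalityI subsetI)
    fix w assume "w \<in> U ` N"
    then obtain w' where w': "w' \<in> H" "w = U w'" "(\<lambda>n. cinner ((U ^^ n) u) w') \<longlonglongrightarrow> 0"
      by (auto simp: N_def)
    have "(\<lambda>n. cinner ((U ^^ Suc n) u) w) = (\<lambda>n. cinner ((U ^^ n) u) w')"
      using u w' by (simp add: U_cinner funpow_U_in)
    then have "(\<lambda>n. cinner ((U ^^ n) u) w) \<longlonglongrightarrow> 0" using w'(3) by (simp add: LIMSEQ_imp_Suc)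
    then show "w \<in> N" using w' by (simp add: N_def U_in)
  next
    fix w assume w: "w \<in> N"
    then obtain w' where w': "w' \<in> H" "w = U w'" using U_image by (auto simp: N_def)
    have "(\<lambda>n. cinner ((U ^^ n) u) w') = (\<lambda>n. cinner ((U ^^ Suc n) u) w)"
      using u w' by (simp add: U_cinner funpow_U_in)
    also have "\<dots> \<longlonglongrightarrow> 0" using w LIMSEQ_Suc unfolding N_def by blast
    finally show "w \<in> U ` N" using w' by (auto simp: N_def)
  qed
  moreover have "poly_op p U v \<in> N"
    using p(2) poly_op_in[OF csubspace_H _ v] U_image by (simp add: N_def)
  moreover have False if "e \<in> H" "e \<noteq> 0" "U e = s *\<^sub>C e" "\<And>w. w \<in> N \<Longrightarrow> cinner e w = 0" for e s
  proof -
    have "e \<in> N" using that(1-3) u by (simp add: N_def cinner_funpow_U_eigenvector)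
    then have "cinner e e = 0" using that(4) by blast
    then show False using that(2) by (simp add: cinner_self)
  qed
  ultimately have "v \<in> N"
    by (intro reducing_subspace_absorbs[of N v p]) (use v p in \<open>auto simp: N_def\<close>)
  then show ?thesis by (simp add: N_def)
qed

text \<open>The subspace \<open>N\<close> is the closed span of the eigenvectors, written as a
  double orthogonal complement so that closedness and invariance come from the inner product alone.
  It contains \<open>poly_op p U g = 0\<close> and therefore absorbs \<open>g\<close>.\<close>

lemma annihilated_orthogonal_continuous_part:
  assumes w: "w \<in> H" "\<And>e s. \<lbrakk>e \<in> H; e \<noteq> 0; U e = s *\<^sub>C e\<rbrakk> \<Longrightarrow> cinner w e = 0"
    and g: "g \<in> H" "p \<noteq> 0" "poly_op p U g = 0"
  shows "cinner w g = 0"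
proof -
  define K where "K = {x \<in> H. \<forall>e s. e \<in> H \<longrightarrow> e \<noteq> 0 \<longrightarrow> U e = s *\<^sub>C e \<longrightarrow> cinner x e = 0}"
  define N where "N = {x \<in> H. \<forall>y\<in>K. cinner x y = 0}"
  have KU: "U x \<in> K \<longleftrightarrow> x \<in> K" if "x \<in> H" for x
  proof -
    have "cinner (U x) e = 0 \<longleftrightarrow> cinner x e = 0" if "e \<in> H" "e \<noteq> 0" "U e = s *\<^sub>C e" for e s
      using cinner_U_eigenvector[OF that \<open>x \<in> H\<close>] eigenvalue_norm[OF that] by auto
    then show ?thesis using that U_in unfolding K_def by blast
  qed
  have NH: "N \<subseteq> H" by (auto simp: N_def)
  have N1: "csubspace N"
    using csubspaceD[OF csubspace_H] by (auto simp: N_def csubspace_def cinner_add_left cinner_scaleC_left cinner.zero_left)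
  have N2: "closed N"
  proof -
    have "N = H \<inter> (\<Inter>y\<in>K. {x. cinner x y = 0})" by (auto simp: N_def)
    moreover have "closed {x. cinner x y = 0}" for y :: 'a
      by (intro closed_Collect_eq continuous_intros linear_continuous_on cinner.bounded_linear_left)
    ultimately show ?thesis using closed_H by (simp add: closed_Int closed_INT)
  qed
  have N3: "U ` N = N"
  proof (intro equalityI subsetI)
    fix x assume "x \<in> U ` N"
    then obtain x' where x': "x' \<in> N" "x = U x'" by blast
    have "cinner x y = 0" if y: "y \<in> K" for y
    proof -
      have "y \<in> U ` H" using y by (simp add: K_def U_image)
      then obtain y' where y': "y' \<in> H" "y = U y'" by blast
      then have "y' \<in> K" using KU y by blast
      then show ?thesis using x' y' by (simp add: N_def U_cinner)
    qed
    then show "x \<in> N" using x' by (auto simp: N_def U_in)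
  next
    fix x assume x: "x \<in> N"
    then obtain x' where x': "x' \<in> H" "x = U x'" using U_image by (auto simp: N_def)
    have "cinner x' y = 0" if y: "y \<in> K" for y
    proof -
      have "y \<in> H" "U y \<in> K" using y KU by (auto simp: K_def)
      then show ?thesis using x x' U_cinner[of x' y] by (auto simp: N_def)
    qed
    then show "x \<in> U ` N" using x' by (auto simp: N_def)
  qed
  have contra: False if e: "e \<in> H" "e \<noteq> 0" "U e = s *\<^sub>C e" and eN: "\<And>w. w \<in> N \<Longrightarrow> cinner e w = 0" for e s
  proof -
    have "cinner e y = 0" if "y \<in> K" for y
      using that e cinner_commute[of e y] by (auto simp: K_def)
    then have "e \<in> N" using e by (simp add: N_def)
    then have "cinner e e = 0" using eN by blast
    then show False using e by (simp add: cinner_self)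
  qed
  have "poly_op p U g \<in> N" using g N1 by (simp add: csubspace_0)
  then have "g \<in> N"
    by (rule reducing_subspace_absorbs[OF N1 N2 NH N3 g(1,2)]) (rule contra)
  moreover have "w \<in> K" using w by (auto simp: K_def)
  ultimately have "cinner g w = 0" by (simp add: N_def)
  then show ?thesis using cinner_commute[of w g] by simp
qed

end

lemma csubspace_closure:
  fixes S :: "'a::complex_inner_space set"
  assumes "csubspace S"
  shows "csubspace (closure S)"
  unfolding csubspace_def
proof (intro conjI ballI allI)
  show "0 \<in> closure S" using csubspace_0[OF assms] closure_subset by blast
next
  fix x y assume "x \<in> closure S" "y \<in> closure S"
  then obtain a b where "\<And>n. a n \<in> S" "a \<longlonglongrightarrow> x" "\<And>n. b n \<in> S" "b \<longlonglongrightarrow> y"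
    unfolding closure_sequential by metis
  then show "x + y \<in> closure S"
    unfolding closure_sequential using csubspace_add[OF assms]
    by (intro exI[of _ "\<lambda>n. a n + b n"]) (auto intro: tendsto_add)
next
  fix c x assume "x \<in> closure S"
  then obtain a where "\<And>n. a n \<in> S" "a \<longlonglongrightarrow> x" unfolding closure_sequential by metis
  then show "c *\<^sub>C x \<in> closure S"
    unfolding closure_sequential using csubspace_scaleC[OF assms]
    by (intro exI[of _ "\<lambda>n. c *\<^sub>C a n"]) (auto intro: scaleC.tendsto)
qed

section \<open>Measures on the circle with square summable moments\<close>

lemma space_circle_borel [simp]: "space circle_borel = sphere 0 1"
  by (simp add: circle_borel_def)

lemma sets_circle_borel_iff: "A \<in> sets circle_borel \<longleftrightarrow> A \<in> sets borel \<and> A \<subseteq> sphere 0 1"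
  unfolding circle_borel_def by (subst sets_restrict_space_iff) auto

lemma borel_measurable_circle_borel: "continuous_on (sphere 0 1) f \<Longrightarrow> f \<in> borel_measurable circle_borel"
  unfolding circle_borel_def by (rule borel_measurable_continuous_on_restrict)

lemma sets_circle_lebesgue [simp]: "sets circle_lebesgue = sets circle_borel"
  by (simp add: circle_lebesgue_def)

lemma space_circle_lebesgue [simp]: "space circle_lebesgue = sphere 0 1"
  by (simp add: circle_lebesgue_def)

lemma cis_measurable [measurable]: "cis \<in> measurable (restrict_space lborel {0..<2 * pi}) circle_borel"
proof -
  have "cis \<in> borel_measurable lborel"
    by (simp add: borel_measurable_continuous_onI continuous_on_cis)
  then show ?thesis
    unfolding circle_borel_def
    by (intro measurable_restrict_space2 measurable_restrict_space1) auto
qed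

lemma finite_measure_circle_lebesgue: "finite_measure circle_lebesgue"
  unfolding circle_lebesgue_def
  by (intro finite_measure.finite_measure_distr cis_measurable finite_measureI)
    (simp add: emeasure_restrict_space)

lemma integral_circle_lebesgue:
  fixes f :: "complex \<Rightarrow> 'b::euclidean_space"
  assumes "continuous_on (sphere 0 1) f"
  shows "integral\<^sup>L circle_lebesgue f = integral {0..2 * pi} (\<lambda>t. f (cis t))"
proof -
  have cont: "continuous_on {0..2 * pi} (\<lambda>t. f (cis t))"
    by (rule continuous_on_compose2[OF assms]) (auto intro: continuous_on_cis)
  have 1: "set_integrable lborel {0..2 * pi} (\<lambda>t. f (cis t))"
    by (rule borel_integrable_atLeastAtMost'[OF cont])
  have 2: "set_integrable lborel {0..<2 * pi} (\<lambda>t. f (cis t))"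
    by (rule set_integrable_subset[OF 1]) auto
  have "integral\<^sup>L circle_lebesgue f = (LINT t:{0..<2 * pi}|lborel. f (cis t))"
    unfolding circle_lebesgue_def
    by (simp add: integral_distr[OF cis_measurable borel_measurable_circle_borel[OF assms]]
        integral_restrict_space set_lebesgue_integral_def)
  also have "\<dots> = integral {0..<2 * pi} (\<lambda>t. f (cis t))"
    by (rule set_borel_integral_eq_integral(2)[OF 2])
  also have "\<dots> = integral {0..2 * pi} (\<lambda>t. f (cis t))"
    by (rule integral_spike_set) (rule negligible_subset[of "{2 * pi}"], auto)+
  finally show ?thesis .
qed

lemma circle_lebesgue_orthogonal:
  "(LINT z|circle_lebesgue. z ^ j * cnj (z ^ k)) = (if j = k then of_real (2 * pi) else 0)"
proof -
  define m where "m = real j - real k"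
  have "(LINT z|circle_lebesgue. z ^ j * cnj (z ^ k)) = integral {0..2 * pi} (\<lambda>t. cis (m * t))"
  proof -
    have "cis t ^ j * cnj (cis t ^ k) = cis (m * t)" for t
      unfolding Complex.DeMoivre cis_cnj cis_mult by (simp add: algebra_simps m_def)
    then show ?thesis
      by (subst integral_circle_lebesgue) (auto intro!: continuous_intros simp del: complex_cnj_power)
  qed
  also have "\<dots> = (if j = k then of_real (2 * pi) else 0)"
  proof (cases "j = k")
    case False
    then have m: "m \<noteq> 0" by (simp add: m_def)
    have "((\<lambda>t. cis (m * t)) has_integral
        (cis (m * (2 * pi)) / (\<i> * m) - cis (m * 0) / (\<i> * m))) {0..2 * pi}"
      using m by (intro fundamental_theorem_of_calculus)
        (auto intro!: derivative_eq_intros simp: has_vector_derivative_def scaleR_conv_of_real field_simps)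
    moreover have "cis (m * (2 * pi)) = 1"
      using cis_multiple_2pi[of m] by (simp add: mult_ac m_def)
    ultimately show ?thesis using False by (simp add: integral_unique)
  qed (simp add: m_def scaleR_conv_of_real)
  finally show ?thesis .
qed

lemma integrable_continuous_on_circle:
  fixes f :: "complex \<Rightarrow> 'b::{banach, second_countable_topology}"
  assumes "finite_measure M" "sets M = sets circle_borel" "continuous_on (sphere 0 1) f"
  shows "integrable M f"
proof -
  have sp: "space M = sphere 0 1" using sets_eq_imp_space_eq[OF assms(2)] by simp
  have "compact (f ` sphere 0 1)" by (intro compact_continuous_image assms compact_sphere)
  then obtain B where "\<And>z. z \<in> sphere 0 1 \<Longrightarrow> norm (f z) \<le> B"
    by (meson bounded_iff compact_imp_bounded image_eqI)
  moreover have "f \<in> borel_measurable M"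
    using borel_measurable_circle_borel[OF assms(3)] measurable_cong_sets[OF assms(2) refl] by blast
  ultimately show ?thesis
    by (intro finite_measure.integrable_const_bound[OF assms(1), of _ B] AE_I2) (auto simp: sp)
qed

lemma integral_poly_norm_square:
  "(LINT z|circle_lebesgue. (cmod (poly p z))\<^sup>2) = 2 * pi * (\<Sum>k\<le>degree p. (cmod (poly.coeff p k))\<^sup>2)"
proof -
  let ?c = "poly.coeff p"
  have int: "integrable circle_lebesgue f" if "continuous_on (sphere 0 1) f" for f :: "complex \<Rightarrow> complex"
    using finite_measure_circle_lebesgue that by (intro integrable_continuous_on_circle) auto
  have "complex_of_real (LINT z|circle_lebesgue. (cmod (poly p z))\<^sup>2) =
      (LINT z|circle_lebesgue. of_real ((cmod (poly p z))\<^sup>2))"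
    by (rule integral_complex_of_real[symmetric])
  also have "\<dots> = (LINT z|circle_lebesgue. (\<Sum>j\<le>degree p. \<Sum>k\<le>degree p. (?c j * cnj (?c k)) * (z ^ j * cnj (z ^ k))))"
  proof -
    have "complex_of_real ((cmod (poly p z))\<^sup>2) =
        (\<Sum>j\<le>degree p. \<Sum>k\<le>degree p. (?c j * cnj (?c k)) * (z ^ j * cnj (z ^ k)))" for z
    proof -
      have "complex_of_real ((cmod (poly p z))\<^sup>2) = poly p z * cnj (poly p z)"
        by (rule complex_norm_square)
      also have "\<dots> = (\<Sum>j\<le>degree p. \<Sum>k\<le>degree p. (?c j * cnj (?c k)) * (z ^ j * cnj (z ^ k)))"
        unfolding poly_altdef cnj_sum sum_product by (intro sum.cong refl) (simp add: mult_ac)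
      finally show ?thesis .
    qed
    then show ?thesis by presburger
  qed
  also have "\<dots> = (\<Sum>j\<le>degree p. \<Sum>k\<le>degree p. (?c j * cnj (?c k)) * (LINT z|circle_lebesgue. z ^ j * cnj (z ^ k)))"
  proof -
    have "integrable circle_lebesgue (\<lambda>z. (?c j * cnj (?c k)) * (z ^ j * cnj (z ^ k)))" for j k
      by (intro int continuous_intros)
    then show ?thesis by (simp add: Bochner_Integration.integral_sum integrable_sum)
  qed
  also have "\<dots> = (\<Sum>j\<le>degree p. of_real (2 * pi) * (?c j * cnj (?c j)))"
    unfolding circle_lebesgue_orthogonal
    by (intro sum.cong refl) (simp add: if_distrib[of "\<lambda>x. _ * x"] mult.commute cong: if_cong)
  also have "\<dots> = of_real (2 * pi * (\<Sum>k\<le>degree p. (cmod (?c k))\<^sup>2))"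
    by (simp add: sum_distrib_left flip: complex_norm_square)
  finally show ?thesis by (simp only: of_real_eq_iff)
qed

text \<open>A real trigonometric polynomial on the circle: the factor \<open>z ^ N\<close> clears
  the negative frequencies, and the coefficients become those of an ordinary
  \<open>poly\<close>.\<close>

definition trig_poly :: "(complex \<Rightarrow> real) \<Rightarrow> bool" where
  "trig_poly g \<longleftrightarrow> (\<exists>N p. \<forall>z\<in>sphere 0 1. z ^ N * of_real (g z) = poly p z)"

lemma trig_poly_real_polynomial_function:
  fixes g :: "complex \<Rightarrow> real"
  assumes "real_polynomial_function g"
  shows "trig_poly g"
  using assms
proof (induction rule: real_polynomial_function.induct)
  case (linear f)
  interpret bounded_linear f by fact
  \<comment> \<open>On the circle \<open>z * Re z = (z^2 + 1) / 2\<close> and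
    \<open>z * Im z = - \<i> * (z^2 - 1) / 2\<close>; the coefficients are the corresponding
    combinations of \<open>f 1\<close> and \<open>f \<i>\<close>.\<close>
  have "z ^ 1 * of_real (f z) = poly [:(f 1 + \<i> * f \<i>) / 2, 0, (f 1 - \<i> * f \<i>) / 2:] z"
    if "z \<in> sphere 0 1" for z
  proof -
    have "z = Re z *\<^sub>R 1 + Im z *\<^sub>R \<i>" by (simp add: complex_eq_iff)
    then have fz: "f z = Re z * f 1 + Im z * f \<i>" by (metis add scaleR real_scaleR_def)
    have zz: "z * cnj z = 1" using that by (simp add: complex_norm_square[symmetric])
    have re: "complex_of_real (Re z) = (z + cnj z) / 2" and im: "complex_of_real (Im z) = - \<i> * (z - cnj z) / 2"
      by (simp_all add: complex_eq_iff)
    have "z * of_real (f z) = ((z * z + z * cnj z) * f 1 - \<i> * (z * z - z * cnj z) * f \<i>) / 2"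
      unfolding fz of_real_add of_real_mult re im by (simp add: field_simps)
    also have "(z * z + z * cnj z) * f 1 - \<i> * (z * z - z * cnj z) * f \<i> =
        (f 1 + \<i> * f \<i>) + z * z * (f 1 - \<i> * f \<i>)"
      unfolding zz by (simp add: algebra_simps)
    also have "\<dots> / 2 = poly [:(f 1 + \<i> * f \<i>) / 2, 0, (f 1 - \<i> * f \<i>) / 2:] z"
      by (simp add: add_divide_distrib)
    finally show ?thesis by simp
  qed
  then show ?case unfolding trig_poly_def by blast
next
  case (const c)
  show ?case unfolding trig_poly_def by (intro exI[of _ 0] exI[of _ "[:of_real c:]"]) simp
next
  case (add f g)
  then obtain N p M q where *: "\<forall>z\<in>sphere 0 1. z ^ N * of_real (f z) = poly p z"
    "\<forall>z\<in>sphere 0 1. z ^ M * of_real (g z) = poly q z" unfolding trig_poly_def by blast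
  have "z ^ (N + M) * of_real (f z + g z) = poly (monom 1 M * p + monom 1 N * q) z"
    if "z \<in> sphere 0 1" for z
    using bspec[OF *(1) that, symmetric] bspec[OF *(2) that, symmetric]
    by (simp add: power_add algebra_simps poly_monom)
  then show ?case unfolding trig_poly_def by blast
next
  case (mult f g)
  then obtain N p M q where *: "\<forall>z\<in>sphere 0 1. z ^ N * of_real (f z) = poly p z"
    "\<forall>z\<in>sphere 0 1. z ^ M * of_real (g z) = poly q z" unfolding trig_poly_def by blast
  have "z ^ (N + M) * of_real (f z * g z) = poly (p * q) z"
    if "z \<in> sphere 0 1" for z
    using bspec[OF *(1) that, symmetric] bspec[OF *(2) that, symmetric]
    by (simp add: power_add algebra_simps)
  then show ?case unfolding trig_poly_def by blast
qed

lemma continuous_on_real_polynomial_function_circle: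
  "real_polynomial_function g \<Longrightarrow> continuous_on S (g :: complex \<Rightarrow> real)"
  by (induction rule: real_polynomial_function.induct)
    (auto intro: continuous_intros linear_continuous_on)

text \<open>Bessel's inequality on the side of the measure, Parseval's identity on the side of the
  trigonometric polynomial.\<close>

lemma trig_poly_integral_bound:
  fixes \<nu> :: "complex measure"
  assumes fin: "finite_measure \<nu>" and sets: "sets \<nu> = sets circle_borel"
    and summ: "summable (\<lambda>n. (cmod (LINT z|\<nu>. z ^ n))\<^sup>2)"
    and g: "trig_poly g" "continuous_on (sphere 0 1) g"
  shows "(LINT z|\<nu>. g z)\<^sup>2 \<le> suminf (\<lambda>n. (cmod (LINT z|\<nu>. z ^ n))\<^sup>2) * (LINT z|circle_lebesgue. (g z)\<^sup>2)"
proof -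
  define c where "c n = (LINT z|\<nu>. z ^ n)" for n :: nat
  define B where "B = suminf (\<lambda>n. (cmod (c n))\<^sup>2)"
  have sp: "space \<nu> = sphere 0 1" using sets_eq_imp_space_eq[OF sets] by simp
  obtain N p where p: "\<And>z. z \<in> sphere 0 1 \<Longrightarrow> z ^ N * of_real (g z) = poly p z"
    using g(1) unfolding trig_poly_def by blast
  define e where "e k = (LINT z|\<nu>. z ^ k * cnj z ^ N)" for k :: nat
  have int: "integrable \<nu> f" if "continuous_on (sphere 0 1) f" for f :: "complex \<Rightarrow> complex"
    using fin sets that by (rule integrable_continuous_on_circle)
  have zz: "z * cnj z = 1" if "z \<in> sphere 0 1" for z
    using that by (simp add: complex_norm_square[symmetric])
  have gz: "of_real (g z) = (\<Sum>k\<le>degree p. poly.coeff p k * (z ^ k * cnj z ^ N))" if "z \<in> sphere 0 1" for z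
  proof -
    have "of_real (g z) = (z * cnj z) ^ N * of_real (g z)" by (simp add: zz[OF that])
    also have "\<dots> = cnj z ^ N * poly p z"
      unfolding p[OF that, symmetric] by (simp add: power_mult_distrib mult_ac)
    finally show ?thesis by (simp add: poly_altdef sum_distrib_left mult_ac)
  qed
  have "complex_of_real (LINT z|\<nu>. g z) = (LINT z|\<nu>. (\<Sum>k\<le>degree p. poly.coeff p k * (z ^ k * cnj z ^ N)))"
    unfolding integral_complex_of_real[symmetric]
    by (rule Bochner_Integration.integral_cong) (auto simp: sp gz)
  also have "\<dots> = (\<Sum>k\<le>degree p. poly.coeff p k * e k)"
  proof -
    have "integrable \<nu> (\<lambda>z. poly.coeff p k * (z ^ k * cnj z ^ N))" for k
      by (intro int continuous_intros)
    then show ?thesis by (simp add: Bochner_Integration.integral_sum e_def)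
  qed
  finally have rep: "complex_of_real (LINT z|\<nu>. g z) = (\<Sum>k\<le>degree p. poly.coeff p k * e k)" .
  have e_low: "e k = cnj (c (N - k))" if "k < N" for k
  proof -
    have "z ^ k * cnj z ^ N = cnj (z ^ (N - k))" if "z \<in> sphere 0 1" for z
    proof -
      have "z ^ k * cnj z ^ N = (z * cnj z) ^ k * cnj z ^ (N - k)"
        using \<open>k < N\<close> by (simp add: power_mult_distrib mult.assoc flip: power_add)
      then show ?thesis by (simp add: zz[OF that])
    qed
    then have "e k = (LINT z|\<nu>. cnj (z ^ (N - k)))"
      unfolding e_def by (intro Bochner_Integration.integral_cong) (auto simp: sp)
    then show ?thesis by (simp add: c_def del: complex_cnj_power)
  qed
  have e_high: "e k = c (k - N)" if "N \<le> k" for k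
  proof -
    have "z ^ k * cnj z ^ N = z ^ (k - N)" if "z \<in> sphere 0 1" for z
    proof -
      have "z ^ k * cnj z ^ N = (z * cnj z) ^ N * z ^ (k - N)"
        using \<open>N \<le> k\<close> by (simp add: power_mult_distrib mult.commute mult.left_commute flip: power_add)
      then show ?thesis by (simp add: zz[OF that])
    qed
    then show ?thesis
      unfolding e_def c_def by (intro Bochner_Integration.integral_cong) (auto simp: sp)
  qed
  \<comment> \<open>Nonnegative frequencies give moments and negative ones conjugates of moments, so
    no moment is used more than twice. This is the origin of the bound \<open>2 * B\<close>.\<close>
  have part: "(\<Sum>k\<in>K. (cmod (c (h k)))\<^sup>2) \<le> B" if "finite K" "inj_on h K" for K and h :: "nat \<Rightarrow> nat"
  proof -
    have "(\<Sum>k\<in>K. (cmod (c (h k)))\<^sup>2) = (\<Sum>n\<in>h ` K. (cmod (c n))\<^sup>2)"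
      using that by (simp add: sum.reindex)
    also have "\<dots> \<le> B" unfolding B_def
      using summ that by (intro sum_le_suminf) (auto simp: c_def)
    finally show ?thesis .
  qed
  let ?D = "{..degree p}"
  have "(\<Sum>k\<in>?D. (cmod (e k))\<^sup>2) = (\<Sum>k\<in>?D \<inter> {..<N}. (cmod (e k))\<^sup>2) + (\<Sum>k\<in>?D - {..<N}. (cmod (e k))\<^sup>2)"
    by (rule sum.Int_Diff) simp
  also have "\<dots> = (\<Sum>k\<in>?D \<inter> {..<N}. (cmod (c (N - k)))\<^sup>2) + (\<Sum>k\<in>?D - {..<N}. (cmod (c (k - N)))\<^sup>2)"
    by (intro arg_cong2[of _ _ _ _ "(+)"] sum.cong) (auto simp: e_low e_high)
  also have "\<dots> \<le> B + B" by (intro add_mono part) (auto simp: inj_on_def)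
  finally have e_bound: "(\<Sum>k\<le>degree p. (cmod (e k))\<^sup>2) \<le> 2 * B" by simp
  have g_sq: "(LINT z|circle_lebesgue. (g z)\<^sup>2) = 2 * pi * (\<Sum>k\<le>degree p. (cmod (poly.coeff p k))\<^sup>2)"
  proof -
    have "(g z)\<^sup>2 = (cmod (poly p z))\<^sup>2" if "z \<in> sphere 0 1" for z
    proof -
      have "\<bar>g z\<bar> = cmod (poly p z)"
        using arg_cong[OF p[OF that], of cmod] that by (simp add: norm_mult norm_power)
      then show ?thesis by (metis power2_abs)
    qed
    then have "(LINT z|circle_lebesgue. (g z)\<^sup>2) = (LINT z|circle_lebesgue. (cmod (poly p z))\<^sup>2)"
      by (intro Bochner_Integration.integral_cong) auto
    then show ?thesis by (simp add: integral_poly_norm_square)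
  qed
  have "\<bar>LINT z|\<nu>. g z\<bar> = cmod (\<Sum>k\<le>degree p. poly.coeff p k * e k)"
    unfolding rep[symmetric] by simp
  also have "\<dots> \<le> (\<Sum>k\<le>degree p. cmod (poly.coeff p k) * cmod (e k))"
    by (rule order_trans[OF norm_sum]) (simp add: norm_mult)
  finally have "\<bar>LINT z|\<nu>. g z\<bar>\<^sup>2 \<le> (\<Sum>k\<le>degree p. cmod (poly.coeff p k) * cmod (e k))\<^sup>2"
    by (rule power_mono) simp
  also have "\<dots> \<le> (\<Sum>k\<le>degree p. (cmod (poly.coeff p k))\<^sup>2) * (\<Sum>k\<le>degree p. (cmod (e k))\<^sup>2)"
    by (rule Cauchy_Schwarz_ineq_sum)
  also have "\<dots> \<le> (\<Sum>k\<le>degree p. (cmod (poly.coeff p k))\<^sup>2) * (2 * B)"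
    by (intro mult_left_mono e_bound sum_nonneg) auto
  also have "\<dots> \<le> B * (LINT z|circle_lebesgue. (g z)\<^sup>2)"
  proof -
    have "0 \<le> B" unfolding B_def using summ by (intro suminf_nonneg) (auto simp: c_def)
    moreover have "0 \<le> (\<Sum>k\<le>degree p. (cmod (poly.coeff p k))\<^sup>2)" by (intro sum_nonneg) auto
    ultimately have "2 * (B * (\<Sum>k\<le>degree p. (cmod (poly.coeff p k))\<^sup>2)) \<le> 2 * pi * (B * (\<Sum>k\<le>degree p. (cmod (poly.coeff p k))\<^sup>2))"
      using pi_gt3 by (intro mult_right_mono mult_nonneg_nonneg) auto
    then show ?thesis unfolding g_sq by (simp add: mult_ac)
  qed
  finally show ?thesis by (simp add: B_def c_def)
qed

text \<open>Integration against \<open>\<nu>\<close> is bounded in the \<open>L^2\<close> norm of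
  Lebesgue measure on trigonometric polynomials. It is tested on an approximation of a function that
  is 1 on a compact subset of \<open>\<Lambda>\<close> and 0 outside a thin open
  neighbourhood.\<close>

theorem square_summable_moments_null:
  fixes \<nu> :: "complex measure"
  assumes fin: "finite_measure \<nu>" and sets: "sets \<nu> = sets circle_borel"
    and summ: "summable (\<lambda>n. (cmod (LINT z|\<nu>. z ^ n))\<^sup>2)"
    and \<Lambda>: "\<Lambda> \<in> null_sets circle_lebesgue"
  shows "measure \<nu> \<Lambda> = 0"
proof -
  interpret \<nu>: finite_measure \<nu> by fact
  interpret leb: finite_measure circle_lebesgue by (rule finite_measure_circle_lebesgue)
  define B where "B = suminf (\<lambda>n. (cmod (LINT z|\<nu>. z ^ n))\<^sup>2)"
  define V where "V = measure \<nu> (sphere 0 1)"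
  have sp: "space \<nu> = sphere 0 1" using sets_eq_imp_space_eq[OF sets] by simp
  have B0: "0 \<le> B" unfolding B_def using summ by (intro suminf_nonneg) auto
  have id\<nu>: "(\<lambda>z. z) \<in> measurable \<nu> borel"
    using borel_measurable_circle_borel[of "\<lambda>z. z"] measurable_cong_sets[OF sets refl] by auto
  have idleb: "(\<lambda>z. z) \<in> measurable circle_lebesgue borel"
    using borel_measurable_circle_borel[of "\<lambda>z. z"] measurable_cong_sets[OF sets_circle_lebesgue refl] by auto
  \<comment> \<open>Inner and outer regularity are applied to the images of both measures on the
    whole plane, where compact and open sets are at hand.\<close>
  define \<nu>' where "\<nu>' = distr \<nu> borel (\<lambda>z. z)"
  define leb' where "leb' = distr circle_lebesgue borel (\<lambda>z. z)"
  interpret \<nu>': finite_measure \<nu>' unfolding \<nu>'_def by (rule \<nu>.finite_measure_distr[OF id\<nu>])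
  interpret leb': finite_measure leb' unfolding leb'_def by (rule leb.finite_measure_distr[OF idleb])
  have em\<nu>': "emeasure \<nu>' A = emeasure \<nu> (A \<inter> sphere 0 1)" if "A \<in> sets borel" for A
    using that id\<nu> by (simp add: \<nu>'_def emeasure_distr sp)
  have emleb': "emeasure leb' A = emeasure circle_lebesgue (A \<inter> sphere 0 1)" if "A \<in> sets borel" for A
    using that idleb by (simp add: leb'_def emeasure_distr)
  have \<Lambda>b: "\<Lambda> \<in> sets borel" "\<Lambda> \<subseteq> sphere 0 1"
    using \<Lambda> by (auto simp: null_sets_def sets_circle_borel_iff)
  have borel_in: "A \<inter> sphere 0 1 \<in> sets \<nu>" if "A \<in> sets borel" for A
    using that by (auto simp: sets sets_circle_borel_iff intro!: sets.Int)
  \<comment> \<open>The term \<open>e\<close> is lost by inner regularity and \<open>e * V\<close>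
    by uniform approximation. Under the root stands the \<open>L^2\<close> bound:
    \<open>g^2 \<le> 2 f^2 + 2 (g - f)^2\<close> contributes \<open>2 * e\<close> from the
    neighbourhood and \<open>2 * e^2\<close> times the total length \<open>2 * pi\<close>.\<close>
  have main: "measure \<nu> \<Lambda> \<le> e + e * V + sqrt (B * (2 * e + 4 * pi * e\<^sup>2))" if e: "0 < e" for e :: real
  proof -
    have "emeasure \<nu>' \<Lambda> = (SUP K \<in> {K. K \<subseteq> \<Lambda> \<and> compact K}. emeasure \<nu>' K)"
      by (rule inner_regular) (use \<Lambda>b \<nu>'.emeasure_finite in \<open>auto simp: \<nu>'_def\<close>)
    moreover have "\<exists>K. K \<subseteq> \<Lambda> \<and> compact K \<and> measure \<nu> \<Lambda> - e < measure \<nu> K"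
    proof (cases "measure \<nu> \<Lambda> - e < 0")
      case True
      then show ?thesis by (intro exI[of _ "{}"]) auto
    next
      case False
      have "ennreal (measure \<nu> \<Lambda> - e) < ennreal (measure \<nu> \<Lambda>)"
        using e False by (intro ennreal_lessI) auto
      also have "\<dots> = emeasure \<nu>' \<Lambda>"
        using \<Lambda>b by (simp add: em\<nu>' \<nu>.emeasure_eq_measure Int_absorb2)
      also have "\<dots> = (SUP K \<in> {K. K \<subseteq> \<Lambda> \<and> compact K}. emeasure \<nu>' K)" by fact
      finally obtain K where K: "K \<subseteq> \<Lambda>" "compact K" "ennreal (measure \<nu> \<Lambda> - e) < emeasure \<nu>' K"
        unfolding less_SUP_iff by auto
      have "K \<subseteq> sphere 0 1" using K \<Lambda>b by auto
      then have "emeasure \<nu>' K = ennreal (measure \<nu> K)"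
        using K by (simp add: em\<nu>' borel_compact \<nu>.emeasure_eq_measure Int_absorb2)
      then have "measure \<nu> \<Lambda> - e < measure \<nu> K"
        using K(3) False by (simp add: ennreal_less_iff)
      then show ?thesis using K by blast
    qed
    ultimately obtain K where K: "K \<subseteq> \<Lambda>" "compact K" "measure \<nu> \<Lambda> - e < measure \<nu> K" by blast
    have Ks: "K \<subseteq> sphere 0 1" "K \<in> sets borel" "closed K"
      using K \<Lambda>b by (auto intro: borel_compact compact_imp_closed)
    have K_sets: "K \<in> sets circle_borel" using Ks by (simp add: sets_circle_borel_iff)
    have "emeasure circle_lebesgue K = 0"
      by (rule emeasure_eq_0[of \<Lambda>]) (use \<Lambda> K(1) in auto)
    then have "emeasure leb' K = 0" using Ks by (simp add: emleb' Int_absorb2)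
    moreover have "emeasure leb' K = (INF U \<in> {U. K \<subseteq> U \<and> open U}. emeasure leb' U)"
      by (rule outer_regular) (use Ks leb'.emeasure_finite in \<open>auto simp: leb'_def\<close>)
    ultimately have "(INF U \<in> {U. K \<subseteq> U \<and> open U}. emeasure leb' U) < ennreal e" using e by simp
    then obtain Q where Q: "K \<subseteq> Q" "open Q" "emeasure leb' Q < ennreal e"
      unfolding INF_less_iff by auto
    have Q_sets: "Q \<inter> sphere 0 1 \<in> sets circle_lebesgue" using borel_in[of Q] Q sets by simp
    have Q_small: "measure circle_lebesgue (Q \<inter> sphere 0 1) \<le> e"
      using Q(2,3) emleb'[of Q] e by (simp add: leb.emeasure_eq_measure ennreal_less_iff)
    obtain f :: "complex \<Rightarrow> real" where f: "continuous_on UNIV f"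
      "\<And>x. f x \<in> closed_segment 1 0" "\<And>x. x \<in> K \<Longrightarrow> f x = 1" "\<And>x. x \<in> - Q \<Longrightarrow> f x = 0"
      using Urysohn[of K "- Q" "1::real" 0] Ks(3) Q(1,2) by (metis Compl_disjoint2 closed_Compl disjoint_eq_subset_Compl double_compl)
    have f01: "0 \<le> f x" "f x \<le> 1" for x using f(2)[of x] by (auto simp: closed_segment_eq_real_ivl)
    have fc: "continuous_on (sphere 0 1) f" using f(1) continuous_on_subset by blast
    obtain g where g: "real_polynomial_function g" "\<And>x. x \<in> sphere 0 1 \<Longrightarrow> \<bar>f x - g x\<bar> < e"
      using Stone_Weierstrass_real_polynomial_function[OF compact_sphere fc e] by blast
    have gc: "continuous_on (sphere 0 1) g" by (rule continuous_on_real_polynomial_function_circle[OF g(1)])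
    have int\<nu>: "integrable \<nu> h" if "continuous_on (sphere 0 1) h" for h :: "complex \<Rightarrow> real"
      using fin sets that by (rule integrable_continuous_on_circle)
    have intleb: "integrable circle_lebesgue h" if "continuous_on (sphere 0 1) h" for h :: "complex \<Rightarrow> real"
      using finite_measure_circle_lebesgue sets_circle_lebesgue that by (rule integrable_continuous_on_circle)
    have "measure \<nu> K = (LINT z|\<nu>. indicator K z)"
      using Ks sp by (simp add: Int_absorb2)
    also have "\<dots> \<le> (LINT z|\<nu>. g z + e)"
    proof (rule integral_mono)
      show "integrable \<nu> (indicator K :: complex \<Rightarrow> real)"
        using K_sets by (simp add: sets \<nu>.emeasure_eq_measure)
      show "integrable \<nu> (\<lambda>z. g z + e)" by (intro int\<nu> continuous_intros gc)
      fix z assume "z \<in> space \<nu>"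
      then have "f z \<le> g z + e" using g(2)[of z] sp by auto
      moreover have "indicator K z \<le> f z" using f01 f(3) by (auto simp: indicator_def)
      ultimately show "indicator K z \<le> g z + e" by simp
    qed
    also have "\<dots> = (LINT z|\<nu>. g z) + e * V"
      using int\<nu>[OF gc] by (simp add: V_def sp)
    also have "(LINT z|\<nu>. g z) \<le> sqrt (B * (2 * e + 4 * pi * e\<^sup>2))"
    proof (rule real_le_rsqrt)
      have "(LINT z|\<nu>. g z)\<^sup>2 \<le> B * (LINT z|circle_lebesgue. (g z)\<^sup>2)"
        unfolding B_def by (rule trig_poly_integral_bound[OF fin sets summ trig_poly_real_polynomial_function[OF g(1)] gc])
      also have "(LINT z|circle_lebesgue. (g z)\<^sup>2) \<le> (LINT z|circle_lebesgue. 2 * indicator (Q \<inter> sphere 0 1) z + 2 * e\<^sup>2)"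
      proof (rule integral_mono)
        show "integrable circle_lebesgue (\<lambda>z. (g z)\<^sup>2)" by (intro intleb continuous_intros gc)
        show "integrable circle_lebesgue (\<lambda>z. 2 * indicator (Q \<inter> sphere 0 1) z + 2 * e\<^sup>2 :: real)"
          using Q_sets by (simp add: leb.emeasure_eq_measure)
        fix z assume z: "z \<in> space circle_lebesgue"
        then have "\<bar>g z - f z\<bar> < e" using g(2)[of z] by (simp add: abs_minus_commute)
        then have "\<bar>g z - f z\<bar>\<^sup>2 \<le> e\<^sup>2" by (intro power_mono) auto
        then have "(g z - f z)\<^sup>2 \<le> e\<^sup>2" by simp
        moreover have "(g z)\<^sup>2 \<le> 2 * (f z)\<^sup>2 + 2 * (g z - f z)\<^sup>2"
          using zero_le_power2[of "2 * f z - g z"] by (simp add: power2_eq_square algebra_simps)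
        moreover have "(f z)\<^sup>2 \<le> indicator (Q \<inter> sphere 0 1) z"
          using z f01[of z] f(4)[of z] by (auto simp: indicator_def power_le_one)
        ultimately show "(g z)\<^sup>2 \<le> 2 * indicator (Q \<inter> sphere 0 1) z + 2 * e\<^sup>2" by linarith
      qed
      also have "\<dots> = 2 * measure circle_lebesgue (Q \<inter> sphere 0 1) + 2 * e\<^sup>2 * measure circle_lebesgue (sphere 0 1)"
        using Q_sets by (simp add: leb.emeasure_eq_measure)
      also have "\<dots> \<le> 2 * e + 4 * pi * e\<^sup>2"
      proof -
        have "complex_of_real (measure circle_lebesgue (sphere 0 1)) = complex_of_real (2 * pi)"
          using circle_lebesgue_orthogonal[of 0 0] by (simp add: scaleR_conv_of_real)
        then have "measure circle_lebesgue (sphere 0 1) = 2 * pi" by (simp only: of_real_eq_iff)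
        then show ?thesis using Q_small by simp
      qed
      finally show "(LINT z|\<nu>. g z)\<^sup>2 \<le> B * (2 * e + 4 * pi * e\<^sup>2)" using B0 by (simp add: mult_left_mono)
    qed
    finally show ?thesis using K(3) by simp
  qed
  have "(\<lambda>n. inverse (real (Suc n)) + inverse (real (Suc n)) * V +
      sqrt (B * (2 * inverse (real (Suc n)) + 4 * pi * (inverse (real (Suc n)))\<^sup>2)))
    \<longlonglongrightarrow> 0 + 0 * V + sqrt (B * (2 * 0 + 4 * pi * 0\<^sup>2))"
    by (intro tendsto_intros LIMSEQ_inverse_real_of_nat)
  then have "measure \<nu> \<Lambda> \<le> 0 + 0 * V + sqrt (B * (2 * 0 + 4 * pi * 0\<^sup>2))"
    by (rule LIMSEQ_le_const) (intro exI allI impI main, simp)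
  then show ?thesis using measure_nonneg[of \<nu> \<Lambda>] by simp
qed

section \<open>Spectral resolutions\<close>

text \<open>Polarization recovers the sesquilinear form from the quadratic form; the operator norm
  is at most twice the numerical radius.\<close>

lemma norm_le_of_quadratic_form_le:
  assumes T: "clinear T" and q: "\<And>x. cmod (cinner (T x) x) \<le> e * (norm x)\<^sup>2"
  shows "norm (T x) \<le> 2 * e * norm x"
proof -
  have polar: "4 * cinner (T x) y = cinner (T (x + y)) (x + y) - cinner (T (x - y)) (x - y)
      + \<i> * cinner (T (x + \<i> *\<^sub>C y)) (x + \<i> *\<^sub>C y) - \<i> * cinner (T (x - \<i> *\<^sub>C y)) (x - \<i> *\<^sub>C y)" for x y
    by (simp add: clinear_add[OF T] clinear_diff[OF T] clinear_scaleC[OF T] cinner.add_left cinner.add_right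
        cinner.diff_left cinner.diff_right cinner_scaleC_left cinner_scaleC_right algebra_simps)
  have para: "(norm (x + y))\<^sup>2 + (norm (x - y))\<^sup>2 = 2 * (norm x)\<^sup>2 + 2 * (norm y)\<^sup>2" for x y :: 'a
    by (simp add: power2_norm_eq_inner inner_simps inner_commute)
  have form: "cmod (cinner (T x) y) \<le> e * ((norm x)\<^sup>2 + (norm y)\<^sup>2)" for x y
  proof -
    have "4 * cmod (cinner (T x) y) = cmod (4 * cinner (T x) y)" by (simp add: norm_mult)
    also have "\<dots> \<le> cmod (cinner (T (x + y)) (x + y)) + cmod (cinner (T (x - y)) (x - y))
      + cmod (cinner (T (x + \<i> *\<^sub>C y)) (x + \<i> *\<^sub>C y)) + cmod (cinner (T (x - \<i> *\<^sub>C y)) (x - \<i> *\<^sub>C y))"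
      unfolding polar
      by (intro order_trans[OF norm_triangle_ineq4] order_trans[OF norm_triangle_ineq] add_mono)
        (auto simp: norm_mult)
    also have "\<dots> \<le> e * (norm (x + y))\<^sup>2 + e * (norm (x - y))\<^sup>2 + e * (norm (x + \<i> *\<^sub>C y))\<^sup>2 + e * (norm (x - \<i> *\<^sub>C y))\<^sup>2"
      by (intro add_mono q)
    also have "\<dots> = 4 * (e * ((norm x)\<^sup>2 + (norm y)\<^sup>2))"
    proof -
      have "e * a + e * b + e * c + e * d = e * ((a + b) + (c + d))" for a b c d
        by (simp add: algebra_simps)
      from this[of "(norm (x + y))\<^sup>2"] show ?thesis by (simp only: para) simp
    qed
    finally show ?thesis by simp
  qed
  show ?thesis
  proof (cases "x = 0 \<or> T x = 0")
    case True
    moreover have "0 \<le> e * norm x"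
    proof (cases "x = 0")
      case False
      have "0 \<le> e * (norm x)\<^sup>2" using q[of x] norm_ge_zero order_trans by blast
      then show ?thesis using False by (simp add: zero_le_mult_iff)
    qed simp
    ultimately show ?thesis using clinear_0[OF T] by auto
  next
    case False
    \<comment> \<open>Rescaling \<open>T x\<close> to the length of \<open>x\<close> balances the
      two squared norms in \<open>form\<close>.\<close>
    define y where "y = (norm x / norm (T x)) *\<^sub>R T x"
    have ny: "norm y = norm x" using False by (simp add: y_def)
    have "cinner (T x) y = of_real (norm x / norm (T x)) * of_real ((norm (T x))\<^sup>2)"
      unfolding y_def by (simp only: cinner.scaleR_right cinner_self scaleR_conv_of_real)
    also have "\<dots> = of_real (norm x * norm (T x))" using False by (simp add: power2_eq_square)
    finally have "norm x * norm (T x) = cmod (cinner (T x) y)" by (simp add: norm_mult)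
    also have "\<dots> \<le> norm x * (2 * e * norm x)"
      using form[of x y] ny by (simp add: power2_eq_square algebra_simps)
    finally show ?thesis using False by (simp add: mult_le_cancel_left)
  qed
qed

text \<open>The spectral identity speaks of the quadratic form of \<open>U\<close> only. The powers
  of \<open>U\<close>, and the fact that \<open>E\<close> commutes with \<open>U\<close>, have to be
  derived from it.\<close>

locale spectral_resolution =
  fixes U :: "'a::complex_inner_space \<Rightarrow> 'a" and E :: "complex set \<Rightarrow> 'a \<Rightarrow> 'a"
  assumes clinear_U: "clinear U" and norm_U_le: "norm (U x) \<le> norm x"
    and clinear_E: "A \<in> sets circle_borel \<Longrightarrow> clinear (E A)"
    and E_selfadjoint: "A \<in> sets circle_borel \<Longrightarrow> cinner (E A x) y = cinner x (E A y)"
    and E_Int: "\<lbrakk>A \<in> sets circle_borel; B \<in> sets circle_borel\<rbrakk> \<Longrightarrow> E (A \<inter> B) x = E A (E B x)"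
    and E_empty: "E {} x = 0"
    and E_UN: "\<lbrakk>range F \<subseteq> sets circle_borel; disjoint_family F\<rbrakk> \<Longrightarrow>
      (\<lambda>N. \<Sum>i<N. E (F i) x) \<longlonglongrightarrow> E (\<Union>i. F i) x"
    and spectral: "cinner (U x) x =
      (LINT z|measure_of (sphere 0 1) (sets circle_borel) (\<lambda>A. ennreal ((norm (E A x))\<^sup>2)). z)"
begin

abbreviation \<mu> :: "'a \<Rightarrow> complex measure" where
  "\<mu> x \<equiv> measure_of (sphere 0 1) (sets circle_borel) (\<lambda>A. ennreal ((norm (E A x))\<^sup>2))"

lemma E_idem: "A \<in> sets circle_borel \<Longrightarrow> E A (E A x) = E A x"
  using E_Int[of A A x] by simp

lemma norm_E_square:
  assumes "A \<in> sets circle_borel"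
  shows "of_real ((norm (E A x))\<^sup>2) = cinner (E A x) x"
proof -
  have "cinner (E A x) x = cinner (E A (E A x)) x" by (simp add: E_idem assms)
  also have "\<dots> = cinner (E A x) (E A x)" by (rule E_selfadjoint[OF assms])
  finally show ?thesis by (simp only: cinner_self)
qed

lemma norm_E_le:
  assumes "A \<in> sets circle_borel"
  shows "norm (E A x) \<le> norm x"
proof (cases "E A x = 0")
  case False
  have "(norm (E A x))\<^sup>2 = cmod (cinner (E A x) x)"
    unfolding norm_E_square[OF assms, symmetric] norm_of_real by simp
  also have "\<dots> \<le> norm (E A x) * norm x" by (rule norm_cinner_le)
  finally show ?thesis using False by (simp add: power2_eq_square mult_le_cancel_left)
qed simp

lemma E_orthogonal:
  assumes "A \<in> sets circle_borel" "B \<in> sets circle_borel" "A \<inter> B = {}"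
  shows "cinner (E A x) (E B x) = 0"
  using E_Int[OF assms(1,2), of x] assms by (simp add: E_selfadjoint E_empty cinner.zero_right)

lemma sigma_algebra_circle: "sigma_algebra (sphere 0 1) (sets circle_borel)"
  using sets.sigma_algebra_axioms[of circle_borel] by simp

lemma norm_E_square_sums:
  assumes A: "range A \<subseteq> sets circle_borel" "disjoint_family A"
  shows "(\<lambda>i. (norm (E (A i) x))\<^sup>2) sums (norm (E (\<Union>i. A i) x))\<^sup>2"
proof -
  have Ai: "A i \<in> sets circle_borel" for i using A by auto
  have "(norm (\<Sum>i<N. E (A i) x))\<^sup>2 = (\<Sum>i<N. (norm (E (A i) x))\<^sup>2)" for N
  proof (induction N)
    case (Suc N)
    have "inner (E (A i) x) (E (A N) x) = 0" if "i < N" for i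
      using E_orthogonal[OF Ai Ai, of i N x] A(2) that
      by (auto simp: disjoint_family_on_def simp flip: Re_cinner)
    then have "inner (\<Sum>i<N. E (A i) x) (E (A N) x) = 0" by (simp add: inner_sum_left)
    then show ?case using Suc by (simp add: power2_norm_eq_inner inner_simps inner_commute)
  qed simp
  moreover have "(\<lambda>N. (norm (\<Sum>i<N. E (A i) x))\<^sup>2) \<longlonglongrightarrow> (norm (E (\<Union>i. A i) x))\<^sup>2"
    by (intro tendsto_intros E_UN A)
  ultimately show ?thesis by (simp add: sums_def)
qed

lemma emeasure_\<mu>:
  assumes "A \<in> sets circle_borel"
  shows "emeasure (\<mu> x) A = ennreal ((norm (E A x))\<^sup>2)"
proof (rule emeasure_measure_of_sigma[OF sigma_algebra_circle _ _ assms])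
  show "positive (sets circle_borel) (\<lambda>A. ennreal ((norm (E A x))\<^sup>2))"
    by (simp add: positive_def E_empty)
  show "countably_additive (sets circle_borel) (\<lambda>A. ennreal ((norm (E A x))\<^sup>2))"
    unfolding countably_additive_def
    by (intro allI impI suminf_ennreal_eq norm_E_square_sums) auto
qed

lemma sets_\<mu> [simp]: "sets (\<mu> x) = sets circle_borel"
  by (rule sigma_algebra.sets_measure_of_eq[OF sigma_algebra_circle])

lemma space_\<mu> [simp]: "space (\<mu> x) = sphere 0 1"
  using sets_eq_imp_space_eq[OF sets_\<mu>] by simp

lemma measure_\<mu>: "A \<in> sets circle_borel \<Longrightarrow> measure (\<mu> x) A = (norm (E A x))\<^sup>2"
  by (simp add: measure_def emeasure_\<mu>)

lemma finite_measure_\<mu>: "finite_measure (\<mu> x)"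
  by (rule finite_measureI) (simp add: emeasure_\<mu> sets.top[of circle_borel, simplified])

text \<open>Both coordinates are rounded down to multiples of \<open>1 / M\<close>. The rounded
  point may leave the circle; what matters is that only finitely many values occur and that they are
  within \<open>2 / M\<close>.\<close>

definition grid :: "nat \<Rightarrow> complex \<Rightarrow> complex" where
  "grid M z = Complex (of_int \<lfloor>real M * Re z\<rfloor> / real M) (of_int \<lfloor>real M * Im z\<rfloor> / real M)"

definition cell :: "nat \<Rightarrow> complex \<Rightarrow> complex set" where
  "cell M v = {z \<in> sphere 0 1. grid M z = v}"

definition nodes :: "nat \<Rightarrow> complex set" where
  "nodes M = grid M ` sphere 0 1"

text \<open>The functional calculus of a step function: the integral of \<open>grid M z ^ k\<close>
  against \<open>E\<close>. It is a finite sum, hence available before any integral of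
  operators.\<close>

definition S :: "nat \<Rightarrow> nat \<Rightarrow> 'a \<Rightarrow> 'a" where
  "S M k x = (\<Sum>v\<in>nodes M. v ^ k *\<^sub>C E (cell M v) x)"

lemma grid_close:
  assumes "M > 0"
  shows "cmod (z - grid M z) \<le> 2 / real M"
proof -
  have fl: "\<bar>a - of_int \<lfloor>real M * a\<rfloor> / real M\<bar> \<le> 1 / real M" for a
  proof -
    have "a - of_int \<lfloor>real M * a\<rfloor> / real M = (real M * a - of_int \<lfloor>real M * a\<rfloor>) / real M"
      using assms by (simp add: field_simps)
    moreover have "\<bar>real M * a - of_int \<lfloor>real M * a\<rfloor>\<bar> \<le> 1" by linarith
    ultimately show ?thesis using assms by (simp add: divide_right_mono)
  qed
  have "cmod (z - grid M z) \<le> \<bar>Re (z - grid M z)\<bar> + \<bar>Im (z - grid M z)\<bar>" by (rule cmod_le)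
  then show ?thesis using fl[of "Re z"] fl[of "Im z"] by (simp add: grid_def)
qed

lemma finite_nodes: "finite (nodes M)"
proof -
  have "nodes M \<subseteq> (\<lambda>(a, b). Complex (of_int a / real M) (of_int b / real M)) ` ({- int M..int M} \<times> {- int M..int M})"
  proof
    fix v assume "v \<in> nodes M"
    then obtain z where z: "cmod z = 1" "v = grid M z" by (auto simp: nodes_def)
    have b: "\<lfloor>real M * a\<rfloor> \<in> {- int M..int M}" if "\<bar>a\<bar> \<le> 1" for a
    proof -
      have "\<bar>real M * a\<bar> \<le> real M" using that by (simp add: abs_mult mult_left_le)
      then show ?thesis by (auto simp: le_floor_iff floor_le_iff abs_le_iff)
    qed
    have "\<bar>Re z\<bar> \<le> 1" "\<bar>Im z\<bar> \<le> 1" using z abs_Re_le_cmod[of z] abs_Im_le_cmod[of z] by auto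
    then show "v \<in> (\<lambda>(a, b). Complex (of_int a / real M) (of_int b / real M)) ` ({- int M..int M} \<times> {- int M..int M})"
      using z b by (auto simp: grid_def intro!: image_eqI[of _ _ "(\<lfloor>real M * Re z\<rfloor>, \<lfloor>real M * Im z\<rfloor>)"])
  qed
  then show ?thesis by (rule finite_subset) auto
qed

lemma grid_measurable: "grid M \<in> borel_measurable circle_borel"
proof -
  have "(\<lambda>z. of_int \<lfloor>real M * Re z\<rfloor> / real M) \<in> borel_measurable borel"
    "(\<lambda>z. of_int \<lfloor>real M * Im z\<rfloor> / real M) \<in> borel_measurable borel"
    by measurable
  then have "grid M \<in> borel_measurable borel"
    unfolding grid_def borel_measurable_complex_iff by simp
  then show ?thesis unfolding circle_borel_def by (rule measurable_restrict_space1)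
qed

lemma cell_sets: "cell M v \<in> sets circle_borel"
proof -
  have "grid M -` {v} \<inter> space circle_borel \<in> sets circle_borel"
    by (rule measurable_sets[OF grid_measurable]) simp
  also have "grid M -` {v} \<inter> space circle_borel = cell M v" by (auto simp: cell_def)
  finally show ?thesis .
qed

lemma cell_disjoint: "v \<noteq> w \<Longrightarrow> cell M v \<inter> cell M w = {}"
  by (auto simp: cell_def)

lemma clinear_S: "clinear (S M k)"
  using clinear_E[OF cell_sets]
  by (auto simp: clinear_def S_def scaleC_add_right sum.distrib scaleC.sum_right scaleC_scaleC mult.commute intro!: sum.cong)

text \<open>Distinct cells are disjoint, so products of their projections vanish and powers of the
  step function become compositions of operators.\<close>

lemma S_Suc: "S M (Suc k) x = S M 1 (S M k x)"
proof -
  have "E (cell M v) (S M k x) = v ^ k *\<^sub>C E (cell M v) x" if v: "v \<in> nodes M" for v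
  proof -
    have "E (cell M v) (S M k x) = (\<Sum>w\<in>nodes M. w ^ k *\<^sub>C E (cell M v) (E (cell M w) x))"
      unfolding S_def using clinear_E[OF cell_sets]
      by (simp add: clinear_sum clinear_scaleC)
    also have "\<dots> = (\<Sum>w\<in>nodes M. if w = v then v ^ k *\<^sub>C E (cell M v) x else 0)"
      by (intro sum.cong refl) (auto simp: E_Int[OF cell_sets cell_sets, symmetric] cell_disjoint E_empty)
    finally show ?thesis using v by (simp add: finite_nodes)
  qed
  then show ?thesis unfolding S_def[of M 1] S_def[of M "Suc k"]
    by (intro sum.cong refl) (simp add: scaleC_scaleC)
qed

lemma S_commute_E:
  assumes "A \<in> sets circle_borel"
  shows "E A (S M k x) = S M k (E A x)"
proof -
  have "E A (E (cell M v) x) = E (cell M v) (E A x)" for v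
    using E_Int[OF assms cell_sets, of M v x] E_Int[OF cell_sets assms, of M v x] by (simp add: Int_commute)
  then show ?thesis
    unfolding S_def using clinear_E[OF assms] by (simp add: clinear_sum clinear_scaleC)
qed

lemma integrable_grid_power: "integrable (\<mu> x) (\<lambda>z. grid M z ^ k)"
  and integral_grid_power: "(LINT z|\<mu> x. grid M z ^ k) = cinner (S M k x) x"
proof -
  have rep: "grid M z ^ k = (\<Sum>v\<in>nodes M. indicator (cell M v) z *\<^sub>R v ^ k)" if "z \<in> sphere 0 1" for z
  proof -
    have "(\<Sum>v\<in>nodes M. indicator (cell M v) z *\<^sub>R v ^ k) = (\<Sum>v\<in>nodes M. if v = grid M z then v ^ k else 0)"
      using that by (intro sum.cong) (auto simp: cell_def)
    also have "\<dots> = grid M z ^ k" using that finite_nodes by (simp add: nodes_def)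
    finally show ?thesis by simp
  qed
  interpret finite_measure "\<mu> x" by (rule finite_measure_\<mu>)
  have ind: "integrable (\<mu> x) (indicator (cell M v) :: complex \<Rightarrow> real)" for v
    using cell_sets by (simp add: emeasure_eq_measure)
  have int: "integrable (\<mu> x) (\<lambda>z. \<Sum>v\<in>nodes M. indicator (cell M v) z *\<^sub>R v ^ k)"
    using ind by (intro Bochner_Integration.integrable_sum integrable_scaleR_left)
  show "integrable (\<mu> x) (\<lambda>z. grid M z ^ k)"
  proof -
    have "integrable (\<mu> x) (\<lambda>z. grid M z ^ k) \<longleftrightarrow>
        integrable (\<mu> x) (\<lambda>z. \<Sum>v\<in>nodes M. indicator (cell M v) z *\<^sub>R v ^ k)"
      by (intro Bochner_Integration.integrable_cong) (auto simp: rep)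
    then show ?thesis using int by blast
  qed
  have "(LINT z|\<mu> x. grid M z ^ k) = (LINT z|\<mu> x. (\<Sum>v\<in>nodes M. indicator (cell M v) z *\<^sub>R v ^ k))"
    by (rule Bochner_Integration.integral_cong) (auto simp: rep)
  also have "\<dots> = (\<Sum>v\<in>nodes M. measure (\<mu> x) (cell M v) *\<^sub>R v ^ k)"
    using ind cell_sets[of M] sets.sets_into_space[OF cell_sets[of M]]
    by (subst Bochner_Integration.integral_sum) (auto simp: Int_absorb2 intro!: integrable_scaleR_left)
  also have "\<dots> = (\<Sum>v\<in>nodes M. v ^ k * cinner (E (cell M v) x) x)"
    using cell_sets by (intro sum.cong refl) (simp add: measure_\<mu> scaleR_conv_of_real norm_E_square[symmetric])
  also have "\<dots> = cinner (S M k x) x"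
    by (simp add: S_def cinner.sum_left cinner_scaleC_left)
  finally show "(LINT z|\<mu> x. grid M z ^ k) = cinner (S M k x) x" .
qed

lemma measure_\<mu>_space_le: "measure (\<mu> x) (sphere 0 1) \<le> (norm x)\<^sup>2"
  using norm_E_le[of "sphere 0 1" x] sets.top[of circle_borel] by (simp add: measure_\<mu> power_mono)

text \<open>The quadratic form of the difference is the integral of \<open>z - grid M z\<close>, at
  most \<open>2 / M\<close> times the total mass. The bound by the numerical radius doubles this
  constant.\<close>

lemma U_S_close:
  assumes M: "M > 0"
  shows "norm (U x - S M 1 x) \<le> 4 / real M * norm x"
proof -
  have "cmod (cinner (U x - S M 1 x) x) \<le> 2 / real M * (norm x)\<^sup>2" for x
  proof -
    interpret finite_measure "\<mu> x" by (rule finite_measure_\<mu>)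
    have int_id: "integrable (\<mu> x) (\<lambda>z. z)"
      by (rule integrable_continuous_on_circle[OF finite_measure_\<mu> sets_\<mu>]) (rule continuous_on_id)
    have int_grid: "integrable (\<mu> x) (grid M)" using integrable_grid_power[of x M 1] by simp
    have "cinner (U x - S M 1 x) x = (LINT z|\<mu> x. z) - (LINT z|\<mu> x. grid M z)"
      using integral_grid_power[of x M 1] by (simp add: cinner.diff_left spectral)
    also have "\<dots> = (LINT z|\<mu> x. z - grid M z)"
      using int_id int_grid by simp
    finally have "cmod (cinner (U x - S M 1 x) x) \<le> (LINT z|\<mu> x. cmod (z - grid M z))"
      by (simp add: integral_norm_bound)
    also have "\<dots> \<le> (LINT z|\<mu> x. 2 / real M)"
      using int_id int_grid grid_close[OF M] by (intro integral_mono) auto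
    also have "\<dots> = 2 / real M * measure (\<mu> x) (sphere 0 1)" by simp
    also have "\<dots> \<le> 2 / real M * (norm x)\<^sup>2"
      by (intro mult_left_mono measure_\<mu>_space_le) auto
    finally show ?thesis .
  qed
  moreover have "clinear (\<lambda>x. U x - S M 1 x)"
    using clinear_U clinear_S[of M 1] by (auto simp: clinear_def scaleC.diff_right)
  ultimately have "norm (U x - S M 1 x) \<le> 2 * (2 / real M) * norm x"
    by (intro norm_le_of_quadratic_form_le) auto
  then show ?thesis by simp
qed

text \<open>The projections commute with each other, hence with the step-function operators, which
  approximate \<open>U\<close> in norm.\<close>

lemma E_commutes_U:
  assumes A: "A \<in> sets circle_borel"
  shows "E A (U x) = U (E A x)"
proof -
  have bound: "norm (E A (U x) - U (E A x)) \<le> 8 * norm x * inverse (real (Suc n))" for n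
  proof -
    let ?S = "S (Suc n) 1"
    have "E A (U x) - U (E A x) = E A (U x - ?S x) - (U (E A x) - ?S (E A x))"
      using S_commute_E[OF A, of "Suc n" 1 x] by (simp add: clinear_diff[OF clinear_E[OF A]])
    then have "norm (E A (U x) - U (E A x)) \<le> norm (E A (U x - ?S x)) + norm (U (E A x) - ?S (E A x))"
      by (metis norm_triangle_ineq4)
    also have "\<dots> \<le> 4 / real (Suc n) * norm x + 4 / real (Suc n) * norm x"
    proof (rule add_mono)
      show "norm (E A (U x - ?S x)) \<le> 4 / real (Suc n) * norm x"
        using norm_E_le[OF A] U_S_close[of "Suc n" x] order_trans by blast
      have "norm (U (E A x) - ?S (E A x)) \<le> 4 / real (Suc n) * norm (E A x)"
        by (rule U_S_close) simp
      also have "\<dots> \<le> 4 / real (Suc n) * norm x"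
        by (intro mult_left_mono norm_E_le A) auto
      finally show "norm (U (E A x) - ?S (E A x)) \<le> 4 / real (Suc n) * norm x" .
    qed
    finally show ?thesis by (simp add: divide_inverse mult_ac)
  qed
  have "(\<lambda>n. 8 * norm x * inverse (real (Suc n))) \<longlonglongrightarrow> 8 * norm x * 0"
    by (intro tendsto_intros LIMSEQ_inverse_real_of_nat)
  then have "norm (E A (U x) - U (E A x)) \<le> 8 * norm x * 0"
    by (rule LIMSEQ_le_const) (use bound in auto)
  then show ?thesis by simp
qed

lemma S_tendsto_funpow_U: "(\<lambda>n. S (Suc n) (Suc k) x) \<longlonglongrightarrow> (U ^^ Suc k) x"
proof (induction k)
  case 0
  have "norm (U x - S (Suc n) 1 x) \<le> 4 * norm x * inverse (real (Suc n))" for n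
    using U_S_close[of "Suc n" x] by (simp add: divide_inverse mult_ac)
  then have "(\<lambda>n. U x - S (Suc n) 1 x) \<longlonglongrightarrow> 0"
    by (rule Lim_null_comparison[OF eventuallyI tendsto_mult_right_zero[OF LIMSEQ_inverse_real_of_nat]])
  then have "(\<lambda>n. U x - (U x - S (Suc n) 1 x)) \<longlonglongrightarrow> U x - 0" by (intro tendsto_diff tendsto_const)
  then show ?case by simp
next
  case (Suc k)
  let ?y = "\<lambda>n. S (Suc n) (Suc k) x"
  have "(\<lambda>n. 4 * inverse (real (Suc n)) * norm (?y n)) \<longlonglongrightarrow> 4 * 0 * norm ((U ^^ Suc k) x)"
    by (intro tendsto_intros LIMSEQ_inverse_real_of_nat Suc.IH)
  then have lim: "(\<lambda>n. 4 * inverse (real (Suc n)) * norm (?y n)) \<longlonglongrightarrow> 0" by simp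
  have "norm (U (?y n) - S (Suc n) 1 (?y n)) \<le> 4 * inverse (real (Suc n)) * norm (?y n)" for n
    using U_S_close[of "Suc n" "?y n"] by (simp only: divide_inverse)
  then have 1: "(\<lambda>n. U (?y n) - S (Suc n) 1 (?y n)) \<longlonglongrightarrow> 0"
    by (rule Lim_null_comparison[OF eventuallyI lim])
  have "(\<lambda>n. norm (?y n - (U ^^ Suc k) x)) \<longlonglongrightarrow> 0"
    using Suc.IH by (simp add: LIM_zero tendsto_norm_zero)
  then have 2: "(\<lambda>n. U (?y n - (U ^^ Suc k) x)) \<longlonglongrightarrow> 0"
    by (rule Lim_null_comparison[OF eventuallyI[OF norm_U_le]])
  have "(\<lambda>n. U (?y n - (U ^^ Suc k) x) - (U (?y n) - S (Suc n) 1 (?y n)) + (U ^^ Suc (Suc k)) x)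
      \<longlonglongrightarrow> 0 - 0 + (U ^^ Suc (Suc k)) x"
    by (intro tendsto_intros 1 2)
  moreover have "U (?y n - (U ^^ Suc k) x) - (U (?y n) - S (Suc n) 1 (?y n)) + (U ^^ Suc (Suc k)) x
      = S (Suc n) (Suc (Suc k)) x" for n
    using S_Suc[of "Suc n" "Suc k" x] by (simp add: clinear_diff[OF clinear_U])
  ultimately show ?case by simp
qed

text \<open>Step functions converge on both sides, by dominated convergence under the integral and
  in norm for the operators. Only positive powers are treated: in the intended instance
  \<open>E\<close> of the full circle is the restriction to \<open>Z\<close>, so the total mass need
  not be the squared norm.\<close>

lemma moments: "(LINT z|\<mu> x. z ^ Suc k) = cinner ((U ^^ Suc k) x) x"
proof -
  interpret finite_measure "\<mu> x" by (rule finite_measure_\<mu>)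
  have "(\<lambda>n. LINT z|\<mu> x. grid (Suc n) z ^ Suc k) \<longlonglongrightarrow> (LINT z|\<mu> x. z ^ Suc k)"
  \<comment> \<open>A grid point is at distance at most 2 from a point of the circle, hence of
    modulus at most 3.\<close>
  proof (rule integral_dominated_convergence[where w = "\<lambda>_. 3 ^ Suc k"])
    show "(\<lambda>z. z ^ Suc k) \<in> borel_measurable (\<mu> x)"
      by (rule borel_measurable_integrable, rule integrable_continuous_on_circle[OF finite_measure_\<mu> sets_\<mu>])
        (intro continuous_intros)
    show "(\<lambda>z. grid (Suc n) z ^ Suc k) \<in> borel_measurable (\<mu> x)" for n
      by (rule borel_measurable_integrable[OF integrable_grid_power])
    show "AE z in \<mu> x. (\<lambda>n. grid (Suc n) z ^ Suc k) \<longlonglongrightarrow> z ^ Suc k"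
    proof (rule AE_I2)
      fix z
      have "cmod (z - grid (Suc n) z) \<le> 2 * inverse (real (Suc n))" for n
        using grid_close[of "Suc n" z] by (simp add: divide_inverse)
      then have "(\<lambda>n. z - grid (Suc n) z) \<longlonglongrightarrow> 0"
        by (rule Lim_null_comparison[OF eventuallyI tendsto_mult_right_zero[OF LIMSEQ_inverse_real_of_nat]])
      then have "(\<lambda>n. z - (z - grid (Suc n) z)) \<longlonglongrightarrow> z - 0" by (intro tendsto_diff tendsto_const)
      then have "(\<lambda>n. grid (Suc n) z) \<longlonglongrightarrow> z" by simp
      then show "(\<lambda>n. grid (Suc n) z ^ Suc k) \<longlonglongrightarrow> z ^ Suc k" by (rule tendsto_power)
    qed
    show "AE z in \<mu> x. norm (grid (Suc n) z ^ Suc k) \<le> 3 ^ Suc k" for n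
    proof (rule AE_I2)
      fix z assume "z \<in> space (\<mu> x)"
      then have "cmod z = 1" by simp
      then have "cmod (grid (Suc n) z) \<le> 1 + 2 / real (Suc n)"
        using grid_close[of "Suc n" z] norm_triangle_sub[of "grid (Suc n) z" z] by (simp add: norm_minus_commute)
      also have "\<dots> \<le> 3" by (simp add: divide_le_eq)
      finally show "norm (grid (Suc n) z ^ Suc k) \<le> 3 ^ Suc k"
        unfolding norm_power by (intro power_mono) auto
    qed
  qed simp
  moreover have "(\<lambda>n. LINT z|\<mu> x. grid (Suc n) z ^ Suc k) \<longlonglongrightarrow> cinner ((U ^^ Suc k) x) x"
    unfolding integral_grid_power by (intro cinner.tendsto S_tendsto_funpow_U tendsto_const)
  ultimately show ?thesis by (rule LIMSEQ_unique)
qed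

text \<open>Summability ignores the first term, so the missing zeroth moment is harmless.\<close>

lemma E_null:
  assumes "\<Lambda> \<in> null_sets circle_lebesgue" "summable (\<lambda>n. (cmod (cinner ((U ^^ n) x) x))\<^sup>2)"
  shows "E \<Lambda> x = 0"
proof -
  have "summable (\<lambda>n. (cmod (cinner ((U ^^ Suc n) x) x))\<^sup>2)"
    using assms(2) by (subst summable_Suc_iff)
  then have "summable (\<lambda>n. (cmod (LINT z|\<mu> x. z ^ Suc n))\<^sup>2)" by (simp only: moments)
  then have "summable (\<lambda>n. (cmod (LINT z|\<mu> x. z ^ n))\<^sup>2)" by (subst (asm) summable_Suc_iff)
  then have "measure (\<mu> x) \<Lambda> = 0"
    by (rule square_summable_moments_null[OF finite_measure_\<mu> sets_\<mu> _ assms(1)])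
  moreover have "\<Lambda> \<in> sets circle_borel" using assms(1) by (auto simp: null_sets_def)
  ultimately show ?thesis by (simp add: measure_\<mu>)
qed

lemma E_funpow_commute: "A \<in> sets circle_borel \<Longrightarrow> E A ((U ^^ n) x) = (U ^^ n) (E A x)"
  by (induction n) (auto simp: E_commutes_U)

lemma E_poly_op: "A \<in> sets circle_borel \<Longrightarrow> E A (poly_op p U x) = poly_op p U (E A x)"
  by (simp add: poly_op_def clinear_sum[OF clinear_E] clinear_scaleC[OF clinear_E] E_funpow_commute)

end

section \<open>The Hilbert space of square summable functions as a type\<close>

lemma square_summable_comparison:
  fixes f g :: "'z \<Rightarrow> real"
  assumes "g summable_on A" "\<And>x. x \<in> A \<Longrightarrow> 0 \<le> f x" "\<And>x. x \<in> A \<Longrightarrow> f x \<le> g x"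
  shows "f summable_on A"
proof -
  have "0 \<le> g x" if "x \<in> A" for x using assms(2,3)[OF that] by simp
  then have "(\<lambda>x. norm (g x)) summable_on A" using assms(1) by (simp cong: summable_on_cong)
  then have "(\<lambda>x. norm (f x)) summable_on A" by (rule Infinite_Sum.abs_summable_on_comparison_test) (use assms in force)
  then show ?thesis by (rule Infinite_Sum.abs_summable_summable)
qed

definition square_summable :: "('z \<Rightarrow> 'w::complex_inner_space) \<Rightarrow> bool" where
  "square_summable f \<longleftrightarrow> (\<lambda>x. (norm (f x))\<^sup>2) summable_on UNIV"

lemma square_summable_add:
  assumes "square_summable f" "square_summable g"
  shows "square_summable (\<lambda>x. f x + g x)"
  unfolding square_summable_def
proof (rule square_summable_comparison)
  show "(\<lambda>x. 2 * (norm (f x))\<^sup>2 + 2 * (norm (g x))\<^sup>2) summable_on UNIV"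
    using assms unfolding square_summable_def by (intro summable_on_add summable_on_cmult_right)
  fix x
  have "(norm (f x + g x))\<^sup>2 \<le> (norm (f x) + norm (g x))\<^sup>2" by (intro power_mono norm_triangle_ineq) simp
  also have "\<dots> \<le> 2 * (norm (f x))\<^sup>2 + 2 * (norm (g x))\<^sup>2"
    using zero_le_power2[of "norm (f x) - norm (g x)"] by (simp add: power2_eq_square algebra_simps)
  finally show "(norm (f x + g x))\<^sup>2 \<le> 2 * (norm (f x))\<^sup>2 + 2 * (norm (g x))\<^sup>2" .
qed simp

lemma square_summable_scaleC: "square_summable f \<Longrightarrow> square_summable (\<lambda>x. c *\<^sub>C f x)"
  unfolding square_summable_def by (simp add: power_mult_distrib summable_on_cmult_right)

lemma square_summable_uminus: "square_summable f \<Longrightarrow> square_summable (\<lambda>x. - f x)"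
  unfolding square_summable_def by simp

lemma square_summable_diff:
  "square_summable f \<Longrightarrow> square_summable g \<Longrightarrow> square_summable (\<lambda>x. f x - g x)"
  using square_summable_add[of f "\<lambda>x. - g x"] square_summable_uminus[of g] by simp

lemma square_summable_scaleR: "square_summable f \<Longrightarrow> square_summable (\<lambda>x. r *\<^sub>R f x)"
  using square_summable_scaleC[of f "of_real r"] by (simp add: scaleC_of_real)

lemma square_summable_cinner:
  assumes "square_summable f" "square_summable g"
  shows "(\<lambda>x. cinner (f x) (g x)) summable_on UNIV"
proof -
  have "(\<lambda>x. (norm (f x))\<^sup>2 + (norm (g x))\<^sup>2) summable_on UNIV"
    using assms unfolding square_summable_def by (intro summable_on_add)
  then have "(\<lambda>x. norm (cinner (f x) (g x))) summable_on UNIV"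
  proof (rule square_summable_comparison)
    fix x
    have "norm (cinner (f x) (g x)) \<le> norm (f x) * norm (g x)" by (rule norm_cinner_le)
    also have "\<dots> \<le> (norm (f x))\<^sup>2 + (norm (g x))\<^sup>2"
    proof -
      have "2 * (norm (f x) * norm (g x)) \<le> (norm (f x))\<^sup>2 + (norm (g x))\<^sup>2"
        using zero_le_power2[of "norm (f x) - norm (g x)"] by (simp add: power2_eq_square algebra_simps)
      moreover have "0 \<le> norm (f x) * norm (g x)" by simp
      ultimately show ?thesis by linarith
    qed
    finally show "norm (cinner (f x) (g x)) \<le> (norm (f x))\<^sup>2 + (norm (g x))\<^sup>2" .
  qed simp
  then show ?thesis by (rule Infinite_Sum.abs_summable_summable)
qed

lemma square_summable_finite_support:
  assumes "finite {x. f x \<noteq> 0}"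
  shows "square_summable f"
proof -
  have "(\<lambda>x. (norm (f x))\<^sup>2) summable_on {x. f x \<noteq> 0}" using assms by simp
  then show ?thesis unfolding square_summable_def
    by (rule summable_on_cong_neutral[THEN iffD1, rotated -1]) auto
qed

lemma square_summable_restrict:
  assumes "square_summable f"
  shows "square_summable (\<lambda>x. if x \<in> A then f x else 0)"
  using assms unfolding square_summable_def
  by (rule square_summable_comparison) auto

text \<open>As a type, the space of square summable functions inherits norm, topology and
  completeness through classes. The functions supported on \<open>Z\<close> then form the closed
  subspace \<open>l2_space Z\<close>.\<close>

typedef (overloaded) ('z, 'w::complex_inner_space) ell2 = "{f :: 'z \<Rightarrow> 'w. square_summable f}"
  morphisms ell2_fun Ell2
  by (rule exI[of _ "\<lambda>_. 0"]) (simp add: square_summable_def)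

setup_lifting type_definition_ell2

lemma square_summable_ell2_fun [simp]: "square_summable (ell2_fun f)"
  using ell2_fun[of f] by simp

lemma ell2_fun_Ell2: "square_summable f \<Longrightarrow> ell2_fun (Ell2 f) = f"
  by (simp add: Ell2_inverse)

lemma ell2_eqI: "(\<And>x. ell2_fun f x = ell2_fun g x) \<Longrightarrow> f = g"
  using ell2_fun_inject by blast

instantiation ell2 :: (type, complex_inner_space) complex_inner_space
begin

lift_definition zero_ell2 :: "('a, 'b) ell2" is "\<lambda>_. 0"
  by (simp add: square_summable_def)

lift_definition plus_ell2 :: "('a, 'b) ell2 \<Rightarrow> ('a, 'b) ell2 \<Rightarrow> ('a, 'b) ell2" is "\<lambda>f g x. f x + g x"
  by (rule square_summable_add)

lift_definition uminus_ell2 :: "('a, 'b) ell2 \<Rightarrow> ('a, 'b) ell2" is "\<lambda>f x. - f x"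
  by (rule square_summable_uminus)

lift_definition minus_ell2 :: "('a, 'b) ell2 \<Rightarrow> ('a, 'b) ell2 \<Rightarrow> ('a, 'b) ell2" is "\<lambda>f g x. f x - g x"
  by (rule square_summable_diff)

lift_definition scaleR_ell2 :: "real \<Rightarrow> ('a, 'b) ell2 \<Rightarrow> ('a, 'b) ell2" is "\<lambda>r f x. r *\<^sub>R f x"
  by (rule square_summable_scaleR)

lift_definition scaleC_ell2 :: "complex \<Rightarrow> ('a, 'b) ell2 \<Rightarrow> ('a, 'b) ell2" is "\<lambda>c f x. c *\<^sub>C f x"
  by (rule square_summable_scaleC)

definition cinner_ell2 :: "('a, 'b) ell2 \<Rightarrow> ('a, 'b) ell2 \<Rightarrow> complex" where
  "cinner_ell2 f g = infsum (\<lambda>x. cinner (ell2_fun f x) (ell2_fun g x)) UNIV"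

definition inner_ell2 :: "('a, 'b) ell2 \<Rightarrow> ('a, 'b) ell2 \<Rightarrow> real" where
  "inner_ell2 f g = Re (cinner f g)"

definition norm_ell2 :: "('a, 'b) ell2 \<Rightarrow> real" where
  "norm_ell2 f = sqrt (inner f f)"

definition dist_ell2 :: "('a, 'b) ell2 \<Rightarrow> ('a, 'b) ell2 \<Rightarrow> real" where
  "dist_ell2 f g = norm (f - g)"

definition sgn_ell2 :: "('a, 'b) ell2 \<Rightarrow> ('a, 'b) ell2" where
  "sgn_ell2 f = scaleR (inverse (norm f)) f"

definition [code del]:
  "(uniformity :: (('a, 'b) ell2 \<times> ('a, 'b) ell2) filter) = (INF e\<in>{0 <..}. principal {(x, y). dist x y < e})"

definition [code del]:
  "open (S :: ('a, 'b) ell2 set) \<longleftrightarrow> (\<forall>x\<in>S. \<forall>\<^sub>F (x', y) in uniformity. x' = x \<longrightarrow> y \<in> S)"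

instance
proof
  fix f g h :: "('a, 'b) ell2" and r s :: real and a b :: complex
  have summ: "(\<lambda>x. cinner (ell2_fun f x) (ell2_fun g x)) summable_on UNIV" for f g :: "('a, 'b) ell2"
    by (intro square_summable_cinner) simp_all
  show "f + g + h = f + (g + h)" by transfer (simp add: add.assoc)
  show "f + g = g + f" by transfer (simp add: add.commute)
  show "0 + f = f" by transfer simp
  show "- f + f = 0" by transfer simp
  show "f - g = f + - g" by transfer simp
  show "r *\<^sub>R (f + g) = r *\<^sub>R f + r *\<^sub>R g" by transfer (simp add: scaleR_add_right)
  show "(r + s) *\<^sub>R f = r *\<^sub>R f + s *\<^sub>R f" by transfer (simp add: scaleR_add_left)
  show "r *\<^sub>R s *\<^sub>R f = (r * s) *\<^sub>R f" by transfer simp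
  show "1 *\<^sub>R f = f" by transfer simp
  show "dist f g = norm (f - g)" by (rule dist_ell2_def)
  show "sgn f = scaleR (inverse (norm f)) f" by (rule sgn_ell2_def)
  show "(uniformity :: (('a, 'b) ell2 \<times> ('a, 'b) ell2) filter) = (INF e\<in>{0 <..}. principal {(x, y). dist x y < e})"
    by (rule uniformity_ell2_def)
  show "open S \<longleftrightarrow> (\<forall>x\<in>S. \<forall>\<^sub>F (x', y) in uniformity. x' = x \<longrightarrow> y \<in> S)" for S :: "('a, 'b) ell2 set"
    by (rule open_ell2_def)
  show "a *\<^sub>C (f + g) = a *\<^sub>C f + a *\<^sub>C g" by transfer (simp add: scaleC_add_right)
  show "(a + b) *\<^sub>C f = a *\<^sub>C f + b *\<^sub>C f" by transfer (simp add: scaleC_add_left)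
  show "a *\<^sub>C b *\<^sub>C f = (a * b) *\<^sub>C f" by transfer (simp add: scaleC_scaleC)
  show "complex_of_real r *\<^sub>C f = r *\<^sub>R f" by transfer (simp add: scaleC_of_real)
  show cc: "cinner f g = cnj (cinner g f)" for f g :: "('a, 'b) ell2"
    unfolding cinner_ell2_def infsum_cnj[symmetric] by (intro infsum_cong cinner_commute)
  show ca: "cinner (f + g) h = cinner f h + cinner g h" for f g h :: "('a, 'b) ell2"
    unfolding cinner_ell2_def plus_ell2.rep_eq cinner_add_left by (intro infsum_add summ)
  show cs: "cinner (a *\<^sub>C f) g = a * cinner f g" for a and f g :: "('a, 'b) ell2"
    unfolding cinner_ell2_def scaleC_ell2.rep_eq cinner_scaleC_left by (rule infsum_cmult_right')
  show "Re (cinner f g) = inner f g" by (simp add: inner_ell2_def)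
  show "inner f g = inner g f" unfolding inner_ell2_def by (subst cc) simp
  show "inner (f + g) h = inner f h + inner g h" by (simp add: inner_ell2_def ca)
  have "r *\<^sub>R f = complex_of_real r *\<^sub>C f" by transfer (simp add: scaleC_of_real)
  then show "inner (r *\<^sub>R f) g = r * inner f g" by (simp add: inner_ell2_def cs)
  have sq: "(\<lambda>x. (norm (ell2_fun f x))\<^sup>2) summable_on UNIV"
    using square_summable_ell2_fun[of f] unfolding square_summable_def .
  have nn: "inner f f = infsum (\<lambda>x. (norm (ell2_fun f x))\<^sup>2) UNIV"
    unfolding inner_ell2_def cinner_ell2_def infsum_Re[OF summ, symmetric]
    by (simp add: Re_cinner power2_norm_eq_inner)
  show "0 \<le> inner f f" unfolding nn by (intro infsum_nonneg) simp
  show "(inner f f = 0) = (f = 0)"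
  proof
    assume "inner f f = 0"
    then have "(norm (ell2_fun f x))\<^sup>2 = 0" for x
      using nonneg_infsum_le_0D[OF _ sq, of x] nn by simp
    then show "f = 0" by (intro ell2_eqI) (simp add: zero_ell2.rep_eq)
  next
    assume "f = 0"
    then show "inner f f = 0" unfolding nn by (simp add: zero_ell2.rep_eq)
  qed
  show "norm f = sqrt (inner f f)" by (rule norm_ell2_def)
qed

end

lemma norm_ell2_square: "(norm f)\<^sup>2 = infsum (\<lambda>x. (norm (ell2_fun f x))\<^sup>2) UNIV"
proof -
  have "(norm f)\<^sup>2 = Re (cinner f f)" by (simp add: Re_cinner power2_norm_eq_inner)
  also have "\<dots> = infsum (\<lambda>x. (norm (ell2_fun f x))\<^sup>2) UNIV"
    unfolding cinner_ell2_def
    by (subst infsum_Re[symmetric]) (auto simp: square_summable_cinner Re_cinner power2_norm_eq_inner)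
  finally show ?thesis .
qed

lemma sum_norm_ell2_fun_le:
  assumes "finite F"
  shows "(\<Sum>x\<in>F. (norm (ell2_fun f x))\<^sup>2) \<le> (norm f)\<^sup>2"
  unfolding norm_ell2_square
  using square_summable_ell2_fun[of f] assms unfolding square_summable_def
  by (intro finite_sum_le_infsum) auto

lemma norm_ell2_fun_le: "norm (ell2_fun f x) \<le> norm f"
  using sum_norm_ell2_fun_le[of "{x}" f] by simp

text \<open>The candidate limit is pointwise. Bounds on finite partial sums survive the pointwise
  limit, and the infinite sum is controlled by its finite partial sums.\<close>

instance ell2 :: (type, "{complex_inner_space, complete_space}") complete_space
proof
  fix X :: "nat \<Rightarrow> ('a, 'b) ell2" assume X: "Cauchy X"
  have "Cauchy (\<lambda>n. ell2_fun (X n) x)" for x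
  proof (rule CauchyI)
    fix e :: real assume "e > 0"
    then obtain M where M: "\<And>m n. M \<le> m \<Longrightarrow> M \<le> n \<Longrightarrow> norm (X m - X n) < e"
      using CauchyD[OF X] by blast
    have "norm (ell2_fun (X m) x - ell2_fun (X n) x) < e" if "M \<le> m" "M \<le> n" for m n
      using norm_ell2_fun_le[of "X m - X n" x] M[OF that] by (simp add: minus_ell2.rep_eq)
    then show "\<exists>M. \<forall>m\<ge>M. \<forall>n\<ge>M. norm (ell2_fun (X m) x - ell2_fun (X n) x) < e" by blast
  qed
  then have "\<exists>l. (\<lambda>n. ell2_fun (X n) x) \<longlonglongrightarrow> l" for x
    using Cauchy_convergent convergent_def by blast
  then obtain L where L: "\<And>x. (\<lambda>n. ell2_fun (X n) x) \<longlonglongrightarrow> L x" by metis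
  have fin: "(\<Sum>x\<in>F. (norm (ell2_fun (X m) x - L x))\<^sup>2) \<le> e\<^sup>2"
    if F: "finite F" and m: "M \<le> m" and M: "\<And>n. M \<le> n \<Longrightarrow> norm (X m - X n) < e" for F m M e
  proof (rule LIMSEQ_le_const2)
    show "(\<lambda>n. \<Sum>x\<in>F. (norm (ell2_fun (X m) x - ell2_fun (X n) x))\<^sup>2) \<longlonglongrightarrow> (\<Sum>x\<in>F. (norm (ell2_fun (X m) x - L x))\<^sup>2)"
      by (intro tendsto_intros L)
    have "(\<Sum>x\<in>F. (norm (ell2_fun (X m) x - ell2_fun (X n) x))\<^sup>2) \<le> e\<^sup>2" if "M \<le> n" for n
    proof -
      have "(\<Sum>x\<in>F. (norm (ell2_fun (X m) x - ell2_fun (X n) x))\<^sup>2) \<le> (norm (X m - X n))\<^sup>2"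
        using sum_norm_ell2_fun_le[OF F, of "X m - X n"] by (simp add: minus_ell2.rep_eq)
      also have "\<dots> \<le> e\<^sup>2" using M[OF that] by (intro power_mono) auto
      finally show ?thesis .
    qed
    then show "\<exists>N. \<forall>n\<ge>N. (\<Sum>x\<in>F. (norm (ell2_fun (X m) x - ell2_fun (X n) x))\<^sup>2) \<le> e\<^sup>2" by blast
  qed
  have summ: "square_summable (\<lambda>x. ell2_fun (X m) x - L x)"
    if m: "M \<le> m" and M: "\<And>n. M \<le> n \<Longrightarrow> norm (X m - X n) < e" for m M e
    unfolding square_summable_def
    by (rule nonneg_bdd_above_summable_on) (auto intro!: bdd_aboveI2[of _ _ "e\<^sup>2"] fin[OF _ m M])
  obtain M1 where M1: "\<And>m n. M1 \<le> m \<Longrightarrow> M1 \<le> n \<Longrightarrow> norm (X m - X n) < 1"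
    using CauchyD[OF X, of 1] by auto
  have "square_summable (\<lambda>x. ell2_fun (X M1) x - (ell2_fun (X M1) x - L x))"
    by (intro square_summable_diff summ[of M1 M1 1]) (auto intro: M1)
  then have sL: "square_summable L" by simp
  have "X \<longlonglongrightarrow> Ell2 L"
  proof (rule LIMSEQ_I)
    fix r :: real assume r: "0 < r"
    obtain M where M: "\<And>m n. M \<le> m \<Longrightarrow> M \<le> n \<Longrightarrow> norm (X m - X n) < r / 2"
      using CauchyD[OF X, of "r / 2"] r by auto
    have "norm (X m - Ell2 L) < r" if m: "M \<le> m" for m
    proof -
      have "(norm (X m - Ell2 L))\<^sup>2 \<le> (r / 2)\<^sup>2"
        unfolding norm_ell2_square minus_ell2.rep_eq ell2_fun_Ell2[OF sL]
        using summ[OF m, of "r / 2"] M[OF m] unfolding square_summable_def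
        by (intro infsum_le_finite_sums fin[OF _ m]) auto
      then have "norm (X m - Ell2 L) \<le> r / 2" by (rule power2_le_imp_le) (use r in simp)
      then show ?thesis using r by simp
    qed
    then show "\<exists>no. \<forall>n\<ge>no. norm (X n - Ell2 L) < r" by blast
  qed
  then show "convergent X" by (rule convergentI)
qed

lift_definition ket :: "'z \<Rightarrow> 'w \<Rightarrow> ('z, 'w::complex_inner_space) ell2" is delta
  by (rule square_summable_finite_support) (auto simp: delta_def intro: finite_subset[of _ "{_}"])

lift_definition ell2_restrict :: "'z set \<Rightarrow> ('z, 'w) ell2 \<Rightarrow> ('z, 'w::complex_inner_space) ell2"
  is "\<lambda>A f x. if x \<in> A then f x else 0"
  by (rule square_summable_restrict)

lemma ell2_fun_ket: "ell2_fun (ket x v) y = (if y = x then v else 0)"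
  by (simp add: ket.rep_eq delta_def)

lemma cinner_ket: "cinner f (ket x v) = cinner (ell2_fun f x) v"
proof -
  have "cinner f (ket x v) = infsum (\<lambda>y. cinner (ell2_fun f y) (ell2_fun (ket x v) y)) {x}"
    unfolding cinner_ell2_def by (rule infsum_cong_neutral) (auto simp: ell2_fun_ket cinner.zero_right)
  then show ?thesis by (simp add: ell2_fun_ket)
qed

lemma cinner_ket_left: "cinner (ket x v) f = cinner v (ell2_fun f x)"
  using cinner_ket[of f x v] by (metis cinner_commute)

lemma ell2_fun_sum: "ell2_fun (\<Sum>i\<in>I. f i) x = (\<Sum>i\<in>I. ell2_fun (f i) x)"
  by (induction I rule: infinite_finite_induct) (auto simp: zero_ell2.rep_eq plus_ell2.rep_eq)

lemma ell2_restrict_finite_eq_sum: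
  "finite F \<Longrightarrow> ell2_restrict F f = (\<Sum>x\<in>F. ket x (ell2_fun f x))"
  by (intro ell2_eqI) (simp add: ell2_restrict.rep_eq ell2_fun_sum ell2_fun_ket)

lemma ell2_restrict_approximation:
  assumes "0 < e"
  obtains F where "finite F" "norm (f - ell2_restrict F f) < e"
proof -
  let ?g = "\<lambda>x. (norm (ell2_fun f x))\<^sup>2"
  have summ: "?g summable_on UNIV" using square_summable_ell2_fun[of f] unfolding square_summable_def .
  then have "(?g has_sum infsum ?g UNIV) UNIV" by simp
  then have "((\<lambda>F. sum ?g F) \<longlongrightarrow> infsum ?g UNIV) (finite_subsets_at_top UNIV)"
    by (simp add: has_sum_def)
  then have "\<forall>\<^sub>F F in finite_subsets_at_top UNIV. infsum ?g UNIV - e\<^sup>2 < sum ?g F"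
    using assms by (intro order_tendstoD) auto
  then obtain F where F: "finite F" "infsum ?g UNIV - e\<^sup>2 < sum ?g F"
    unfolding eventually_finite_subsets_at_top by blast
  have "f - ell2_restrict F f = ell2_restrict (- F) f"
    by (intro ell2_eqI) (simp add: minus_ell2.rep_eq ell2_restrict.rep_eq)
  then have "(norm (f - ell2_restrict F f))\<^sup>2 = infsum (\<lambda>x. (norm (ell2_fun (ell2_restrict (- F) f) x))\<^sup>2) UNIV"
    by (simp add: norm_ell2_square)
  also have "\<dots> = infsum ?g (- F)"
    by (rule infsum_cong_neutral) (auto simp: ell2_restrict.rep_eq)
  also have "\<dots> = infsum ?g UNIV - sum ?g F"
    using infsum_Diff[OF summ, of F] F(1) by (simp add: Compl_eq_Diff_UNIV)
  also have "\<dots> < e\<^sup>2" using F by simp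
  finally have "norm (f - ell2_restrict F f) < e" using assms by (simp add: power2_less_imp_less)
  then show thesis using F(1) that by blast
qed

section \<open>Square summable functions on a subset\<close>

lemma l2_iff: "f \<in> l2 Z \<longleftrightarrow> (\<forall>x. x \<notin> Z \<longrightarrow> f x = 0) \<and> square_summable f"
proof -
  have "(\<lambda>x. (norm (f x))\<^sup>2) summable_on Z \<longleftrightarrow> (\<lambda>x. (norm (f x))\<^sup>2) summable_on UNIV"
    if "\<forall>x. x \<notin> Z \<longrightarrow> f x = 0"
    using that by (intro summable_on_cong_neutral) auto
  then show ?thesis by (auto simp: l2_def functions_on_def square_summable_def)
qed

definition l2_space :: "'z set \<Rightarrow> ('z, 'w::complex_inner_space) ell2 set" where
  "l2_space Z = {f. \<forall>x. x \<notin> Z \<longrightarrow> ell2_fun f x = 0}"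

lemma ell2_fun_in_l2: "f \<in> l2_space Z \<Longrightarrow> ell2_fun f \<in> l2 Z"
  by (simp add: l2_iff l2_space_def)

lemma ell2_fun_Ell2_l2: "f \<in> l2 Z \<Longrightarrow> ell2_fun (Ell2 f) = f"
  by (simp add: l2_iff ell2_fun_Ell2)

lemma Ell2_in_l2_space: "f \<in> l2 Z \<Longrightarrow> Ell2 f \<in> l2_space Z"
  by (simp add: l2_iff l2_space_def ell2_fun_Ell2)

lemma ket_in_l2_space: "x \<in> Z \<Longrightarrow> ket x v \<in> l2_space Z"
  by (auto simp: l2_space_def ell2_fun_ket)

lemma l2_inner_ell2:
  assumes "f \<in> l2_space Z"
  shows "l2_inner Z (ell2_fun f) (ell2_fun g) = cinner f g"
  unfolding l2_inner_def cinner_ell2_def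
  by (rule infsum_cong_neutral) (use assms in \<open>auto simp: l2_space_def cinner.zero_left\<close>)

lemma l2_norm_ell2: "f \<in> l2_space Z \<Longrightarrow> l2_norm Z (ell2_fun f) = norm f"
  by (simp add: l2_norm_def l2_inner_ell2 cinner_self)

lemma csubspace_l2_space: "csubspace (l2_space Z)"
  by (auto simp: csubspace_def l2_space_def zero_ell2.rep_eq plus_ell2.rep_eq scaleC_ell2.rep_eq)

lemma closed_l2_space: "closed (l2_space Z)"
proof -
  have "bounded_linear (\<lambda>f :: ('a, 'b) ell2. ell2_fun f x)" for x
    by (rule bounded_linear_intro[of _ 1])
      (auto simp: plus_ell2.rep_eq scaleR_ell2.rep_eq norm_ell2_fun_le)
  then have "closed {f :: ('a, 'b) ell2. ell2_fun f x = 0}" for x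
    by (intro closed_Collect_eq linear_continuous_on continuous_on_const)
  moreover have "l2_space Z = (\<Inter>x\<in>-Z. {f :: ('a, 'b) ell2. ell2_fun f x = 0})"
    by (auto simp: l2_space_def)
  ultimately show ?thesis by (simp add: closed_INT)
qed

lemma ell2_restrict_in_l2_space: "ell2_restrict Z f \<in> l2_space Z"
  by (simp add: l2_space_def ell2_restrict.rep_eq)

lemma ell2_restrict_id: "f \<in> l2_space Z \<Longrightarrow> ell2_restrict Z f = f"
  by (intro ell2_eqI) (auto simp: l2_space_def ell2_restrict.rep_eq)

lemma clinear_ell2_restrict: "clinear (ell2_restrict Z)"
  by (auto simp: clinear_def ell2_restrict.rep_eq plus_ell2.rep_eq scaleC_ell2.rep_eq intro!: ell2_eqI)

lemma cinner_ell2_restrict: "cinner (ell2_restrict Z f) g = cinner f (ell2_restrict Z g)"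
  unfolding cinner_ell2_def
  by (rule infsum_cong) (auto simp: ell2_restrict.rep_eq cinner.zero_left cinner.zero_right)

lemma norm_ell2_restrict_le: "norm (ell2_restrict Z f) \<le> norm f"
proof (cases "ell2_restrict Z f = 0")
  case False
  have "cinner (ell2_restrict Z f) (ell2_restrict Z f) = cinner f (ell2_restrict Z f)"
    by (simp add: cinner_ell2_restrict ell2_restrict_id ell2_restrict_in_l2_space)
  then have "cmod (of_real ((norm (ell2_restrict Z f))\<^sup>2)) = cmod (cinner f (ell2_restrict Z f))"
    by (simp only: cinner_self)
  then have "(norm (ell2_restrict Z f))\<^sup>2 \<le> norm f * norm (ell2_restrict Z f)"
    using norm_cinner_le[of f "ell2_restrict Z f"] by (simp only: norm_of_real)
  then show ?thesis using False by (simp add: power2_eq_square)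
qed simp

text \<open>Restricting the argument to \<open>Z\<close> first makes the lifted operator linear on
  the whole type, although \<open>T\<close> is constrained on \<open>l2 Z\<close> only.\<close>

definition lift_op :: "'z set \<Rightarrow> (('z \<Rightarrow> 'w) \<Rightarrow> ('z \<Rightarrow> 'w)) \<Rightarrow>
    ('z, 'w::complex_inner_space) ell2 \<Rightarrow> ('z, 'w) ell2" where
  "lift_op Z T f = Ell2 (T (ell2_fun (ell2_restrict Z f)))"

lemma lift_op_fun:
  assumes "T ` l2 Z \<subseteq> l2 Z"
  shows "ell2_fun (lift_op Z T f) = T (ell2_fun (ell2_restrict Z f))"
proof -
  have "T (ell2_fun (ell2_restrict Z f)) \<in> l2 Z"
    using assms ell2_fun_in_l2[OF ell2_restrict_in_l2_space] by blast
  then show ?thesis unfolding lift_op_def by (rule ell2_fun_Ell2_l2)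
qed

lemma lift_op_in:
  assumes "T ` l2 Z \<subseteq> l2 Z"
  shows "lift_op Z T f \<in> l2_space Z"
  unfolding lift_op_def using assms ell2_fun_in_l2[OF ell2_restrict_in_l2_space]
  by (intro Ell2_in_l2_space) blast

lemma lift_op_fun_l2_space:
  "T ` l2 Z \<subseteq> l2 Z \<Longrightarrow> f \<in> l2_space Z \<Longrightarrow> ell2_fun (lift_op Z T f) = T (ell2_fun f)"
  by (simp add: lift_op_fun ell2_restrict_id)

lemma lift_op_restrict: "lift_op Z T (ell2_restrict Z f) = lift_op Z T f"
  by (simp add: lift_op_def ell2_restrict_id ell2_restrict_in_l2_space)

lemma clinear_lift_op:
  assumes "T ` l2 Z \<subseteq> l2 Z" "linear_on_l2 Z T"
  shows "clinear (lift_op Z T)"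
proof -
  have l2: "ell2_fun (ell2_restrict Z f) \<in> l2 Z" for f :: "('a, 'b) ell2"
    by (intro ell2_fun_in_l2 ell2_restrict_in_l2_space)
  have 1: "lift_op Z T (f + g) = lift_op Z T f + lift_op Z T g" for f g
  proof (rule ell2_eqI)
    fix x
    have "ell2_fun (ell2_restrict Z (f + g)) = (\<lambda>x. ell2_fun (ell2_restrict Z f) x + ell2_fun (ell2_restrict Z g) x)"
      by (simp add: clinear_add[OF clinear_ell2_restrict] plus_ell2.rep_eq)
    then show "ell2_fun (lift_op Z T (f + g)) x = ell2_fun (lift_op Z T f + lift_op Z T g) x"
      using assms(2) l2 by (simp add: lift_op_fun[OF assms(1)] plus_ell2.rep_eq linear_on_l2_def)
  qed
  have 2: "lift_op Z T (c *\<^sub>C f) = c *\<^sub>C lift_op Z T f" for c f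
  proof (rule ell2_eqI)
    fix x
    have "ell2_fun (ell2_restrict Z (c *\<^sub>C f)) = (\<lambda>x. c *\<^sub>C ell2_fun (ell2_restrict Z f) x)"
      by (simp add: clinear_scaleC[OF clinear_ell2_restrict] scaleC_ell2.rep_eq)
    then show "ell2_fun (lift_op Z T (c *\<^sub>C f)) x = ell2_fun (c *\<^sub>C lift_op Z T f) x"
      using assms(2) l2 by (simp add: lift_op_fun[OF assms(1)] scaleC_ell2.rep_eq linear_on_l2_def)
  qed
  show ?thesis using 1 2 by (simp add: clinear_def)
qed

lemma unitary_on_csubspace_lift_op:
  fixes U :: "('z \<Rightarrow> 'w::{complex_inner_space, complete_space}) \<Rightarrow> ('z \<Rightarrow> 'w)"
  assumes "unitary_on_l2 Z U"
  shows "unitary_on_csubspace (l2_space Z) (lift_op Z U)"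
proof
  have im: "U ` l2 Z = l2 Z" and lin: "linear_on_l2 Z U"
    and iso: "\<And>f g. f \<in> l2 Z \<Longrightarrow> g \<in> l2 Z \<Longrightarrow> l2_inner Z (U f) (U g) = l2_inner Z f g"
    using assms by (auto simp: unitary_on_l2_def)
  then have sub: "U ` l2 Z \<subseteq> l2 Z" by simp
  show "csubspace (l2_space Z :: ('z, 'w) ell2 set)" by (rule csubspace_l2_space)
  show "closed (l2_space Z :: ('z, 'w) ell2 set)" by (rule closed_l2_space)
  show "clinear (lift_op Z U)" by (rule clinear_lift_op[OF sub lin])
  show "lift_op Z U ` l2_space Z = l2_space Z"
  proof (intro equalityI subsetI)
    fix f assume "f \<in> lift_op Z U ` l2_space Z"
    then show "f \<in> l2_space Z" using lift_op_in[OF sub] by blast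
  next
    fix f :: "('z, 'w) ell2" assume f: "f \<in> l2_space Z"
    have "ell2_fun f \<in> U ` l2 Z" using ell2_fun_in_l2[OF f] im by simp
    then obtain g where g: "g \<in> l2 Z" "ell2_fun f = U g" by blast
    have "ell2_fun (lift_op Z U (Ell2 g)) = ell2_fun f"
      using g by (simp add: lift_op_fun_l2_space[OF sub Ell2_in_l2_space] ell2_fun_Ell2_l2)
    then have "f = lift_op Z U (Ell2 g)" by (simp add: ell2_fun_inject)
    then show "f \<in> lift_op Z U ` l2_space Z" using Ell2_in_l2_space[OF g(1)] by blast
  qed
  fix f g :: "('z, 'w) ell2" assume fg: "f \<in> l2_space Z" "g \<in> l2_space Z"
  have "cinner (lift_op Z U f) (lift_op Z U g) = l2_inner Z (U (ell2_fun f)) (U (ell2_fun g))"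
    using fg by (simp add: l2_inner_ell2[OF lift_op_in[OF sub], symmetric] lift_op_fun_l2_space[OF sub])
  also have "\<dots> = cinner f g" using fg by (simp add: iso ell2_fun_in_l2 l2_inner_ell2)
  finally show "cinner (lift_op Z U f) (lift_op Z U g) = cinner f g" .
qed

section \<open>Orthogonal projections\<close>

definition proj :: "'a set \<Rightarrow> 'a \<Rightarrow> 'a::{complex_inner_space, complete_space}" where
  "proj S u = (SOME v. v \<in> S \<and> (\<forall>w\<in>S. cinner (u - v) w = 0))"

lemma orthogonal_decomposition_unique:
  assumes "csubspace S" "v \<in> S" "v' \<in> S"
    "\<And>w. w \<in> S \<Longrightarrow> cinner (u - v) w = 0" "\<And>w. w \<in> S \<Longrightarrow> cinner (u - v') w = 0"
  shows "v = v'"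
proof -
  have "v - v' \<in> S" using assms by (intro csubspace_diff)
  then have "cinner (u - v') (v - v') - cinner (u - v) (v - v') = 0" using assms by simp
  then have "cinner (v - v') (v - v') = 0" by (simp add: cinner.diff_left)
  then show ?thesis by (simp add: cinner_self)
qed

context
  fixes S :: "'a::{complex_inner_space, complete_space} set"
  assumes S: "csubspace S" "closed S"
begin

lemma proj_in: "proj S u \<in> S" and proj_orthogonal: "w \<in> S \<Longrightarrow> cinner (u - proj S u) w = 0"
proof -
  have "\<exists>v. v \<in> S \<and> (\<forall>w\<in>S. cinner (u - v) w = 0)"
    using closed_csubspace_projection_exists[OF S, of u] by blast
  then have "proj S u \<in> S \<and> (\<forall>w\<in>S. cinner (u - proj S u) w = 0)" unfolding proj_def by (rule someI_ex)
  then show "proj S u \<in> S" "w \<in> S \<Longrightarrow> cinner (u - proj S u) w = 0" by auto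
qed

lemma proj_eqI: "v \<in> S \<Longrightarrow> (\<And>w. w \<in> S \<Longrightarrow> cinner (u - v) w = 0) \<Longrightarrow> proj S u = v"
  by (rule orthogonal_decomposition_unique[OF S(1) proj_in]) (auto intro: proj_orthogonal)

lemma proj_cinner: "w \<in> S \<Longrightarrow> cinner (proj S u) w = cinner u w"
  using proj_orthogonal[of w u] by (simp add: cinner.diff_left)

lemma proj_diff: "proj S (u - v) = proj S u - proj S v"
  by (rule proj_eqI) (auto intro: csubspace_diff[OF S(1)] proj_in simp: proj_cinner cinner.diff_left)

lemma clinear_proj: "clinear (proj S)"
  unfolding clinear_def
  by (intro conjI allI proj_eqI)
    (auto intro: csubspaceD[OF S(1)] proj_in simp: proj_cinner cinner.diff_left cinner_add_left cinner_scaleC_left)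

lemma norm_square_proj: "(norm u)\<^sup>2 = (norm (proj S u))\<^sup>2 + (norm (u - proj S u))\<^sup>2"
proof -
  have "inner (u - proj S u) (proj S u) = 0"
    using proj_orthogonal[OF proj_in, of u] by (simp flip: Re_cinner)
  then show ?thesis by (simp add: power2_norm_eq_inner inner_simps inner_commute)
qed

lemma norm_diff_proj_le: "norm (u - proj S u) \<le> norm u"
  by (rule power2_le_imp_le) (use norm_square_proj[of u] in auto)

end

section \<open>Walks on a lattice\<close>

lemma cinner_ell2_nonzeroE:
  assumes "cinner f g \<noteq> 0"
  obtains x where "ell2_fun f x \<noteq> 0" "ell2_fun g x \<noteq> 0"
proof (rule ccontr)
  assume "\<not> thesis"
  then have "ell2_fun f x = 0 \<or> ell2_fun g x = 0" for x using that by blast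
  then have "cinner (ell2_fun f x) (ell2_fun g x) = 0" for x
    using cinner.zero_left cinner.zero_right by metis
  then have "cinner f g = 0" by (simp add: cinner_ell2_def)
  then show False using assms by simp
qed

definition lat :: "nat \<Rightarrow> (nat \<Rightarrow>\<^sub>0 int) set" where
  "lat d = {c. Poly_Mapping.keys c \<subseteq> {..<d}}"

lemma lat_0 [simp]: "0 \<in> lat d"
  and lat_uminus [simp]: "- c \<in> lat d \<longleftrightarrow> c \<in> lat d"
  by (auto simp: lat_def)

lemma lat_add: "a \<in> lat d \<Longrightarrow> b \<in> lat d \<Longrightarrow> a + b \<in> lat d"
  using keys_add[of a b] by (auto simp: lat_def)

lemma lat_diff: "a \<in> lat d \<Longrightarrow> b \<in> lat d \<Longrightarrow> a - b \<in> lat d"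
  using lat_add[of a d "- b"] by simp

lemma lat_Suc: "c \<in> lat d \<Longrightarrow> c \<in> lat (Suc d)"
  by (force simp: lat_def)

lemma single_lat_Suc: "Poly_Mapping.single d n \<in> lat (Suc d)"
  by (simp add: lat_def)

lemma cube_subset_lat: "cube d lo hi \<subseteq> lat d"
  by (auto simp: cube_def lat_def)

text \<open>The group action in coordinates: \<open>Z\<close> is the product of the cell
  \<open>F0\<close> and the lattice through \<open>base\<close> and \<open>pos\<close>, and one step
  moves \<open>pos\<close> by at most \<open>\<rho>\<close> in each coordinate. Commutation with
  translations is stated pointwise because the translation operators \<open>Tr\<close> are built
  from \<open>sh\<close> only inside the locale.\<close>

locale lattice_walk = unitary_on_csubspace "l2_space Z" V
  for Z :: "'z set" and V :: "('z, 'w::fin_dim_complex_inner_space) ell2 \<Rightarrow> ('z, 'w) ell2" +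
  fixes F0 :: "'z set" and d :: nat and sh :: "(nat \<Rightarrow>\<^sub>0 int) \<Rightarrow> 'z \<Rightarrow> 'z"
    and base :: "'z \<Rightarrow> 'z" and pos :: "'z \<Rightarrow> (nat \<Rightarrow>\<^sub>0 int)" and \<rho> :: int
  assumes finite_F0: "finite F0" and F0_subset: "F0 \<subseteq> Z"
    and sh_in: "\<lbrakk>c \<in> lat d; x \<in> Z\<rbrakk> \<Longrightarrow> sh c x \<in> Z"
    and sh_add: "\<lbrakk>a \<in> lat d; b \<in> lat d; x \<in> Z\<rbrakk> \<Longrightarrow> sh (a + b) x = sh a (sh b x)"
    and base_in: "x \<in> Z \<Longrightarrow> base x \<in> F0" and pos_lat: "x \<in> Z \<Longrightarrow> pos x \<in> lat d"
    and sh_pos_base: "x \<in> Z \<Longrightarrow> sh (pos x) (base x) = x"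
    and base_sh_F0: "\<lbrakk>c \<in> lat d; x \<in> F0\<rbrakk> \<Longrightarrow> base (sh c x) = x"
    and pos_sh_F0: "\<lbrakk>c \<in> lat d; x \<in> F0\<rbrakk> \<Longrightarrow> pos (sh c x) = c"
    and \<rho>_nonneg: "0 \<le> \<rho>"
    and propagation: "\<lbrakk>x \<in> Z; ell2_fun (V (ket x v)) y \<noteq> 0\<rbrakk> \<Longrightarrow>
      y \<in> Z \<and> pos y - pos x \<in> cube d (- \<rho>) (\<rho> + 1)"
    and V_shift: "\<lbrakk>c \<in> lat d; f \<in> l2_space Z; g \<in> l2_space Z;
        \<And>x. x \<in> Z \<Longrightarrow> ell2_fun g x = ell2_fun f (sh (- c) x)\<rbrakk> \<Longrightarrow>
      x \<in> Z \<Longrightarrow> ell2_fun (V g) x = ell2_fun (V f) (sh (- c) x)"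
begin

lemma sh_sh:
  assumes "c \<in> lat d" "x \<in> Z"
  shows "sh c x = sh (c + pos x) (base x)"
proof -
  have "base x \<in> Z" using assms(2) base_in F0_subset by blast
  then show ?thesis using assms sh_add[of c "pos x" "base x"] by (simp add: sh_pos_base pos_lat)
qed

lemma base_sh: "\<lbrakk>c \<in> lat d; x \<in> Z\<rbrakk> \<Longrightarrow> base (sh c x) = base x"
  using sh_sh base_sh_F0[of "c + pos x" "base x"] by (simp add: lat_add pos_lat base_in)

lemma pos_sh: "\<lbrakk>c \<in> lat d; x \<in> Z\<rbrakk> \<Longrightarrow> pos (sh c x) = c + pos x"
  using sh_sh pos_sh_F0[of "c + pos x" "base x"] by (simp add: lat_add pos_lat base_in)

lemma point_eqI: "\<lbrakk>x \<in> Z; y \<in> Z; pos x = pos y; base x = base y\<rbrakk> \<Longrightarrow> x = y"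
  using sh_pos_base by metis

lemma sh_0: "x \<in> Z \<Longrightarrow> sh 0 x = x"
  by (rule point_eqI) (auto simp: sh_in base_sh pos_sh)

lemma sh_sh_minus: "\<lbrakk>c \<in> lat d; x \<in> Z\<rbrakk> \<Longrightarrow> sh c (sh (- c) x) = x"
  and sh_minus_sh: "\<lbrakk>c \<in> lat d; x \<in> Z\<rbrakk> \<Longrightarrow> sh (- c) (sh c x) = x"
  using sh_add[of c "- c" x] sh_add[of "- c" c x] by (auto simp: sh_0)

lemma bij_betw_sh: "c \<in> lat d \<Longrightarrow> bij_betw (sh c) Z Z"
  by (rule bij_betwI[where g = "sh (- c)"]) (auto simp: sh_in sh_sh_minus sh_minus_sh)

definition Tr :: "(nat \<Rightarrow>\<^sub>0 int) \<Rightarrow> ('z, 'w) ell2 \<Rightarrow> ('z, 'w) ell2" where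
  "Tr c f = Ell2 (\<lambda>x. if x \<in> Z then ell2_fun f (sh (- c) x) else 0)"

lemma ell2_fun_Tr:
  assumes c: "c \<in> lat d"
  shows "ell2_fun (Tr c f) x = (if x \<in> Z then ell2_fun f (sh (- c) x) else 0)"
proof -
  have "(\<lambda>x. (norm (ell2_fun f x))\<^sup>2) summable_on UNIV"
    using square_summable_ell2_fun[of f] unfolding square_summable_def .
  then have "(\<lambda>x. (norm (ell2_fun f x))\<^sup>2) summable_on Z" by (rule summable_on_subset_banach) simp
  then have "(\<lambda>x. (norm (ell2_fun f (sh (- c) x)))\<^sup>2) summable_on Z"
    using summable_on_reindex_bij_betw[OF bij_betw_sh[of "- c"], of "\<lambda>x. (norm (ell2_fun f x))\<^sup>2"] c by simp
  then have "(\<lambda>x. if x \<in> Z then ell2_fun f (sh (- c) x) else 0) \<in> l2 Z"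
    by (auto simp: l2_def functions_on_def cong: summable_on_cong)
  then show ?thesis unfolding Tr_def by (simp add: ell2_fun_Ell2_l2)
qed

lemma Tr_in: "c \<in> lat d \<Longrightarrow> Tr c f \<in> l2_space Z"
  by (simp add: l2_space_def ell2_fun_Tr)

lemma clinear_Tr: "c \<in> lat d \<Longrightarrow> clinear (Tr c)"
  by (auto simp: clinear_def plus_ell2.rep_eq scaleC_ell2.rep_eq ell2_fun_Tr intro!: ell2_eqI)

lemma Tr_add: "\<lbrakk>a \<in> lat d; b \<in> lat d\<rbrakk> \<Longrightarrow> Tr (a + b) f = Tr a (Tr b f)"
  by (rule ell2_eqI) (auto simp: ell2_fun_Tr lat_add sh_in sh_add[of "- b" "- a", symmetric] add.commute)

lemma Tr_0: "f \<in> l2_space Z \<Longrightarrow> Tr 0 f = f"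
  by (rule ell2_eqI) (auto simp: ell2_fun_Tr sh_0 l2_space_def)

lemma Tr_minus_Tr: "\<lbrakk>c \<in> lat d; f \<in> l2_space Z\<rbrakk> \<Longrightarrow> Tr (- c) (Tr c f) = f"
  using Tr_add[of "- c" c f] by (simp add: Tr_0)

lemma V_Tr:
  assumes "c \<in> lat d" "f \<in> l2_space Z"
  shows "V (Tr c f) = Tr c (V f)"
proof (rule ell2_eqI)
  fix x
  show "ell2_fun (V (Tr c f)) x = ell2_fun (Tr c (V f)) x"
  proof (cases "x \<in> Z")
    case True
    then show ?thesis
      using V_shift[OF assms Tr_in[OF assms(1)] _ True] assms by (simp add: ell2_fun_Tr)
  next
    case False
    then show ?thesis
      using U_in[OF Tr_in[OF assms(1), of f]] assms by (simp add: ell2_fun_Tr l2_space_def)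
  qed
qed

lemma funpow_V_Tr: "\<lbrakk>c \<in> lat d; f \<in> l2_space Z\<rbrakk> \<Longrightarrow> (V ^^ n) (Tr c f) = Tr c ((V ^^ n) f)"
  by (induction n) (auto simp: V_Tr funpow_U_in)

lemma Tr_ket: "\<lbrakk>c \<in> lat d; x \<in> Z\<rbrakk> \<Longrightarrow> Tr c (ket x v) = ket (sh c x) v"
  by (rule ell2_eqI) (auto simp: ell2_fun_Tr ell2_fun_ket sh_minus_sh sh_in sh_sh_minus)

lemma cinner_Tr:
  assumes "c \<in> lat d" "f \<in> l2_space Z"
  shows "cinner (Tr c f) (Tr c g) = cinner f g"
proof -
  have "cinner (Tr c f) (Tr c g) = infsum (\<lambda>x. cinner (ell2_fun f (sh (- c) x)) (ell2_fun g (sh (- c) x))) Z"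
    unfolding cinner_ell2_def
    by (rule infsum_cong_neutral) (use assms in \<open>auto simp: ell2_fun_Tr cinner.zero_left\<close>)
  also have "\<dots> = infsum (\<lambda>x. cinner (ell2_fun f x) (ell2_fun g x)) Z"
    using infsum_reindex_bij_betw[OF bij_betw_sh[of "- c"], of "\<lambda>x. cinner (ell2_fun f x) (ell2_fun g x)"] assms by simp
  also have "\<dots> = cinner f g"
    unfolding cinner_ell2_def
    by (rule infsum_cong_neutral) (use assms in \<open>auto simp: l2_space_def cinner.zero_left\<close>)
  finally show ?thesis .
qed

lemma cinner_Tr_left:
  assumes "c \<in> lat d" "f \<in> l2_space Z" "g \<in> l2_space Z"
  shows "cinner (Tr c f) g = cinner f (Tr (- c) g)"
  using cinner_Tr[OF assms(1,2), of "Tr (- c) g"] Tr_minus_Tr[of "- c" g] assms by simp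

definition Zcube :: "int \<Rightarrow> int \<Rightarrow> 'z set" where
  "Zcube lo hi = {x \<in> Z. pos x \<in> cube d lo hi}"

lemma bij_betw_Zcube: "bij_betw (\<lambda>(x, c). sh c x) (F0 \<times> cube d lo hi) (Zcube lo hi)"
  by (rule bij_betwI[where g = "\<lambda>x. (base x, pos x)"])
    (use cube_subset_lat[of d lo hi] F0_subset in
      \<open>auto simp: Zcube_def sh_in base_in sh_pos_base base_sh_F0 pos_sh_F0 subset_iff\<close>)

lemma finite_Zcube [simp]: "finite (Zcube lo hi)"
  using bij_betw_finite[OF bij_betw_Zcube[of lo hi]] finite_F0 by simp

lemma card_Zcube: "card (Zcube lo hi) = card F0 * nat (hi - lo) ^ d"
  using bij_betw_same_card[OF bij_betw_Zcube[of lo hi]] by (simp add: card_cartesian_product card_cube)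

section \<open>Finitely supported functions and their spreading under the walk\<close>

definition supp_in :: "int \<Rightarrow> ('z, 'w) ell2 \<Rightarrow> bool" where
  "supp_in r f \<longleftrightarrow> (\<forall>x. ell2_fun f x \<noteq> 0 \<longrightarrow> x \<in> Zcube (- r) (r + 1))"

lemma supp_in_l2_space: "supp_in r f \<Longrightarrow> f \<in> l2_space Z"
  by (auto simp: supp_in_def l2_space_def Zcube_def)

lemma supp_in_mono: "supp_in r f \<Longrightarrow> r \<le> r' \<Longrightarrow> supp_in r' f"
  using cube_mono[of "- r'" "- r" "r + 1" "r' + 1" d] by (auto simp: supp_in_def Zcube_def)

lemma supp_in_sum: "(\<And>i. i \<in> I \<Longrightarrow> supp_in r (f i)) \<Longrightarrow> supp_in r (\<Sum>i\<in>I. f i)"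
  unfolding supp_in_def ell2_fun_sum by (meson sum.not_neutral_contains_not_neutral)

lemma supp_in_scaleC: "supp_in r f \<Longrightarrow> supp_in r (c *\<^sub>C f)"
  by (auto simp: supp_in_def scaleC_ell2.rep_eq)

lemma eq_sum_ket:
  assumes "finite A" "\<And>x. ell2_fun f x \<noteq> 0 \<Longrightarrow> x \<in> A"
  shows "f = (\<Sum>x\<in>A. ket x (ell2_fun f x))"
proof -
  have "f = ell2_restrict A f"
    by (rule ell2_eqI) (use assms(2) in \<open>force simp: ell2_restrict.rep_eq\<close>)
  also have "\<dots> = (\<Sum>x\<in>A. ket x (ell2_fun f x))" by (rule ell2_restrict_finite_eq_sum[OF assms(1)])
  finally show ?thesis .
qed

lemma ell2_fun_V_finite:
  assumes "finite A" "\<And>x. ell2_fun f x \<noteq> 0 \<Longrightarrow> x \<in> A"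
  shows "ell2_fun (V f) y = (\<Sum>x\<in>A. ell2_fun (V (ket x (ell2_fun f x))) y)"
  by (subst eq_sum_ket[OF assms]) (auto simp: clinear_sum[OF clinear_U] ell2_fun_sum)

lemma supp_in_V:
  assumes "supp_in r f"
  shows "supp_in (r + \<rho>) (V f)"
  unfolding supp_in_def
proof (intro allI impI)
  fix y assume "ell2_fun (V f) y \<noteq> 0"
  then have "(\<Sum>x\<in>Zcube (- r) (r + 1). ell2_fun (V (ket x (ell2_fun f x))) y) \<noteq> 0"
    using assms ell2_fun_V_finite[of "Zcube (- r) (r + 1)" f y] by (auto simp: supp_in_def)
  then obtain x where x: "x \<in> Zcube (- r) (r + 1)" "ell2_fun (V (ket x (ell2_fun f x))) y \<noteq> 0"
    by (rule sum.not_neutral_contains_not_neutral)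
  then have "y \<in> Z" "pos y - pos x \<in> cube d (- \<rho>) (\<rho> + 1)" "pos x \<in> cube d (- r) (r + 1)"
    using propagation[of x _ y] by (auto simp: Zcube_def)
  then show "y \<in> Zcube (- (r + \<rho>)) (r + \<rho> + 1)"
    using cube_add[of "pos x" d r "pos y - pos x" \<rho>] by (simp add: Zcube_def)
qed

lemma supp_in_funpow_V:
  assumes "supp_in r f"
  shows "supp_in (r + \<rho> * int n) ((V ^^ n) f)"
proof (induction n)
  case (Suc n)
  from supp_in_V[OF this] show ?case by (simp add: algebra_simps)
qed (use assms in simp)

lemma supp_in_Tr:
  assumes "supp_in r f" "c \<in> cube d (- \<tau>) (\<tau> + 1)"
  shows "supp_in (r + \<tau>) (Tr c f)"
  unfolding supp_in_def
proof (intro allI impI)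
  have c: "c \<in> lat d" using assms(2) cube_subset_lat by blast
  fix x assume "ell2_fun (Tr c f) x \<noteq> 0"
  then have x: "x \<in> Z" "sh (- c) x \<in> Zcube (- r) (r + 1)"
    using assms(1) c by (auto simp: ell2_fun_Tr supp_in_def split: if_splits)
  then have "- c + pos x \<in> cube d (- r) (r + 1)" using c by (simp add: Zcube_def pos_sh)
  from cube_add[OF this assms(2)] show "x \<in> Zcube (- (r + \<tau>)) (r + \<tau> + 1)"
    using x by (simp add: Zcube_def algebra_simps)
qed

lemma supp_in_ket: "x \<in> Z \<Longrightarrow> \<exists>r\<ge>0. supp_in r (ket x v)"
proof -
  assume x: "x \<in> Z"
  obtain r where "0 \<le> r" "{pos x} \<subseteq> cube d (-r) (r + 1)"
    using finite_subset_cube[of "{pos x}" d] pos_lat[OF x] by (auto simp: lat_def)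
  then show ?thesis using x by (auto simp: supp_in_def Zcube_def ell2_fun_ket split: if_splits)
qed

lemma supp_in_finite:
  assumes "f \<in> l2_space Z" "finite {x. ell2_fun f x \<noteq> 0}"
  shows "\<exists>r\<ge>0. supp_in r f"
proof -
  have "{x. ell2_fun f x \<noteq> 0} \<subseteq> Z" using assms(1) by (auto simp: l2_space_def)
  then have "Poly_Mapping.keys y \<subseteq> {..<d}" if "y \<in> pos ` {x. ell2_fun f x \<noteq> 0}" for y
    using that pos_lat by (auto simp: lat_def)
  then obtain r where "0 \<le> r" "pos ` {x. ell2_fun f x \<noteq> 0} \<subseteq> cube d (-r) (r + 1)"
    using finite_subset_cube[of "pos ` {x. ell2_fun f x \<noteq> 0}" d] assms(2) by blast
  then show ?thesis using \<open>{x. ell2_fun f x \<noteq> 0} \<subseteq> Z\<close> by (auto simp: supp_in_def Zcube_def)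
qed

text \<open>A fixed enlargement multiplies the volume of a large box by a factor close to 1, which
  the ratio of \<open>m\<close> to \<open>k\<close> outweighs.\<close>

lemma eventually_cube_card:
  fixes k m :: nat
  assumes "k < m"
  shows "\<forall>\<^sub>F r in sequentially. k * nat (2 * (int r + c) + 1) ^ d < m * nat (2 * int r + 1) ^ d"
proof -
  define e where "e = 1 / real m / 2"
  \<comment> \<open>The choice makes \<open>m * e\<close> one half, which is less than the gap of at
    least 1 between \<open>k\<close> and \<open>m\<close>.\<close>
  have e: "0 < e" using assms by (simp add: e_def)
  define c' where "c' = nat (2 * \<bar>c\<bar>)"
  have "filterlim (\<lambda>r. nat (2 * int r + 1) + c') sequentially sequentially"
    by (rule filterlim_at_top_mono[OF filterlim_ident]) (auto intro!: always_eventually)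
  from eventually_compose_filterlim[OF eventually_power_collar_small[OF e, of d c'] this]
  show ?thesis
  proof eventually_elim
    case (elim r)
    let ?n = "nat (2 * int r + 1)"
    have "0 < real (?n + c') ^ d" by simp
    have "real k \<le> real m - 1" using assms by (simp add: of_nat_diff flip: of_nat_Suc)
    have le: "nat (2 * (int r + c) + 1) \<le> ?n + c'" by (simp add: c'_def)
    have "real k * real (nat (2 * (int r + c) + 1)) ^ d \<le> real k * real (?n + c') ^ d"
      by (intro mult_left_mono power_mono) (use le in auto)
    also have "\<dots> \<le> (real m - 1) * real (?n + c') ^ d"
      using \<open>real k \<le> real m - 1\<close> by (intro mult_right_mono) auto
    also have "\<dots> < (real m - real m * e) * real (?n + c') ^ d"
      using assms by (intro mult_strict_right_mono) (auto simp: e_def)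
    also have "\<dots> = real m * (real (?n + c') ^ d - e * real (?n + c') ^ d)"
      by (simp add: algebra_simps)
    also have "\<dots> \<le> real m * real ?n ^ d"
      using elim by (intro mult_left_mono) auto
    finally have "real (k * nat (2 * (int r + c) + 1) ^ d) < real (m * nat (2 * int r + 1) ^ d)"
      by (simp only: of_nat_mult of_nat_power)
    then show ?case by (simp only: of_nat_less_iff)
  qed
qed

lemma ell2_eq_0_coordinates:
  assumes E: "\<And>w::'w. w = (\<Sum>e\<in>E. inner w e *\<^sub>R e)"
    and "\<And>x. ell2_fun f x \<noteq> 0 \<Longrightarrow> x \<in> A" "\<And>x e. x \<in> A \<Longrightarrow> e \<in> E \<Longrightarrow> cinner (ell2_fun f x) e = 0"
  shows "f = 0"
proof (rule ell2_eqI)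
  fix x
  have "inner (ell2_fun f x) e = 0" if "e \<in> E" "x \<in> A" for e
    using assms(3)[OF that(2,1)] by (simp flip: Re_cinner)
  then have "ell2_fun f x = 0" if "x \<in> A" using E[of "ell2_fun f x"] that by simp
  then show "ell2_fun f x = ell2_fun 0 x" using assms(2) by (auto simp: zero_ell2.rep_eq)
qed

text \<open>The powers of \<open>V\<close> applied to \<open>a\<close> are linearly dependent over the group ring, since
  functions supported in a box of the lattice grow only like a module of finite rank.\<close>

lemma group_ring_relation:
  assumes a: "supp_in ra a" "0 \<le> ra"
  shows "\<exists>m r c. (\<exists>k\<le>m. \<exists>\<gamma>\<in>cube d (- int r) (int r + 1). c k \<gamma> \<noteq> 0) \<and>
    (\<Sum>k\<le>m. \<Sum>\<gamma>\<in>cube d (- int r) (int r + 1). c k \<gamma> *\<^sub>C Tr \<gamma> ((V ^^ k) a)) = 0"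
proof -
  obtain E :: "'w set" where E: "finite E" "\<And>w. w = (\<Sum>e\<in>E. inner w e *\<^sub>R e)"
    using finite_orthonormal_basis_exists by metis
  \<comment> \<open>One unit cell carries \<open>m\<close> coordinates, so \<open>Suc m\<close>
    powers of \<open>V\<close> exceed the rank as soon as the box is large. The constant
    \<open>cc\<close> bounds how far these powers reach beyond the box of shifts.\<close>
  define m where "m = card F0 * card E"
  define cc where "cc = ra + \<rho> * int m"
  obtain r :: nat where r: "m * nat (2 * (int r + cc) + 1) ^ d < Suc m * nat (2 * int r + 1) ^ d"
    using eventually_happens[OF eventually_cube_card[of m "Suc m" cc]] by auto
  let ?C = "cube d (- int r) (int r + 1)"
  let ?B = "Zcube (- (int r + cc)) (int r + cc + 1)"
  define I where "I = {..m} \<times> ?C"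
  have "int r + 1 - (- int r) = 2 * int r + 1" by simp
  then have cI: "card I = Suc m * nat (2 * int r + 1) ^ d" unfolding I_def card_cartesian_product card_cube by simp
  have eq: "int r + cc + 1 - (- (int r + cc)) = 2 * (int r + cc) + 1" by simp
  have cB: "card (?B \<times> E) = m * nat (2 * (int r + cc) + 1) ^ d"
    unfolding card_cartesian_product card_Zcube eq m_def by (simp only: mult_ac)
  have "card (?B \<times> E) < card I" unfolding cI cB by (rule r)
  moreover have "finite (?B \<times> E)" "finite I" using E(1) by (auto simp: I_def)
  ultimately obtain c where c: "\<exists>i\<in>I. c i \<noteq> 0"
    "\<And>x e. x \<in> ?B \<Longrightarrow> e \<in> E \<Longrightarrow> (\<Sum>i\<in>I. c i * cinner (ell2_fun (Tr (snd i) ((V ^^ fst i) a)) x) e) = 0"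
    using homogeneous_system_nontrivial_solution[of "?B \<times> E" I
        "\<lambda>(x, e) i. cinner (ell2_fun (Tr (snd i) ((V ^^ fst i) a)) x) e"] by fastforce
  define g where "g = (\<Sum>i\<in>I. c i *\<^sub>C Tr (snd i) ((V ^^ fst i) a))"
  have "supp_in (int r + cc) g"
    unfolding g_def
  proof (intro supp_in_sum supp_in_scaleC)
    fix i assume i: "i \<in> I"
    then have "supp_in (ra + \<rho> * int (fst i) + int r) (Tr (snd i) ((V ^^ fst i) a))"
      by (intro supp_in_Tr supp_in_funpow_V a) (auto simp: I_def)
    moreover have "\<rho> * int (fst i) \<le> \<rho> * int m" using i \<rho>_nonneg by (intro mult_left_mono) (auto simp: I_def)
    ultimately show "supp_in (int r + cc) (Tr (snd i) ((V ^^ fst i) a))"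
      by (elim supp_in_mono) (simp add: cc_def)
  qed
  then have "g = 0"
    using c(2) by (intro ell2_eq_0_coordinates[OF E(2), of _ ?B])
      (auto simp: supp_in_def g_def ell2_fun_sum scaleC_ell2.rep_eq cinner.sum_left cinner_scaleC_left)
  then have "(\<Sum>k\<le>m. \<Sum>\<gamma>\<in>?C. c (k, \<gamma>) *\<^sub>C Tr \<gamma> ((V ^^ k) a)) = 0"
    unfolding g_def I_def by (simp add: sum.cartesian_product case_prod_unfold)
  moreover have "\<exists>k\<le>m. \<exists>\<gamma>\<in>?C. c (k, \<gamma>) \<noteq> 0" using c(1) by (auto simp: I_def)
  ultimately show ?thesis by (intro exI[of _ m] exI[of _ r] exI[of _ "\<lambda>k \<gamma>. c (k, \<gamma>)"]) auto
qed

text \<open>Correlations as one function on the space-time lattice, with coordinate \<open>d\<close>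
  as time. The value 0 at negative times is a cut-off: it makes \<open>finite_below\<close> hold and
  disturbs the linear relation at finitely many points only.\<close>

definition corr :: "('z, 'w) ell2 \<Rightarrow> ('z, 'w) ell2 \<Rightarrow> (nat \<Rightarrow>\<^sub>0 int) \<Rightarrow> complex" where
  "corr a b x = (if x \<in> lat (Suc d) \<and> 0 \<le> Poly_Mapping.lookup x d
     then cinner ((V ^^ nat (Poly_Mapping.lookup x d)) a) (Tr (x - Poly_Mapping.single d (Poly_Mapping.lookup x d)) b)
     else 0)"

lemma spatial_lat:
  assumes "x \<in> lat (Suc d)"
  shows "x - Poly_Mapping.single d (Poly_Mapping.lookup x d) \<in> lat d"
  using assms by (auto simp: lat_def in_keys_iff lookup_minus lookup_single when_def subset_iff less_Suc_eq split: if_splits)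

text \<open>Finite propagation confines the correlations to a light cone, which meets each bounded
  time interval in a finite set.\<close>

lemma finite_below_corr:
  assumes "supp_in ra a" "supp_in rb b" "0 \<le> ra" "0 \<le> rb"
  shows "finite_below d (corr a b)"
  unfolding finite_below_def
proof
  fix n
  define R where "R = ra + rb + \<rho> * \<bar>n\<bar> + \<bar>n\<bar>"
  have "x \<in> cube (Suc d) (- R) (R + 1)" if x: "corr a b x \<noteq> 0" "Poly_Mapping.lookup x d \<le> n" for x
  proof -
    let ?t = "Poly_Mapping.lookup x d"
    let ?s = "x - Poly_Mapping.single d ?t"
    have xl: "x \<in> lat (Suc d)" "0 \<le> ?t" using x(1) by (auto simp: corr_def split: if_splits)
    have "cinner ((V ^^ nat ?t) a) (Tr ?s b) \<noteq> 0" using x(1) by (auto simp: corr_def split: if_splits)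
    then obtain y where y: "ell2_fun ((V ^^ nat ?t) a) y \<noteq> 0" "ell2_fun (Tr ?s b) y \<noteq> 0"
      by (rule cinner_ell2_nonzeroE)
    have s: "?s \<in> lat d" by (rule spatial_lat[OF xl(1)])
    have y1: "y \<in> Z" "pos y \<in> cube d (- (ra + \<rho> * ?t)) (ra + \<rho> * ?t + 1)"
      using supp_in_funpow_V[OF assms(1), of "nat ?t"] y(1) xl by (auto simp: supp_in_def Zcube_def)
    have "sh (- ?s) y \<in> Zcube (- rb) (rb + 1)"
      using assms(2) y(2) s by (auto simp: ell2_fun_Tr supp_in_def split: if_splits)
    then have "pos (sh (- ?s) y) \<in> cube d (- rb) (rb + 1)" by (simp only: Zcube_def mem_Collect_eq)
    moreover have "pos (sh (- ?s) y) = - ?s + pos y" 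
      by (rule pos_sh) (use s y1 in \<open>simp_all only: lat_uminus\<close>)
    ultimately have "- ?s + pos y \<in> cube d (- rb) (rb + 1)" by (simp only:)
    from cube_add[OF y1(2) cube_uminus[OF this]]
    have sc: "?s \<in> cube d (- (ra + \<rho> * ?t + rb)) (ra + \<rho> * ?t + rb + 1)" by (simp add: algebra_simps)
    have "\<rho> * ?t \<le> \<rho> * \<bar>n\<bar>" using x(2) \<rho>_nonneg by (intro mult_left_mono) auto
    then have bound: "ra + \<rho> * ?t + rb \<le> R" "?t \<le> R" using x(2) assms \<rho>_nonneg mult_nonneg_nonneg[of \<rho> "\<bar>n\<bar>"] unfolding R_def by linarith+
    have "\<bar>Poly_Mapping.lookup x i\<bar> \<le> R" if "i < Suc d" for i
    proof (cases "i = d")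
      case True
      then show ?thesis using xl bound by simp
    next
      case False
      then have "i < d" using that by simp
      then have "\<bar>Poly_Mapping.lookup ?s i\<bar> \<le> ra + \<rho> * ?t + rb" using sc by (auto simp: cube_def)
      then show ?thesis using False bound by (simp add: lookup_minus lookup_single when_def)
    qed
    then show ?thesis using xl by (fastforce simp: cube_def lat_def abs_le_iff)
  qed
  then show "finite {x. corr a b x \<noteq> 0 \<and> Poly_Mapping.lookup x d \<le> n}"
    by (intro finite_subset[OF _ finite_cube[of "Suc d" "- R" "R + 1"]]) auto
qed

lemma corr_single: "b \<in> l2_space Z \<Longrightarrow> corr a b (Poly_Mapping.single d n) = (if 0 \<le> n then cinner ((V ^^ nat n) a) b else 0)"
  by (auto simp: corr_def lat_def Tr_0)

text \<open>Applying a power of \<open>V\<close> to the group ring relation and pairing with a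
  translate of \<open>b\<close> gives a convolution identity at all nonnegative times. At negative
  times the convolution is finitely supported because \<open>corr a b\<close> is finite below any
  time.\<close>

lemma corr_annihilated:
  assumes a: "supp_in ra a" "0 \<le> ra" and b: "supp_in rb b" "0 \<le> rb"
  shows "\<exists>S q. finite S \<and> S \<noteq> {} \<and> S \<subseteq> lat (Suc d) \<and> (\<forall>s\<in>S. q s \<noteq> 0) \<and>
    finite {x. conv S q (corr a b) x \<noteq> 0} \<and> (\<forall>x. conv S q (corr a b) x \<noteq> 0 \<longrightarrow> x \<in> lat (Suc d))"
proof -
  obtain m r c where c: "\<exists>k\<le>m. \<exists>\<gamma>\<in>cube d (- int r) (int r + 1). c k \<gamma> \<noteq> 0"
    and rel: "(\<Sum>k\<le>m. \<Sum>\<gamma>\<in>cube d (- int r) (int r + 1). c k \<gamma> *\<^sub>C Tr \<gamma> ((V ^^ k) a)) = 0"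
    using group_ring_relation[OF a] by blast
  let ?C = "cube d (- int r) (int r + 1)"
  have Cl: "\<gamma> \<in> lat d" if "\<gamma> \<in> ?C" for \<gamma> using that cube_subset_lat by blast
  have aH: "a \<in> l2_space Z" and bH: "b \<in> l2_space Z" using a b supp_in_l2_space by auto
  define J where "J = {i \<in> {..m} \<times> ?C. c (fst i) (snd i) \<noteq> 0}"
  \<comment> \<open>Convolution evaluates at \<open>x - s\<close>, so a power \<open>k\<close> of
    \<open>V\<close>, which moves time forward, is placed at time \<open>- k\<close>.\<close>
  define \<iota> where "\<iota> = (\<lambda>i :: nat \<times> (nat \<Rightarrow>\<^sub>0 int). snd i - Poly_Mapping.single d (int (fst i)))"
  have J: "finite J" "J \<noteq> {}" using c by (auto simp: J_def)
  have time: "Poly_Mapping.lookup (\<iota> i) d = - int (fst i)" and space: "\<iota> i + Poly_Mapping.single d (int (fst i)) = snd i"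
    if "i \<in> J" for i
    using that Cl[of "snd i"] by (auto simp: \<iota>_def J_def lookup_minus lat_def lookup_eq_0_lessThan)
  have inj: "inj_on \<iota> J"
  proof (rule inj_onI)
    fix i j assume ij: "i \<in> J" "j \<in> J" "\<iota> i = \<iota> j"
    then have "fst i = fst j" using time[of i] time[of j] by simp
    then show "i = j" using space[OF ij(1)] space[OF ij(2)] ij(3) by (simp add: prod_eq_iff)
  qed
  define S where "S = \<iota> ` J"
  define q where "q s = (let i = inv_into J \<iota> s in c (fst i) (snd i))" for s
  have q\<iota>: "q (\<iota> i) = c (fst i) (snd i)" if "i \<in> J" for i using that inj by (simp add: q_def)
  have S_lat: "S \<subseteq> lat (Suc d)"
  proof
    fix s assume "s \<in> S"
    then obtain i where i: "i \<in> J" "s = \<iota> i" by (auto simp: S_def)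
    have "snd i \<in> lat (Suc d)" "Poly_Mapping.single d (int (fst i)) \<in> lat (Suc d)"
      using Cl[of "snd i"] i(1) by (auto simp: J_def intro: lat_Suc single_lat_Suc)
    then show "s \<in> lat (Suc d)" using i(2) by (simp add: \<iota>_def lat_diff)
  qed
  have conv_eq: "conv S q (corr a b) x = (\<Sum>k\<le>m. \<Sum>\<gamma>\<in>?C. c k \<gamma> * corr a b (x - \<gamma> + Poly_Mapping.single d (int k)))" for x
  proof -
    have "conv S q (corr a b) x = (\<Sum>i\<in>J. c (fst i) (snd i) * corr a b (x - \<iota> i))"
      unfolding conv_def S_def by (subst sum.reindex[OF inj]) (auto simp: q\<iota> intro!: sum.cong)
    also have "\<dots> = (\<Sum>i\<in>{..m} \<times> ?C. c (fst i) (snd i) * corr a b (x - \<iota> i))"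
      by (rule sum.mono_neutral_left) (auto simp: J_def)
    also have "\<dots> = (\<Sum>k\<le>m. \<Sum>\<gamma>\<in>?C. c k \<gamma> * corr a b (x - \<gamma> + Poly_Mapping.single d (int k)))"
      by (simp add: sum.cartesian_product case_prod_unfold \<iota>_def algebra_simps)
    finally show ?thesis .
  qed
  have vanish: "conv S q (corr a b) x = 0" if x: "x \<in> lat (Suc d)" "0 \<le> Poly_Mapping.lookup x d" for x
  proof -
    let ?t = "nat (Poly_Mapping.lookup x d)"
    let ?s = "x - Poly_Mapping.single d (Poly_Mapping.lookup x d)"
    have s: "?s \<in> lat d" by (rule spatial_lat[OF x(1)])
    have term_eq: "corr a b (x - \<gamma> + Poly_Mapping.single d (int k)) = cinner ((V ^^ ?t) (Tr \<gamma> ((V ^^ k) a))) (Tr ?s b)"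
      if \<gamma>: "\<gamma> \<in> ?C" for k \<gamma>
    proof -
      have g: "\<gamma> \<in> lat d" "\<gamma> \<in> lat (Suc d)" using Cl[OF \<gamma>] by (auto intro: lat_Suc)
      let ?y = "x - \<gamma> + Poly_Mapping.single d (int k)"
      have yl: "?y \<in> lat (Suc d)"
        using x g by (intro lat_add lat_diff single_lat_Suc)
      have yt: "Poly_Mapping.lookup ?y d = Poly_Mapping.lookup x d + int k"
        using g by (simp add: lookup_add lookup_minus lat_def lookup_eq_0_lessThan)
      have ys: "?y - Poly_Mapping.single d (Poly_Mapping.lookup x d + int k) = - \<gamma> + ?s"
        by (simp add: single_add algebra_simps)
      have "corr a b ?y = cinner ((V ^^ (?t + k)) a) (Tr (- \<gamma> + ?s) b)"
        unfolding corr_def yt ys using yl x by (simp add: nat_add_distrib)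
      also have "Tr (- \<gamma> + ?s) b = Tr (- \<gamma>) (Tr ?s b)" using g s by (intro Tr_add) auto
      also have "cinner ((V ^^ (?t + k)) a) \<dots> = cinner (Tr \<gamma> ((V ^^ (?t + k)) a)) (Tr ?s b)"
        using g s aH by (simp add: cinner_Tr_left funpow_U_in Tr_in)
      also have "Tr \<gamma> ((V ^^ (?t + k)) a) = (V ^^ ?t) (Tr \<gamma> ((V ^^ k) a))"
        using g aH by (simp add: funpow_add funpow_V_Tr funpow_U_in)
      finally show ?thesis .
    qed
    have cl: "clinear (V ^^ ?t)" by (rule clinear_funpow[OF clinear_U])
    have "conv S q (corr a b) x = (\<Sum>k\<le>m. \<Sum>\<gamma>\<in>?C. c k \<gamma> * cinner ((V ^^ ?t) (Tr \<gamma> ((V ^^ k) a))) (Tr ?s b))"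
      unfolding conv_eq by (intro sum.cong refl) (simp add: term_eq)
    also have "\<dots> = cinner ((V ^^ ?t) (\<Sum>k\<le>m. \<Sum>\<gamma>\<in>?C. c k \<gamma> *\<^sub>C Tr \<gamma> ((V ^^ k) a))) (Tr ?s b)"
      by (simp add: clinear_sum[OF cl] clinear_scaleC[OF cl] cinner.sum_left cinner_scaleC_left)
    also have "\<dots> = 0" unfolding rel by (simp add: clinear_0[OF cl] cinner.zero_left)
    finally show ?thesis .
  qed
  have in_lat: "x \<in> lat (Suc d)" if "conv S q (corr a b) x \<noteq> 0" for x
  proof -
    from that obtain s where s: "s \<in> S" "corr a b (x - s) \<noteq> 0" by (rule conv_nonzeroE)
    then have "x - s \<in> lat (Suc d)" by (auto simp: corr_def split: if_splits)
    then have "x - s + s \<in> lat (Suc d)" using s S_lat by (intro lat_add) auto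
    then show ?thesis by simp
  qed
  have "finite_below d (conv S q (corr a b))"
    by (intro finite_below_conv finite_below_corr[OF a(1) b(1) a(2) b(2)]) (simp add: S_def J)
  then have "finite {x. conv S q (corr a b) x \<noteq> 0 \<and> Poly_Mapping.lookup x d \<le> 0}"
    by (simp add: finite_below_def)
  moreover have "{x. conv S q (corr a b) x \<noteq> 0} \<subseteq> {x. conv S q (corr a b) x \<noteq> 0 \<and> Poly_Mapping.lookup x d \<le> 0}"
    using vanish in_lat by force
  ultimately have "finite {x. conv S q (corr a b) x \<noteq> 0}" by (rule rev_finite_subset)
  moreover have "\<forall>s\<in>S. q s \<noteq> 0" by (auto simp: S_def q\<iota>) (auto simp: J_def)
  ultimately show ?thesis
    using J S_lat in_lat by (intro exI[of _ S] exI[of _ q]) (auto simp: S_def)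
qed

text \<open>By unitarity the delayed correlation at time \<open>n - k\<close> is the correlation of
  \<open>(V ^^ n) a\<close> with \<open>(V ^^ k) b\<close>. The asymptotic recurrence is therefore a
  statement about one polynomial in \<open>V\<close> applied to \<open>b\<close>.\<close>

theorem correlation_decay:
  assumes a: "supp_in ra a" "0 \<le> ra" and b: "supp_in rb b" "0 \<le> rb"
  shows "\<exists>p C. p \<noteq> 0 \<and> (\<forall>n. real n * cmod (cinner ((V ^^ n) a) (poly_op p V b)) \<le> C)"
proof -
  have aH: "a \<in> l2_space Z" and bH: "b \<in> l2_space Z" using a b supp_in_l2_space by auto
  define \<psi> where "\<psi> n = corr a b (Poly_Mapping.single d n)" for n
  have \<psi>: "\<psi> n = (if 0 \<le> n then cinner ((V ^^ nat n) a) b else 0)" for n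
    unfolding \<psi>_def by (rule corr_single[OF bH])
  obtain S q where S: "finite S" "S \<noteq> {}" "S \<subseteq> lat (Suc d)" "\<forall>s\<in>S. q s \<noteq> 0"
    "finite {x. conv S q (corr a b) x \<noteq> 0}" "\<forall>x. conv S q (corr a b) x \<noteq> 0 \<longrightarrow> x \<in> lat (Suc d)"
    using corr_annihilated[OF a b] by blast
  have "\<exists>N e. (\<exists>k\<le>N. \<exists>j\<le>N. e k j \<noteq> (0::complex)) \<and>
    (\<forall>n::int. (\<Sum>k\<le>N. (\<Sum>j\<le>N. e k j * of_int n ^ j) * corr a b (Poly_Mapping.single d (n - int k))) = 0)"
    by (rule holonomic_recurrence[OF finite_below_corr[OF a(1) b(1) a(2) b(2)] S(1,2)])
      (use S in \<open>auto simp: lat_def\<close>)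
  then obtain N e where e: "\<exists>k\<le>N. \<exists>j\<le>N. e k j \<noteq> (0::complex)"
    "\<And>n. (\<Sum>k\<le>N. (\<Sum>j\<le>N. e k j * of_int n ^ j) * \<psi> (n - int k)) = 0"
    unfolding \<psi>_def by blast
  have bd: "norm (\<psi> n) \<le> norm a * norm b" for n
    using norm_cinner_le[of "(V ^^ nat n) a" b] norm_funpow_U[OF aH, of "nat n"] by (simp add: \<psi>)
  obtain c C where c: "\<exists>k\<le>N. c k \<noteq> 0" and C: "\<And>n. n \<ge> 1 \<Longrightarrow> real n * norm (\<Sum>k\<le>N. c k * \<psi> (int n - int k)) \<le> C"
    using bounded_holonomic_asymptotic_recurrence[where N = N and e = e and \<psi> = \<psi>, OF e(2) e(1) bd] by blast
  \<comment> \<open>The coefficients are conjugated because \<open>cinner\<close> is antilinear in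
    its second argument.\<close>
  define p where "p = (\<Sum>k\<le>N. monom (cnj (c k)) k)"
  have cp: "poly.coeff p k = (if k \<le> N then cnj (c k) else 0)" for k
    by (simp add: p_def coeff_sum sum.delta)
  have "p \<noteq> 0" using c cp by (metis coeff_0 complex_cnj_zero_iff)
  have dp: "degree p \<le> N" by (rule degree_le) (simp add: cp)
  define y where "y = poly_op p V b"
  have large: "real n * cmod (cinner ((V ^^ n) a) y) \<le> C" if n: "n \<ge> Suc N" for n
  proof -
    have "cinner ((V ^^ n) a) y = (\<Sum>k\<le>N. c k * cinner ((V ^^ n) a) ((V ^^ k) b))"
      unfolding y_def poly_op_bound[OF dp] by (simp add: cinner.sum_right cinner_scaleC_right cp)
    also have "\<dots> = (\<Sum>k\<le>N. c k * \<psi> (int n - int k))"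
    proof (intro sum.cong refl arg_cong2[of _ _ _ _ "(*)"])
      fix k assume "k \<in> {..N}"
      then have k: "k \<le> n" using n by simp
      have "(V ^^ n) a = (V ^^ k) ((V ^^ (n - k)) a)" using k by (metis funpow_add comp_apply le_add_diff_inverse)
      then have "cinner ((V ^^ n) a) ((V ^^ k) b) = cinner ((V ^^ (n - k)) a) b"
        using aH bH by (simp add: funpow_U_cinner funpow_U_in)
      then show "cinner ((V ^^ n) a) ((V ^^ k) b) = \<psi> (int n - int k)"
        using k by (simp add: \<psi> flip: of_nat_diff)
    qed
    finally show ?thesis using C[of n] n by simp
  qed
  have small: "real n * cmod (cinner ((V ^^ n) a) y) \<le> real N * (norm a * norm y)" if "n \<le> N" for n
    using norm_cinner_le[of "(V ^^ n) a" y] norm_funpow_U[OF aH, of n] that by (intro mult_mono) auto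
  have "real n * cmod (cinner ((V ^^ n) a) y) \<le> max C (real N * (norm a * norm y))" for n
    using large[of n] small[of n] by (cases "n \<le> N") (auto simp: not_less_eq_eq le_max_iff_disj)
  then show ?thesis using \<open>p \<noteq> 0\<close> unfolding y_def by blast
qed

end

lemma tendsto_0_of_bounded_mult:
  assumes "\<And>n. real n * cmod (f n) \<le> C"
  shows "f \<longlonglongrightarrow> 0"
proof (rule Lim_null_comparison[OF _ lim_const_over_n[of C]])
  show "\<forall>\<^sub>F n in sequentially. cmod (f n) \<le> C / real n"
    using eventually_gt_at_top[of 0]
    by eventually_elim (use assms in \<open>simp add: pos_le_divide_eq mult.commute\<close>)
qed

lemma summable_square_of_bounded_mult:
  assumes "\<And>n. real n * cmod (f n) \<le> C"
  shows "summable (\<lambda>n. (cmod (f n))\<^sup>2)"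
proof (rule summable_comparison_test_ev)
  show "summable (\<lambda>n. C\<^sup>2 * (1 / real n ^ 2))"
    using inverse_power_summable[of 2, where 'a = real] by (intro summable_mult) (simp add: divide_inverse power_inverse)
  show "\<forall>\<^sub>F n in sequentially. norm ((cmod (f n))\<^sup>2) \<le> C\<^sup>2 * (1 / real n ^ 2)"
    using eventually_gt_at_top[of 0]
  proof eventually_elim
    case (elim n)
    then have "cmod (f n) \<le> C / real n" using assms[of n] by (simp add: pos_le_divide_eq mult.commute)
    then have "(cmod (f n))\<^sup>2 \<le> (C / real n)\<^sup>2" by (intro power_mono) auto
    then show ?case by (simp add: power_divide)
  qed
qed

lemma poly_op_linear_factor:
  assumes T: "clinear T"
  shows "poly_op ([:- s, 1:] * p) T x = T (poly_op p T x) - s *\<^sub>C poly_op p T x"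
proof -
  have "T (poly_op p T x) = poly_op p T (T x)"
    by (simp add: poly_op_def clinear_sum[OF T] clinear_scaleC[OF T] funpow_swap1)
  moreover have "[:- s, 1:] * p = smult (- s) p + pCons 0 p" by simp
  ultimately show ?thesis
    by (simp only: poly_op_add poly_op_smult poly_op_pCons) (simp add: scaleC.minus_left)
qed

context unitary_on_csubspace
begin

lemma csubspace_eigenspace: "csubspace {e \<in> H. U e = \<omega> *\<^sub>C e}"
  using csubspaceD[OF csubspace_H]
  by (auto simp: csubspace_def clinear_0[OF clinear_U] clinear_add[OF clinear_U] clinear_scaleC[OF clinear_U]
      scaleC_add_right scaleC_scaleC mult.commute)

lemma closed_eigenspace: "closed {e \<in> H. U e = \<omega> *\<^sub>C e}"
  unfolding closed_sequential_limits
proof (intro allI impI, elim conjE)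
  fix x l assume x: "\<forall>n. x n \<in> {e \<in> H. U e = \<omega> *\<^sub>C e}" "x \<longlonglongrightarrow> l"
  have lH: "l \<in> H" using closed_sequentially[OF closed_H] x by auto
  have "norm (U (x n) - U l) = norm (x n - l)" for n
    using norm_U[OF csubspace_diff[OF csubspace_H, of "x n" l]] x(1) lH by (simp add: clinear_diff[OF clinear_U])
  then have "(\<lambda>n. U (x n)) \<longlonglongrightarrow> U l"
    using x(2) by (simp add: tendsto_iff dist_norm)
  moreover have "(\<lambda>n. U (x n)) = (\<lambda>n. \<omega> *\<^sub>C x n)" using x(1) by auto
  moreover have "(\<lambda>n. \<omega> *\<^sub>C x n) \<longlonglongrightarrow> \<omega> *\<^sub>C l" by (intro scaleC.tendsto tendsto_const x(2))
  ultimately have "U l = \<omega> *\<^sub>C l" using LIMSEQ_unique by metis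
  then show "l \<in> {e \<in> H. U e = \<omega> *\<^sub>C e}" using lH by simp
qed

lemma funpow_eigenvector: "U e = \<omega> *\<^sub>C e \<Longrightarrow> (U ^^ n) e = \<omega> ^ n *\<^sub>C e"
  by (induction n) (auto simp: clinear_scaleC[OF clinear_U] scaleC_scaleC mult.commute)

end

context lattice_walk
begin

text \<open>The decay theorem needs finite support, which the projected vector need not have. The
  extra factor \<open>V - \<omega>\<close> on the other side is orthogonal to the eigenspace, so
  there the correlations of the projected vector and of \<open>w\<close> agree; the enlarged
  polynomial is then absorbed.\<close>

lemma decay_off_eigenspace:
  assumes only: "\<And>e s. \<lbrakk>e \<in> l2_space Z; e \<noteq> 0; V e = s *\<^sub>C e\<rbrakk> \<Longrightarrow> s = \<omega>"
    and w: "supp_in rw w" "0 \<le> rw" and b: "supp_in rb b" "0 \<le> rb"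
  shows "(\<lambda>n. cinner ((V ^^ n) (w - proj {e \<in> l2_space Z. V e = \<omega> *\<^sub>C e} w)) b) \<longlonglongrightarrow> 0"
proof -
  let ?K = "{e \<in> l2_space Z. V e = \<omega> *\<^sub>C e}"
  note K = csubspace_eigenspace[of \<omega>] closed_eigenspace[of \<omega>]
  have wH: "w \<in> l2_space Z" and bH: "b \<in> l2_space Z" using w b supp_in_l2_space by auto
  define \<pi> where "\<pi> = proj ?K w"
  have \<pi>K: "\<pi> \<in> ?K" unfolding \<pi>_def by (rule proj_in[OF K])
  define u where "u = w - \<pi>"
  have uH: "u \<in> l2_space Z" unfolding u_def using wH \<pi>K by (intro csubspace_diff[OF csubspace_H]) auto
  obtain p C where p: "p \<noteq> 0" "\<And>n. real n * cmod (cinner ((V ^^ n) w) (poly_op p V b)) \<le> C"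
    using correlation_decay[OF w b] by blast
  define y where "y = poly_op p V b"
  have yH: "y \<in> l2_space Z"
    unfolding y_def using U_image bH by (intro poly_op_in[OF csubspace_H]) auto
  have wy: "(\<lambda>n. cinner ((V ^^ n) w) y) \<longlonglongrightarrow> 0"
    unfolding y_def by (rule tendsto_0_of_bounded_mult[OF p(2)])
  have wVy: "(\<lambda>n. cinner ((V ^^ n) w) (V y)) \<longlonglongrightarrow> 0"
  proof (rule LIMSEQ_imp_Suc)
    have "cinner ((V ^^ Suc n) w) (V y) = cinner ((V ^^ n) w) y" for n
      using wH yH by (simp add: U_cinner funpow_U_in)
    then show "(\<lambda>n. cinner ((V ^^ Suc n) w) (V y)) \<longlonglongrightarrow> 0" using wy by simp
  qed
  have \<pi>y: "cinner \<pi> (V y - \<omega> *\<^sub>C y) = 0"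
  proof (cases "\<pi> = 0")
    case False
    then have "cinner (V y) \<pi> = \<omega> * cinner y \<pi>"
      using cinner_U_eigenvector[of \<pi> \<omega> y] \<pi>K yH by auto
    then have "cinner \<pi> (V y) = cnj \<omega> * cinner \<pi> y"
      by (metis cinner_commute complex_cnj_mult)
    then show ?thesis by (simp add: cinner.diff_right cinner_scaleC_right)
  qed (simp add: cinner.zero_left)
  have "cinner ((V ^^ n) u) (V y - \<omega> *\<^sub>C y) = cinner ((V ^^ n) w) (V y) - cnj \<omega> * cinner ((V ^^ n) w) y" for n
  proof -
    have "(V ^^ n) \<pi> = \<omega> ^ n *\<^sub>C \<pi>" using \<pi>K by (intro funpow_eigenvector) auto
    then have "cinner ((V ^^ n) \<pi>) (V y - \<omega> *\<^sub>C y) = 0" by (simp add: cinner_scaleC_left \<pi>y)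
    then have "cinner ((V ^^ n) u) (V y - \<omega> *\<^sub>C y) = cinner ((V ^^ n) w) (V y - \<omega> *\<^sub>C y)"
      by (simp add: u_def clinear_diff[OF clinear_funpow[OF clinear_U]] cinner.diff_left)
    then show ?thesis by (simp add: cinner.diff_right cinner_scaleC_right)
  qed
  moreover have "(\<lambda>n. cinner ((V ^^ n) w) (V y) - cnj \<omega> * cinner ((V ^^ n) w) y) \<longlonglongrightarrow> 0 - cnj \<omega> * 0"
    by (intro tendsto_intros wVy wy)
  ultimately have lim: "(\<lambda>n. cinner ((V ^^ n) u) (poly_op ([:- \<omega>, 1:] * p) V b)) \<longlonglongrightarrow> 0"
    unfolding poly_op_linear_factor[OF clinear_U] y_def by simp
  have "cinner u e = 0" if "e \<in> l2_space Z" "e \<noteq> 0" "V e = s *\<^sub>C e" for e s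
    unfolding u_def \<pi>_def using only[OF that] that by (intro proj_orthogonal[OF K]) auto
  moreover have "[:- \<omega>, 1:] * p \<noteq> 0" using p(1) by (simp only: mult_eq_0_iff) simp
  ultimately have "(\<lambda>n. cinner ((V ^^ n) u) b) \<longlonglongrightarrow> 0"
    using cinner_funpow_tendsto_0[OF uH _ bH _ lim] by blast
  then show ?thesis by (simp add: u_def \<pi>_def)
qed

text \<open>Finitely supported vectors are dense and all powers are isometric, so weak decay extends
  to every \<open>u\<close>; at one site of finite dimension it is decay in norm. The hypothesis
  also admits a walk without eigenvalues, where the projection is 0.\<close>

lemma asymptotics_single_eigenvalue:
  assumes only: "\<And>e s. \<lbrakk>e \<in> l2_space Z; e \<noteq> 0; V e = s *\<^sub>C e\<rbrakk> \<Longrightarrow> s = \<omega>"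
    and u: "u \<in> l2_space Z" and x: "x \<in> Z"
  shows "(\<lambda>n. ell2_fun ((V ^^ n) u) x - \<omega> ^ n *\<^sub>C ell2_fun (proj {e \<in> l2_space Z. V e = \<omega> *\<^sub>C e} u) x) \<longlonglongrightarrow> 0"
proof -
  let ?K = "{e \<in> l2_space Z. V e = \<omega> *\<^sub>C e}"
  note K = csubspace_eigenspace[of \<omega>] closed_eigenspace[of \<omega>]
  note cl = clinear_funpow[OF clinear_U]
  have rest: "f - proj ?K f \<in> l2_space Z" if "f \<in> l2_space Z" for f
    using that proj_in[OF K, of f] by (intro csubspace_diff[OF csubspace_H]) auto
  have weak: "(\<lambda>n. cinner ((V ^^ n) (u - proj ?K u)) (ket x v)) \<longlonglongrightarrow> 0" for v
  proof (rule LIMSEQ_I)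
    fix r :: real assume r: "0 < r"
    define \<epsilon> where "\<epsilon> = r / (2 * (norm (ket x v) + 1))"
    have n1: "0 < norm (ket x v) + 1" by (intro add_nonneg_pos) auto
    have \<epsilon>: "0 < \<epsilon>" using r n1 by (simp add: \<epsilon>_def)
    obtain F where F: "finite F" "norm (u - ell2_restrict F u) < \<epsilon>"
      using ell2_restrict_approximation[OF \<epsilon>] by blast
    define w where "w = ell2_restrict F u"
    have wH: "w \<in> l2_space Z" using u by (auto simp: w_def l2_space_def ell2_restrict.rep_eq)
    have "finite {x. ell2_fun w x \<noteq> 0}"
      by (rule finite_subset[OF _ F(1)]) (auto simp: w_def ell2_restrict.rep_eq)
    then obtain rw where "0 \<le> rw" "supp_in rw w" using supp_in_finite[OF wH] by blast
    moreover obtain rb where "0 \<le> rb" "supp_in rb (ket x v)" using supp_in_ket[OF x] by blast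
    ultimately have "(\<lambda>n. cinner ((V ^^ n) (w - proj ?K w)) (ket x v)) \<longlonglongrightarrow> 0"
      using decay_off_eigenspace[of \<omega> rw w rb "ket x v"] only by blast
    from LIMSEQ_D[OF this, of "r / 2"] r obtain N
      where N: "\<And>n. n \<ge> N \<Longrightarrow> norm (cinner ((V ^^ n) (w - proj ?K w)) (ket x v)) < r / 2" by auto
    have "norm (cinner ((V ^^ n) (u - proj ?K u)) (ket x v)) < r" if n: "n \<ge> N" for n
    proof -
      let ?z = "(u - w) - proj ?K (u - w)"
      have uwH: "u - w \<in> l2_space Z" using u wH by (intro csubspace_diff[OF csubspace_H])
      have "u - proj ?K u = (w - proj ?K w) + ?z" by (simp add: proj_diff[OF K])
      then have "cinner ((V ^^ n) (u - proj ?K u)) (ket x v) =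
          cinner ((V ^^ n) (w - proj ?K w)) (ket x v) + cinner ((V ^^ n) ?z) (ket x v)"
        by (simp only: clinear_add[OF cl] cinner.add_left)
      moreover have "norm (cinner ((V ^^ n) ?z) (ket x v)) \<le> r / 2"
      proof -
        have "norm (cinner ((V ^^ n) ?z) (ket x v)) \<le> norm ?z * norm (ket x v)"
          using norm_cinner_le[of "(V ^^ n) ?z" "ket x v"] norm_funpow_U[OF rest[OF uwH], of n] by simp
        also have "\<dots> \<le> norm (u - w) * norm (ket x v)"
          by (intro mult_right_mono norm_diff_proj_le[OF K]) simp
        also have "\<dots> \<le> \<epsilon> * (norm (ket x v) + 1)"
          using F(2) \<epsilon> by (intro mult_mono) (auto simp: w_def)
        also have "\<dots> = r / 2" using n1 by (simp add: \<epsilon>_def field_simps)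
        finally show ?thesis .
      qed
      ultimately show ?thesis
        using N[OF n] norm_triangle_ineq[of "cinner ((V ^^ n) (w - proj ?K w)) (ket x v)" "cinner ((V ^^ n) ?z) (ket x v)"]
        by simp
    qed
    then show "\<exists>no. \<forall>n\<ge>no. norm (cinner ((V ^^ n) (u - proj ?K u)) (ket x v) - 0) < r" by auto
  qed
  have "(\<lambda>n. ell2_fun ((V ^^ n) (u - proj ?K u)) x) \<longlonglongrightarrow> 0"
  proof (rule fin_dim_tendstoI)
    fix e
    from tendsto_Re[OF weak[of e]]
    show "(\<lambda>n. inner (ell2_fun ((V ^^ n) (u - proj ?K u)) x) e) \<longlonglongrightarrow> inner 0 e"
      by (simp add: cinner_ket Re_cinner)
  qed
  moreover have "(V ^^ n) (proj ?K u) = \<omega> ^ n *\<^sub>C proj ?K u" for n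
    using proj_in[OF K, of u] by (intro funpow_eigenvector) auto
  ultimately show ?thesis
    by (simp add: clinear_diff[OF cl] minus_ell2.rep_eq scaleC_ell2.rep_eq)
qed

text \<open>For a point mass \<open>u\<close> the vector \<open>p(V) u\<close> has square summable
  autocorrelations, so \<open>E \<Lambda>\<close> kills it. Since \<open>E\<close> commutes with
  \<open>V\<close>, the polynomial \<open>p(V)\<close> kills \<open>E \<Lambda> u\<close>, which is
  thus orthogonal to the continuous vector \<open>w\<close>. Hence \<open>E \<Lambda> w\<close> is
  orthogonal to all point masses.\<close>

lemma continuous_part_null:
  assumes E: "spectral_resolution V E" and E_in: "\<And>A f. A \<in> sets circle_borel \<Longrightarrow> E A f \<in> l2_space Z"
    and \<Lambda>: "\<Lambda> \<in> null_sets circle_lebesgue"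
    and w: "w \<in> l2_space Z" "\<And>e s. \<lbrakk>e \<in> l2_space Z; e \<noteq> 0; V e = s *\<^sub>C e\<rbrakk> \<Longrightarrow> cinner w e = 0"
  shows "E \<Lambda> w = 0"
proof -
  interpret E: spectral_resolution V E by (rule E)
  have \<Lambda>s: "\<Lambda> \<in> sets circle_borel" using \<Lambda> by (auto simp: null_sets_def)
  have orth: "cinner (E \<Lambda> w) (ket x v) = 0" if x: "x \<in> Z" for x v
  proof -
    define u where "u = ket x v"
    obtain r where r: "0 \<le> r" "supp_in r u" using supp_in_ket[OF x] u_def by blast
    have uH: "u \<in> l2_space Z" using r supp_in_l2_space by blast
    obtain p C where p: "p \<noteq> 0" "\<And>n. real n * cmod (cinner ((V ^^ n) u) (poly_op p V u)) \<le> C"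
      using correlation_decay[OF r(2,1) r(2,1)] by blast
    define u' where "u' = poly_op p V u"
    \<comment> \<open>Only the left copy of \<open>u'\<close> is expanded; its terms sit at the
      later times \<open>n + k\<close>, where the factor \<open>n\<close> is below
      \<open>n + k\<close>.\<close>
    have "real n * cmod (cinner ((V ^^ n) u') u') \<le> (\<Sum>k\<le>degree p. cmod (poly.coeff p k) * C)" for n
    proof -
      note cl = clinear_funpow[OF clinear_U, of n]
      have "cinner ((V ^^ n) u') u' = (\<Sum>k\<le>degree p. poly.coeff p k * cinner ((V ^^ (n + k)) u) u')"
        unfolding u'_def[unfolded poly_op_def]
        by (simp add: clinear_sum[OF cl] clinear_scaleC[OF cl] cinner.sum_left cinner_scaleC_left funpow_add)
      then have "cmod (cinner ((V ^^ n) u') u') \<le> (\<Sum>k\<le>degree p. cmod (poly.coeff p k) * cmod (cinner ((V ^^ (n + k)) u) u'))"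
        using norm_sum[of "\<lambda>k. poly.coeff p k * cinner ((V ^^ (n + k)) u) u'" "{..degree p}"] by (simp add: norm_mult)
      then have "real n * cmod (cinner ((V ^^ n) u') u')
          \<le> real n * (\<Sum>k\<le>degree p. cmod (poly.coeff p k) * cmod (cinner ((V ^^ (n + k)) u) u'))"
        by (rule mult_left_mono) simp
      also have "\<dots> = (\<Sum>k\<le>degree p. cmod (poly.coeff p k) * (real n * cmod (cinner ((V ^^ (n + k)) u) u')))"
        by (simp add: sum_distrib_left mult_ac)
      also have "\<dots> \<le> (\<Sum>k\<le>degree p. cmod (poly.coeff p k) * C)"
      proof (intro sum_mono mult_left_mono)
        fix k
        have "real n * cmod (cinner ((V ^^ (n + k)) u) u') \<le> real (n + k) * cmod (cinner ((V ^^ (n + k)) u) u')"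
          by (intro mult_right_mono) auto
        also have "\<dots> \<le> C" unfolding u'_def by (rule p(2))
        finally show "real n * cmod (cinner ((V ^^ (n + k)) u) u') \<le> C" .
      qed simp
      finally show ?thesis .
    qed
    then have "summable (\<lambda>n. (cmod (cinner ((V ^^ n) u') u'))\<^sup>2)" by (rule summable_square_of_bounded_mult)
    then have "E \<Lambda> u' = 0" by (rule E.E_null[OF \<Lambda>])
    then have z: "poly_op p V (E \<Lambda> u) = 0" by (simp add: u'_def E.E_poly_op[OF \<Lambda>s])
    have "cinner w (E \<Lambda> u) = 0"
      by (rule annihilated_orthogonal_continuous_part[OF w(1) _ E_in[OF \<Lambda>s] p(1) z]) (rule w(2))
    then show ?thesis by (simp add: u_def E.E_selfadjoint[OF \<Lambda>s])
  qed
  show ?thesis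
  proof (rule ell2_eqI)
    fix x
    show "ell2_fun (E \<Lambda> w) x = ell2_fun 0 x"
    proof (cases "x \<in> Z")
      case True
      then show ?thesis
        using orth[OF True, of "ell2_fun (E \<Lambda> w) x"] by (simp add: cinner_ket cinner_self zero_ell2.rep_eq)
    next
      case False
      then show ?thesis using E_in[OF \<Lambda>s, of w] by (simp add: l2_space_def zero_ell2.rep_eq)
    qed
  qed
qed

end

section \<open>Quasi-periodic eigenfunctions\<close>

lemma ket_add: "ket x (v + w) = ket x v + ket x w"
  by (rule ell2_eqI) (simp add: ell2_fun_ket plus_ell2.rep_eq)

lemma ket_scaleC: "ket x (c *\<^sub>C v) = c *\<^sub>C ket x v"
  by (rule ell2_eqI) (simp add: ell2_fun_ket scaleC_ell2.rep_eq)

lemma ket_0 [simp]: "ket x 0 = 0"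
  by (rule ell2_eqI) (simp add: ell2_fun_ket zero_ell2.rep_eq)

lemma ell2_fun_0 [simp]: "ell2_fun 0 x = 0"
  by (simp add: zero_ell2.rep_eq)

context lattice_walk
begin

definition near :: "'z \<Rightarrow> 'z set" where
  "near y = {x \<in> Z. pos x - pos y \<in> cube d (- \<rho>) (\<rho> + 1)}"

lemma finite_near: "y \<in> Z \<Longrightarrow> finite (near y)"
proof -
  assume y: "y \<in> Z"
  have "near y \<subseteq> (\<lambda>(x, c). sh (c + pos y) x) ` (F0 \<times> cube d (- \<rho>) (\<rho> + 1))"
  proof
    fix x assume "x \<in> near y"
    then show "x \<in> (\<lambda>(x, c). sh (c + pos y) x) ` (F0 \<times> cube d (- \<rho>) (\<rho> + 1))"
      by (auto simp: near_def base_in sh_pos_base intro!: image_eqI[of _ _ "(base x, pos x - pos y)"])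
  qed
  then show ?thesis by (rule finite_subset) (use finite_F0 in auto)
qed

lemma near_self: "y \<in> Z \<Longrightarrow> y \<in> near y"
  using \<rho>_nonneg by (simp add: near_def)

lemma near_propagation:
  assumes "x \<in> Z" "ell2_fun (V (ket x v)) y \<noteq> 0"
  shows "x \<in> near y"
proof -
  have "pos y - pos x \<in> cube d (- \<rho>) (\<rho> + 1)" using propagation[OF assms] by simp
  from cube_uminus[OF this] show ?thesis using assms by (simp add: near_def)
qed

text \<open>The extension of \<open>V\<close> to arbitrary functions. The finite set
  \<open>near y\<close> contains every site that can influence \<open>y\<close>, independently of
  \<open>f\<close>, so linearity is immediate.\<close>

definition ext :: "('z \<Rightarrow> 'w) \<Rightarrow> 'z \<Rightarrow> 'w" where
  "ext f y = (\<Sum>x\<in>near y. ell2_fun (V (ket x (f x))) y)"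

lemma ext_sum: "ext (\<lambda>x. \<Sum>i\<in>I. c i *\<^sub>C f i x) y = (\<Sum>i\<in>I. c i *\<^sub>C ext (f i) y)"
proof -
  have "ket x (\<Sum>i\<in>I. c i *\<^sub>C f i x) = (\<Sum>i\<in>I. c i *\<^sub>C ket x (f i x))" for x
    by (induction I rule: infinite_finite_induct) (auto simp: ket_add ket_scaleC)
  then have "ext (\<lambda>x. \<Sum>i\<in>I. c i *\<^sub>C f i x) y = (\<Sum>x\<in>near y. \<Sum>i\<in>I. c i *\<^sub>C ell2_fun (V (ket x (f i x))) y)"
    by (simp add: ext_def clinear_sum[OF clinear_U] clinear_scaleC[OF clinear_U] ell2_fun_sum scaleC_ell2.rep_eq)
  also have "\<dots> = (\<Sum>i\<in>I. \<Sum>x\<in>near y. c i *\<^sub>C ell2_fun (V (ket x (f i x))) y)" by (rule sum.swap)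
  finally show ?thesis by (simp add: ext_def scaleC.sum_right)
qed

text \<open>The value at \<open>y\<close> depends on \<open>f\<close> near \<open>y\<close> only, so
  \<open>f\<close> may be replaced there by a finitely supported function, on which \<open>V\<close>
  itself acts.\<close>

lemma ext_eq_V:
  assumes h: "supp_in r h" and y: "y \<in> Z" and agree: "\<And>x. x \<in> near y \<Longrightarrow> ell2_fun h x = f x"
  shows "ext f y = ell2_fun (V h) y"
proof -
  let ?A = "Zcube (- r) (r + 1)"
  have "ell2_fun (V h) y = (\<Sum>x\<in>?A. ell2_fun (V (ket x (ell2_fun h x))) y)"
    using h by (intro ell2_fun_V_finite) (auto simp: supp_in_def)
  also have "\<dots> = (\<Sum>x\<in>?A \<inter> near y. ell2_fun (V (ket x (ell2_fun h x))) y)"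
    by (intro sum.mono_neutral_right finite_Zcube) (use near_propagation in \<open>auto simp: Zcube_def\<close>)
  also have "\<dots> = (\<Sum>x\<in>near y. ell2_fun (V (ket x (ell2_fun h x))) y)"
  proof (rule sum.mono_neutral_left[OF finite_near[OF y]])
    show "\<forall>x\<in>near y - ?A \<inter> near y. ell2_fun (V (ket x (ell2_fun h x))) y = 0"
    proof
      fix x assume "x \<in> near y - ?A \<inter> near y"
      then have "ell2_fun h x = 0" using h by (auto simp: supp_in_def)
      then show "ell2_fun (V (ket x (ell2_fun h x))) y = 0" by (simp add: clinear_0[OF clinear_U])
    qed
  qed simp
  also have "\<dots> = ext f y" unfolding ext_def by (intro sum.cong refl) (simp add: agree)
  finally show ?thesis ..
qed

definition localized_eigenvalue :: "complex \<Rightarrow> bool" where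
  "localized_eigenvalue \<omega> \<longleftrightarrow> (\<exists>g r. g \<noteq> 0 \<and> 0 \<le> r \<and> supp_in r g \<and> V g = \<omega> *\<^sub>C g)"

definition character :: "((nat \<Rightarrow>\<^sub>0 int) \<Rightarrow> complex) \<Rightarrow> bool" where
  "character \<kappa> \<longleftrightarrow> (\<forall>a\<in>lat d. \<forall>b\<in>lat d. \<kappa> (a + b) = \<kappa> a * \<kappa> b) \<and> (\<forall>a\<in>lat d. cmod (\<kappa> a) = 1)"

definition qp_eigenfunction :: "((nat \<Rightarrow>\<^sub>0 int) \<Rightarrow> complex) \<Rightarrow> complex \<Rightarrow> ('z \<Rightarrow> 'w) \<Rightarrow> bool" where
  "qp_eigenfunction \<kappa> \<omega> f \<longleftrightarrow> (\<exists>x\<in>Z. f x \<noteq> 0) \<and> (\<forall>x. x \<notin> Z \<longrightarrow> f x = 0) \<and>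
     (\<forall>c\<in>lat d. \<forall>x\<in>Z. f (sh c x) = \<kappa> c *\<^sub>C f x) \<and> (\<forall>y\<in>Z. ext f y = \<omega> *\<^sub>C f y)"

lemma
  assumes "character \<kappa>"
  shows character_add: "\<lbrakk>a \<in> lat d; b \<in> lat d\<rbrakk> \<Longrightarrow> \<kappa> (a + b) = \<kappa> a * \<kappa> b"
    and character_nonzero: "a \<in> lat d \<Longrightarrow> \<kappa> a \<noteq> 0"
    and character_0: "\<kappa> 0 = 1"
    and character_uminus: "a \<in> lat d \<Longrightarrow> \<kappa> (- a) = inverse (\<kappa> a)"
proof -
  show add: "\<kappa> (a + b) = \<kappa> a * \<kappa> b" if "a \<in> lat d" "b \<in> lat d" for a b
    using assms that by (auto simp: character_def)
  show nz: "\<kappa> a \<noteq> 0" if "a \<in> lat d" for a using assms that by (force simp: character_def)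
  show z: "\<kappa> 0 = 1" using add[of 0 0] nz[of 0] by simp
  show "\<kappa> (- a) = inverse (\<kappa> a)" if "a \<in> lat d"
  proof -
    have "\<kappa> a * \<kappa> (- a) = 1" using add[of a "- a"] that z by simp
    then show ?thesis using nz[OF that] by (simp add: field_simps)
  qed
qed

text \<open>Substituting \<open>c = a - pos x\<close> moves the sum onto the support of
  \<open>g\<close>. The range no longer depends on \<open>x\<close>, which lets one formula define
  the periodization globally.\<close>

lemma weighted_orbit_sum:
  assumes g: "supp_in r g" "0 \<le> r" and x: "x \<in> Z" "pos x \<in> cube d (- \<tau>) (\<tau> + 1)"
  shows "(\<Sum>c\<in>cube d (- (r + \<tau>)) (r + \<tau> + 1). e c *\<^sub>C ell2_fun g (sh c x)) =
    (\<Sum>a\<in>cube d (- r) (r + 1). e (a - pos x) *\<^sub>C ell2_fun g (sh a (base x)))"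
proof -
  let ?D = "cube d (- r) (r + 1)"
  have px: "pos x \<in> lat d" and bx: "base x \<in> F0" "base x \<in> Z"
    using x pos_lat base_in F0_subset by auto
  have img: "a - pos x \<in> cube d (- (r + \<tau>)) (r + \<tau> + 1)" if "a \<in> ?D" for a
    using cube_add[OF that cube_uminus[OF x(2)]] by simp
  have shx: "sh (a - pos x) x = sh a (base x)" if "a \<in> ?D" for a
  proof -
    have "a \<in> lat d" using that cube_subset_lat by blast
    then show ?thesis using sh_sh[of "a - pos x" x] x px by (simp add: lat_diff)
  qed
  have "(\<Sum>a\<in>?D. e (a - pos x) *\<^sub>C ell2_fun g (sh a (base x))) =
      (\<Sum>a\<in>?D. e (a - pos x) *\<^sub>C ell2_fun g (sh (a - pos x) x))"
    by (intro sum.cong refl) (simp add: shx)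
  also have "\<dots> = (\<Sum>c\<in>(\<lambda>a. a - pos x) ` ?D. e c *\<^sub>C ell2_fun g (sh c x))"
    by (subst sum.reindex) (auto simp: inj_on_def)
  also have "\<dots> = (\<Sum>c\<in>cube d (- (r + \<tau>)) (r + \<tau> + 1). e c *\<^sub>C ell2_fun g (sh c x))"
  proof (rule sum.mono_neutral_left)
    show "\<forall>c\<in>cube d (- (r + \<tau>)) (r + \<tau> + 1) - (\<lambda>a. a - pos x) ` ?D. e c *\<^sub>C ell2_fun g (sh c x) = 0"
    proof
      fix c assume c: "c \<in> cube d (- (r + \<tau>)) (r + \<tau> + 1) - (\<lambda>a. a - pos x) ` ?D"
      have "ell2_fun g (sh c x) = 0"
      proof (rule ccontr)
        assume "ell2_fun g (sh c x) \<noteq> 0"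
        then have "pos (sh c x) \<in> ?D" using g by (auto simp: supp_in_def Zcube_def)
        moreover have "c \<in> lat d" using c cube_subset_lat by blast
        ultimately have "c + pos x \<in> ?D" using x by (simp add: pos_sh)
        then have "c \<in> (\<lambda>a. a - pos x) ` ?D" by (intro image_eqI[of _ _ "c + pos x"]) auto
        then show False using c by blast
      qed
      then show "e c *\<^sub>C ell2_fun g (sh c x) = 0" by simp
    qed
  qed (use img in auto)
  finally show ?thesis ..
qed

text \<open>The naive periodization of a localized eigenfunction may vanish for a given character.
  Weighting it with powers of an additive functional amounts to differentiating in the
  character; the lowest nonvanishing derivative is again quasi-periodic.\<close>

lemma localized_imp_qp_eigenfunction:
  assumes loc: "localized_eigenvalue \<omega>" and \<kappa>: "character \<kappa>"
  shows "\<exists>f. qp_eigenfunction \<kappa> \<omega> f"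
proof -
  obtain g r where g: "g \<noteq> 0" "0 \<le> r" "supp_in r g" "V g = \<omega> *\<^sub>C g"
    using loc by (auto simp: localized_eigenvalue_def)
  let ?D = "cube d (- r) (r + 1)"
  have Dl: "a \<in> lat d" if "a \<in> ?D" for a using that cube_subset_lat by blast
  obtain l :: "(nat \<Rightarrow>\<^sub>0 int) \<Rightarrow> int" where l: "\<And>x y. l (x + y) = l x + l y" "inj_on l ?D"
    using additive_functional_inj_on[of ?D] by auto
  have l0: "l 0 = 0" using l(1)[of 0 0] by simp
  have lm: "l (x - y) = l x - l y" for x y using l(1)[of "x - y" y] by simp
  \<comment> \<open>Up to a sign convention these weights are the derivatives of order
    \<open>k\<close> at 0 of the inverse character twisted by the exponential of a multiple of
    \<open>l\<close>.\<close>
  define e where "e k c = inverse (\<kappa> c) * of_int (l c) ^ k" for k :: nat and c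
  define f where "f k x = (if x \<in> Z then \<Sum>a\<in>?D. e k (a - pos x) *\<^sub>C ell2_fun g (sh a (base x)) else 0)" for k x
  have ex: "\<exists>k. \<exists>x\<in>Z. f k x \<noteq> 0"
  proof (rule ccontr)
    assume "\<not> ?thesis"
    then have f0: "f k x = 0" if "x \<in> Z" for k x using that by blast
    obtain x1 where x1: "ell2_fun g x1 \<noteq> 0" using g(1) ell2_eqI[of g 0] by auto
    then have x1Z: "x1 \<in> Z" "pos x1 \<in> ?D" using g(3) by (auto simp: supp_in_def Zcube_def)
    define x0 where "x0 = base x1"
    have x0: "x0 \<in> F0" "x0 \<in> Z" "sh (pos x1) x0 = x1"
      using base_in x1Z F0_subset sh_pos_base by (auto simp: x0_def)
    have x0p: "pos x0 = 0" "base x0 = x0" using pos_sh_F0[of 0 x0] base_sh_F0[of 0 x0] x0 by (auto simp: sh_0)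
    let ?w = "\<lambda>a. inverse (\<kappa> a) *\<^sub>C ell2_fun g (sh a x0)"
    have mono: "(\<Sum>a\<in>?D. of_int (l a) ^ k *\<^sub>C ?w a) = 0" for k
      using f0[OF x0(2), of k] x0 x0p by (simp add: f_def e_def scaleC_scaleC mult.commute)
    have pol: "(\<Sum>a\<in>?D. poly P (of_int (l a)) *\<^sub>C ?w a) = 0" for P
    proof -
      have "poly P (of_int (l a)) *\<^sub>C ?w a = (\<Sum>k\<le>degree P. poly.coeff P k *\<^sub>C (of_int (l a) ^ k *\<^sub>C ?w a))" for a
        by (simp only: poly_altdef scaleC.sum_left scaleC_scaleC sum_distrib_right mult.assoc)
      then have "(\<Sum>a\<in>?D. poly P (of_int (l a)) *\<^sub>C ?w a) =
          (\<Sum>a\<in>?D. \<Sum>k\<le>degree P. poly.coeff P k *\<^sub>C (of_int (l a) ^ k *\<^sub>C ?w a))" by simp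
      also have "\<dots> = (\<Sum>k\<le>degree P. \<Sum>a\<in>?D. poly.coeff P k *\<^sub>C (of_int (l a) ^ k *\<^sub>C ?w a))" by (rule sum.swap)
      also have "\<dots> = (\<Sum>k\<le>degree P. poly.coeff P k *\<^sub>C (\<Sum>a\<in>?D. of_int (l a) ^ k *\<^sub>C ?w a))"
        by (simp only: scaleC.sum_right)
      also have "\<dots> = 0" by (simp only: mono scaleC_zero_right sum.neutral_const)
      finally show ?thesis .
    qed
    \<comment> \<open>If all weighted sums vanished, so would all sums weighted by polynomials in
      \<open>l\<close>. This interpolation polynomial is nonzero at \<open>pos x1\<close> only,
      which isolates the nonzero value of \<open>g\<close> at \<open>x1\<close>; injectivity of
      \<open>l\<close> is what allows it.\<close>
    define P where "P = (\<Prod>a\<in>?D - {pos x1}. [:- of_int (l a), 1:] :: complex poly)"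
    have Pz: "poly P (of_int (l a)) = 0" if "a \<in> ?D" "a \<noteq> pos x1" for a
      using that unfolding P_def poly_prod by (intro prod_zero) auto
    have Pnz: "poly P (of_int (l (pos x1))) \<noteq> 0"
    proof -
      have neq: "l a \<noteq> l (pos x1)" if "a \<in> ?D - {pos x1}" for a using l(2) x1Z(2) that by (auto dest: inj_onD)
      then have "poly [:- of_int (l a), 1:] (of_int (l (pos x1)) :: complex) \<noteq> 0" if "a \<in> ?D - {pos x1}" for a
        using neq[OF that] by auto
      then show ?thesis unfolding P_def poly_prod by (simp add: prod_zero_iff del: poly_pCons)
    qed
    have "(\<Sum>a\<in>?D. poly P (of_int (l a)) *\<^sub>C ?w a) = (\<Sum>a\<in>{pos x1}. poly P (of_int (l a)) *\<^sub>C ?w a)"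
      using x1Z Pz by (intro sum.mono_neutral_right) auto
    then have "poly P (of_int (l (pos x1))) *\<^sub>C ?w (pos x1) = 0" using pol[of P] by simp
    then show False
      using Pnz x1 x0 character_nonzero[OF \<kappa> Dl[OF x1Z(2)]] by simp
  qed
  define k where "k = (LEAST k. \<exists>x\<in>Z. f k x \<noteq> 0)"
  have k: "\<exists>x\<in>Z. f k x \<noteq> 0" unfolding k_def by (rule LeastI_ex[OF ex])
  have less: "f j x = 0" if "j < k" for j x
    using not_less_Least[of j "\<lambda>k. \<exists>x\<in>Z. f k x \<noteq> 0"] that by (auto simp: k_def f_def)
  have qp: "f k (sh c x) = \<kappa> c *\<^sub>C f k x" if c: "c \<in> lat d" and x: "x \<in> Z" for c x
  proof -
    \<comment> \<open>A shift replaces \<open>l\<close> by \<open>l - l c\<close> in the weight. The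
      binomial theorem then expresses the shifted function through orders \<open>j \<le> k\<close>,
      of which only \<open>j = k\<close> survives by minimality.\<close>
    have coef: "e k (a - pos (sh c x)) = \<kappa> c * (\<Sum>j\<le>k. of_nat (k choose j) * of_int (- l c) ^ (k - j) * e j (a - pos x))"
      if a: "a \<in> ?D" for a
    proof -
      have lats: "a - pos x \<in> lat d" "- c \<in> lat d" using Dl[OF a] c pos_lat[OF x] by (auto simp: lat_diff)
      have "a - pos (sh c x) = (a - pos x) + - c" using c x by (simp add: pos_sh)
      then have "\<kappa> (a - pos (sh c x)) = \<kappa> (a - pos x) * inverse (\<kappa> c)"
        by (simp only: character_add[OF \<kappa> lats] character_uminus[OF \<kappa> c])
      then have inv: "inverse (\<kappa> (a - pos (sh c x))) = \<kappa> c * inverse (\<kappa> (a - pos x))" by simp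
      have "l (a - pos (sh c x)) = l (a - pos x) + - l c" using c x by (simp add: pos_sh lm l(1))
      then have "complex_of_int (l (a - pos (sh c x))) ^ k = (of_int (l (a - pos x)) + of_int (- l c)) ^ k"
        by (simp only: of_int_add)
      also have "\<dots> = (\<Sum>j\<le>k. of_nat (k choose j) * of_int (l (a - pos x)) ^ j * of_int (- l c) ^ (k - j))"
        by (rule binomial_ring)
      finally show ?thesis
        unfolding e_def inv by (simp add: sum_distrib_left mult_ac)
    qed
    have "f k (sh c x) = (\<Sum>a\<in>?D. (\<kappa> c * (\<Sum>j\<le>k. of_nat (k choose j) * of_int (- l c) ^ (k - j) * e j (a - pos x)))
        *\<^sub>C ell2_fun g (sh a (base x)))"
      unfolding f_def using c x by (simp add: sh_in base_sh coef del: of_int_minus)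
    also have "\<dots> = (\<Sum>a\<in>?D. \<Sum>j\<le>k. (\<kappa> c * of_nat (k choose j) * of_int (- l c) ^ (k - j)) *\<^sub>C
        (e j (a - pos x) *\<^sub>C ell2_fun g (sh a (base x))))"
      by (simp only: sum_distrib_left scaleC.sum_left scaleC_scaleC mult.assoc)
    also have "\<dots> = (\<Sum>j\<le>k. \<Sum>a\<in>?D. (\<kappa> c * of_nat (k choose j) * of_int (- l c) ^ (k - j)) *\<^sub>C
        (e j (a - pos x) *\<^sub>C ell2_fun g (sh a (base x))))" by (rule sum.swap)
    also have "\<dots> = (\<Sum>j\<le>k. (\<kappa> c * of_nat (k choose j) * of_int (- l c) ^ (k - j)) *\<^sub>C f j x)"
      using x by (simp add: f_def scaleC.sum_right)
    also have "\<dots> = (\<Sum>j\<in>{k}. (\<kappa> c * of_nat (k choose j) * of_int (- l c) ^ (k - j)) *\<^sub>C f j x)"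
      using less by (intro sum.mono_neutral_right) auto
    finally show ?thesis by simp
  qed
  have eig: "ext (f k) y = \<omega> *\<^sub>C f k y" if y: "y \<in> Z" for y
  proof -
    obtain \<tau> where \<tau>: "0 \<le> \<tau>" "pos ` near y \<subseteq> cube d (- \<tau>) (\<tau> + 1)"
      using finite_subset_cube[of "pos ` near y" d] finite_near[OF y] pos_lat
      by (auto simp: near_def lat_def image_subset_iff)
    let ?C = "cube d (- (r + \<tau>)) (r + \<tau> + 1)"
    have Cl: "c \<in> lat d" if "c \<in> ?C" for c using that cube_subset_lat by blast
    \<comment> \<open>A finite sum of translates of \<open>g\<close>, hence an eigenvector of
      \<open>V\<close>, which agrees with the periodization on the whole neighbourhood of
      \<open>y\<close>.\<close>
    define h where "h = (\<Sum>c\<in>?C. e k c *\<^sub>C Tr (- c) g)"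
    have hs: "supp_in (r + (r + \<tau>)) h"
      unfolding h_def by (intro supp_in_sum supp_in_scaleC supp_in_Tr g(3) cube_uminus)
    have hf: "ell2_fun h x = f k x" if x: "x \<in> near y" for x
    proof -
      have xZ: "x \<in> Z" "pos x \<in> cube d (- \<tau>) (\<tau> + 1)" using x \<tau> by (auto simp: near_def)
      have "ell2_fun h x = (\<Sum>c\<in>?C. e k c *\<^sub>C ell2_fun g (sh c x))"
        unfolding h_def ell2_fun_sum scaleC_ell2.rep_eq
        by (intro sum.cong refl) (use xZ Cl in \<open>simp add: ell2_fun_Tr\<close>)
      also have "\<dots> = f k x" using weighted_orbit_sum[OF g(3,2) xZ] xZ by (simp add: f_def)
      finally show ?thesis .
    qed
    have "V h = (\<Sum>c\<in>?C. e k c *\<^sub>C Tr (- c) (V g))"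
      unfolding h_def clinear_sum[OF clinear_U] clinear_scaleC[OF clinear_U]
      by (intro sum.cong refl) (use Cl supp_in_l2_space[OF g(3)] in \<open>simp add: V_Tr\<close>)
    also have "\<dots> = (\<Sum>c\<in>?C. \<omega> *\<^sub>C (e k c *\<^sub>C Tr (- c) g))"
      unfolding g(4)
      by (intro sum.cong refl) (use Cl in \<open>simp add: clinear_scaleC[OF clinear_Tr] scaleC_scaleC mult.commute\<close>)
    also have "\<dots> = \<omega> *\<^sub>C h" by (simp add: h_def scaleC.sum_right)
    finally have "V h = \<omega> *\<^sub>C h" .
    then show ?thesis
      using ext_eq_V[OF hs y hf] hf[OF near_self[OF y]] by (simp add: scaleC_ell2.rep_eq)
  qed
  have "f k x = 0" if "x \<notin> Z" for x using that by (simp add: f_def)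
  then have "qp_eigenfunction \<kappa> \<omega> (f k)" using k qp eig by (simp add: qp_eigenfunction_def)
  then show ?thesis by blast
qed

text \<open>The usual argument for distinct eigenvalues: applying \<open>ext\<close> and subtracting
  \<open>\<omega>0\<close> times the relation removes one term.\<close>

lemma qp_eigenfunctions_independent:
  assumes "finite J" "\<And>\<omega>. \<omega> \<in> J \<Longrightarrow> qp_eigenfunction \<kappa> \<omega> (f \<omega>)"
    "\<And>x. x \<in> Z \<Longrightarrow> (\<Sum>\<omega>\<in>J. c \<omega> *\<^sub>C f \<omega> x) = 0"
  shows "\<forall>\<omega>\<in>J. c \<omega> = 0"
  using assms
proof (induction J arbitrary: c rule: finite_induct)
  case (insert \<omega>0 J)
  have f: "ext (f \<omega>) y = \<omega> *\<^sub>C f \<omega> y" if "\<omega> \<in> insert \<omega>0 J" "y \<in> Z" for \<omega> y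
    using insert.prems(1)[OF that(1)] that(2) by (simp add: qp_eigenfunction_def)
  have "(\<Sum>\<omega>\<in>J. (c \<omega> * (\<omega> - \<omega>0)) *\<^sub>C f \<omega> y) = 0" if y: "y \<in> Z" for y
  proof -
    have "(\<Sum>\<omega>\<in>insert \<omega>0 J. (c \<omega> * \<omega>) *\<^sub>C f \<omega> y) = (\<Sum>\<omega>\<in>insert \<omega>0 J. c \<omega> *\<^sub>C ext (f \<omega>) y)"
      using f y by (intro sum.cong refl) (simp add: scaleC_scaleC)
    also have "\<dots> = ext (\<lambda>x. \<Sum>\<omega>\<in>insert \<omega>0 J. c \<omega> *\<^sub>C f \<omega> x) y" by (rule ext_sum[symmetric])
    also have "\<dots> = 0"
      unfolding ext_def by (rule sum.neutral)
        (use insert.prems(2) in \<open>auto simp: near_def clinear_0[OF clinear_U] simp del: sum.insert\<close>)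
    finally have 1: "(\<Sum>\<omega>\<in>insert \<omega>0 J. (c \<omega> * \<omega>) *\<^sub>C f \<omega> y) = 0" .
    have "(\<Sum>\<omega>\<in>insert \<omega>0 J. (c \<omega> * (\<omega> - \<omega>0)) *\<^sub>C f \<omega> y) =
        (\<Sum>\<omega>\<in>insert \<omega>0 J. (c \<omega> * \<omega>) *\<^sub>C f \<omega> y) - \<omega>0 *\<^sub>C (\<Sum>\<omega>\<in>insert \<omega>0 J. c \<omega> *\<^sub>C f \<omega> y)"
      unfolding scaleC.sum_right sum_subtractf[symmetric]
      by (intro sum.cong refl) (simp add: scaleC_scaleC right_diff_distrib scaleC.diff_left mult.commute)
    also have "\<dots> = 0" unfolding 1 insert.prems(2)[OF y] by simp
    finally show ?thesis using insert.hyps by simp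
  qed
  then have "\<forall>\<omega>\<in>J. c \<omega> * (\<omega> - \<omega>0) = 0" by (intro insert.IH insert.prems(1)) auto
  then have J0: "\<forall>\<omega>\<in>J. c \<omega> = 0" using insert.hyps by auto
  obtain x where x: "x \<in> Z" "f \<omega>0 x \<noteq> 0"
    using insert.prems(1)[of \<omega>0] by (auto simp: qp_eigenfunction_def)
  have "c \<omega>0 *\<^sub>C f \<omega>0 x = 0" using insert.prems(2)[OF x(1)] insert.hyps J0 by simp
  then show ?case using x J0 by simp
qed simp

lemma qp_eq_0I:
  assumes "\<And>x. x \<in> F0 \<Longrightarrow> f x = 0" "\<And>c x. c \<in> lat d \<Longrightarrow> x \<in> Z \<Longrightarrow> f (sh c x) = \<kappa> c *\<^sub>C f x" "x \<in> Z"
  shows "f x = 0"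
proof -
  have b: "base x \<in> F0" "base x \<in> Z" using base_in[OF assms(3)] F0_subset by auto
  have "f x = f (sh (pos x) (base x))" by (simp only: sh_pos_base[OF assms(3)])
  also have "\<dots> = \<kappa> (pos x) *\<^sub>C f (base x)" by (rule assms(2)[OF pos_lat[OF assms(3)] b(2)])
  finally show ?thesis using assms(1)[OF b(1)] by simp
qed

text \<open>A quasi-periodic function is determined by its values on \<open>F0\<close>, so the
  eigenfunctions live in a space of finite dimension and only finitely many of them can be
  independent.\<close>

lemma finite_qp_eigenvalues: "finite {\<omega>. \<exists>f. qp_eigenfunction \<kappa> \<omega> f}"
proof (rule ccontr)
  assume inf: "infinite {\<omega>. \<exists>f. qp_eigenfunction \<kappa> \<omega> f}"
  obtain E :: "'w set" where E: "finite E" "\<And>w. w = (\<Sum>e\<in>E. inner w e *\<^sub>R e)"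
    using finite_orthonormal_basis_exists by metis
  obtain J where J: "finite J" "card J = Suc (card (F0 \<times> E))" "J \<subseteq> {\<omega>. \<exists>f. qp_eigenfunction \<kappa> \<omega> f}"
    using infinite_arbitrarily_large[OF inf] by blast
  then obtain f where f: "\<And>\<omega>. \<omega> \<in> J \<Longrightarrow> qp_eigenfunction \<kappa> \<omega> (f \<omega>)" 
  proof -
    have "\<forall>\<omega>\<in>J. \<exists>f. qp_eigenfunction \<kappa> \<omega> f" using J(3) by blast
    from bchoice[OF this] that show thesis by blast
  qed
  have fin: "finite (F0 \<times> E)" using finite_F0 E by simp
  have lt: "card (F0 \<times> E) < card J" using J(2) by simp
  obtain c where c: "\<exists>\<omega>\<in>J. c \<omega> \<noteq> 0"
    "\<And>x e. x \<in> F0 \<Longrightarrow> e \<in> E \<Longrightarrow> (\<Sum>\<omega>\<in>J. c \<omega> * cinner (f \<omega> x) e) = 0"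
    using homogeneous_system_nontrivial_solution[OF fin J(1) lt, of "\<lambda>(x, e) \<omega>. cinner (f \<omega> x) e"] by fastforce
  define F where "F x = (\<Sum>\<omega>\<in>J. c \<omega> *\<^sub>C f \<omega> x)" for x
  have "F x = 0" if "x \<in> F0" for x
  proof -
    have "cinner (F x) e = 0" if "e \<in> E" for e
      using c(2)[OF \<open>x \<in> F0\<close> that] by (simp add: F_def cinner.sum_left cinner_scaleC_left)
    then have "inner (F x) e = 0" if "e \<in> E" for e using that by (simp flip: Re_cinner)
    then show ?thesis using E(2)[of "F x"] by simp
  qed
  moreover have "F (sh a x) = \<kappa> a *\<^sub>C F x" if "a \<in> lat d" "x \<in> Z" for a x
  proof -
    have "f \<omega> (sh a x) = \<kappa> a *\<^sub>C f \<omega> x" if "\<omega> \<in> J" for \<omega>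
      using f[OF that] \<open>a \<in> lat d\<close> \<open>x \<in> Z\<close> by (simp add: qp_eigenfunction_def)
    then show ?thesis by (simp add: F_def scaleC.sum_right scaleC_scaleC mult.commute)
  qed
  ultimately have "F x = 0" if "x \<in> Z" for x
    using qp_eq_0I[of F \<kappa> x] that by blast
  then have "\<forall>\<omega>\<in>J. c \<omega> = 0" by (intro qp_eigenfunctions_independent[OF J(1) f]) (auto simp: F_def)
  then show False using c(1) by blast
qed

end

section \<open>Localized eigenfunctions by counting dimensions\<close>

lemma cis_sum: "finite A \<Longrightarrow> cis (\<Sum>i\<in>A. g i) = (\<Prod>i\<in>A. cis (g i))"
  by (induction A rule: finite_induct) (simp_all flip: cis_mult)

lemma sum_roots_of_unity:
  fixes m :: int
  assumes "m \<noteq> 0" "\<bar>m\<bar> < int n"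
  shows "(\<Sum>a\<in>{0..<int n}. cis (2 * pi / real n * (of_int m * of_int a))) = 0"
proof -
  have n: "real n \<noteq> 0" using assms by auto
  define z where "z = cis (2 * pi * of_int m / real n)"
  have "z \<noteq> 1"
  proof
    assume "z = 1"
    then have "cos (2 * pi * of_int m / real n) = 1" by (simp add: z_def complex_eq_iff)
    then obtain k :: int where "2 * pi * of_int m / real n = of_int k * 2 * pi"
      unfolding cos_one_2pi_int by blast
    then have "real_of_int m = real_of_int (k * int n)" using n by (simp add: field_simps)
    then have mk: "m = k * int n" by (simp only: of_int_eq_iff)
    then have "k \<noteq> 0" using assms by auto
    then have "1 * int n \<le> \<bar>k\<bar> * int n" by (intro mult_right_mono) auto
    then show False using assms(2) mk by (simp add: abs_mult)
  qed
  have "z ^ n = cis (2 * pi * of_int m)" using n by (simp add: z_def Complex.DeMoivre)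
  then have zn: "z ^ n = 1" using cis_multiple_2pi[of "of_int m"] by simp
  have "(\<Sum>a\<in>{0..<int n}. cis (2 * pi / real n * (of_int m * of_int a))) = (\<Sum>a<n. cis (2 * pi / real n * (of_int m * real a)))"
    by (rule sum.reindex_bij_witness[of _ int nat]) auto
  also have "\<dots> = (\<Sum>a<n. z ^ a)"
    by (simp add: z_def Complex.DeMoivre mult_ac)
  also have "\<dots> = 0" using geometric_sum[OF \<open>z \<noteq> 1\<close>, of n] zn by simp
  finally show ?thesis .
qed

definition torsion_character :: "nat \<Rightarrow> nat \<Rightarrow> (nat \<Rightarrow>\<^sub>0 int) \<Rightarrow> (nat \<Rightarrow>\<^sub>0 int) \<Rightarrow> complex" where
  "torsion_character d n \<theta> c =
     cis (\<Sum>i<d. 2 * pi / real n * (of_int (Poly_Mapping.lookup \<theta> i) * of_int (Poly_Mapping.lookup c i)))"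

text \<open>The box is a set of representatives modulo \<open>n\<close>. The sum factors over the
  coordinates, and a coordinate in which the two parameters differ contributes a full sum over
  powers of a nontrivial root of unity.\<close>

lemma torsion_character_orthogonal:
  assumes \<theta>: "\<theta> \<in> cube d 0 (int n)" "\<theta>' \<in> cube d 0 (int n)" "\<theta> \<noteq> \<theta>'"
  shows "(\<Sum>c\<in>cube d 0 (int n). torsion_character d n \<theta> c * cnj (torsion_character d n \<theta>' c)) = 0"
proof -
  let ?m = "\<lambda>i. Poly_Mapping.lookup \<theta> i - Poly_Mapping.lookup \<theta>' i"
  define F where "F i a = cis (2 * pi / real n * (of_int (?m i) * of_int a))" for i and a :: int
  obtain j where j: "j < d" "?m j \<noteq> 0"
  proof (rule ccontr)
    assume "\<not> thesis"
    then have "\<And>i. i < d \<Longrightarrow> Poly_Mapping.lookup \<theta> i = Poly_Mapping.lookup \<theta>' i" using that by force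
    then have "\<theta> = \<theta>'" using \<theta>(1,2)
      by (intro poly_mapping_eqI) (metis (mono_tags, lifting) cube_def lookup_eq_0_lessThan mem_Collect_eq)
    then show False using \<theta>(3) by simp
  qed
  have "torsion_character d n \<theta> c * cnj (torsion_character d n \<theta>' c) = (\<Prod>i<d. F i (Poly_Mapping.lookup c i))" for c
    unfolding torsion_character_def F_def cis_cnj cis_mult cis_sum[OF finite_lessThan, symmetric]
    by (intro arg_cong[where f = cis]) (simp add: sum_subtractf[symmetric] algebra_simps)
  then have "(\<Sum>c\<in>cube d 0 (int n). torsion_character d n \<theta> c * cnj (torsion_character d n \<theta>' c)) =
      (\<Sum>c\<in>cube d 0 (int n). (\<lambda>g. \<Prod>i<d. F i (g i)) (\<lambda>i\<in>{..<d}. Poly_Mapping.lookup c i))"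
    by simp
  also have "\<dots> = (\<Sum>g\<in>{..<d} \<rightarrow>\<^sub>E {0..<int n}. \<Prod>i<d. F i (g i))"
    by (rule sum.reindex_bij_betw[OF bij_betw_cube])
  also have "\<dots> = (\<Prod>i<d. \<Sum>a\<in>{0..<int n}. F i a)"
    by (rule prod_sum_PiE[symmetric]) auto
  also have "\<dots> = 0"
  proof (rule prod_zero)
    have "0 \<le> Poly_Mapping.lookup \<theta> j" "Poly_Mapping.lookup \<theta> j < int n"
      "0 \<le> Poly_Mapping.lookup \<theta>' j" "Poly_Mapping.lookup \<theta>' j < int n"
      using \<theta> j(1) by (auto simp: cube_def)
    then have "\<bar>?m j\<bar> < int n" by linarith
    from sum_roots_of_unity[OF j(2) this] show "\<exists>i\<in>{..<d}. (\<Sum>a\<in>{0..<int n}. F i a) = 0"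
      using j(1) by (auto simp: F_def)
  qed simp
  finally show ?thesis .
qed

lemma sum_square_inner_orthonormal_le:
  fixes e :: "'i \<Rightarrow> 'a::real_inner"
  assumes "finite I" "\<And>i j. i \<in> I \<Longrightarrow> j \<in> I \<Longrightarrow> inner (e i) (e j) = (if i = j then 1 else 0)"
  shows "(\<Sum>i\<in>I. (inner (e i) f)\<^sup>2) \<le> (norm f)\<^sup>2"
proof -
  define s where "s = (\<Sum>i\<in>I. inner (e i) f *\<^sub>R e i)"
  have "inner s s = (\<Sum>i\<in>I. inner (e i) f * (\<Sum>j\<in>I. inner (e j) f * inner (e j) (e i)))"
    by (simp add: s_def inner_sum_left inner_sum_right)
  also have "\<dots> = (\<Sum>i\<in>I. (inner (e i) f)\<^sup>2)"
    using assms by (intro sum.cong refl) (simp add: power2_eq_square if_distrib[of "\<lambda>x. _ * x"] cong: if_cong)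
  finally have ss: "inner s s = (\<Sum>i\<in>I. (inner (e i) f)\<^sup>2)" .
  have sf: "inner s f = (\<Sum>i\<in>I. (inner (e i) f)\<^sup>2)"
    by (simp add: s_def inner_sum_left power2_eq_square)
  have "0 \<le> inner (f - s) (f - s)" by simp
  also have "\<dots> = inner f f - (\<Sum>i\<in>I. (inner (e i) f)\<^sup>2)"
    using ss sf by (simp add: inner_simps inner_commute)
  finally show ?thesis by (simp add: power2_norm_eq_inner)
qed

text \<open>Orthogonalization over the reals. The size of \<open>F\<close> is the rank of
  \<open>Y\<close>, and the last clause, Parseval on \<open>Y\<close>, lets a sum of squared norms
  be compared with that rank.\<close>

lemma orthonormal_spanning_set:
  fixes Y :: "'a::real_inner set"
  assumes "finite Y"
  obtains F where "finite F" "F \<subseteq> span Y" "\<And>e f. e \<in> F \<Longrightarrow> f \<in> F \<Longrightarrow> inner e f = (if e = f then 1 else 0)"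
    "\<And>y. y \<in> Y \<Longrightarrow> (norm y)\<^sup>2 = (\<Sum>f\<in>F. (inner y f)\<^sup>2)"
proof -
  obtain C where C: "finite C" "span C = span Y" "pairwise orthogonal C"
    using basis_orthogonal[OF assms] by blast
  define F where "F = (\<lambda>x. x /\<^sub>R norm x) ` (C - {0})"
  have fin: "finite F" using C by (simp add: F_def)
  have on: "inner e f = (if e = f then 1 else 0)" if "e \<in> F" "f \<in> F" for e f
  proof -
    obtain x y where xy: "x \<in> C" "y \<in> C" "x \<noteq> 0" "y \<noteq> 0" "e = x /\<^sub>R norm x" "f = y /\<^sub>R norm y"
      using \<open>e \<in> F\<close> \<open>f \<in> F\<close> unfolding F_def by blast
    show ?thesis
    proof (cases "x = y")
      case True
      then show ?thesis using xy by (simp add: power2_norm_eq_inner[symmetric] power2_eq_square)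
    next
      case False
      then have "inner x y = 0" using C(3) xy by (auto simp: pairwise_def orthogonal_def)
      then have "inner e f = 0" by (simp add: xy)
      moreover have "e \<noteq> f"
      proof
        assume "e = f"
        then have "inner e e = 0" using \<open>inner e f = 0\<close> by simp
        then show False using xy by simp
      qed
      ultimately show ?thesis by simp
    qed
  qed
  have "F \<subseteq> span C" unfolding F_def by (auto intro: span_scale span_base)
  then have sub: "F \<subseteq> span Y" using C by simp
  have "C \<subseteq> span F"
  proof
    fix x assume x: "x \<in> C"
    show "x \<in> span F"
    proof (cases "x = 0")
      case False
      then have "x /\<^sub>R norm x \<in> span F" using x by (auto simp: F_def intro!: span_base)
      then have "norm x *\<^sub>R (x /\<^sub>R norm x) \<in> span F" by (rule span_scale)
      then show ?thesis using False by simp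
    qed (simp add: span_zero)
  qed
  then have "span Y \<subseteq> span F" using C(2) by (metis span_minimal subspace_span)
  then have YF: "Y \<subseteq> span F" using span_superset by blast
  have "(norm y)\<^sup>2 = (\<Sum>f\<in>F. (inner y f)\<^sup>2)" if y: "y \<in> Y" for y
  proof -
    define z where "z = y - (\<Sum>f\<in>F. inner y f *\<^sub>R f)"
    have zf: "inner z f = 0" if "f \<in> F" for f
    proof -
      have "(\<Sum>g\<in>F. inner y g * inner g f) = (\<Sum>g\<in>F. if g = f then inner y f else 0)"
        using on that by (intro sum.cong refl) auto
      then show ?thesis using that fin by (simp add: z_def inner_diff_left inner_sum_left)
    qed
    have zs: "inner z w = 0" if "w \<in> span F" for w
      using that by (induction rule: span_induct_alt) (auto simp: inner_add_right zf)
    have "z \<in> span F" unfolding z_def 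
      by (intro span_diff span_sum span_scale) (use y YF in \<open>auto intro: span_base\<close>)
    then have "z = 0" using zs inner_eq_zero_iff by blast
    then have "y = (\<Sum>f\<in>F. inner y f *\<^sub>R f)" by (simp add: z_def)
    then have "inner y y = inner (\<Sum>f\<in>F. inner y f *\<^sub>R f) y" by simp
    also have "\<dots> = (\<Sum>f\<in>F. (inner y f)\<^sup>2)"
      unfolding inner_sum_left inner_scaleR_left power2_eq_square
      by (intro sum.cong refl) (simp add: inner_commute)
    finally show ?thesis by (simp only: power2_norm_eq_inner)
  qed
  with that fin sub on show thesis by blast
qed

context lattice_walk
begin

lemma supp_in_add: "supp_in r f \<Longrightarrow> supp_in r g \<Longrightarrow> supp_in r (f + g)"
  unfolding supp_in_def plus_ell2.rep_eq by (metis add_0)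

lemma character_torsion: "character (torsion_character d n \<theta>)"
  by (simp add: character_def torsion_character_def cis_mult lookup_add sum.distrib[symmetric] algebra_simps)

text \<open>Among the quasi-periodic eigenfunctions for the \<open>n ^ d\<close> characters of order \<open>n\<close>, some
  combination vanishes on the collar of a box of side \<open>n\<close>; cut off to the box it is a
  localized eigenfunction.\<close>

lemma qp_eigenfunctions_imp_localized:
  assumes "\<And>\<kappa>. character \<kappa> \<Longrightarrow> \<exists>f. qp_eigenfunction \<kappa> \<omega> f"
  shows "localized_eigenvalue \<omega>"
proof -
  obtain E :: "'w set" where E: "finite E" "\<And>w. w = (\<Sum>e\<in>E. inner w e *\<^sub>R e)"
    using finite_orthonormal_basis_exists by metis
  define m where "m = card F0 * card E"
  \<comment> \<open>The inner box loses \<open>2 * \<rho>\<close> on each side: a site that shares a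
    neighbour with a point outside the large box lies within \<open>2 * \<rho>\<close> of the
    outside.\<close>
  define s where "s = nat (4 * \<rho>)"
  \<comment> \<open>The tolerance \<open>1 / Suc m\<close> beats the factor \<open>m\<close>, the
    number of coordinates per cell, so the collar imposes fewer conditions than there are
    characters.\<close>
  have "0 < 1 / real (Suc m)" by simp
  from eventually_conj[OF eventually_power_collar_small[OF this, of d s] eventually_gt_at_top[of s]]
  obtain n where n: "real n ^ d - real (n - s) ^ d \<le> 1 / real (Suc m) * real n ^ d" "s < n"
    using eventually_happens by fastforce
  have n0: "0 < n" using n by simp
  obtain f where f: "\<And>\<theta>. qp_eigenfunction (torsion_character d n \<theta>) \<omega> (f \<theta>)"
    using assms[OF character_torsion] by metis
  let ?B = "Zcube 0 (int n)" and ?C = "Zcube (2 * \<rho>) (int n - 2 * \<rho>)" and ?I = "cube d 0 (int n)"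
  have CB: "?C \<subseteq> ?B" using \<rho>_nonneg cube_mono[of 0 "2 * \<rho>" "int n - 2 * \<rho>" "int n" d] by (auto simp: Zcube_def)
  have "int n - 2 * \<rho> - 2 * \<rho> = int (n - s)" using n(2) \<rho>_nonneg by (simp add: s_def of_nat_diff)
  then have side: "nat (int n - 2 * \<rho> - 2 * \<rho>) = n - s" by simp
  have cardC: "card ?C = card F0 * (n - s) ^ d" unfolding card_Zcube side ..
  have cardB: "card ?B = card F0 * n ^ d" unfolding card_Zcube by simp
  have "card ((?B - ?C) \<times> E) < card ?I"
  proof -
    have le: "(n - s) ^ d \<le> n ^ d" by (intro power_mono) auto
    have "card ((?B - ?C) \<times> E) = card F0 * (n ^ d - (n - s) ^ d) * card E"
      using CB by (simp add: card_cartesian_product card_Diff_subset cardB cardC diff_mult_distrib2)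
    then have "real (card ((?B - ?C) \<times> E)) = real m * (real n ^ d - real (n - s) ^ d)"
      using le by (simp add: m_def of_nat_diff)
    also have "\<dots> \<le> real m * (1 / real (Suc m) * real n ^ d)" by (intro mult_left_mono n) auto
    also have "\<dots> = real m / real (Suc m) * real n ^ d" by simp
    also have "\<dots> < 1 * real n ^ d" using n0 by (intro mult_strict_right_mono) auto
    also have "\<dots> = real (card ?I)" by (simp add: card_cube)
    finally show ?thesis by (simp only: of_nat_less_iff)
  qed
  moreover have "finite ((?B - ?C) \<times> E)" using E by simp
  ultimately obtain c where c: "\<exists>\<theta>\<in>?I. c \<theta> \<noteq> 0"
    "\<And>x e. x \<in> ?B - ?C \<Longrightarrow> e \<in> E \<Longrightarrow> (\<Sum>\<theta>\<in>?I. c \<theta> * cinner (f \<theta> x) e) = 0"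
    using homogeneous_system_nontrivial_solution[of "(?B - ?C) \<times> E" ?I "\<lambda>(x, e) \<theta>. cinner (f \<theta> x) e"] by fastforce
  define g where "g x = (\<Sum>\<theta>\<in>?I. c \<theta> *\<^sub>C f \<theta> x)" for x
  have collar: "g x = 0" if "x \<in> ?B - ?C" for x
  proof -
    have "cinner (g x) e = 0" if "e \<in> E" for e
      using c(2)[OF \<open>x \<in> ?B - ?C\<close> that] by (simp add: g_def cinner.sum_left cinner_scaleC_left)
    then have "inner (g x) e = 0" if "e \<in> E" for e using that by (simp flip: Re_cinner)
    then show ?thesis using E(2)[of "g x"] by simp
  qed
  have ext_g: "ext g y = \<omega> *\<^sub>C g y" if "y \<in> Z" for y
  proof -
    have "ext g y = (\<Sum>\<theta>\<in>?I. c \<theta> *\<^sub>C ext (f \<theta>) y)" unfolding g_def by (rule ext_sum)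
    also have "\<dots> = \<omega> *\<^sub>C g y"
      using f that by (simp add: g_def qp_eigenfunction_def scaleC.sum_right scaleC_scaleC mult.commute)
    finally show ?thesis .
  qed
  define h where "h = Ell2 (\<lambda>x. if x \<in> ?B then g x else 0)"
  have h: "ell2_fun h x = (if x \<in> ?B then g x else 0)" for x
    unfolding h_def by (subst ell2_fun_Ell2) (auto intro!: square_summable_finite_support intro: finite_subset[OF _ finite_Zcube[of 0 "int n"]])
  have hs: "supp_in (int n) h"
    using cube_mono[of "- int n" 0 "int n" "int n + 1" d] by (auto simp: supp_in_def h Zcube_def)
  have "h \<noteq> 0"
  proof
    assume "h = 0"
    then have g0: "g x = 0" if "x \<in> ?B" for x using h[of x] that by simp
    obtain \<theta>0 where \<theta>0: "\<theta>0 \<in> ?I" "c \<theta>0 \<noteq> 0" using c(1) by blast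
    \<comment> \<open>Fourier inversion on the finite box: summation against the conjugate of one
      character removes all other terms. A combination that vanishes on the box would force an
      eigenfunction with nonzero coefficient to vanish on \<open>F0\<close>, hence
      everywhere.\<close>
    have f0: "f \<theta>0 x = 0" if x: "x \<in> F0" for x
    proof -
      have xZ: "x \<in> Z" using x F0_subset by blast
      have px: "pos x = 0" using pos_sh_F0[of 0 x] x xZ by (simp add: sh_0)
      have lat: "a \<in> lat d" if "a \<in> ?I" for a using that cube_subset_lat by blast
      have "0 = (\<Sum>a\<in>?I. cnj (torsion_character d n \<theta>0 a) *\<^sub>C g (sh a x))"
        using g0 lat xZ px by (intro sum.neutral[symmetric] ballI) (simp add: Zcube_def sh_in pos_sh)
      also have "\<dots> = (\<Sum>a\<in>?I. \<Sum>\<theta>\<in>?I. (c \<theta> * (torsion_character d n \<theta> a * cnj (torsion_character d n \<theta>0 a))) *\<^sub>C f \<theta> x)"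
      proof (rule sum.cong[OF refl])
        fix a assume "a \<in> ?I"
        then have "f \<theta> (sh a x) = torsion_character d n \<theta> a *\<^sub>C f \<theta> x" for \<theta>
          using f[of \<theta>] lat xZ by (simp add: qp_eigenfunction_def)
        then show "cnj (torsion_character d n \<theta>0 a) *\<^sub>C g (sh a x) =
            (\<Sum>\<theta>\<in>?I. (c \<theta> * (torsion_character d n \<theta> a * cnj (torsion_character d n \<theta>0 a))) *\<^sub>C f \<theta> x)"
          by (simp add: g_def scaleC.sum_right scaleC_scaleC mult_ac)
      qed
      also have "\<dots> = (\<Sum>\<theta>\<in>?I. \<Sum>a\<in>?I. (c \<theta> * (torsion_character d n \<theta> a * cnj (torsion_character d n \<theta>0 a))) *\<^sub>C f \<theta> x)"
        by (rule sum.swap)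
      also have "\<dots> = (\<Sum>\<theta>\<in>?I. (c \<theta> * (\<Sum>a\<in>?I. torsion_character d n \<theta> a * cnj (torsion_character d n \<theta>0 a))) *\<^sub>C f \<theta> x)"
        by (simp only: scaleC.sum_left sum_distrib_left)
      also have "\<dots> = (\<Sum>\<theta>\<in>{\<theta>0}. (c \<theta> * (\<Sum>a\<in>?I. torsion_character d n \<theta> a * cnj (torsion_character d n \<theta>0 a))) *\<^sub>C f \<theta> x)"
        using \<theta>0 torsion_character_orthogonal by (intro sum.mono_neutral_right) auto
      also have "\<dots> = (c \<theta>0 * of_nat (n ^ d)) *\<^sub>C f \<theta>0 x"
      proof -
        have "torsion_character d n \<theta>0 a * cnj (torsion_character d n \<theta>0 a) = 1" for a
          by (simp add: torsion_character_def cis_cnj cis_mult)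
        then show ?thesis by (simp add: card_cube)
      qed
      finally show ?thesis using \<theta>0 n0 by simp
    qed
    have "f \<theta>0 x = 0" if "x \<in> Z" for x
      using qp_eq_0I[of "f \<theta>0" "torsion_character d n \<theta>0" x] f0 f[of \<theta>0] that by (simp add: qp_eigenfunction_def)
    then show False using f[of \<theta>0] by (auto simp: qp_eigenfunction_def)
  qed
  moreover have "V h = \<omega> *\<^sub>C h"
  proof (rule ell2_eqI)
    fix y
    show "ell2_fun (V h) y = ell2_fun (\<omega> *\<^sub>C h) y"
    proof (cases "y \<in> Z")
      case False
      then show ?thesis
        using U_in[OF supp_in_l2_space[OF hs]] supp_in_l2_space[OF hs] by (simp add: l2_space_def scaleC_ell2.rep_eq)
    next
      case True
      show ?thesis
      proof (cases "near y \<subseteq> ?B")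
        case sub: True
        then have "ext g y = ell2_fun (V h) y" by (intro ext_eq_V[OF hs True]) (auto simp: h)
        then show ?thesis using ext_g[OF True] near_self[OF True] sub by (auto simp: h scaleC_ell2.rep_eq)
      next
        case False
        then obtain x where x: "x \<in> near y" "x \<notin> ?B" by blast
        then have xp: "x \<in> Z" "pos x \<in> lat d" "pos x \<notin> ?I" using pos_lat by (auto simp: near_def Zcube_def)
        then obtain i where i: "i < d" "\<not> (0 \<le> Poly_Mapping.lookup (pos x) i \<and> Poly_Mapping.lookup (pos x) i < int n)"
          by (auto simp: cube_def lat_def)
        \<comment> \<open>Two steps of length \<open>\<rho>\<close> through \<open>y\<close> lead
          from \<open>z\<close> to the outside point \<open>x\<close>. So \<open>z\<close> is
          outside the box or in the collar, and \<open>h\<close> vanishes there; both sides of the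
          eigenvalue equation are 0 at \<open>y\<close>.\<close>
        have zero: "ell2_fun h z = 0" if z: "z \<in> near y" for z
        proof (cases "z \<in> ?B")
          case True
          have "\<bar>Poly_Mapping.lookup (pos x) i - Poly_Mapping.lookup (pos y) i\<bar> \<le> \<rho>"
            "\<bar>Poly_Mapping.lookup (pos z) i - Poly_Mapping.lookup (pos y) i\<bar> \<le> \<rho>"
            using x z i(1) by (auto simp: near_def cube_def lookup_minus abs_le_iff)
          then have "\<not> (2 * \<rho> \<le> Poly_Mapping.lookup (pos z) i \<and> Poly_Mapping.lookup (pos z) i < int n - 2 * \<rho>)"
            using i(2) by linarith
          then have "z \<notin> ?C" using i(1) by (auto simp: Zcube_def cube_def)
          then show ?thesis using collar True h by simp
        qed (simp add: h)
        then have "ext (\<lambda>_. 0) y = ell2_fun (V h) y" by (intro ext_eq_V[OF hs True]) auto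
        then have "ell2_fun (V h) y = 0" by (simp add: ext_def clinear_0[OF clinear_U])
        then show ?thesis using zero[OF near_self[OF True]] by (simp add: scaleC_ell2.rep_eq)
      qed
    qed
  qed
  ultimately show ?thesis using hs by (auto simp: localized_eigenvalue_def intro!: exI[of _ h] exI[of _ "int n"])
qed

text \<open>The eigenspace is invariant under translations in both directions, so projecting
  commutes with translating. Every translate of a basis vector thus contributes the same amount to
  the trace.\<close>

lemma proj_Tr:
  assumes c: "c \<in> lat d" and f: "f \<in> l2_space Z"
  shows "proj {e \<in> l2_space Z. V e = \<omega> *\<^sub>C e} (Tr c f) = Tr c (proj {e \<in> l2_space Z. V e = \<omega> *\<^sub>C e} f)"
proof -
  let ?K = "{e \<in> l2_space Z. V e = \<omega> *\<^sub>C e}"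
  note K = csubspace_eigenspace[of \<omega>] closed_eigenspace[of \<omega>]
  have TK: "Tr a e \<in> ?K" if "a \<in> lat d" "e \<in> ?K" for a e
    using that by (simp add: Tr_in V_Tr clinear_scaleC[OF clinear_Tr])
  have pK: "proj ?K f \<in> ?K" by (rule proj_in[OF K])
  show ?thesis
  proof (rule proj_eqI[OF K TK[OF c pK]])
    fix w assume w: "w \<in> ?K"
    have "cinner (Tr c f - Tr c (proj ?K f)) w = cinner (f - proj ?K f) (Tr (- c) w)"
      using c f pK w csubspace_diff[OF csubspace_H f, of "proj ?K f"]
      by (simp add: cinner_Tr_left clinear_diff[OF clinear_Tr, symmetric])
    also have "\<dots> = 0" using c w TK[of "- c" w] by (intro proj_orthogonal[OF K]) simp
    finally show "cinner (Tr c f - Tr c (proj ?K f)) w = 0" .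
  qed
qed

text \<open>If no eigenfunction is localized, \<open>V - \<omega>\<close> is injective on functions supported in a box,
  and the projection onto the eigenspace kills its image.  Hence the rank of that projection
  on a box is at most the size of the collar, although its trace grows like the volume.\<close>

lemma eigenvector_imp_localized:
  assumes f: "f \<in> l2_space Z" "f \<noteq> 0" "V f = \<omega> *\<^sub>C f"
  shows "localized_eigenvalue \<omega>"
proof (rule ccontr)
  assume noloc: "\<not> localized_eigenvalue \<omega>"
  let ?K = "{e \<in> l2_space Z. V e = \<omega> *\<^sub>C e}"
  note K = csubspace_eigenspace[of \<omega>] closed_eigenspace[of \<omega>]
  let ?P = "proj ?K"
  have P_lin: "clinear ?P" by (rule clinear_proj[OF K])
  obtain E :: "'w set" where E: "finite E" "\<And>e. e \<in> E \<Longrightarrow> norm e = 1"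
    "\<And>e f. e \<in> E \<Longrightarrow> f \<in> E \<Longrightarrow> e \<noteq> f \<Longrightarrow> inner e f = 0" "\<And>w. w = (\<Sum>e\<in>E. inner w e *\<^sub>R e)"
    by (rule finite_orthonormal_basis_exists) (rule that)
  have scale: "r *\<^sub>R x = of_real r *\<^sub>C x" for r and x :: "('z, 'w) ell2" by (simp add: scaleC_of_real)
  obtain x1 where x1: "ell2_fun f x1 \<noteq> 0" using f(2) ell2_eqI[of f 0] by auto
  then have x1Z: "x1 \<in> Z" using f(1) by (auto simp: l2_space_def)
  define x0 where "x0 = base x1"
  have x0: "x0 \<in> F0" "x0 \<in> Z" "sh (pos x1) x0 = x1"
    using base_in x1Z F0_subset sh_pos_base by (auto simp: x0_def)
  \<comment> \<open>In the direction of \<open>f\<close> at \<open>x1\<close> the point mass has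
    nonzero inner product with the eigenvector \<open>f\<close>. Its projection is therefore nonzero
    and \<open>\<tau>\<close> is positive.\<close>
  define v where "v = ell2_fun f x1 /\<^sub>R norm (ell2_fun f x1)"
  have v: "norm v = 1" using x1 by (simp add: v_def)
  define e where "e c = ket (sh c x0) v" for c
  have eT: "e c = Tr c (ket x0 v)" if "c \<in> lat d" for c using that x0 by (simp add: e_def Tr_ket)
  have eH: "e c \<in> l2_space Z" if "c \<in> lat d" for c using that by (simp add: eT Tr_in)
  define \<tau> where "\<tau> = (norm (?P (ket x0 v)))\<^sup>2"
  have Pe: "(norm (?P (e c)))\<^sup>2 = \<tau>" if c: "c \<in> lat d" for c
  proof -
    have "?P (ket x0 v) \<in> l2_space Z" using proj_in[OF K, of "ket x0 v"] by simp
    then have "cinner (?P (e c)) (?P (e c)) = cinner (?P (ket x0 v)) (?P (ket x0 v))"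
      using c x0 by (simp add: eT proj_Tr ket_in_l2_space cinner_Tr)
    then have "complex_of_real ((norm (?P (e c)))\<^sup>2) = of_real ((norm (?P (ket x0 v)))\<^sup>2)"
      by (simp only: cinner_self)
    then show ?thesis by (simp only: of_real_eq_iff \<tau>_def)
  qed
  have "0 < \<tau>"
  proof -
    have "cinner (?P (e (pos x1))) f = cinner (e (pos x1)) f" by (rule proj_cinner[OF K]) (use f in simp)
    also have "\<dots> = cinner v (ell2_fun f x1)" using x0 by (simp add: e_def cinner_ket_left)
    also have "\<dots> \<noteq> 0" using x1 by (simp add: v_def cinner.scaleR_left cinner_self)
    finally have "?P (e (pos x1)) \<noteq> 0" by (auto simp: cinner.zero_left)
    then have "0 < (norm (?P (e (pos x1))))\<^sup>2" by simp
    then show ?thesis by (simp only: Pe[OF pos_lat[OF x1Z]])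
  qed
  define m where "m = card F0 * card E"
  \<comment> \<open>Here the collar has width \<open>\<rho>\<close> on each side, since one
    application of \<open>V\<close> spreads a support by that much.\<close>
  define s where "s = nat (2 * \<rho>)"
  \<comment> \<open>The value makes \<open>m * \<epsilon>\<close> smaller than
    \<open>\<tau>\<close>; the summand 1 also covers \<open>m = 0\<close>.\<close>
  define \<epsilon> where "\<epsilon> = \<tau> / (2 * (real m + 1))"
  have "0 < \<epsilon>" using \<open>0 < \<tau>\<close> by (simp add: \<epsilon>_def add_nonneg_pos)
  have "filterlim (\<lambda>k. 2 * k + 1) sequentially sequentially"
    by (rule filterlim_subseq) (auto simp: strict_mono_def)
  from eventually_conj[OF eventually_compose_filterlim[OF eventually_power_collar_small[OF \<open>0 < \<epsilon>\<close>, of d s] this]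
      eventually_gt_at_top[of "nat \<rho>"]]
  obtain k where k: "real (2 * k + 1) ^ d - real (2 * k + 1 - s) ^ d \<le> \<epsilon> * real (2 * k + 1) ^ d" "nat \<rho> < k"
    using eventually_happens by fastforce
  define n where "n = int k"
  have n: "\<rho> \<le> n" using k by (simp add: n_def)
  let ?I = "cube d (- n) (n + 1)"
  let ?B = "Zcube (- n) (n + 1)" and ?C = "Zcube (- (n - \<rho>)) (n - \<rho> + 1)"
  have side: "nat (n + 1 - - n) = 2 * k + 1" "nat (n - \<rho> + 1 - - (n - \<rho>)) = 2 * k + 1 - s"
    using n \<rho>_nonneg by (auto simp: n_def s_def)
  have cards: "card ?I = (2 * k + 1) ^ d" "card ?B = card F0 * (2 * k + 1) ^ d" "card ?C = card F0 * (2 * k + 1 - s) ^ d"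
    unfolding card_cube card_Zcube side by auto
  have Il: "c \<in> lat d" if "c \<in> ?I" for c using that cube_subset_lat by blast
  have e_on: "inner (e c) (e c') = (if c = c' then 1 else 0)" if "c \<in> ?I" "c' \<in> ?I" for c c'
  proof -
    have "sh c x0 = sh c' x0 \<longleftrightarrow> c = c'" using pos_sh_F0[OF Il x0(1)] that by metis
    then show ?thesis
      using v by (auto simp: e_def cinner_ket ell2_fun_ket cinner.zero_left cinner_self simp flip: Re_cinner)
  qed
  have "finite ((\<lambda>c. ?P (e c)) ` ?I)" by simp
  then obtain F where F: "finite F" "F \<subseteq> span ((\<lambda>c. ?P (e c)) ` ?I)"
    "\<And>e f. e \<in> F \<Longrightarrow> f \<in> F \<Longrightarrow> inner e f = (if e = f then 1 else 0)"
    "\<And>y. y \<in> (\<lambda>c. ?P (e c)) ` ?I \<Longrightarrow> (norm y)\<^sup>2 = (\<Sum>f\<in>F. (inner y f)\<^sup>2)"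
    by (rule orthonormal_spanning_set) (rule that)
  \<comment> \<open>\<open>F\<close> comes from the span of projected box functions and
    \<open>P\<close> is linear, so each of its members has a preimage supported in the box. The
    preimages can then be counted by coordinates.\<close>
  have FP: "\<exists>w. supp_in n w \<and> \<phi> = ?P w" if "\<phi> \<in> F" for \<phi>
  proof -
    let ?W = "{?P w | w. supp_in n w}"
    have "subspace ?W"
      unfolding subspace_def
    proof (intro conjI ballI allI)
      show "0 \<in> ?W" using clinear_0[OF P_lin] by (intro CollectI exI[of _ 0]) (simp add: supp_in_def)
    next
      fix x y assume "x \<in> ?W" "y \<in> ?W"
      then obtain a b where "supp_in n a" "supp_in n b" "x = ?P a" "y = ?P b" by blast
      then show "x + y \<in> ?W"
        by (intro CollectI exI[of _ "a + b"]) (simp add: clinear_add[OF P_lin] supp_in_add)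
    next
      fix r x assume "x \<in> ?W"
      then obtain a where "supp_in n a" "x = ?P a" by blast
      then show "r *\<^sub>R x \<in> ?W"
        unfolding scale by (intro CollectI exI[of _ "of_real r *\<^sub>C a"]) (simp add: clinear_scaleC[OF P_lin] supp_in_scaleC)
    qed
    moreover have "(\<lambda>c. ?P (e c)) ` ?I \<subseteq> ?W"
    proof clarify
      fix c assume c: "c \<in> ?I"
      have "sh c x0 \<in> ?B" using c Il x0 by (simp add: Zcube_def sh_in pos_sh_F0)
      then have "supp_in n (e c)" by (auto simp: e_def supp_in_def ell2_fun_ket)
      then show "\<exists>w. ?P (e c) = ?P w \<and> supp_in n w" by blast
    qed
    ultimately have "span ((\<lambda>c. ?P (e c)) ` ?I) \<subseteq> ?W" by (rule span_minimal[rotated])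
    then show ?thesis using F(2) that by blast
  qed
  then obtain w where w: "\<And>\<phi>. \<phi> \<in> F \<Longrightarrow> supp_in n (w \<phi>)" "\<And>\<phi>. \<phi> \<in> F \<Longrightarrow> \<phi> = ?P (w \<phi>)" by metis
  have P_kills: "?P (V g - \<omega> *\<^sub>C g) = 0" if g: "g \<in> l2_space Z" for g
  proof (rule proj_eqI[OF K csubspace_0[OF K(1)]])
    fix y assume y: "y \<in> ?K"
    show "cinner (V g - \<omega> *\<^sub>C g - 0) y = 0"
    proof (cases "y = 0")
      case False
      then show ?thesis
        using cinner_U_eigenvector[of y \<omega> g] y g by (simp add: cinner.diff_left cinner_scaleC_left)
    qed (simp add: cinner.zero_right)
  qed
  \<comment> \<open>Otherwise the preimages \<open>w\<close> and the vectors
    \<open>(V - \<omega>)\<close> applied to basis vectors of the inner box, which all live in the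
    large box, satisfy a real linear relation. Projecting kills the second kind, and orthonormality
    of \<open>F\<close> makes the coefficients of the first kind vanish. The rest is a
    \<open>g\<close> with \<open>V g = \<omega> g\<close>, hence 0, and its coefficients vanish
    too.\<close>
  have cardF: "card F \<le> card (?B \<times> E) - card (?C \<times> E)"
  proof (rule ccontr)
    assume "\<not> ?thesis"
    then have "card (?B \<times> E) < card F + card (?C \<times> E)" by linarith
    also have "\<dots> = card (F <+> (?C \<times> E))" using F(1) E(1) by (subst card_Plus) auto
    finally have lt: "card (?B \<times> E) < card (F <+> (?C \<times> E))" .
    define A where "A i = (case i of Inl \<phi> \<Rightarrow> w \<phi> | Inr (z, b) \<Rightarrow> V (ket z b) - \<omega> *\<^sub>C ket z b)" for i
    have "finite (?B \<times> E)" "finite (F <+> (?C \<times> E))" using F(1) E(1) by auto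
    from homogeneous_system_nontrivial_solution[OF this lt, of "\<lambda>(x, b) i. inner (ell2_fun (A i) x) b"]
    obtain t where t: "\<exists>i\<in>F <+> (?C \<times> E). t i \<noteq> 0"
      "\<And>x b. x \<in> ?B \<Longrightarrow> b \<in> E \<Longrightarrow> (\<Sum>i\<in>F <+> (?C \<times> E). t i * inner (ell2_fun (A i) x) b) = 0"
      by fastforce
    define g where "g = (\<Sum>zb\<in>?C \<times> E. t (Inr zb) *\<^sub>R ket (fst zb) (snd zb))"
    have gs: "supp_in (n - \<rho>) g"
      unfolding g_def scale by (intro supp_in_sum supp_in_scaleC) (auto simp: supp_in_def ell2_fun_ket split: if_splits)
    have Vg: "V g - \<omega> *\<^sub>C g = (\<Sum>zb\<in>?C \<times> E. t (Inr zb) *\<^sub>R A (Inr zb))"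
      unfolding g_def A_def scale
      by (simp add: clinear_sum[OF clinear_U] clinear_scaleC[OF clinear_U] scaleC.sum_right case_prod_unfold
          scaleC.diff_right scaleC_scaleC mult.commute sum_subtractf)
    define S where "S = (\<Sum>i\<in>F <+> (?C \<times> E). t i *\<^sub>R A i)"
    have S_eq: "S = (\<Sum>\<phi>\<in>F. t (Inl \<phi>) *\<^sub>R w \<phi>) + (V g - \<omega> *\<^sub>C g)"
      unfolding S_def Vg using F(1) E(1) by (subst sum.Plus) (auto simp: A_def)
    have "supp_in n S"
    proof -
      have "supp_in n (V g)" using supp_in_V[OF gs] by simp
      moreover have "supp_in n g" using gs \<rho>_nonneg by (auto elim: supp_in_mono)
      moreover have "supp_in n (\<Sum>\<phi>\<in>F. t (Inl \<phi>) *\<^sub>R w \<phi>)"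
        unfolding scale by (intro supp_in_sum supp_in_scaleC w)
      moreover have "V g - \<omega> *\<^sub>C g = V g + (- \<omega>) *\<^sub>C g" by (simp add: scaleC.minus_left)
      ultimately show ?thesis unfolding S_eq by (simp only: supp_in_add supp_in_scaleC)
    qed
    moreover have "ell2_fun S x = 0" if x: "x \<in> ?B" for x
    proof -
      have "inner (ell2_fun S x) b = 0" if "b \<in> E" for b
        using t(2)[OF x that] by (simp add: S_def ell2_fun_sum scaleR_ell2.rep_eq inner_sum_left)
      then show ?thesis using E(4)[of "ell2_fun S x"] by simp
    qed
    ultimately have "S = 0" by (intro ell2_eqI) (auto simp: supp_in_def)
    then have "0 = ?P S" by (simp add: clinear_0[OF P_lin])
    also have "\<dots> = (\<Sum>\<phi>\<in>F. t (Inl \<phi>) *\<^sub>R ?P (w \<phi>))"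
      unfolding S_eq clinear_add[OF P_lin] P_kills[OF supp_in_l2_space[OF gs]]
      by (simp add: clinear_sum[OF P_lin] scale clinear_scaleC[OF P_lin])
    also have "\<dots> = (\<Sum>\<phi>\<in>F. t (Inl \<phi>) *\<^sub>R \<phi>)" using w(2) by (intro sum.cong) auto
    finally have comb: "(\<Sum>\<phi>\<in>F. t (Inl \<phi>) *\<^sub>R \<phi>) = 0" by simp
    have tF: "t (Inl \<phi>) = 0" if "\<phi> \<in> F" for \<phi>
    proof -
      have "0 = inner (\<Sum>\<psi>\<in>F. t (Inl \<psi>) *\<^sub>R \<psi>) \<phi>" unfolding comb by simp
      also have "\<dots> = (\<Sum>\<psi>\<in>F. if \<psi> = \<phi> then t (Inl \<phi>) else 0)"
        unfolding inner_sum_left using F(3) that by (intro sum.cong refl) auto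
      also have "\<dots> = t (Inl \<phi>)" using F(1) that by simp
      finally show ?thesis by simp
    qed
    then have "V g - \<omega> *\<^sub>C g = 0" using S_eq \<open>S = 0\<close> by simp
    then have "V g = \<omega> *\<^sub>C g" by simp
    then have "g = 0" using noloc gs n by (auto simp: localized_eigenvalue_def)
    have tC: "t (Inr (z, b)) = 0" if zb: "z \<in> ?C" "b \<in> E" for z b
    proof -
      have "0 = inner (ell2_fun g z) b" using \<open>g = 0\<close> by simp
      also have "\<dots> = (\<Sum>zb\<in>?C \<times> E. t (Inr zb) * inner (ell2_fun (ket (fst zb) (snd zb)) z) b)"
        by (simp add: g_def ell2_fun_sum scaleR_ell2.rep_eq inner_sum_left)
      also have "\<dots> = (\<Sum>zb\<in>?C \<times> E. if zb = (z, b) then t (Inr (z, b)) else 0)"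
      proof (rule sum.cong[OF refl])
        fix y assume y: "y \<in> ?C \<times> E"
        have "inner b b = 1" using E(2)[OF zb(2)] by (simp add: norm_eq_1)
        then show "t (Inr y) * inner (ell2_fun (ket (fst y) (snd y)) z) b = (if y = (z, b) then t (Inr (z, b)) else 0)"
          using E(3)[of "snd y" b] y zb by (auto simp: ell2_fun_ket prod_eq_iff)
      qed
      also have "\<dots> = t (Inr (z, b))" using zb E(1) by simp
      finally show ?thesis by simp
    qed
    show False using t(1) tF tC by auto
  qed
  \<comment> \<open>The trace is counted twice: by sites it is \<open>\<tau>\<close> times the
    volume; by members of \<open>F\<close>, which lie in the eigenspace, Bessel's inequality bounds
    it by the rank.\<close>
  have "\<tau> * real (card ?I) = (\<Sum>c\<in>?I. (norm (?P (e c)))\<^sup>2)" using Pe Il by simp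
  also have "\<dots> = (\<Sum>c\<in>?I. \<Sum>\<phi>\<in>F. (inner (?P (e c)) \<phi>)\<^sup>2)" using F(4) by (intro sum.cong) auto
  also have "\<dots> = (\<Sum>\<phi>\<in>F. \<Sum>c\<in>?I. (inner (?P (e c)) \<phi>)\<^sup>2)" by (rule sum.swap)
  also have "\<dots> = (\<Sum>\<phi>\<in>F. \<Sum>c\<in>?I. (inner (e c) \<phi>)\<^sup>2)"
  proof (intro sum.cong refl)
    fix \<phi> c assume "\<phi> \<in> F"
    then have "\<phi> \<in> ?K" using w(2)[of \<phi>] proj_in[OF K, of "w \<phi>"] by simp
    then have "cinner (?P (e c)) \<phi> = cinner (e c) \<phi>" by (rule proj_cinner[OF K])
    then show "(inner (?P (e c)) \<phi>)\<^sup>2 = (inner (e c) \<phi>)\<^sup>2" by (simp flip: Re_cinner)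
  qed
  also have "\<dots> \<le> (\<Sum>\<phi>\<in>F. (norm \<phi>)\<^sup>2)"
    by (intro sum_mono sum_square_inner_orthonormal_le finite_cube e_on)
  also have "\<dots> = real (card F)" using F(3) by (simp add: power2_norm_eq_inner)
  also have "\<dots> \<le> real (card (?B \<times> E) - card (?C \<times> E))" using cardF by simp
  also have "\<dots> = real m * (real (2 * k + 1) ^ d - real (2 * k + 1 - s) ^ d)"
  proof -
    have "(2 * k + 1 - s) ^ d \<le> (2 * k + 1) ^ d" by (intro power_mono) auto
    moreover have "card (?B \<times> E) - card (?C \<times> E) = m * ((2 * k + 1) ^ d - (2 * k + 1 - s) ^ d)"
      unfolding card_cartesian_product cards m_def by (simp add: diff_mult_distrib2 mult_ac)
    ultimately show ?thesis by (simp only: of_nat_mult of_nat_diff of_nat_power)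
  qed
  also have "\<dots> \<le> real m * (\<epsilon> * real (2 * k + 1) ^ d)" by (intro mult_left_mono k) auto
  finally have "\<tau> * real (2 * k + 1) ^ d \<le> (real m * \<epsilon>) * real (2 * k + 1) ^ d"
    unfolding cards(1) by (simp only: of_nat_power mult.assoc)
  then have "\<tau> \<le> real m * \<epsilon>" by (rule mult_right_le_imp_le) simp
  also have "\<dots> < \<tau>"
  proof -
    have "real m * \<epsilon> = \<tau> * (real m / (2 * (real m + 1)))" by (simp add: \<epsilon>_def)
    also have "\<dots> < \<tau> * 1" using \<open>0 < \<tau>\<close> by (intro mult_strict_left_mono) (auto simp: divide_less_eq)
    finally show ?thesis by simp
  qed
  finally show False by simp
qed

end

section \<open>From operators on functions to operators on the Hilbert space\<close>

lemma funpow_lift_op: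
  assumes "T ` l2 Z \<subseteq> l2 Z" "u \<in> l2 Z"
  shows "ell2_fun ((lift_op Z T ^^ n) (Ell2 u)) = (T ^^ n) u \<and> (lift_op Z T ^^ n) (Ell2 u) \<in> l2_space Z"
proof (induction n)
  case 0
  then show ?case using assms by (simp add: ell2_fun_Ell2_l2 Ell2_in_l2_space)
next
  case (Suc n)
  then show ?case using assms(1) by (simp add: lift_op_fun_l2_space lift_op_in)
qed

lemma eigenspace_on_l2:
  assumes "T ` l2 Z \<subseteq> l2 Z"
  shows "eigenspace_on (l2 Z) T \<omega> = ell2_fun ` {e \<in> l2_space Z. lift_op Z T e = \<omega> *\<^sub>C e}"
proof (intro equalityI subsetI)
  fix f assume "f \<in> eigenspace_on (l2 Z) T \<omega>"
  then have f: "f \<in> l2 Z" "T f = (\<lambda>x. \<omega> *\<^sub>C f x)" by (auto simp: eigenspace_on_def)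
  have "ell2_fun (lift_op Z T (Ell2 f)) = ell2_fun (\<omega> *\<^sub>C Ell2 f)"
    using f assms by (simp add: lift_op_fun_l2_space Ell2_in_l2_space ell2_fun_Ell2_l2 scaleC_ell2.rep_eq)
  then have "lift_op Z T (Ell2 f) = \<omega> *\<^sub>C Ell2 f" by (simp add: ell2_fun_inject)
  then show "f \<in> ell2_fun ` {e \<in> l2_space Z. lift_op Z T e = \<omega> *\<^sub>C e}"
    using f by (intro image_eqI[of _ _ "Ell2 f"]) (auto simp: ell2_fun_Ell2_l2 Ell2_in_l2_space)
next
  fix f assume "f \<in> ell2_fun ` {e \<in> l2_space Z. lift_op Z T e = \<omega> *\<^sub>C e}"
  then obtain e where e: "e \<in> l2_space Z" "lift_op Z T e = \<omega> *\<^sub>C e" "f = ell2_fun e" by blast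
  then have "T f = (\<lambda>x. \<omega> *\<^sub>C f x)"
    using lift_op_fun_l2_space[OF assms e(1)] by (simp add: scaleC_ell2.rep_eq)
  then show "f \<in> eigenspace_on (l2 Z) T \<omega>" using e by (simp add: eigenspace_on_def ell2_fun_in_l2)
qed

lemma eigenvalue_on_l2:
  assumes "T ` l2 Z \<subseteq> l2 Z"
  shows "eigenvalue_on (l2 Z) T \<omega> \<longleftrightarrow> (\<exists>e\<in>l2_space Z. e \<noteq> 0 \<and> lift_op Z T e = \<omega> *\<^sub>C e)"
proof -
  have "ell2_fun e \<noteq> (\<lambda>_. 0) \<longleftrightarrow> e \<noteq> 0" for e :: "('a, 'b) ell2"
    using ell2_fun_inject[of e 0] by (simp add: zero_ell2.rep_eq)
  then show ?thesis unfolding eigenvalue_on_def eigenspace_on_l2[OF assms] by auto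
qed

lemma proj_onto_eq_proj:
  fixes S :: "('z, 'w::{complex_inner_space, complete_space}) ell2 set"
  assumes S: "csubspace S" "closed S" "S \<subseteq> l2_space Z" and u: "u \<in> l2 Z"
  shows "proj_onto Z (ell2_fun ` S) u = ell2_fun (proj S (Ell2 u))"
  unfolding proj_onto_def
proof (rule the_equality)
  have inner: "l2_inner Z (\<lambda>x. u x - ell2_fun v x) (ell2_fun w) = cinner (Ell2 u - v) w" if "v \<in> S" "w \<in> S" for v w
  proof -
    have "Ell2 u - v \<in> l2_space Z"
      using that S u by (intro csubspace_diff[OF csubspace_l2_space] Ell2_in_l2_space) auto
    from l2_inner_ell2[OF this, of w] show ?thesis using u by (simp add: minus_ell2.rep_eq ell2_fun_Ell2_l2)
  qed
  show "ell2_fun (proj S (Ell2 u)) \<in> ell2_fun ` S \<and>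
    (\<forall>w\<in>ell2_fun ` S. l2_inner Z (\<lambda>x. u x - ell2_fun (proj S (Ell2 u)) x) w = 0)"
    using proj_in[OF S(1,2)] proj_orthogonal[OF S(1,2)] inner by auto
  fix v assume "v \<in> ell2_fun ` S \<and> (\<forall>w\<in>ell2_fun ` S. l2_inner Z (\<lambda>x. u x - v x) w = 0)"
  then obtain v' where v': "v' \<in> S" "v = ell2_fun v'" "\<forall>w\<in>S. l2_inner Z (\<lambda>x. u x - ell2_fun v' x) (ell2_fun w) = 0"
    by auto
  then have "proj S (Ell2 u) = v'" using inner by (intro proj_eqI[OF S(1,2)]) auto
  then show "v = ell2_fun (proj S (Ell2 u))" using v' by simp
qed

lemma lin_span_add:
  assumes "f \<in> lin_span A" "g \<in> lin_span A"
  shows "(\<lambda>x. f x + g x) \<in> lin_span A"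
proof -
  obtain F c where F: "finite F" "F \<subseteq> A" "f = (\<lambda>x. \<Sum>h\<in>F. c h *\<^sub>C h x)"
    using assms(1) unfolding lin_span_def by blast
  obtain G b where G: "finite G" "G \<subseteq> A" "g = (\<lambda>x. \<Sum>h\<in>G. b h *\<^sub>C h x)"
    using assms(2) unfolding lin_span_def by blast
  let ?c = "\<lambda>h. (if h \<in> F then c h else 0) + (if h \<in> G then b h else 0)"
  have "f x + g x = (\<Sum>h\<in>F \<union> G. ?c h *\<^sub>C h x)" for x
  proof -
    have "(\<Sum>h\<in>F. c h *\<^sub>C h x) = (\<Sum>h\<in>F \<union> G. (if h \<in> F then c h else 0) *\<^sub>C h x)"
      using F(1) G(1) by (intro sum.mono_neutral_cong_left) auto
    moreover have "(\<Sum>h\<in>G. b h *\<^sub>C h x) = (\<Sum>h\<in>F \<union> G. (if h \<in> G then b h else 0) *\<^sub>C h x)"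
      using F(1) G(1) by (intro sum.mono_neutral_cong_left) auto
    ultimately show ?thesis unfolding F(3) G(3) by (simp add: scaleC_add_left sum.distrib)
  qed
  then have "(\<lambda>x. f x + g x) = (\<lambda>x. \<Sum>h\<in>F \<union> G. ?c h *\<^sub>C h x)" by blast
  then show ?thesis
    unfolding lin_span_def using F G
    by (intro CollectI exI[of _ "F \<union> G"] exI[of _ ?c]) auto
qed

lemma lin_span_scaleC:
  assumes "f \<in> lin_span A"
  shows "(\<lambda>x. a *\<^sub>C f x) \<in> lin_span A"
proof -
  obtain F c where F: "finite F" "F \<subseteq> A" "f = (\<lambda>x. \<Sum>h\<in>F. c h *\<^sub>C h x)"
    using assms unfolding lin_span_def by blast
  then show ?thesis
    unfolding lin_span_def
    by (intro CollectI exI[of _ F] exI[of _ "\<lambda>h. a * c h"]) (simp add: scaleC.sum_right scaleC_scaleC)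
qed

lemma lin_span_zero: "(\<lambda>_. 0) \<in> lin_span A"
  unfolding lin_span_def by (intro CollectI exI[of _ "{}"]) auto

lemma lin_span_superset: "f \<in> A \<Longrightarrow> f \<in> lin_span A"
  unfolding lin_span_def by (intro CollectI exI[of _ "{f}"] exI[of _ "\<lambda>_. 1"]) auto

lemma lin_span_subset_l2:
  assumes "A \<subseteq> l2 Z"
  shows "lin_span A \<subseteq> l2 Z"
proof
  fix f assume "f \<in> lin_span A"
  then obtain F c where F: "finite F" "F \<subseteq> A" "f = (\<lambda>x. \<Sum>h\<in>F. c h *\<^sub>C h x)"
    unfolding lin_span_def by blast
  have "f = ell2_fun (\<Sum>h\<in>F. c h *\<^sub>C Ell2 h)"
  proof -
    have "ell2_fun (Ell2 h) = h" if "h \<in> F" for h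
      using F(2) assms that by (intro ell2_fun_Ell2_l2) blast
    then show ?thesis
      unfolding F(3) by (intro ext) (simp add: ell2_fun_sum scaleC_ell2.rep_eq)
  qed
  moreover have "(\<Sum>h\<in>F. c h *\<^sub>C Ell2 h) \<in> l2_space Z"
    using F(2) assms
    by (intro csubspace_sum[OF csubspace_l2_space] csubspace_scaleC[OF csubspace_l2_space] Ell2_in_l2_space) auto
  ultimately show "f \<in> l2 Z" using ell2_fun_in_l2 by simp
qed

text \<open>Approximability in \<open>l2_norm\<close> becomes metric closure in \<open>ell2\<close>,
  so the projection theorem for closed subspaces applies to the span of the eigenvectors.\<close>

lemma closed_lin_span_eq:
  fixes A :: "('z \<Rightarrow> 'w::{complex_inner_space, complete_space}) set"
  assumes A: "A \<subseteq> l2 Z"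
  shows "closed_lin_span Z A = ell2_fun ` closure {f. ell2_fun f \<in> lin_span A}"
    and "csubspace {f. ell2_fun f \<in> lin_span A}"
    and "closure {f. ell2_fun f \<in> lin_span A} \<subseteq> l2_space Z"
proof -
  let ?S = "{f. ell2_fun f \<in> lin_span A}"
  show cs: "csubspace ?S"
    by (auto simp: csubspace_def zero_ell2.rep_eq plus_ell2.rep_eq scaleC_ell2.rep_eq
        lin_span_zero lin_span_add lin_span_scaleC)
  have SH: "?S \<subseteq> l2_space Z"
    using lin_span_subset_l2[OF A] by (auto simp: l2_iff l2_space_def)
  show cl: "closure ?S \<subseteq> l2_space Z" by (rule closure_minimal[OF SH closed_l2_space])
  have key: "u \<in> closed_lin_span Z A \<longleftrightarrow> Ell2 u \<in> closure ?S" if u: "u \<in> l2 Z" for u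
  proof -
    have nrm: "l2_norm Z (\<lambda>x. u x - ell2_fun v x) = dist v (Ell2 u)" if v: "v \<in> ?S" for v
    proof -
      have "Ell2 u - v \<in> l2_space Z"
        using v SH u by (intro csubspace_diff[OF csubspace_l2_space] Ell2_in_l2_space) auto
      from l2_norm_ell2[OF this] show ?thesis
        using u by (simp add: minus_ell2.rep_eq ell2_fun_Ell2_l2 dist_norm norm_minus_commute)
    qed
    have "(\<exists>v\<in>lin_span A. l2_norm Z (\<lambda>x. u x - v x) < e) \<longleftrightarrow> (\<exists>v\<in>?S. dist v (Ell2 u) < e)" for e
    proof
      assume "\<exists>v\<in>lin_span A. l2_norm Z (\<lambda>x. u x - v x) < e"
      then obtain v where v: "v \<in> lin_span A" "l2_norm Z (\<lambda>x. u x - v x) < e" by blast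
      have v2: "v \<in> l2 Z" using v(1) lin_span_subset_l2[OF A] by blast
      then have "Ell2 v \<in> ?S" using v(1) by (simp add: ell2_fun_Ell2_l2)
      moreover have "dist (Ell2 v) (Ell2 u) < e"
        using nrm[OF \<open>Ell2 v \<in> ?S\<close>] v(2) v2 by (simp add: ell2_fun_Ell2_l2)
      ultimately show "\<exists>v\<in>?S. dist v (Ell2 u) < e" by blast
    next
      assume "\<exists>v\<in>?S. dist v (Ell2 u) < e"
      then obtain v where v: "v \<in> ?S" "dist v (Ell2 u) < e" by blast
      then show "\<exists>v\<in>lin_span A. l2_norm Z (\<lambda>x. u x - v x) < e"
        using nrm[OF v(1)] by (intro bexI[of _ "ell2_fun v"]) auto
    qed
    then show ?thesis unfolding closed_lin_span_def closure_approachable using u by simp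
  qed
  show "closed_lin_span Z A = ell2_fun ` closure ?S"
  proof (intro equalityI subsetI)
    fix u assume u: "u \<in> closed_lin_span Z A"
    then have "u \<in> l2 Z" by (simp add: closed_lin_span_def)
    then show "u \<in> ell2_fun ` closure ?S"
      using key[of u] u by (intro image_eqI[of _ _ "Ell2 u"]) (auto simp: ell2_fun_Ell2_l2)
  next
    fix u assume "u \<in> ell2_fun ` closure ?S"
    then obtain f where f: "f \<in> closure ?S" "u = ell2_fun f" by blast
    then have "u \<in> l2 Z" using cl ell2_fun_in_l2 by blast
    then show "u \<in> closed_lin_span Z A" using key[of u] f by (simp add: ell2_fun_inverse)
  qed
qed

text \<open>Subtracting the projection onto the closed span of the eigenvectors leaves a vector
  orthogonal to each of them. Together with membership in \<open>l2 Z\<close> this is all that later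
  steps use of the continuous part.\<close>

lemma continuous_proj_properties:
  fixes U :: "('z \<Rightarrow> 'w::{complex_inner_space, complete_space}) \<Rightarrow> ('z \<Rightarrow> 'w)"
  assumes U: "U ` l2 Z \<subseteq> l2 Z" and u: "u \<in> l2 Z"
  shows "continuous_proj Z U u \<in> l2 Z"
    and "\<lbrakk>e \<in> l2_space Z; e \<noteq> 0; lift_op Z U e = s *\<^sub>C e\<rbrakk> \<Longrightarrow> cinner (Ell2 (continuous_proj Z U u)) e = 0"
proof -
  let ?A = "eigenvectors_on (l2 Z) U"
  let ?S = "closure {f. ell2_fun f \<in> lin_span ?A}"
  have A: "?A \<subseteq> l2 Z" by (auto simp: eigenvectors_on_def eigenspace_on_def)
  note cls = closed_lin_span_eq[OF A]
  have S: "csubspace ?S" "closed ?S" using csubspace_closure[OF cls(2)] by auto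
  let ?w = "Ell2 u - proj ?S (Ell2 u)"
  have pp: "pure_point_proj Z U u = ell2_fun (proj ?S (Ell2 u))"
    unfolding pure_point_proj_def cls(1) by (rule proj_onto_eq_proj[OF S cls(3) u])
  have cp: "continuous_proj Z U u = ell2_fun ?w"
    unfolding continuous_proj_def pp using u by (simp add: minus_ell2.rep_eq ell2_fun_Ell2_l2)
  have wH: "?w \<in> l2_space Z"
    using u cls(3) proj_in[OF S, of "Ell2 u"]
    by (intro csubspace_diff[OF csubspace_l2_space] Ell2_in_l2_space) auto
  show "continuous_proj Z U u \<in> l2 Z" unfolding cp by (rule ell2_fun_in_l2[OF wH])
  assume e: "e \<in> l2_space Z" "e \<noteq> 0" "lift_op Z U e = s *\<^sub>C e"
  have "ell2_fun e \<in> eigenspace_on (l2 Z) U s" unfolding eigenspace_on_l2[OF U]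
    by (rule imageI) (use e in simp)
  moreover have "ell2_fun e \<noteq> (\<lambda>_. 0)" using e(2) ell2_fun_inject[of e 0] by (simp add: zero_ell2.rep_eq)
  ultimately have "ell2_fun e \<in> ?A" unfolding eigenvectors_on_def by blast
  then have "ell2_fun e \<in> lin_span ?A" by (rule lin_span_superset)
  then have "e \<in> {f. ell2_fun f \<in> lin_span ?A}" by simp
  then have "e \<in> ?S" by (rule subsetD[OF closure_subset])
  then have "cinner ?w e = 0" by (rule proj_orthogonal[OF S])
  then show "cinner (Ell2 (continuous_proj Z U u)) e = 0" by (simp only: cp ell2_fun_inverse)
qed

lemma orthogonal_projection_on_l2_lift:
  fixes P :: "('z \<Rightarrow> 'w::complex_inner_space) \<Rightarrow> ('z \<Rightarrow> 'w)"
  assumes "orthogonal_projection_on_l2 Z P"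
  shows "P ` l2 Z \<subseteq> l2 Z" "clinear (lift_op Z P)"
    "cinner (lift_op Z P f) g = cinner f (lift_op Z P g)"
proof -
  show sub: "P ` l2 Z \<subseteq> l2 Z" using assms by (simp add: orthogonal_projection_on_l2_def)
  show "clinear (lift_op Z P)"
    using assms by (intro clinear_lift_op sub) (simp add: orthogonal_projection_on_l2_def)
  have sa: "cinner (lift_op Z P f) g = cinner f (lift_op Z P g)" if "f \<in> l2_space Z" "g \<in> l2_space Z" for f g
  proof -
    have "cinner (lift_op Z P f) g = l2_inner Z (P (ell2_fun f)) (ell2_fun g)"
      using that by (simp add: l2_inner_ell2[OF lift_op_in[OF sub], symmetric] lift_op_fun_l2_space[OF sub])
    also have "\<dots> = l2_inner Z (ell2_fun f) (P (ell2_fun g))"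
      using assms ell2_fun_in_l2[OF that(1)] ell2_fun_in_l2[OF that(2)]
      unfolding orthogonal_projection_on_l2_def by blast
    also have "\<dots> = cinner f (lift_op Z P g)"
      using that by (simp add: l2_inner_ell2[symmetric] lift_op_fun_l2_space[OF sub])
    finally show ?thesis .
  qed
  let ?R = "ell2_restrict Z"
  have R: "?R h \<in> l2_space Z" for h :: "('z, 'w) ell2" by (rule ell2_restrict_in_l2_space)
  have "cinner (lift_op Z P f) g = cinner (?R (lift_op Z P (?R f))) g"
    by (simp add: lift_op_restrict ell2_restrict_id[OF lift_op_in[OF sub]])
  also have "\<dots> = cinner (lift_op Z P (?R f)) (?R g)" by (rule cinner_ell2_restrict)
  also have "\<dots> = cinner (?R f) (lift_op Z P (?R g))" by (rule sa[OF R R])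
  also have "\<dots> = cinner f (?R (lift_op Z P (?R g)))" by (rule cinner_ell2_restrict)
  also have "\<dots> = cinner f (lift_op Z P g)"
    by (simp add: lift_op_restrict ell2_restrict_id[OF lift_op_in[OF sub]])
  finally show "cinner (lift_op Z P f) g = cinner f (lift_op Z P g)" .
qed

lemma scalar_spectral_measure_eq:
  assumes "projection_valued_measure Z E" "u \<in> l2 Z"
  shows "scalar_spectral_measure Z E u =
    measure_of (sphere 0 1) (sets circle_borel) (\<lambda>A. ennreal ((norm (lift_op Z (E A) (Ell2 u)))\<^sup>2))"
  unfolding scalar_spectral_measure_def
proof (rule measure_of_eq)
  show "sets circle_borel \<subseteq> Pow (sphere 0 1)" using sets_circle_borel_iff by blast
  fix A assume "A \<in> sigma_sets (sphere 0 1) (sets circle_borel)"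
  then have A: "A \<in> sets circle_borel"
    using sets.sigma_sets_eq[of circle_borel] by simp
  then have sub: "E A ` l2 Z \<subseteq> l2 Z"
    using assms(1) by (simp add: projection_valued_measure_def orthogonal_projection_on_l2_def)
  have "ell2_fun (lift_op Z (E A) (Ell2 u)) = E A u"
    using assms(2) by (simp add: lift_op_fun_l2_space[OF sub] Ell2_in_l2_space ell2_fun_Ell2_l2)
  then show "ennreal ((l2_norm Z (E A u))\<^sup>2) = ennreal ((norm (lift_op Z (E A) (Ell2 u)))\<^sup>2)"
    using l2_norm_ell2[OF lift_op_in[OF sub], of "Ell2 u"] by simp
qed

text \<open>Every lifted operator restricts its argument to \<open>Z\<close> first, so identities
  known on \<open>l2 Z\<close> hold on the whole type. The full circle then acts as the restriction
  to \<open>Z\<close>.\<close>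

lemma spectral_resolution_lift:
  fixes U :: "('z \<Rightarrow> 'w::{complex_inner_space, complete_space}) \<Rightarrow> ('z \<Rightarrow> 'w)"
  assumes U: "unitary_on_l2 Z U" and E: "is_spectral_measure Z U E"
  shows "spectral_resolution (lift_op Z U) (\<lambda>A. lift_op Z (E A))"
proof -
  interpret V: unitary_on_csubspace "l2_space Z" "lift_op Z U"
    by (rule unitary_on_csubspace_lift_op[OF U])
  have Usub: "U ` l2 Z \<subseteq> l2 Z" using U by (simp add: unitary_on_l2_def)
  have pvm: "projection_valued_measure Z E" using E by (simp add: is_spectral_measure_def)
  have op: "orthogonal_projection_on_l2 Z (E A)" if "A \<in> sets circle_borel" for A
    using pvm that by (simp add: projection_valued_measure_def)
  note sub = orthogonal_projection_on_l2_lift(1)[OF op]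
  let ?R = "ell2_restrict Z"
  have R: "?R x \<in> l2_space Z" for x :: "('z, 'w) ell2" by (rule ell2_restrict_in_l2_space)
  have R2: "ell2_fun (?R x) \<in> l2 Z" for x :: "('z, 'w) ell2" by (intro ell2_fun_in_l2 R)
  show ?thesis
  proof
    show "clinear (lift_op Z U)" by (rule V.clinear_U)
    show "norm (lift_op Z U x) \<le> norm x" for x
      using V.norm_U[OF R, of x] norm_ell2_restrict_le[of Z x] by (simp add: lift_op_restrict)
    show "clinear (lift_op Z (E A))" if "A \<in> sets circle_borel" for A
      by (rule orthogonal_projection_on_l2_lift(2)[OF op[OF that]])
    show "cinner (lift_op Z (E A) x) y = cinner x (lift_op Z (E A) y)" if "A \<in> sets circle_borel" for A x y
      by (rule orthogonal_projection_on_l2_lift(3)[OF op[OF that]])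
    show "lift_op Z (E (A \<inter> B)) x = lift_op Z (E A) (lift_op Z (E B) x)"
      if A: "A \<in> sets circle_borel" and B: "B \<in> sets circle_borel" for A B x
    proof -
      have "ell2_fun (lift_op Z (E A) (lift_op Z (E B) x)) = E A (E B (ell2_fun (?R x)))"
        by (simp add: lift_op_fun_l2_space[OF sub[OF A] lift_op_in[OF sub[OF B]]] lift_op_fun[OF sub[OF B]])
      also have "\<dots> = E (A \<inter> B) (ell2_fun (?R x))"
        using pvm A B R2 by (simp add: projection_valued_measure_def)
      also have "\<dots> = ell2_fun (lift_op Z (E (A \<inter> B)) x)"
        by (simp add: lift_op_fun[OF sub] A B sets.Int)
      finally show ?thesis by (simp add: ell2_fun_inject)
    qed
    show "lift_op Z (E {}) x = 0" for x
    proof -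
      have "ell2_fun (lift_op Z (E {}) x) = ell2_fun 0"
        using pvm R2 by (simp add: lift_op_fun[OF sub] projection_valued_measure_def zero_ell2.rep_eq)
      then show ?thesis by (simp only: ell2_fun_inject)
    qed
    show "(\<lambda>N. \<Sum>i<N. lift_op Z (E (F i)) x) \<longlonglongrightarrow> lift_op Z (E (\<Union>i. F i)) x"
      if F: "range F \<subseteq> sets circle_borel" "disjoint_family F" for F x
    proof -
      have Fi: "F i \<in> sets circle_borel" for i using F by auto
      have FU: "(\<Union>i. F i) \<in> sets circle_borel" using F by auto
      let ?d = "\<lambda>N. lift_op Z (E (\<Union>i. F i)) x - (\<Sum>i<N. lift_op Z (E (F i)) x)"
      have dH: "?d N \<in> l2_space Z" for N
        by (intro csubspace_diff[OF csubspace_l2_space] csubspace_sum[OF csubspace_l2_space] lift_op_in sub FU Fi)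
      have "l2_norm Z (\<lambda>y. E (\<Union>i. F i) (ell2_fun (?R x)) y - (\<Sum>i<N. E (F i) (ell2_fun (?R x)) y)) = norm (?d N)" for N
        using l2_norm_ell2[OF dH, of N]
        by (simp add: minus_ell2.rep_eq ell2_fun_sum lift_op_fun[OF sub[OF FU]] lift_op_fun[OF sub[OF Fi]])
      moreover have "(\<lambda>N. l2_norm Z (\<lambda>y. E (\<Union>i. F i) (ell2_fun (?R x)) y - (\<Sum>i<N. E (F i) (ell2_fun (?R x)) y))) \<longlonglongrightarrow> 0"
        using pvm F R2[of x] unfolding projection_valued_measure_def by blast
      ultimately have "(\<lambda>N. norm (?d N)) \<longlonglongrightarrow> 0" by simp
      then have "?d \<longlonglongrightarrow> 0" by (rule tendsto_norm_zero_cancel)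
      then have "(\<lambda>N. lift_op Z (E (\<Union>i. F i)) x - ?d N) \<longlonglongrightarrow> lift_op Z (E (\<Union>i. F i)) x - 0"
        by (intro tendsto_diff tendsto_const)
      then show ?thesis by simp
    qed
    show "cinner (lift_op Z U x) x =
      (LINT z|measure_of (sphere 0 1) (sets circle_borel) (\<lambda>A. ennreal ((norm (lift_op Z (E A) x))\<^sup>2)). z)" for x
    proof -
      have "cinner (lift_op Z U x) x = cinner (?R (lift_op Z U x)) x"
        by (simp add: ell2_restrict_id[OF lift_op_in[OF Usub]])
      also have "\<dots> = cinner (lift_op Z U x) (?R x)" by (rule cinner_ell2_restrict)
      also have "\<dots> = l2_inner Z (U (ell2_fun (?R x))) (ell2_fun (?R x))"
        by (simp add: l2_inner_ell2[OF lift_op_in[OF Usub], symmetric] lift_op_fun[OF Usub])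
      also have "\<dots> = (LINT z|scalar_spectral_measure Z E (ell2_fun (?R x)). z)"
        using E R2[of x] by (simp add: is_spectral_measure_def)
      also have "scalar_spectral_measure Z E (ell2_fun (?R x)) =
          measure_of (sphere 0 1) (sets circle_borel) (\<lambda>A. ennreal ((norm (lift_op Z (E A) x))\<^sup>2))"
        unfolding scalar_spectral_measure_eq[OF pvm R2] by (simp add: ell2_fun_inverse lift_op_restrict)
      finally show ?thesis .
    qed
  qed
qed

section \<open>Free actions of lattices\<close>

text \<open>The hypotheses of the theorem that the argument works from. Inside, the isomorphism with
  the standard lattice provides coordinates that turn the action into an instance of
  \<open>lattice_walk\<close>.\<close>

locale free_lattice_action =
  fixes Z F0 :: "'z set" and G :: "('g, 'm) monoid_scheme" and d :: nat and act :: "'g \<Rightarrow> 'z \<Rightarrow> 'z"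
    and U :: "('z \<Rightarrow> 'w::fin_dim_complex_inner_space) \<Rightarrow> ('z \<Rightarrow> 'w)"
  assumes free_abelian: "free_abelian_group_of_rank G d"
    and free: "free_action G Z act"
    and finite_orbits: "finite (orbits G Z act)"
    and fundamental: "fundamental_set G Z act F0"
    and unitary: "unitary_on_l2 Z U"
    and commutes: "commutes_with_action G Z act U"
    and finite_prop: "finite_propagation G act F0 U"
begin

sublocale group_action G Z act
  using free by (simp add: free_action_def)

lemma comm_group_G: "comm_group G"
  using free_abelian by (simp add: free_abelian_group_of_rank_def)

sublocale group G
  using comm_group_G by (simp add: comm_group_def)

definition coord :: "'g \<Rightarrow> (nat \<Rightarrow>\<^sub>0 int)" where
  "coord = (SOME h. h \<in> iso G (free_Abelian_group {..<d}))"

definition el :: "(nat \<Rightarrow>\<^sub>0 int) \<Rightarrow> 'g" where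
  "el = inv_into (carrier G) coord"

lemma coord_iso: "coord \<in> iso G (free_Abelian_group {..<d})"
proof -
  have "\<exists>h. h \<in> iso G (free_Abelian_group {..<d})"
    using free_abelian by (auto simp: free_abelian_group_of_rank_def is_iso_def)
  then show ?thesis unfolding coord_def by (rule someI_ex)
qed

lemma coord_bij: "bij_betw coord (carrier G) (lat d)"
proof -
  have "carrier (free_Abelian_group {..<d}) = lat d" by (auto simp: lat_def)
  then show ?thesis using coord_iso by (auto simp: iso_def)
qed

lemma coord_mult: "\<lbrakk>a \<in> carrier G; b \<in> carrier G\<rbrakk> \<Longrightarrow> coord (a \<otimes>\<^bsub>G\<^esub> b) = coord a + coord b"
  using coord_iso by (auto simp: iso_def hom_def)

lemma coord_lat: "a \<in> carrier G \<Longrightarrow> coord a \<in> lat d"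
  using coord_bij by (auto simp: bij_betw_def)

lemma el_carrier: "c \<in> lat d \<Longrightarrow> el c \<in> carrier G"
  unfolding el_def using coord_bij by (intro inv_into_into) (simp add: bij_betw_def)

lemma coord_el: "c \<in> lat d \<Longrightarrow> coord (el c) = c"
  unfolding el_def using coord_bij by (intro f_inv_into_f) (simp add: bij_betw_def)

lemma el_coord: "a \<in> carrier G \<Longrightarrow> el (coord a) = a"
  unfolding el_def using coord_bij by (intro inv_into_f_f) (simp_all add: bij_betw_def)

lemma el_add: "\<lbrakk>a \<in> lat d; b \<in> lat d\<rbrakk> \<Longrightarrow> el (a + b) = el a \<otimes>\<^bsub>G\<^esub> el b"
  using coord_mult[of "el a" "el b"] el_coord[of "el a \<otimes>\<^bsub>G\<^esub> el b"] by (simp add: el_carrier coord_el)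

lemma coord_one: "coord \<one>\<^bsub>G\<^esub> = 0"
  using coord_mult[of "\<one>\<^bsub>G\<^esub>" "\<one>\<^bsub>G\<^esub>"] by simp

lemma el_0: "el 0 = \<one>\<^bsub>G\<^esub>"
  using el_coord[of "\<one>\<^bsub>G\<^esub>"] by (simp add: coord_one)

lemma el_uminus:
  assumes "c \<in> lat d"
  shows "el (- c) = inv\<^bsub>G\<^esub> (el c)"
proof -
  have "el (- c) \<otimes>\<^bsub>G\<^esub> el c = \<one>\<^bsub>G\<^esub>" using el_add[of "- c" c] assms by (simp add: el_0)
  then show ?thesis using assms by (intro inv_equality[symmetric]) (simp_all add: el_carrier)
qed

definition sh :: "(nat \<Rightarrow>\<^sub>0 int) \<Rightarrow> 'z \<Rightarrow> 'z" where
  "sh c x = act (el c) x"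

lemma sh_in: "\<lbrakk>c \<in> lat d; x \<in> Z\<rbrakk> \<Longrightarrow> sh c x \<in> Z"
  unfolding sh_def using element_image[OF el_carrier] by blast

lemma sh_add: "\<lbrakk>a \<in> lat d; b \<in> lat d; x \<in> Z\<rbrakk> \<Longrightarrow> sh (a + b) x = sh a (sh b x)"
  by (simp add: sh_def el_add composition_rule el_carrier)

lemma sh_0: "x \<in> Z \<Longrightarrow> sh 0 x = x"
  using id_eq_one by (metis sh_def el_0 restrict_apply')

text \<open>Freeness makes the lattice position of a point relative to its representative unique;
  this is what makes \<open>pos\<close> a coordinate.\<close>

lemma sh_free:
  assumes "a \<in> lat d" "b \<in> lat d" "x \<in> Z" "sh a x = sh b x"
  shows "a = b"
proof -
  have "sh (a - b) x = sh (- b) (sh a x)"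
    using sh_add[of "- b" a x] assms by (simp add: add.commute)
  also have "\<dots> = sh (- b + b) x" unfolding assms(4) using assms by (simp only: sh_add lat_uminus)
  finally have "act (el (a - b)) x = x" using assms(3) by (simp add: sh_0) (simp add: sh_def)
  then have "el (a - b) = \<one>\<^bsub>G\<^esub>"
    using free assms el_carrier[OF lat_diff] by (auto simp: free_action_def)
  then have "a - b = 0" using coord_el[OF lat_diff[OF assms(1,2)]] by (simp add: coord_one)
  then show ?thesis by simp
qed

definition base :: "'z \<Rightarrow> 'z" where
  "base x = (THE y. y \<in> F0 \<inter> orbit G act x)"

lemma F0_subset: "F0 \<subseteq> Z"
  using fundamental by (simp add: fundamental_set_def)

lemma base_unique: "x \<in> Z \<Longrightarrow> \<exists>!y. y \<in> F0 \<inter> orbit G act x"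
  using fundamental by (auto simp: fundamental_set_def orbits_def)

lemma base_in_orbit: "x \<in> Z \<Longrightarrow> base x \<in> F0 \<inter> orbit G act x"
  unfolding base_def by (rule theI'[OF base_unique])

lemma base_eqI: "x \<in> Z \<Longrightarrow> y \<in> F0 \<Longrightarrow> y \<in> orbit G act x \<Longrightarrow> base x = y"
  using base_unique[of x] base_in_orbit[of x] by blast

lemma orbit_iff: "x \<in> Z \<Longrightarrow> y \<in> orbit G act x \<longleftrightarrow> (\<exists>c\<in>lat d. y = sh c x)"
proof -
  have "y \<in> orbit G act x \<longleftrightarrow> (\<exists>a\<in>carrier G. y = act a x)" by (auto simp: orbit_def)
  also have "\<dots> \<longleftrightarrow> (\<exists>c\<in>lat d. y = sh c x)"
    unfolding sh_def using el_carrier el_coord coord_lat by metis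
  finally show ?thesis .
qed

lemma ex_pos: "x \<in> Z \<Longrightarrow> \<exists>c. c \<in> lat d \<and> sh c (base x) = x"
proof -
  assume x: "x \<in> Z"
  then obtain c where c: "c \<in> lat d" "base x = sh c x" using base_in_orbit[OF x] orbit_iff[OF x] by blast
  then have "sh (- c) (base x) = x" using x sh_add[of "- c" c x] by (simp add: sh_0)
  then show ?thesis using c by (intro exI[of _ "- c"]) simp
qed

definition pos :: "'z \<Rightarrow> (nat \<Rightarrow>\<^sub>0 int)" where
  "pos x = (SOME c. c \<in> lat d \<and> sh c (base x) = x)"

lemma pos_lat: "x \<in> Z \<Longrightarrow> pos x \<in> lat d" and sh_pos_base: "x \<in> Z \<Longrightarrow> sh (pos x) (base x) = x"
proof -
  assume "x \<in> Z"
  then have "pos x \<in> lat d \<and> sh (pos x) (base x) = x" unfolding pos_def by (rule someI_ex[OF ex_pos])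
  then show "pos x \<in> lat d" "sh (pos x) (base x) = x" by auto
qed

lemma base_sh_F0:
  assumes "c \<in> lat d" "x \<in> F0"
  shows "base (sh c x) = x"
proof -
  have x: "x \<in> Z" using assms F0_subset by blast
  have "x = sh (- c) (sh c x)" using sh_add[of "- c" c x] assms x by (simp add: sh_0)
  then have "x \<in> orbit G act (sh c x)"
    using orbit_iff[OF sh_in[OF assms(1) x]] assms by (metis lat_uminus)
  then show ?thesis by (intro base_eqI sh_in assms x)
qed

lemma pos_sh_F0:
  assumes "c \<in> lat d" "x \<in> F0"
  shows "pos (sh c x) = c"
proof -
  have x: "x \<in> Z" using assms F0_subset by blast
  have y: "sh c x \<in> Z" using assms x by (intro sh_in)
  have "sh (pos (sh c x)) x = sh c x" using sh_pos_base[OF y] base_sh_F0[OF assms] by simp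
  then show ?thesis by (rule sh_free[OF pos_lat[OF y] assms(1) x])
qed

lemma finite_F0: "finite F0"
proof (rule inj_on_finite[OF _ _ finite_orbits])
  show "inj_on (orbit G act) F0"
  proof (rule inj_onI)
    fix x y assume xy: "x \<in> F0" "y \<in> F0" "orbit G act x = orbit G act y"
    then have Z: "x \<in> Z" "y \<in> Z" using F0_subset by auto
    have refl: "z \<in> orbit G act z" if "z \<in> Z" for z
      unfolding orbit_iff[OF that] by (rule bexI[of _ 0]) (simp_all add: sh_0 that)
    have "base x = x" by (rule base_eqI[OF Z(1) xy(1) refl[OF Z(1)]])
    moreover have "base x = y" using refl[OF Z(2)] xy by (intro base_eqI[OF Z(1) xy(2)]) simp
    ultimately show "x = y" by simp
  qed
  show "orbit G act ` F0 \<subseteq> orbits G Z act" using F0_subset by (auto simp: orbits_def)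
qed

lemma U_sub: "U ` l2 Z \<subseteq> l2 Z"
  using unitary by (simp add: unitary_on_l2_def)

abbreviation V :: "('z, 'w) ell2 \<Rightarrow> ('z, 'w) ell2" where
  "V \<equiv> lift_op Z U"

lemma ell2_fun_V_ket: "x \<in> Z \<Longrightarrow> ell2_fun (V (ket x v)) = U (delta x v)"
  by (simp add: lift_op_fun_l2_space[OF U_sub] ket_in_l2_space ket.rep_eq)

text \<open>In coordinates, membership of the target in the coset of the source says that the
  difference of positions lies in the finite image of \<open>S\<close>, which fits into a
  box.\<close>

lemma propagation_bound:
  obtains \<rho> where "0 \<le> \<rho>"
    "\<And>x y v. \<lbrakk>x \<in> Z; ell2_fun (V (ket x v)) y \<noteq> 0\<rbrakk> \<Longrightarrow> y \<in> Z \<and> pos y - pos x \<in> cube d (- \<rho>) (\<rho> + 1)"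
proof -
  obtain S where S: "finite S" "S \<subseteq> carrier G"
    "\<And>x y \<alpha> \<beta> v. \<lbrakk>x \<in> F0; y \<in> F0; \<alpha> \<in> carrier G; \<beta> \<in> carrier G; \<beta> \<notin> \<alpha> <#\<^bsub>G\<^esub> S\<rbrakk> \<Longrightarrow>
      U (delta (act \<alpha> x) v) (act \<beta> y) = 0"
    using finite_prop by (auto simp: finite_propagation_def)
  have "Poly_Mapping.keys c \<subseteq> {..<d}" if "c \<in> coord ` S" for c
    using that S(2) coord_lat by (auto simp: lat_def)
  then obtain \<rho> where \<rho>: "0 \<le> \<rho>" "coord ` S \<subseteq> cube d (- \<rho>) (\<rho> + 1)"
    using finite_subset_cube[of "coord ` S" d] S(1) by blast
  have "y \<in> Z \<and> pos y - pos x \<in> cube d (- \<rho>) (\<rho> + 1)"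
    if x: "x \<in> Z" and nz: "ell2_fun (V (ket x v)) y \<noteq> 0" for x y v
  proof -
    have yZ: "y \<in> Z" using lift_op_in[OF U_sub, of "ket x v"] nz by (auto simp: l2_space_def)
    let ?\<alpha> = "el (pos x)" and ?\<beta> = "el (pos y)"
    have ab: "?\<alpha> \<in> carrier G" "?\<beta> \<in> carrier G" using x yZ by (auto intro: el_carrier pos_lat)
    have "U (delta (act ?\<alpha> (base x)) v) (act ?\<beta> (base y)) \<noteq> 0"
      using nz ell2_fun_V_ket[OF x] sh_pos_base[OF x] sh_pos_base[OF yZ] by (simp add: sh_def)
    then have "?\<beta> \<in> ?\<alpha> <#\<^bsub>G\<^esub> S"
      using S(3)[of "base x" "base y" ?\<alpha> ?\<beta> v] base_in_orbit x yZ ab by blast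
    then obtain s where s: "s \<in> S" "?\<beta> = ?\<alpha> \<otimes>\<^bsub>G\<^esub> s" by (auto simp: l_coset_def)
    then have "coord ?\<beta> = coord ?\<alpha> + coord s" using ab S(2) coord_mult by auto
    then have "pos y = pos x + coord s" using x yZ by (simp add: coord_el pos_lat)
    then have "pos y - pos x = coord s" by simp
    then show ?thesis using yZ s \<rho> by auto
  qed
  with that \<rho>(1) show thesis by blast
qed

lemma V_shift:
  assumes c: "c \<in> lat d" and f: "f \<in> l2_space Z" and g: "g \<in> l2_space Z"
    and fg: "\<And>x. x \<in> Z \<Longrightarrow> ell2_fun g x = ell2_fun f (sh (- c) x)" and x: "x \<in> Z"
  shows "ell2_fun (V g) x = ell2_fun (V f) (sh (- c) x)"
proof -
  have tr: "translate G Z act (el c) h = (\<lambda>x. if x \<in> Z then h (sh (- c) x) else 0)" for h :: "'z \<Rightarrow> 'w"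
    unfolding translate_def sh_def el_uminus[OF c] ..
  have "ell2_fun g = translate G Z act (el c) (ell2_fun f)"
    unfolding tr using fg g by (auto simp: l2_space_def)
  then have "U (ell2_fun g) = translate G Z act (el c) (U (ell2_fun f))"
    using commutes el_carrier[OF c] ell2_fun_in_l2[OF f] by (simp add: commutes_with_action_def)
  then show ?thesis unfolding lift_op_fun_l2_space[OF U_sub g] lift_op_fun_l2_space[OF U_sub f] tr
    using x by simp
qed

lemma lattice_walk_exists: "\<exists>\<rho>. lattice_walk Z V F0 d sh base pos \<rho>"
proof -
  obtain \<rho> where \<rho>: "0 \<le> \<rho>"
    "\<And>x y v. \<lbrakk>x \<in> Z; ell2_fun (V (ket x v)) y \<noteq> 0\<rbrakk> \<Longrightarrow> y \<in> Z \<and> pos y - pos x \<in> cube d (- \<rho>) (\<rho> + 1)"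
    using propagation_bound by blast
  interpret unitary_on_csubspace "l2_space Z" V
    by (rule unitary_on_csubspace_lift_op[OF unitary])
  have "lattice_walk Z V F0 d sh base pos \<rho>"
  proof
    show "base x \<in> F0" if "x \<in> Z" for x using base_in_orbit[OF that] by simp
  qed (fact finite_F0 F0_subset sh_in sh_add pos_lat sh_pos_base base_sh_F0 pos_sh_F0 \<rho> V_shift)+
  then show ?thesis by blast
qed

end

text \<open>The radius \<open>\<rho>\<close> is only known to exist, so it enters as a parameter and
  is supplied when the theorem is proved.\<close>

locale periodic_walk = free_lattice_action Z F0 G d act U + W: lattice_walk Z "lift_op Z U" F0 d sh base pos \<rho>
  for Z F0 :: "'z set" and G :: "('g, 'm) monoid_scheme" and d :: nat and act :: "'g \<Rightarrow> 'z \<Rightarrow> 'z"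
    and U :: "('z \<Rightarrow> 'w::fin_dim_complex_inner_space) \<Rightarrow> ('z \<Rightarrow> 'w)" and \<rho> :: int
begin

lemma extend_op_eq_ext:
  assumes y: "y \<in> Z"
  shows "extend_op Z U f y = W.ext f y"
proof -
  have "extend_op Z U f y = (\<Sum>x | x \<in> Z \<and> U (delta x (f x)) y \<noteq> 0. ell2_fun (V (ket x (f x))) y)"
    unfolding extend_op_def by (intro sum.cong refl) (simp add: ell2_fun_V_ket)
  also have "\<dots> = W.ext f y"
    unfolding W.ext_def
  proof (rule sum.mono_neutral_left[OF W.finite_near[OF y]])
    show "{x. x \<in> Z \<and> U (delta x (f x)) y \<noteq> 0} \<subseteq> W.near y"
      using W.near_propagation by (auto simp: ell2_fun_V_ket)
    show "\<forall>x\<in>W.near y - {x. x \<in> Z \<and> U (delta x (f x)) y \<noteq> 0}. ell2_fun (V (ket x (f x))) y = 0"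
      by (auto simp: W.near_def ell2_fun_V_ket)
  qed
  finally show ?thesis .
qed

lemma extend_op_outside:
  assumes y: "y \<notin> Z"
  shows "extend_op Z U f y = 0"
proof -
  have "U (delta x (f x)) y = 0" if x: "x \<in> Z" for x
    using lift_op_in[OF U_sub, of "ket x (f x)"] ell2_fun_V_ket[OF x, of "f x"] y by (simp add: l2_space_def)
  then show ?thesis unfolding extend_op_def by (intro sum.neutral) auto
qed

text \<open>Group elements and lattice vectors correspond through \<open>el\<close>, and outside
  \<open>Z\<close> the extended operator vanishes. The eigenvalue equation as an identity of total
  functions thus reduces to the points of \<open>Z\<close>.\<close>

lemma eigenvalue_on_C_chi:
  "eigenvalue_on (C_chi G Z act \<kappa>) (U_chi G Z act U \<kappa>) \<omega> \<longleftrightarrow> (\<exists>f. W.qp_eigenfunction (\<kappa> \<circ> el) \<omega> f)"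
proof -
  have C: "f \<in> C_chi G Z act \<kappa> \<longleftrightarrow> (\<forall>x. x \<notin> Z \<longrightarrow> f x = 0) \<and> (\<forall>c\<in>lat d. \<forall>x\<in>Z. f (sh c x) = (\<kappa> \<circ> el) c *\<^sub>C f x)"
    for f :: "'z \<Rightarrow> 'w"
  proof -
    have "(\<forall>x\<in>Z. \<forall>\<alpha>\<in>carrier G. f (act \<alpha> x) = \<kappa> \<alpha> *\<^sub>C f x) \<longleftrightarrow> (\<forall>c\<in>lat d. \<forall>x\<in>Z. f (sh c x) = (\<kappa> \<circ> el) c *\<^sub>C f x)"
      unfolding sh_def comp_def using el_carrier el_coord coord_lat by metis
    then show ?thesis by (simp add: C_chi_def functions_on_def)
  qed
  have "f \<in> eigenspace_on (C_chi G Z act \<kappa>) (U_chi G Z act U \<kappa>) \<omega> \<and> f \<noteq> (\<lambda>_. 0) \<longleftrightarrow> W.qp_eigenfunction (\<kappa> \<circ> el) \<omega> f" for f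
  proof -
    have "extend_op Z U f = (\<lambda>x. \<omega> *\<^sub>C f x) \<longleftrightarrow> (\<forall>y\<in>Z. W.ext f y = \<omega> *\<^sub>C f y)"
      if "\<forall>x. x \<notin> Z \<longrightarrow> f x = 0"
    proof
      assume "extend_op Z U f = (\<lambda>x. \<omega> *\<^sub>C f x)"
      then show "\<forall>y\<in>Z. W.ext f y = \<omega> *\<^sub>C f y" by (simp flip: extend_op_eq_ext)
    next
      assume *: "\<forall>y\<in>Z. W.ext f y = \<omega> *\<^sub>C f y"
      show "extend_op Z U f = (\<lambda>x. \<omega> *\<^sub>C f x)"
      proof
        fix y
        show "extend_op Z U f y = \<omega> *\<^sub>C f y"
          using * that by (cases "y \<in> Z") (simp_all add: extend_op_eq_ext extend_op_outside)
      qed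
    qed
    moreover have "f \<noteq> (\<lambda>_. 0) \<longleftrightarrow> (\<exists>x\<in>Z. f x \<noteq> 0)" if "\<forall>x. x \<notin> Z \<longrightarrow> f x = 0"
      using that by (auto simp: fun_eq_iff)
    ultimately show ?thesis
      unfolding eigenspace_on_def U_chi_def W.qp_eigenfunction_def
      by (auto simp: C restrict_def)
  qed
  then show ?thesis unfolding eigenvalue_on_def by blast
qed

lemma character_comp_el: "\<kappa> \<in> characters G \<Longrightarrow> W.character (\<kappa> \<circ> el)"
  by (auto simp: W.character_def characters_def hom_def circle_group_def el_add el_carrier Pi_iff)

lemma comp_coord_in_characters: "W.character \<kappa> \<Longrightarrow> \<kappa> \<circ> coord \<in> characters G"
  by (auto simp: W.character_def characters_def hom_def circle_group_def coord_mult coord_lat)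

lemma eigenvalue_iff_localized: "eigenvalue_on (l2 Z) U \<omega> \<longleftrightarrow> W.localized_eigenvalue \<omega>"
proof
  assume "eigenvalue_on (l2 Z) U \<omega>"
  then show "W.localized_eigenvalue \<omega>"
    unfolding eigenvalue_on_l2[OF U_sub] using W.eigenvector_imp_localized by blast
next
  assume "W.localized_eigenvalue \<omega>"
  then show "eigenvalue_on (l2 Z) U \<omega>"
    unfolding eigenvalue_on_l2[OF U_sub] W.localized_eigenvalue_def using W.supp_in_l2_space by blast
qed

lemma eigenvalue_iff_all_characters:
  "eigenvalue_on (l2 Z) U \<omega> \<longleftrightarrow>
    (\<forall>\<kappa>\<in>characters G. eigenvalue_on (C_chi G Z act \<kappa>) (U_chi G Z act U \<kappa>) \<omega>)"
proof
  assume "eigenvalue_on (l2 Z) U \<omega>"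
  then show "\<forall>\<kappa>\<in>characters G. eigenvalue_on (C_chi G Z act \<kappa>) (U_chi G Z act U \<kappa>) \<omega>"
    unfolding eigenvalue_iff_localized eigenvalue_on_C_chi
    using W.localized_imp_qp_eigenfunction character_comp_el by blast
next
  assume all: "\<forall>\<kappa>\<in>characters G. eigenvalue_on (C_chi G Z act \<kappa>) (U_chi G Z act U \<kappa>) \<omega>"
  have "\<exists>f. W.qp_eigenfunction \<kappa> \<omega> f" if \<kappa>: "W.character \<kappa>" for \<kappa>
  proof -
    obtain f where f: "W.qp_eigenfunction (\<kappa> \<circ> coord \<circ> el) \<omega> f"
      using all comp_coord_in_characters[OF \<kappa>] unfolding eigenvalue_on_C_chi by blast
    \<comment> \<open>Passing to the group and back changes \<open>\<kappa>\<close> only outside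
      \<open>lat d\<close>, where quasi-periodicity imposes no condition.\<close>
    have "W.qp_eigenfunction \<kappa> \<omega> f"
      using f by (simp add: W.qp_eigenfunction_def coord_el)
    then show ?thesis by blast
  qed
  then show "eigenvalue_on (l2 Z) U \<omega>"
    unfolding eigenvalue_iff_localized by (rule W.qp_eigenfunctions_imp_localized)
qed

text \<open>An eigenvalue occurs for every character, so one character bounds their number; the
  trivial one is taken.\<close>

lemma finite_eigenvalues: "finite {\<omega>. eigenvalue_on (l2 Z) U \<omega>}"
proof (rule finite_subset[OF _ W.finite_qp_eigenvalues[of "\<lambda>_. 1"]])
  have "W.character (\<lambda>_. 1)" by (simp add: W.character_def)
  then show "{\<omega>. eigenvalue_on (l2 Z) U \<omega>} \<subseteq> {\<omega>. \<exists>f. W.qp_eigenfunction (\<lambda>_. 1) \<omega> f}"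
    unfolding eigenvalue_iff_localized using W.localized_imp_qp_eigenfunction by blast
qed

lemma continuous_spectrum: "continuous_spectrum_abs_cont Z U"
  unfolding continuous_spectrum_abs_cont_def absolutely_continuous_def
proof (intro allI impI ballI subsetI)
  fix E and u :: "'z \<Rightarrow> 'w" and \<Lambda>
  assume E: "is_spectral_measure Z U E" and u: "u \<in> l2 Z" and \<Lambda>: "\<Lambda> \<in> null_sets circle_lebesgue"
  interpret S: spectral_resolution V "\<lambda>A. lift_op Z (E A)" by (rule spectral_resolution_lift[OF unitary E])
  have pvm: "projection_valued_measure Z E" using E by (simp add: is_spectral_measure_def)
  let ?w = "continuous_proj Z U u"
  note w = continuous_proj_properties[OF U_sub u]
  have \<Lambda>s: "\<Lambda> \<in> sets circle_borel" using \<Lambda> by (auto simp: null_sets_def)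
  have E_in: "lift_op Z (E A) f \<in> l2_space Z" if "A \<in> sets circle_borel" for A f
    using pvm that by (intro lift_op_in orthogonal_projection_on_l2_lift(1)) (simp add: projection_valued_measure_def)
  have "lift_op Z (E \<Lambda>) (Ell2 ?w) = 0"
    by (rule W.continuous_part_null[OF S.spectral_resolution_axioms E_in \<Lambda> Ell2_in_l2_space[OF w(1)] w(2)])
  then show "\<Lambda> \<in> null_sets (scalar_spectral_measure Z E ?w)"
    unfolding scalar_spectral_measure_eq[OF pvm w(1)] null_sets_def
    using \<Lambda>s by (simp add: S.emeasure_\<mu>)
qed

lemma transition_prob_eq: "u \<in> l2 Z \<Longrightarrow> transition_prob U n u x = (norm (ell2_fun ((V ^^ n) (Ell2 u)) x))\<^sup>2"
  using funpow_lift_op[OF U_sub, of u n] by (simp add: transition_prob_def)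

text \<open>The hypothesis \<open>only\<close> allows that there is no eigenvalue at all, hence the
  separate condition on the modulus of \<open>\<omega>\<close>. The phase
  \<open>\<omega> ^ n\<close> then drops out of the norm.\<close>

lemma transition_prob_limit:
  assumes only: "\<And>\<omega>'. eigenvalue_on (l2 Z) U \<omega>' \<Longrightarrow> \<omega>' = \<omega>" and \<omega>: "cmod \<omega> = 1"
    and u: "u \<in> l2 Z" and x: "x \<in> Z"
  shows "(\<lambda>n. transition_prob U n u x) \<longlonglongrightarrow> (norm (proj_onto Z (eigenspace_on (l2 Z) U \<omega>) u x))\<^sup>2"
proof -
  let ?K = "{e \<in> l2_space Z. V e = \<omega> *\<^sub>C e}"
  let ?\<pi> = "ell2_fun (proj ?K (Ell2 u)) x"
  have eq: "proj_onto Z (eigenspace_on (l2 Z) U \<omega>) u = ell2_fun (proj ?K (Ell2 u))"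
    unfolding eigenspace_on_l2[OF U_sub]
    by (rule proj_onto_eq_proj[OF W.csubspace_eigenspace W.closed_eigenspace _ u]) auto
  have lim: "(\<lambda>n. ell2_fun ((V ^^ n) (Ell2 u)) x - \<omega> ^ n *\<^sub>C ?\<pi>) \<longlonglongrightarrow> 0"
  proof (rule W.asymptotics_single_eigenvalue[OF _ Ell2_in_l2_space[OF u] x])
    show "s = \<omega>" if "e \<in> l2_space Z" "e \<noteq> 0" "V e = s *\<^sub>C e" for e s
      using only[of s] that unfolding eigenvalue_on_l2[OF U_sub] by blast
  qed
  have "(\<lambda>n. norm (ell2_fun ((V ^^ n) (Ell2 u)) x) - norm ?\<pi>) \<longlonglongrightarrow> 0"
  proof (rule Lim_null_comparison[OF _ tendsto_norm_zero[OF lim]], rule always_eventually, rule allI)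
    fix n
    have "norm (\<omega> ^ n *\<^sub>C ?\<pi>) = norm ?\<pi>" using \<omega> by (simp only: norm_scaleC norm_power power_one mult_1_left)
    then show "norm (norm (ell2_fun ((V ^^ n) (Ell2 u)) x) - norm ?\<pi>) \<le> norm (ell2_fun ((V ^^ n) (Ell2 u)) x - \<omega> ^ n *\<^sub>C ?\<pi>)"
      using norm_triangle_ineq3[of "ell2_fun ((V ^^ n) (Ell2 u)) x" "\<omega> ^ n *\<^sub>C ?\<pi>"] by (simp only: real_norm_def)
  qed
  then have "(\<lambda>n. norm (ell2_fun ((V ^^ n) (Ell2 u)) x)) \<longlonglongrightarrow> norm ?\<pi>" by (rule LIM_zero_cancel)
  then have "(\<lambda>n. (norm (ell2_fun ((V ^^ n) (Ell2 u)) x))\<^sup>2) \<longlonglongrightarrow> (norm ?\<pi>)\<^sup>2" by (rule tendsto_power)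
  then show ?thesis unfolding transition_prob_eq[OF u] eq .
qed

lemma eigenvalue_norm: "eigenvalue_on (l2 Z) U \<omega> \<Longrightarrow> cmod \<omega> = 1"
  unfolding eigenvalue_on_l2[OF U_sub] using W.eigenvalue_norm by blast

text \<open>The value 1 is an arbitrary point of the circle: its eigenspace is trivial, so the limit
  is the squared norm of 0.\<close>

lemma no_eigenvalue_limsup:
  assumes none: "\<nexists>\<omega>. eigenvalue_on (l2 Z) U \<omega>" and u: "u \<in> l2 Z" and x: "x \<in> Z"
  shows "limsup (\<lambda>n. ereal (transition_prob U n u x)) = 0"
proof -
  have "eigenspace_on (l2 Z) U 1 \<subseteq> {\<lambda>_. 0}"
    using none unfolding eigenvalue_on_def by blast
  moreover have "proj_onto Z (eigenspace_on (l2 Z) U 1) u \<in> eigenspace_on (l2 Z) U 1"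
  proof -
    have "proj_onto Z (eigenspace_on (l2 Z) U 1) u = ell2_fun (proj {e \<in> l2_space Z. V e = 1 *\<^sub>C e} (Ell2 u))"
      unfolding eigenspace_on_l2[OF U_sub]
      by (rule proj_onto_eq_proj[OF W.csubspace_eigenspace W.closed_eigenspace _ u]) auto
    also have "\<dots> \<in> eigenspace_on (l2 Z) U 1"
      unfolding eigenspace_on_l2[OF U_sub]
      by (rule imageI, rule proj_in[OF W.csubspace_eigenspace W.closed_eigenspace])
    finally show ?thesis .
  qed
  ultimately have z: "proj_onto Z (eigenspace_on (l2 Z) U 1) u x = 0" by auto
  have "(\<lambda>n. transition_prob U n u x) \<longlonglongrightarrow> (norm (proj_onto Z (eigenspace_on (l2 Z) U 1) u x))\<^sup>2"
    by (rule transition_prob_limit) (use none u x in auto)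
  then have "(\<lambda>n. ereal (transition_prob U n u x)) \<longlonglongrightarrow> ereal 0" unfolding z by (simp add: tendsto_ereal)
  then show ?thesis using lim_imp_Limsup[OF sequentially_bot] unfolding zero_ereal_def by blast
qed

text \<open>Started in an eigenvector, the walk only changes the phase, so the transition
  probability is constant in time and positive at some point.\<close>

lemma eigenvalue_limsup:
  assumes "eigenvalue_on (l2 Z) U \<omega>"
  shows "\<exists>u\<in>l2 Z. \<exists>x\<in>Z. limsup (\<lambda>n. ereal (transition_prob U n u x)) \<noteq> 0"
proof -
  obtain e where e: "e \<in> l2_space Z" "e \<noteq> 0" "V e = \<omega> *\<^sub>C e"
    using assms unfolding eigenvalue_on_l2[OF U_sub] by blast
  obtain x where x: "ell2_fun e x \<noteq> 0" using e(2) ell2_eqI[of e 0] by auto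
  then have xZ: "x \<in> Z" using e(1) by (auto simp: l2_space_def)
  have "transition_prob U n (ell2_fun e) x = (norm (ell2_fun e x))\<^sup>2" for n
    using W.funpow_eigenvector[OF e(3), of n] eigenvalue_norm[OF assms]
    by (simp add: transition_prob_eq ell2_fun_in_l2 e ell2_fun_inverse scaleC_ell2.rep_eq norm_power)
  then have "limsup (\<lambda>n. ereal (transition_prob U n (ell2_fun e) x)) = ereal ((norm (ell2_fun e x))\<^sup>2)"
    by (simp add: Limsup_const)
  also have "\<dots> \<noteq> 0" using x by simp
  finally show ?thesis using ell2_fun_in_l2[OF e(1)] xZ by blast
qed

end

theorem corollary1p6:
  fixes Z F\<^sub>0 :: "'z set"
    and G :: "('g, 'm) monoid_scheme"
    and d :: nat
    and act :: "'g \<Rightarrow> 'z \<Rightarrow> 'z"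
    and U :: "('z \<Rightarrow> 'w::fin_dim_complex_inner_space) \<Rightarrow> ('z \<Rightarrow> 'w)"
  assumes "countable Z"
    and "free_abelian_group_of_rank G d"
    and "free_action G Z act"
    and "finite (orbits G Z act)"
    and "fundamental_set G Z act F\<^sub>0"
    and "unitary_on_l2 Z U"
    and "commutes_with_action G Z act U"
    and "finite_propagation G act F\<^sub>0 U"
  shows "(\<forall>\<omega>. eigenvalue_on (l2 Z) U \<omega> \<longleftrightarrow>
            (\<forall>\<kappa>\<in>characters G. eigenvalue_on (C_chi G Z act \<kappa>) (U_chi G Z act U \<kappa>) \<omega>))
       \<and> finite {\<omega>. eigenvalue_on (l2 Z) U \<omega>}
       \<and> continuous_spectrum_abs_cont Z U
       \<and> ((\<nexists>\<omega>. eigenvalue_on (l2 Z) U \<omega>) \<longleftrightarrow>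
            (\<forall>u\<in>l2 Z. \<forall>x\<in>Z. limsup (\<lambda>n. ereal (transition_prob U n u x)) = 0))
       \<and> ((\<nexists>\<omega>. eigenvalue_on (l2 Z) U \<omega>) \<longrightarrow> (\<forall>u\<in>l2 Z. \<forall>x\<in>Z. \<not> localized_at U u x))
       \<and> (\<forall>\<omega>. {\<omega>'. eigenvalue_on (l2 Z) U \<omega>'} = {\<omega>} \<longrightarrow>
            (\<forall>u\<in>l2 Z. \<forall>x\<in>Z. (\<lambda>n. transition_prob U n u x)
               \<longlonglongrightarrow> (norm (proj_onto Z (eigenspace_on (l2 Z) U \<omega>) u x))\<^sup>2))"
proof -
  interpret free_lattice_action Z F\<^sub>0 G d act U
    by unfold_locales (fact assms)+
  obtain \<rho> where "lattice_walk Z V F\<^sub>0 d sh base pos \<rho>"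
    using lattice_walk_exists by blast
  then interpret periodic_walk Z F\<^sub>0 G d act U \<rho>
    by (intro periodic_walk.intro free_lattice_action_axioms)
  have limsup_iff: "(\<nexists>\<omega>. eigenvalue_on (l2 Z) U \<omega>) \<longleftrightarrow>
      (\<forall>u\<in>l2 Z. \<forall>x\<in>Z. limsup (\<lambda>n. ereal (transition_prob U n u x)) = 0)"
    using no_eigenvalue_limsup eigenvalue_limsup by blast
  have "\<not> localized_at U u x"
    if "\<nexists>\<omega>. eigenvalue_on (l2 Z) U \<omega>" "u \<in> l2 Z" "x \<in> Z" for u x
    unfolding localized_at_def using no_eigenvalue_limsup[OF that] by simp
  moreover have "(\<lambda>n. transition_prob U n u x)
      \<longlonglongrightarrow> (norm (proj_onto Z (eigenspace_on (l2 Z) U \<omega>) u x))\<^sup>2"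
    if "{\<omega>'. eigenvalue_on (l2 Z) U \<omega>'} = {\<omega>}" "u \<in> l2 Z" "x \<in> Z" for \<omega> u x
    by (rule transition_prob_limit) (use that eigenvalue_norm in auto)
  ultimately show ?thesis
    using eigenvalue_iff_all_characters finite_eigenvalues continuous_spectrum limsup_iff by blast
qed

end
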